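(* Let $\Pi:L\rightarrow\mathbb{P}^1$ be a holomorphic line bundle over the Riemann sphere $\mathbb{P}^1$. Suppose that $K\subsetneq\mathbb{P}^1$ is a compact subset. Then the following are equivalent. \begin{itemize} \item[$(a)$] $K$ is polar. \item[$(b)$] $A^2(\mathbb{P}^1\setminus K;L)=\Gamma(\mathbb{P}^1;L)$. \item[$(c)$] $\dim A^2(\mathbb{P}^1\setminus K;L)<\infty$. \item[$(d)$] There exists no bounded function $\psi\in\mathcal{C}^\infty(\mathbb{P}^1\setminus K)$ such that $i\partial\bar{\partial}\psi\geq\omega$ on $\mathbb{P}^1\setminus K$ for some volume form $\omega$ on $\mathbb{P}^1$. \end{itemize}
   Context: A volume form on $\mathbb{P}^1$ is a smooth positive $(1,1)$-form, i.e. $f\,\omega_{\mathrm{FS}}$ with $f$ a smooth positive function on $\mathbb{P}^1$ and $\omega_{\mathrm{FS}}$ the Fubini--Study form. For an open set $D\subseteq\mathbb{P}^1$, $\Gamma(D;L)$ is the space of holomorphic sections of $L|_D$. Given a smooth Hermitian metric $h$ on $L$ (over all of $\mathbb{P}^1$) and a volume form $\omega$ on $\mathbb{P}^1$, the Bergman space is $$A^2(D;L)=\left\{s\in\Gamma(D;L):\int_D h(s,s)\,\omega<\infty\right\};$$ since $\mathbb{P}^1$ is compact, as a vector space it does not depend on the choice of $h$ and $\omega$. The equality in $(b)$ means that $A^2(\mathbb{P}^1\setminus K;L)$ consists exactly of the restrictions to $\mathbb{P}^1\setminus K$ of global holomorphic sections of $L$. Dimension is complex vector space dimension. In a local holomorphic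 coordinate $z$, $\partial\bar\partial\psi=\frac{\partial^2\psi}{\partial z\,\partial\bar z}\,dz\wedge d\bar z$, and $\geq$ between real $(1,1)$-forms means that the difference is a nonnegative multiple of $i\,dz\wedge d\bar z$ at each point. The function $\psi$ is real-valued. An upper semicontinuous function $s:U\to[-\infty,\infty)$ on an open set $U\subseteq\mathbb{P}^1$, $s\not\equiv-\infty$, is subharmonic on $U$ if it is subharmonic in every holomorphic coordinate chart. A set $K\subset\mathbb{P}^1$ is polar if for each $\zeta\in\mathbb{P}^1$ there are a connected open neighborhood $V_\zeta\subset\mathbb{P}^1$ of $\zeta$ and a subharmonic function $s_\zeta$ on $V_\zeta$ (in particular $s_\zeta\not\equiv-\infty$) such that $K\cap V_\zeta\subset\{x\in V_\zeta:s_\zeta(x)=-\infty\}$. *)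

theory Defs
  imports
    "HOL-Complex_Analysis.Complex_Analysis"
    "Jordan_Normal_Form.VS_Connect"
begin

section \<open>The Riemann sphere\<close>

text \<open>Points are \<open>Some z\<close> with \<open>z\<close> complex and \<open>None\<close>, the point at infinity.\<close>

type_synonym sphere = "complex option"

abbreviation riemann_sphere :: "sphere topology" where
  "riemann_sphere \<equiv> Alexandroff_compactification euclidean"

text \<open>The complex structure is given by the standard atlas with coordinates \<open>z\<close> and \<open>w = 1 / z\<close>.
  The function \<open>param c\<close> is the inverse of the coordinate \<open>c\<close>; it is defined on all of \<open>\<complex>\<close>.\<close>

datatype std_chart = At_Zero | At_Infinity

fun param :: "std_chart \<Rightarrow> complex \<Rightarrow> sphere" where
  "param At_Zero z = Some z"
| "param At_Infinity w = (if w = 0 then None else Some (inverse w))"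

definition sphere_holomorphic_on :: "(sphere \<Rightarrow> complex) \<Rightarrow> sphere set \<Rightarrow> bool" where
  "sphere_holomorphic_on f U \<longleftrightarrow> (\<forall>c. (f \<circ> param c) holomorphic_on (param c -` U))"

definition holomorphic_chart :: "sphere set \<Rightarrow> (sphere \<Rightarrow> complex) \<Rightarrow> bool" where
  "holomorphic_chart V \<phi> \<longleftrightarrow>
     openin riemann_sphere V \<and> sphere_holomorphic_on \<phi> V \<and> inj_on \<phi> V"

section \<open>Smooth functions\<close>

text \<open>Smoothness is in the real sense; the set \<open>S\<close> is meant to be open.\<close>

fun times_differentiable_on ::
    "nat \<Rightarrow> ('a::real_normed_vector \<Rightarrow> 'b::real_normed_vector) \<Rightarrow> 'a set \<Rightarrow> bool" where
  "times_differentiable_on 0 f S \<longleftrightarrow> continuous_on S f"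
| "times_differentiable_on (Suc n) f S \<longleftrightarrow>
     (\<forall>x\<in>S. f differentiable (at x)) \<and>
     (\<forall>v. times_differentiable_on n (\<lambda>x. frechet_derivative f (at x) v) S)"

definition smooth_on ::
    "('a::real_normed_vector \<Rightarrow> 'b::real_normed_vector) \<Rightarrow> 'a set \<Rightarrow> bool" where
  "smooth_on f S \<longleftrightarrow> (\<forall>n. times_differentiable_on n f S)"

definition sphere_smooth_on :: "(sphere \<Rightarrow> real) \<Rightarrow> sphere set \<Rightarrow> bool" where
  "sphere_smooth_on f U \<longleftrightarrow> (\<forall>c. smooth_on (f \<circ> param c) (param c -` U))"

section \<open>Real (1,1)-forms and volume forms\<close>

text \<open>A real (1,1)-form \<open>\<alpha>\<close> is represented by its coefficients in the two standard coordinates: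
  at the point \<open>param c z\<close> the form is \<open>\<alpha> c z\<close> times \<open>\<i> dz \<and> d(cnj z)\<close>, where \<open>z\<close> is the coordinate
  \<open>c\<close>.\<close>

type_synonym form11 = "std_chart \<Rightarrow> complex \<Rightarrow> real"

definition form_le_on :: "form11 \<Rightarrow> form11 \<Rightarrow> sphere set \<Rightarrow> bool" where
  "form_le_on \<alpha> \<beta> D \<longleftrightarrow> (\<forall>c z. param c z \<in> D \<longrightarrow> \<alpha> c z \<le> \<beta> c z)"

text \<open>The normalisation \<open>(\<i> / 2\<pi>) \<partial>\<partial>-bar log (1 + |z|\<^sup>2)\<close>, of total mass 1; the coefficient is the same
  in both coordinates.\<close>

definition fubini_study :: form11 where
  "fubini_study c z = 1 / (2 * pi * (1 + (cmod z)\<^sup>2)\<^sup>2)"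

definition volume_form :: "form11 \<Rightarrow> bool" where
  "volume_form \<omega> \<longleftrightarrow>
     (\<exists>f. sphere_smooth_on f UNIV \<and> (\<forall>x. f x > 0) \<and>
          \<omega> = (\<lambda>c z. f (param c z) * fubini_study c z))"

text \<open>The integral over \<open>D\<close> of \<open>g \<omega>\<close>, for \<open>g\<close> nonnegative and \<open>\<omega>\<close> a volume form. The point at
  infinity is a null set, and \<open>\<i> dz \<and> d(cnj z) = 2 dx \<and> dy\<close>.\<close>

definition form_nn_integral :: "sphere set \<Rightarrow> (sphere \<Rightarrow> real) \<Rightarrow> form11 \<Rightarrow> ennreal" where
  "form_nn_integral D g \<omega> =
     (\<integral>\<^sup>+z \<in> {z. Some z \<in> D}. ennreal (g (Some z) * (2 * \<omega> At_Zero z)) \<partial>lborel)"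

definition wirtinger :: "(complex \<Rightarrow> complex) \<Rightarrow> complex \<Rightarrow> complex" where
  "wirtinger f z = (frechet_derivative f (at z) 1 - \<i> * frechet_derivative f (at z) \<i>) / 2"

definition wirtinger_bar :: "(complex \<Rightarrow> complex) \<Rightarrow> complex \<Rightarrow> complex" where
  "wirtinger_bar f z = (frechet_derivative f (at z) 1 + \<i> * frechet_derivative f (at z) \<i>) / 2"

text \<open>The form \<open>\<i> \<partial>\<partial>-bar \<psi>\<close>; its coefficient is real because \<open>\<psi>\<close> is.\<close>

definition i_ddbar :: "(sphere \<Rightarrow> real) \<Rightarrow> form11" where
  "i_ddbar \<psi> c z = Re (wirtinger (wirtinger_bar (\<lambda>u. of_real (\<psi> (param c u)))) z)"

section \<open>Subharmonic functions and polar sets\<close>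

text \<open>The mean of \<open>u\<close> over the circle of radius \<open>r\<close> about \<open>w\<close>. Since \<open>e2ennreal\<close> truncates negative
  values to 0, this is the integral of the positive part minus that of the negative part; for \<open>u\<close>
  upper semicontinuous with values below \<open>\<infinity>\<close> the former is finite.\<close>

definition circle_mean :: "(complex \<Rightarrow> ereal) \<Rightarrow> complex \<Rightarrow> real \<Rightarrow> ereal" where
  "circle_mean u w r =
     (enn2ereal (\<integral>\<^sup>+t \<in> {0..2*pi}. e2ennreal (u (w + of_real r * cis t)) \<partial>lborel)
      - enn2ereal (\<integral>\<^sup>+t \<in> {0..2*pi}. e2ennreal (- u (w + of_real r * cis t)) \<partial>lborel))
     / ereal (2 * pi)"

text \<open>In the plane the constant function \<open>-\<infinity>\<close> is allowed; it is excluded on the sphere.\<close>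

definition plane_subharmonic_on :: "(complex \<Rightarrow> ereal) \<Rightarrow> complex set \<Rightarrow> bool" where
  "plane_subharmonic_on u \<Omega> \<longleftrightarrow>
     (\<forall>z\<in>\<Omega>. u z < \<infinity>) \<and>
     (\<forall>a. open {z \<in> \<Omega>. u z < a}) \<and>
     (\<forall>w\<in>\<Omega>. \<exists>\<rho>>0. ball w \<rho> \<subseteq> \<Omega> \<and> (\<forall>r. 0 < r \<and> r < \<rho> \<longrightarrow> u w \<le> circle_mean u w r))"

definition subharmonic_on :: "(sphere \<Rightarrow> ereal) \<Rightarrow> sphere set \<Rightarrow> bool" where
  "subharmonic_on s U \<longleftrightarrow>
     (\<forall>x\<in>U. s x < \<infinity>) \<and>
     (\<forall>a. openin riemann_sphere {x \<in> U. s x < a}) \<and>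
     (\<exists>x\<in>U. s x \<noteq> -\<infinity>) \<and>
     (\<forall>V \<phi>. holomorphic_chart V \<phi> \<and> V \<subseteq> U \<longrightarrow>
        plane_subharmonic_on (s \<circ> inv_into V \<phi>) (\<phi> ` V))"

definition polar :: "sphere set \<Rightarrow> bool" where
  "polar K \<longleftrightarrow>
     (\<forall>\<zeta>. \<exists>V s. openin riemann_sphere V \<and> connectedin riemann_sphere V \<and> \<zeta> \<in> V \<and>
        subharmonic_on s V \<and> K \<inter> V \<subseteq> {x \<in> V. s x = -\<infinity>})"

section \<open>Holomorphic line bundles\<close>

text \<open>The field \<open>trivs\<close> is a holomorphic linear atlas: a set of pairs \<open>(U, \<tau>)\<close> standing for the local
  trivialisations \<open>e \<mapsto> (proj e, \<tau> e)\<close> of the bundle over \<open>U\<close>. The topology and complex structure of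
  the total space are those for which these maps are biholomorphic.\<close>

record 'e line_bundle =
  total_space :: "'e set"
  proj :: "'e \<Rightarrow> sphere"
  fib_add :: "'e \<Rightarrow> 'e \<Rightarrow> 'e"
  fib_smult :: "complex \<Rightarrow> 'e \<Rightarrow> 'e"
  fib_zero :: "sphere \<Rightarrow> 'e"
  trivs :: "(sphere set \<times> ('e \<Rightarrow> complex)) set"

text \<open>Vector spaces are modules over \<open>class_ring\<close>, here the field \<open>\<complex>\<close>. The fields \<open>mult\<close> and \<open>one\<close>
  of the record type \<open>module\<close> play no role.\<close>

definition fibre :: "'e line_bundle \<Rightarrow> sphere \<Rightarrow> (complex, 'e) module" where
  "fibre L x = \<lparr>carrier = {e \<in> total_space L. proj L e = x}, mult = undefined, one = undefined,
     zero = fib_zero L x, add = fib_add L, smult = fib_smult L\<rparr>"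

locale holomorphic_line_bundle =
  fixes L :: "'e line_bundle"
  assumes fibre_vectorspace: "vectorspace class_ring (fibre L x)"
    and trivs_cover: "(\<Union>(U, \<tau>)\<in>trivs L. U) = UNIV"
    and triv_open: "(U, \<tau>) \<in> trivs L \<Longrightarrow> openin riemann_sphere U"
    and triv_bij: "(U, \<tau>) \<in> trivs L \<Longrightarrow> x \<in> U \<Longrightarrow> bij_betw \<tau> (carrier (fibre L x)) UNIV"
    and triv_add: "(U, \<tau>) \<in> trivs L \<Longrightarrow> x \<in> U \<Longrightarrow> a \<in> carrier (fibre L x) \<Longrightarrow>
      b \<in> carrier (fibre L x) \<Longrightarrow> \<tau> (fib_add L a b) = \<tau> a + \<tau> b"
    and triv_smult: "(U, \<tau>) \<in> trivs L \<Longrightarrow> x \<in> U \<Longrightarrow> a \<in> carrier (fibre L x) \<Longrightarrow>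
      \<tau> (fib_smult L k a) = k * \<tau> a"
    and triv_transition: "(U, \<tau>) \<in> trivs L \<Longrightarrow> (V, \<sigma>) \<in> trivs L \<Longrightarrow>
      \<exists>g. sphere_holomorphic_on g (U \<inter> V) \<and>
          (\<forall>x\<in>U \<inter> V. \<forall>e\<in>carrier (fibre L x). \<sigma> e = g x * \<tau> e)"

text \<open>The space of holomorphic sections over \<open>D\<close>. Sections are \<open>undefined\<close> outside \<open>D\<close>.\<close>

definition hol_sections :: "'e line_bundle \<Rightarrow> sphere set \<Rightarrow> (complex, sphere \<Rightarrow> 'e) module" where
  "hol_sections L D = \<lparr>
     carrier = {s \<in> extensional D. (\<forall>x\<in>D. s x \<in> carrier (fibre L x)) \<and>
       (\<forall>(U, \<tau>)\<in>trivs L. sphere_holomorphic_on (\<tau> \<circ> s) (U \<inter> D))},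
     mult = undefined, one = undefined,
     zero = (\<lambda>x\<in>D. fib_zero L x),
     add = (\<lambda>s t. \<lambda>x\<in>D. fib_add L (s x) (t x)),
     smult = (\<lambda>k s. \<lambda>x\<in>D. fib_smult L k (s x))\<rparr>"

text \<open>Only the values \<open>h a b\<close> with \<open>a\<close> and \<open>b\<close> in the same fibre are meaningful. Smoothness refers to
  the local frame given by a trivialisation.\<close>

definition hermitian_metric :: "'e line_bundle \<Rightarrow> ('e \<Rightarrow> 'e \<Rightarrow> complex) \<Rightarrow> bool" where
  "hermitian_metric L h \<longleftrightarrow>
     (\<forall>x. \<forall>a\<in>carrier (fibre L x). \<forall>b\<in>carrier (fibre L x). \<forall>c\<in>carrier (fibre L x). \<forall>k.
        h (fib_add L a b) c = h a c + h b c \<and>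
        h (fib_smult L k a) b = k * h a b \<and>
        h b a = cnj (h a b) \<and>
        (a \<noteq> fib_zero L x \<longrightarrow> 0 < Re (h a a))) \<and>
     (\<forall>(U, \<tau>)\<in>trivs L.
        sphere_smooth_on (\<lambda>x. let e = inv_into (carrier (fibre L x)) \<tau> 1 in Re (h e e)) U)"

section \<open>Bergman spaces\<close>

definition bergman_space ::
    "'e line_bundle \<Rightarrow> ('e \<Rightarrow> 'e \<Rightarrow> complex) \<Rightarrow> form11 \<Rightarrow> sphere set \<Rightarrow> (complex, sphere \<Rightarrow> 'e) module"
  where
  "bergman_space L h \<omega> D = (hol_sections L D)\<lparr>carrier :=
     {s \<in> carrier (hol_sections L D). form_nn_integral D (\<lambda>x. Re (h (s x) (s x))) \<omega> < \<infinity>}\<rparr>"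

end

theory Submission imports Defs begin

text \<open>A compact plane set \<open>F\<close> has capacity zero when probability weights on finite subsets of \<open>F\<close> have
arbitrarily large truncated logarithmic potentials on all of \<open>F\<close>; minimisers of the discrete energy have nearly
constant potential on \<open>F\<close>, so otherwise the potentials of such minimisers stay bounded. Each condition of the
theorem is compared with capacity zero of the pieces of \<open>K\<close> in the charts.

If the pieces have capacity zero, a sum of potentials is a subharmonic function with value \<open>-\<infinity>\<close> on \<open>K\<close>, and
cutoff functions of the potentials, whose energy tends to \<open>0\<close>, show that square integrable holomorphic functions
extend across \<open>K\<close>. Frames of \<open>L\<close> over the two charts with transition function \<open>z\<^sup>d\<close> identify the global
sections with polynomials of bounded degree. If \<open>K\<close> is polar, the comparison principle rules out bounded strictly
subharmonic functions off \<open>K\<close>. If some piece does not have capacity zero, the minimising weights converge along a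
filter to a functional; its potential yields a bounded strictly subharmonic function off \<open>K\<close>, and the Cauchy
transforms of its orthogonal polynomials are square integrable with distinct vanishing orders at infinity, so the
Bergman space has infinite dimension.\<close>

text \<open>One estimate carries both halves: if a probability weight has potential at most M, the
  squared field, the square of the sum of m w / |z - w|, has integral at most 128 + 64 M. When
  potentials of size I are nearly constant on the set, a step function of potential / I has gradient
  energy of order 1 / I, which is why it can cut off square integrable functions; when M stays
  bounded, the same estimate makes Cauchy transforms square integrable. Weights are finite and
  distances are truncated below at d, so every potential is a finite sum of continuous functions and
  self-energies are finite. The pieces lie in discs of radius 1/4: mutual distances are then at most
  1/2, so for d <= 1 all logarithms have one sign, and the unit disc about any point of a piece
  contains the disc of radius 3/4. The local functions in the definition of polarity are merely
  upper semicontinuous and take the value minus infinity, so they are compared with strictly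
  superharmonic functions through quadratics touching from above.\<close>

lemmas hol_cont = holomorphic_on_imp_continuous_on

abbreviation tdist :: "real => complex => complex => real" where "tdist d z w == max (cmod (z - w)) d"

abbreviation sopen where "sopen == openin riemann_sphere"

abbreviation nnint :: "complex set => (complex => real) => ennreal" where "nnint A f \<equiv> (\<integral>\<^sup>+z\<in>A. ennreal (f z) \<partial>lborel)"

section \<open>Charts of the sphere\<close>

lemma open_inverse_vimage: "open U ==> open (- {0} Int inverse -` (U :: complex set))" by (intro continuous_open_preimage continuous_intros) auto

text \<open>In the coordinate 1/z a neighbourhood of 0 is the complement of a bounded set, which is
  what the one-point compactification asks at infinity. All later topology of the sphere is checked
  in the two charts.\<close>

lemma openin_sphere_iff: "sopen V = (\<forall>c. open (param c -` V))" proof -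
 define U where "U = {z. Some z : V}"
 have W: "param At_Infinity -` V = (- {0} Int inverse -` U) Un (if None : V then {0} else {})" by (auto simp: U_def split: if_splits)
 have *: "sopen V = (open U & (None : V --> bounded (- U)))" proof (cases "None : V")
  case True
  have "(V = insert None (Some ` (- C))) = (C = - U)" for C using True by (auto simp: set_eq_iff split_option_all U_def image_iff)
  moreover have "V ~= Some ` A" for A using True by auto
  ultimately show ?thesis using True unfolding openin_Alexandroff_compactification
   by (auto simp: Compl_eq_Diff_UNIV[symmetric] compact_eq_bounded_closed closed_Compl open_closed)
 next
  case False
  have "(V = Some ` A) = (A = U)" for A using False by (auto simp: set_eq_iff split_option_all U_def image_iff)
  moreover have "V ~= insert None A" for A using False by auto
  ultimately show ?thesis using False unfolding openin_Alexandroff_compactification by auto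
 qed
 have "open (param At_Infinity -` V) = (None : V --> bounded (- U))" if U: "open U" proof (cases "None : V")
  case True
  have "bounded (- U) = (\<forall>\<^sub>F z in at_infinity. z : U)" unfolding bounded_iff eventually_at_infinity proof (rule iffI; elim exE)
   show "\<exists>b. \<forall>x. b <= cmod x --> x : U" if "\<forall>x\<in>- U. cmod x <= r" for r using that by (intro exI[of _ "r + 1"]) force
   show "\<exists>r. \<forall>x\<in>- U. cmod x <= r" if "\<forall>x. b <= cmod x --> x : U" for b using that by (intro exI[of _ b]) (meson ComplD linear)
  qed
  also have "(...) = (\<forall>\<^sub>F z in at 0. inverse z : U)" by (simp add: at_to_infinity eventually_filtermap)
  also have "(...) = (\<exists>S. open S & 0 : S & S <= param At_Infinity -` V)" unfolding eventually_at_topological W using True by (auto simp: subset_iff)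
  also have "(...) = open (param At_Infinity -` V)"
  proof
   assume "\<exists>S. open S & 0 : S & S <= param At_Infinity -` V"
   then obtain S where "open S" "0 : S" "S <= param At_Infinity -` V" by blast
   moreover from this have "param At_Infinity -` V = S Un (- {0} Int inverse -` U)" unfolding W using True by auto
   ultimately show "open (param At_Infinity -` V)" using open_inverse_vimage[OF U] by auto
  qed (use True in \<open>auto intro!: exI[of _ "param At_Infinity -` V"]\<close>)
  finally show ?thesis using True by simp
 qed (simp add: W open_inverse_vimage U)
 moreover have "param At_Zero -` V = U" by (auto simp: U_def)
 moreover have "((\<forall>c. P c)) = (P At_Zero & P At_Infinity)" for P by (metis std_chart.exhaust)
 ultimately show ?thesis unfolding * by (simp cong: conj_cong)
qed

lemma open_param: "sopen D ==> open (param c -` D)" using openin_sphere_iff by blast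

lemma topspace_sphere [simp]: "topspace riemann_sphere = UNIV" by (metis UNIV_option_conv topspace_Alexandroff_compactification topspace_euclidean)

text \<open>The closed unit discs of the two charts cover the sphere, which turns bounds over the
  sphere into bounds over two compact discs.\<close>

lemma sphere_cases: obtains c z where "x = param c z" "cmod z <= 1" proof (cases x)
 case None
 thus ?thesis using that[of At_Infinity 0] by simp
next
 case (Some z)
 show ?thesis proof (cases "cmod z <= 1")
  case True
  thus ?thesis using that[of At_Zero z] Some by simp
 next
  case False
  hence "cmod (inverse z) <= 1" by (simp add: norm_inverse inverse_le_1_iff)
  thus ?thesis using that[of At_Infinity "inverse z"] Some False by (metis inverse_inverse_eq inverse_zero norm_zero param.simps(2) zero_le_one)
 qed
qed

lemma inj_param: "inj (param c)" by (cases c) (auto simp: inj_def)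

lemma Hausdorff_sphere: "Hausdorff_space riemann_sphere" by (simp add: Hausdorff_space_Alexandroff_compactification locally_compact_space_euclidean)

lemma sphere_compact_iff: "compactin riemann_sphere K = sopen (- K)"
proof
 assume "compactin riemann_sphere K"
 thus "sopen (- K)" using Hausdorff_sphere compactin_imp_closedin by (metis Compl_eq_Diff_UNIV closedin_def topspace_sphere)
next
 assume "sopen (- K)"
 thus "compactin riemann_sphere K"
  by (metis Compl_eq_Diff_UNIV closedin_def subset_UNIV topspace_sphere closedin_compact_space compact_space_Alexandroff_compactification)
qed

lemma continuous_map_param: "continuous_map euclidean riemann_sphere (param c)" unfolding continuous_map_alt using openin_sphere_iff by (simp only: topspace_sphere) auto

fun opp :: "std_chart => std_chart" where "opp At_Zero = At_Infinity" | "opp At_Infinity = At_Zero"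

lemma opp_other [simp]: "opp (opp c) = c" by (cases c) auto

lemma param_other: "z ~= 0 ==> param (opp c) z = param c (inverse z)" by (cases c) auto

lemma chart_cases: "d = c \<or> d = opp c" by (cases c; cases d) auto

lemma sopen_image: "open S ==> sopen (param c ` S)" unfolding openin_sphere_iff
proof
 fix d assume S: "open S"
 show "open (param d -` param c ` S)" proof (cases "d = c")
  case True
  have "param c -` param c ` S = S" using inj_param by (simp add: inj_vimage_image_eq)
  thus ?thesis using S True by simp
 next
  case False
  hence d: "d = opp c" using chart_cases by blast
  have *: "param d 0 ~: range (param c)" using d by (cases c) (auto split: if_splits)
  have "(param d z : param c ` S) = (z ~= 0 & inverse z : S)" for z proof (cases "z = 0")
   case True thus ?thesis using * by auto
  next
   case False
   hence "param d z = param c (inverse z)" using d param_other by simp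
   thus ?thesis using False inj_param[of c] by (auto simp: inj_def)
  qed
  hence "param d -` param c ` S = (- {0}) Int inverse -` S" by auto
  moreover have "open ((- {0::complex}) Int inverse -` S)" by (rule open_inverse_vimage[OF S])
  ultimately show ?thesis by simp
 qed
qed

lemma connectedin_param_image: "connected S ==> connectedin riemann_sphere (param c ` S)" using connectedin_continuous_map_image[OF continuous_map_param] by simp

lemma param_other_0: "param (opp c) 0 ~: range (param c)" by (cases c) (auto split: if_splits)

lemma in_range_param: "x ~= param (opp c) 0 ==> x : range (param c)" proof (cases c)
 case At_Zero
 assume "x ~= param (opp c) 0"
 thus ?thesis using At_Zero by (cases x) auto
next
 case At_Infinity
 assume x: "x ~= param (opp c) 0"
 show ?thesis proof (cases x)
  case None thus ?thesis using At_Infinity by (intro image_eqI[of _ _ 0]) auto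
 next
  case (Some a)
  thus ?thesis using At_Infinity x by (intro image_eqI[of _ _ "inverse a"]) auto
 qed
qed

section \<open>Comparison of subharmonic functions\<close>

lemma circle_mean_mono: assumes "!!t. u (w + of_real r * cis t) <= v (w + of_real r * cis t)" shows "circle_mean u w r <= circle_mean v w r" unfolding circle_mean_def
proof (intro ereal_divide_right_mono ereal_minus_mono)
 show "enn2ereal (\<integral>\<^sup>+t \<in> {0..2*pi}. e2ennreal (u (w + of_real r * cis t)) \<partial>lborel) <= enn2ereal (\<integral>\<^sup>+t \<in> {0..2*pi}. e2ennreal (v (w + of_real r * cis t)) \<partial>lborel)"
  unfolding less_eq_ennreal.rep_eq[symmetric] by (intro nn_integral_mono mult_right_mono e2ennreal_mono assms) auto
 show "enn2ereal (\<integral>\<^sup>+t \<in> {0..2*pi}. e2ennreal (- v (w + of_real r * cis t)) \<partial>lborel) <= enn2ereal (\<integral>\<^sup>+t \<in> {0..2*pi}. e2ennreal (- u (w + of_real r * cis t)) \<partial>lborel)"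
  unfolding less_eq_ennreal.rep_eq[symmetric] by (intro nn_integral_mono mult_right_mono e2ennreal_mono) (use assms in auto)
qed auto

text \<open>Continuity on the circle makes both extended integrals finite, so that their difference
  is an ordinary integral.\<close>

lemma circle_mean_ereal: assumes "continuous_on {0..2*pi} (%t. q (w + of_real r * cis t))" shows "circle_mean (%z. ereal (q z)) w r
  = ereal (integral {0..2*pi} (%t. q (w + of_real r * cis t)) / (2*pi))" proof - define f where "f t = indicator {0..2*pi} t *\<^sub>R q (w + of_real r * cis t)" for t
 have int: "set_integrable lborel {0..2*pi} (%t. q (w + of_real r * cis t))" using borel_integrable_atLeastAtMost' assms by blast
 hence f: "integrable lborel f" unfolding f_def set_integrable_def by simp
 have I: "integral {0..2*pi} (%t. q (w + of_real r * cis t)) = integral\<^sup>L lborel f"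
  using set_borel_integral_eq_integral(2)[OF int] unfolding f_def set_lebesgue_integral_def by simp
 have 1: "(\<integral>\<^sup>+t \<in> {0..2*pi}. e2ennreal (ereal (q (w + of_real r * cis t))) \<partial>lborel) = (\<integral>\<^sup>+t. ennreal (f t) \<partial>lborel)"
  by (intro nn_integral_cong) (auto simp: f_def indicator_def)
 have 2: "(\<integral>\<^sup>+t \<in> {0..2*pi}. e2ennreal (- ereal (q (w + of_real r * cis t))) \<partial>lborel) = (\<integral>\<^sup>+t. ennreal (- f t) \<partial>lborel)"
  by (intro nn_integral_cong) (auto simp: f_def indicator_def)
 have fin: "(\<integral>\<^sup>+t. ennreal (f t) \<partial>lborel) ~= \<infinity>" "(\<integral>\<^sup>+t. ennreal (- f t) \<partial>lborel) ~= \<infinity>" using f unfolding real_integrable_def by auto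
 have e: "enn2ereal x = ereal (enn2real x)" if "x ~= \<infinity>" for x using that by (cases x) auto
 show ?thesis unfolding circle_mean_def 1 2 e[OF fin(1)] e[OF fin(2)] I real_lebesgue_integral_def[OF f] by simp
qed

text \<open>The terms with b and B are harmonic and vanish at 0, so they average to 0; only the
  constant and k |z|^2 survive.\<close>

lemma integral_quadratic_circle: "integral {0..2*pi} (%t. a + Re (b * (of_real r * cis t)) + Re (B * (of_real r * cis t)^2) + k * (cmod (of_real r * cis t))^2)
  = 2 * pi * (a + k * r^2)" proof - define G where "G t = (a + k * r^2) * t + Re (- \<i> * b * of_real r * cis t) + Re (- \<i>/2 * B * (of_real r)^2 * cis (2*t))" for t
 have eq: "a + Re (b * (of_real r * cis t)) + Re (B * (of_real r * cis t)^2) + k * (cmod (of_real r * cis t))^2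
  = (a + k * r^2) + (r * Re b * cos t - r * Im b * sin t) + r^2 * (Re B * cos (2*t) - Im B * sin (2*t))" for t proof -
  have "(of_real r * cis t)^2 = of_real (r^2) * cis (2*t)" by (simp only: power_mult_distrib Complex.DeMoivre of_real_power) simp
  thus ?thesis by (simp only: norm_mult norm_of_real norm_cis) (simp add: algebra_simps)
 qed
 have Geq: "G t = (a + k * r^2) * t + (r * Re b * sin t + r * Im b * cos t) + r^2 * (Re B * sin (2*t) + Im B * cos (2*t)) / 2" for t proof -
  have "(complex_of_real r)^2 = of_real (r^2)" by simp
  thus ?thesis unfolding G_def by (simp only:) (simp add: algebra_simps add_divide_distrib diff_divide_distrib)
 qed
 have "((%t. (a + k * r^2) + (r * Re b * cos t - r * Im b * sin t) + r^2 * (Re B * cos (2*t) - Im B * sin (2*t))) has_integral G (2*pi) - G 0) {0..2*pi}" unfolding Geq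
  by (rule fundamental_theorem_of_calculus) (auto intro!: derivative_eq_intros simp flip: has_real_derivative_iff_has_vector_derivative simp: field_simps)
 moreover have "G (2*pi) - G 0 = 2 * pi * (a + k * r^2)" unfolding Geq using sin_2npi[of 2] cos_2npi[of 2] by (simp add: mult.assoc)
 ultimately show ?thesis unfolding eq by (simp add: integral_unique)
qed

lemma usc_attains_max:
 fixes u :: "complex => ereal" assumes "compact S" "S ~= {}" and usc: "!!a. openin (top_of_set S) {z\<in>S. u z < a}" obtains p where "p : S" "!!z. z : S ==> u z <= u p" proof -
 have "\<exists>p\<in>S. \<forall>z\<in>S. u z <= u p" proof (rule ccontr)
  assume "~ ?thesis"
  hence *: "\<forall>p\<in>S. \<exists>q\<in>S. u p < u q" by (meson not_le)
  let ?C = "(%q. {z\<in>S. u z < u q}) ` S"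
  have "S <= \<Union>?C" using * by auto
  moreover have "\<forall>c\<in>?C. openin (top_of_set S) c" using usc by auto
  ultimately obtain D where D: "D <= ?C" "finite D" "S <= \<Union>D" using `compact S` unfolding compact_eq_openin_cover by meson
  obtain Q where Q: "finite Q" "Q <= S" "D = (%q. {z\<in>S. u z < u q}) ` Q" using finite_subset_image[OF D(2,1)] by auto
  have "Q ~= {}" using D(3) Q(3) assms(2) by auto
  hence "Max (u ` Q) : u ` Q" using Q(1) by simp
  then obtain q where q: "q : Q" "u q = Max (u ` Q)" by auto
  obtain q' where "q' : Q" "u q < u q'" using D(3) Q q by blast
  thus False using q(2) Q(1) by (metis Max_ge finite_imageI imageI linorder_not_le)
 qed
 thus ?thesis using that by blast
qed

text \<open>The form of subharmonicity used for comparison: a quadratic that lies above u and meets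
  it at p has nonnegative Laplacian 4 k, since its mean over a small circle is a + k r^2.\<close>

lemma touching_quadratic: assumes sub: "plane_subharmonic_on u W" "p : W" and "0 < r\<^sub>0" and up: "u p = ereal a"
  and le: "!!z. z : ball p r\<^sub>0 ==> u z <= ereal (a + Re (b * (z - p)) + Re (B * (z - p)^2) + k * (cmod (z - p))^2)" shows "0 <= k" proof -
 obtain s where s: "s > 0" "!!r. 0 < r ==> r < s ==> u p <= circle_mean u p r" using sub unfolding plane_subharmonic_on_def by blast
 define r where "r = min s r\<^sub>0 / 2"
 have r: "0 < r" "r < s" "r < r\<^sub>0" using s(1) `0 < r\<^sub>0` by (auto simp: r_def)
 let ?q = "%z. a + Re (b * (z - p)) + Re (B * (z - p)^2) + k * (cmod (z - p))^2"
 have "u p <= circle_mean u p r" using s r by blast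
 also have "... <= circle_mean (%z. ereal (?q z)) p r" by (rule circle_mean_mono, rule le) (use r in "auto simp: dist_norm norm_mult")
 also have "... = ereal (integral {0..2*pi} (%t. ?q (p + of_real r * cis t)) / (2*pi))" by (rule circle_mean_ereal) (intro continuous_intros)
 also have "... = ereal (a + k * r^2)" using integral_quadratic_circle[of a b r B k] by simp
 finally have "a <= a + k * r^2" using up by simp
 thus ?thesis using r(1) by (simp add: zero_le_mult_iff)
qed

text \<open>Every real quadratic form on the plane is Re (B z^2) + k |z|^2, with Laplacian 4 k. So
  this is strict superharmonicity expressed by a quadratic from above, the opposite of what
  \<open>touching_quadratic\<close> permits.\<close>

definition strict_super :: "(complex => real) => complex => bool" where "strict_super g p = (\<exists>b B k r. k < 0 & 0 < r &
   (\<forall>z\<in>ball p r. g z <= g p + Re (b * (z - p)) + Re (B * (z - p)^2) + k * (cmod (z - p))^2))"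

text \<open>Second order Taylor expansion at p, where the first partial derivatives are
  differentiable. The mean value theorem is applied, along a segment, to f minus its Taylor
  polynomial; the derivative of that difference is small by differentiability of the partial
  derivatives at p.\<close>

lemma strict_super_twice_differentiable:
 fixes f :: "complex => real" assumes r: "r > 0" and der: "!!z. z : ball p r ==> (f has_derivative f' z) (at z)"
  and A: "((%z. f' z 1) has_derivative A) (at p)" and B: "((%z. f' z \<i>) has_derivative B) (at p)" and neg: "A 1 + B \<i> < 0" shows "strict_super f p" proof -
 \<comment> \<open>Half the Hessian form is Re (c h^2) + k0 |h|^2, the mixed entries going into the
   imaginary part of c. The Taylor error is allowed to be q |h|^2 with q = - k0 / 2, which leaves k0
   / 2 < 0.\<close>
 define k0 where "k0 = (A 1 + B \<i>) / 4"
 define q where "q = - k0 / 2"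
 define b where "b = Complex (f' p 1) (- f' p \<i>)"
 define c where "c = Complex ((A 1 - B \<i>) / 4) (- (A \<i> + B 1) / 4)"
 have k: "k0 < 0" "q > 0" using neg by (auto simp: k0_def q_def)
 have lin: "g h = Re h * g 1 + Im h * g \<i>" if "linear g" for g :: "complex => real" and h proof -
  have "h = Re h *\<^sub>R 1 + Im h *\<^sub>R \<i>" by (simp add: complex_eq_iff)
  hence "g h = g (Re h *\<^sub>R 1 + Im h *\<^sub>R \<i>)" by metis
  thus ?thesis using that by (simp add: linear_add linear_scale)
 qed
 have linf: "linear (f' z)" if "z : ball p r" for z using der[OF that] has_derivative_linear by blast
 have linA: "linear A" "linear B" using A B has_derivative_linear by auto
 obtain d1 where d1: "d1 > 0" "!!z. norm (z - p) < d1 ==> norm (f' z 1 - f' p 1 - A (z - p)) <= q/2 * norm (z - p)"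
  using A k unfolding has_derivative_at_alt by (metis half_gt_zero)
 obtain d2 where d2: "d2 > 0" "!!z. norm (z - p) < d2 ==> norm (f' z \<i> - f' p \<i> - B (z - p)) <= q/2 * norm (z - p)"
  using B k unfolding has_derivative_at_alt by (metis half_gt_zero)
 define rh where "rh = min r (min d1 d2)"
 have rh: "rh > 0" using r d1 d2 by (auto simp: rh_def)
 have main: "f z <= f p + Re (b * (z - p)) + Re (c * (z - p)^2) + (k0/2) * (cmod (z - p))^2" if z: "z : ball p rh" for z proof -
  define h where "h = z - p"
  have hr: "norm h < rh" using z by (simp add: h_def dist_norm norm_minus_commute)
  define Q where "Q = A h * Re h + B h * Im h"
  define D where "D t = f (p + t *\<^sub>R h) - t * f' p h - t^2 / 2 * Q" for t
  have inb: "p + t *\<^sub>R h : ball p r" if "0 <= t" "t <= 1" for t proof -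
   have "norm (t *\<^sub>R h) <= norm h" using that by (simp add: mult_left_le_one_le)
   thus ?thesis using hr by (simp add: dist_norm rh_def)
  qed
  have dD: "DERIV D t :> f' (p + t *\<^sub>R h) h - f' p h - t * Q" if "0 <= t" "t <= 1" for t proof -
   have 1: "((%t. f (p + t *\<^sub>R h)) has_derivative (%s. f' (p + t *\<^sub>R h) (s *\<^sub>R h))) (at t)" proof -
    have 0: "((%t. p + t *\<^sub>R h) has_derivative (%s. s *\<^sub>R h)) (at t)" by (auto intro!: derivative_eq_intros)
    show ?thesis using has_derivative_compose[OF 0, of f] der[OF inb[OF that]] by blast
   qed
   have 2: "(%s. f' (p + t *\<^sub>R h) (s *\<^sub>R h)) = (*) (f' (p + t *\<^sub>R h) h)" using linf[OF inb[OF that]] by (auto simp: linear_scale)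
   have "DERIV (%t. f (p + t *\<^sub>R h)) t :> f' (p + t *\<^sub>R h) h" using 1 unfolding 2 has_field_derivative_def .
   thus ?thesis unfolding D_def by (auto intro!: derivative_eq_intros)
  qed
  obtain t where t: "0 < t" "t < 1" "D 1 - D 0 = f' (p + t *\<^sub>R h) h - f' p h - t * Q" using MVT2[of 0 1 D "%t. f' (p + t *\<^sub>R h) h - f' p h - t * Q"] dD by auto
  have nt: "norm ((p + t *\<^sub>R h) - p) <= norm h" using t by (simp add: mult_left_le_one_le)
  have i: "p + t *\<^sub>R h : ball p r" "p : ball p r" using inb[of t] t r by auto
  have "f' (p + t *\<^sub>R h) h - f' p h - t * Q = Re h * (f' (p + t *\<^sub>R h) 1 - f' p 1 - A (t *\<^sub>R h)) + Im h * (f' (p + t *\<^sub>R h) \<i> - f' p \<i> - B (t *\<^sub>R h))"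
   unfolding Q_def lin[OF linf[OF i(1)], of h] lin[OF linf[OF i(2)], of h] using linA by (simp add: linear_scale algebra_simps)
  also have "... <= \<bar>Re h\<bar> * \<bar>f' (p + t *\<^sub>R h) 1 - f' p 1 - A (t *\<^sub>R h)\<bar> + \<bar>Im h\<bar> * \<bar>f' (p + t *\<^sub>R h) \<i> - f' p \<i> - B (t *\<^sub>R h)\<bar>"
   by (intro add_mono) (metis abs_ge_self abs_mult)+
  also have "... <= norm h * (q/2 * norm h) + norm h * (q/2 * norm h)" proof (intro add_mono mult_mono abs_Re_le_cmod abs_Im_le_cmod)
   have "norm ((p + t *\<^sub>R h) - p) < d1" using nt hr by (simp add: rh_def)
   from order_trans[OF d1(2)[OF this] mult_left_mono[OF nt]] show "\<bar>f' (p + t *\<^sub>R h) 1 - f' p 1 - A (t *\<^sub>R h)\<bar> <= q/2 * norm h" using k by simp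
   have "norm ((p + t *\<^sub>R h) - p) < d2" using nt hr by (simp add: rh_def)
   from order_trans[OF d2(2)[OF this] mult_left_mono[OF nt]] show "\<bar>f' (p + t *\<^sub>R h) \<i> - f' p \<i> - B (t *\<^sub>R h)\<bar> <= q/2 * norm h" using k by simp
  qed auto
  also have "... = q * (norm h)^2" by (simp add: power2_eq_square)
  finally have "D 1 - D 0 <= q * (norm h)^2" using t by simp
  hence "f z <= f p + f' p h + Q/2 + q * (norm h)^2" by (simp add: D_def h_def)
  moreover have "f' p h = Re (b * h)" using lin[OF linf[OF i(2)], of h] by (simp add: b_def algebra_simps)
  moreover have "Q/2 = Re (c * h^2) + k0 * (cmod h)^2" unfolding Q_def lin[OF linA(1), of h] lin[OF linA(2), of h] cmod_power2 c_def k0_def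
   by (simp add: power2_eq_square field_simps)
  ultimately show ?thesis by (simp add: h_def q_def algebra_simps)
 qed
 show ?thesis unfolding strict_super_def by (rule exI[of _ b], rule exI[of _ c], rule exI[of _ "k0/2"], rule exI[of _ rh]) (use main k rh in auto)
qed

text \<open>Re F is harmonic, so the Laplacian is that of - k |z - a|^2.\<close>

lemma strict_super_Re_holomorphic: assumes F: "F holomorphic_on S" "open S" "p : S" and k: "k > 0" shows "strict_super (%z. c + Re (F z) - k * (cmod (z - a))^2) p"
proof -
 obtain r where r: "r > 0" "ball p r <= S" using F openE by blast
 have dF: "(F has_field_derivative deriv F z) (at z)" if "z : S" for z using F that holomorphic_derivI by blast
 have ddF: "(deriv F has_field_derivative deriv (deriv F) z) (at z)" if "z : S" for z using F that holomorphic_derivI[OF holomorphic_deriv] by blast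
 have eq: "c + Re (F z) - k * (cmod (z - a))^2 = c + Re (F z) - k * ((Re (z - a))^2 + (Im (z - a))^2)" for z by (simp add: cmod_power2)
 let ?f' = "%z h. Re (deriv F z * h) - 2 * k * (Re (z - a) * Re h + Im (z - a) * Im h)"
 let ?A = "%h. Re (deriv (deriv F) p * h) - 2 * k * Re h"
 let ?B = "%h. Re (deriv (deriv F) p * h * \<i>) - 2 * k * Im h"
 show ?thesis unfolding eq proof (rule strict_super_twice_differentiable[OF r(1), where f' = ?f' and A = ?A and B = ?B])
  fix z assume "z : ball p r"
  hence z: "z : S" using r by auto
  have 1: "((%z. Re (F z)) has_derivative (%h. Re (deriv F z * h))) (at z)"
   using bounded_linear.has_derivative[OF bounded_linear_Re dF[OF z, unfolded has_field_derivative_def]] .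
  show "((%z. c + Re (F z) - k * ((Re (z - a))^2 + (Im (z - a))^2)) has_derivative ?f' z) (at z)"
   by (rule derivative_eq_intros 1 refl)+ (simp add: fun_eq_iff algebra_simps)
 next
  have 1: "((%z. Re (deriv F z)) has_derivative (%h. Re (deriv (deriv F) p * h))) (at p)"
   using bounded_linear.has_derivative[OF bounded_linear_Re ddF[OF F(3), unfolded has_field_derivative_def]] .
  show "((%z. ?f' z 1) has_derivative ?A) (at p)" by (simp, (rule derivative_eq_intros 1 refl)+) (simp add: fun_eq_iff algebra_simps)
  have 2: "((%z. Im (deriv F z)) has_derivative (%h. Im (deriv (deriv F) p * h))) (at p)"
   using bounded_linear.has_derivative[OF bounded_linear_Im ddF[OF F(3), unfolded has_field_derivative_def]] .
  show "((%z. ?f' z \<i>) has_derivative ?B) (at p)" by (simp, (rule derivative_eq_intros 2 refl)+) (simp add: fun_eq_iff algebra_simps)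
  show "?A 1 + ?B \<i> < 0" using k by simp
 qed
qed

text \<open>Maximum principle for u - g, where g exists only off a set on which u is minus infinity.
  Extended by minus infinity the difference is upper semicontinuous and has a maximum point p. If
  the maximum were positive, p would be an interior point in W, and the quadratic above g at p,
  raised by u p - g p, would touch u from above with k < 0.\<close>

lemma subharmonic_comparison: assumes sub: "plane_subharmonic_on u U" and ball: "cball a s <= U" "s > 0" and W: "open W" and inf: "!!z. z : cball a s - W ==> u z = -\<infinity>"
  and cont: "continuous_on W g" and lower: "!!z. z : cball a s Int W ==> - B <= g z" and bd: "!!z. z : sphere a s Int W ==> u z <= ereal (g z)"
  and ss: "!!p. p : ball a s Int W ==> strict_super g p" and z: "z : cball a s Int W" shows "u z <= ereal (g z)" proof (rule ccontr)
 assume "~ u z <= ereal (g z)"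
 hence gt: "ereal (g z) < u z" by simp
 define G where "G x = (if x : W then u x - ereal (g x) else -\<infinity>)" for x
 have usc: "open {x\<in>U. u x < c}" for c using sub unfolding plane_subharmonic_on_def by blast
 \<comment> \<open>Witnesses for upper semicontinuity of G: u is below t and t - g is below c. Near
   points off W there is no control of g from its continuity, but g >= - B, so t + B < c serves
   instead.\<close>
 define N where "N c t = {y\<in>U. u y < ereal t} Int ({y\<in>W. ereal (t - g y) < c} Un {y. ereal (t + B) < c})" for c t
 have "open {y\<in>W. ereal (t - g y) < c}" for c t proof (cases c)
  case (real c')
  have "open (W Int (%y. t - g y) -` {..<c'})" by (intro continuous_open_preimage continuous_intros cont W)
  moreover have "{y\<in>W. ereal (t - g y) < c} = W Int (%y. t - g y) -` {..<c'}" using real by auto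
  ultimately show ?thesis by simp
 qed (use W in auto)
 hence N: "open (N c t)" for c t unfolding N_def using usc by (intro open_Int open_Un) auto
 have "(G x < c) = (\<exists>t. x : N c t)" if x: "x : cball a s" for x c
 proof
  assume Gx: "G x < c"
  have "\<exists>t. u x < ereal t & (if x : W then ereal (t - g x) < c else ereal (t + B) < c)" proof (cases "x : W")
   case True
   hence "u x < c + ereal (g x)" using Gx by (simp add: G_def ereal_minus_less)
   then obtain t where "u x < ereal t" "ereal t < c + ereal (g x)" using ereal_dense2 by blast
   thus ?thesis using True by (cases c) auto
  next
   case False
   hence "u x = -\<infinity>" "-\<infinity> < c" using inf[of x] x Gx by (auto simp: G_def)
   then obtain t where "ereal t < c" using ereal_dense2 by blast
   thus ?thesis using False `u x = -\<infinity>` by (intro exI[of _ "t - B"]) simp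
  qed
  thus "\<exists>t. x : N c t" using x ball(1) by (auto simp: N_def split: if_splits)
 next
  assume "\<exists>t. x : N c t"
  then obtain t where t: "u x < ereal t" "(x : W & ereal (t - g x) < c) \<or> ereal (t + B) < c" by (auto simp: N_def split: if_splits)
  show "G x < c" proof (cases "x : W")
   case True
   have "u x - ereal (g x) < ereal (t - g x)" using t(1) by (cases "u x") auto
   moreover have "ereal (t - g x) <= ereal (t + B)" using lower[of x] x True by simp
   ultimately have "u x - ereal (g x) < c" using t(2) by (metis le_less_trans less_trans)
   thus ?thesis using True by (simp add: G_def)
  next
   case False
   hence "ereal (t + B) < c" using t(2) by simp
   thus ?thesis using False by (cases c) (auto simp: G_def)
  qed
 qed
 hence eq: "{x\<in>cball a s. G x < c} = cball a s Int (\<Union>t. N c t)" for c by blast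
 have "openin (top_of_set (cball a s)) {x\<in>cball a s. G x < c}" for c unfolding eq by (intro openin_open_Int open_UN ballI N)
 then obtain p where p: "p : cball a s" "!!x. x : cball a s ==> G x <= G p"
  using usc_attains_max[of "cball a s" G] ball(2) by (metis compact_cball cball_eq_empty less_imp_le not_le)
 have "0 < G z" using gt z by (cases "u z") (auto simp: G_def)
 hence Gp: "0 < G p" using p(2)[of z] z by auto
 hence pW: "p : W" by (auto simp: G_def split: if_splits)
 have "u p < \<infinity>" using sub p(1) ball unfolding plane_subharmonic_on_def by blast
 then obtain A where A: "u p = ereal A" using Gp pW by (cases "u p") (auto simp: G_def)
 have pos: "g p < A" using Gp pW A by (simp add: G_def)
 have "p ~: sphere a s" using bd[of p] pW A pos by auto
 hence pb: "p : ball a s" using p(1) by (auto simp: less_le)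
 obtain b l k r where q: "k < 0" "0 < r" "!!z. z : ball p r ==> g z <= g p + Re (b * (z - p)) + Re (l * (z - p)^2) + k * (cmod (z - p))^2"
  using ss[of p] pb pW unfolding strict_super_def by blast
 obtain r' where r': "r' > 0" "ball p r' <= ball a s Int W" using pb pW W by (metis IntI open_Int open_ball openE)
 have "0 <= k" proof (rule touching_quadratic[OF sub _ _ A, of "min r r'"])
  fix x assume "x : ball p (min r r')"
  hence x: "x : ball p r" "x : ball a s" "x : W" using r' by auto
  have "G x <= G p" using p(2)[of x] x by auto
  hence "u x - ereal (g x) <= ereal (A - g p)" using x pW A by (simp add: G_def)
  hence "u x <= ereal (A - g p + g x)" by (cases "u x") auto
  also have "... <= ereal (A + Re (b * (x - p)) + Re (l * (x - p)^2) + k * (cmod (x - p))^2)" using q(3)[OF x(1)] by simp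
  finally show "u x <= ..." .
 qed (use p(1) ball q r' in auto)
 thus False using q by simp
qed

lemma plane_subharmonic_bounded_above: assumes sub: "plane_subharmonic_on u W" and S: "compact S" "S <= W" obtains C :: real where "!!z. z : S ==> u z <= ereal C"
proof (cases "S = {}")
 case False
 have "openin (top_of_set S) {z\<in>S. u z < a}" for a proof -
  have "{z\<in>S. u z < a} = S Int {z\<in>W. u z < a}" using S by auto
  thus ?thesis using sub unfolding plane_subharmonic_on_def by (metis openin_open_Int)
 qed
 then obtain p where p: "p : S" "!!z. z : S ==> u z <= u p" using usc_attains_max[OF S(1) False] by blast
 have "u p < \<infinity>" using sub p(1) S unfolding plane_subharmonic_on_def by blast
 hence "\<exists>C. u p <= ereal C" by (cases "u p") auto
 thus ?thesis using p that by (meson order_trans)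
qed (use that in auto)

text \<open>2 Re F - 1 is the Poisson kernel with pole e: Re F is 1/2 on the circle and 1 at the
  centre. The pole does no harm because u is minus infinity near it. The majorant C + N/2 + R^2 - N
  Re F - |z - x0|^2 equals C on the circle and C - N/2 + R^2 at the centre, with N arbitrary; the
  square makes it strict.\<close>

lemma subharmonic_minus_infinity_propagates: assumes sub: "plane_subharmonic_on u U" and ball: "cball x\<^sub>0 R <= U" "R > 0"
  and e: "cmod (e - x\<^sub>0) = R" and d: "d > 0" and inf: "!!z. z : ball e d ==> u z = -\<infinity>" shows "u x\<^sub>0 = -\<infinity>" proof (cases "x\<^sub>0 : cball e (d/2)")
 case False
 define F where "F z = (e - x\<^sub>0) / (e - z)" for z
 define W where "W = - cball e (d/2)"
 obtain C where C: "!!z. z : cball x\<^sub>0 R ==> u z <= ereal C" using plane_subharmonic_bounded_above[OF sub compact_cball ball(1)] by blast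
 have W: "open W" by (auto simp: W_def)
 have hF: "F holomorphic_on - ball e (d/2)" unfolding F_def using d by (auto intro!: holomorphic_intros)
 have WF: "W <= - ball e (d/2)" by (auto simp: W_def)
 have ReF: "Re (F z) = 1/2" if z: "cmod (z - x\<^sub>0) = R" "z ~= e" for z proof -
  have "(cmod (e - x\<^sub>0))^2 = (cmod (z - x\<^sub>0))^2" using z e by simp
  hence "2 * Re ((e - x\<^sub>0) * cnj (e - z)) = (cmod (e - z))^2" unfolding cmod_power2 by (simp add: algebra_simps power2_eq_square)
  moreover have "Re (F z) = Re ((e - x\<^sub>0) * cnj (e - z)) / (cmod (e - z))^2" unfolding F_def by (subst complex_div_cnj) (simp only: Re_divide_of_real)
  ultimately have "Re (F z) = ((cmod (e - z))^2 / 2) / (cmod (e - z))^2" by (metis nonzero_mult_div_cancel_left zero_neq_numeral)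
  thus ?thesis using z(2) by simp
 qed
 have bound: "u x\<^sub>0 <= ereal (C - N / 2 + R^2)" if N: "N > 0" for N :: real proof -
  let ?g = "%z. (C + N / 2 + R^2) + Re (- of_real N * F z) - 1 * (cmod (z - x\<^sub>0))^2"
  have cg: "continuous_on (- ball e (d/2)) ?g" using hF by (intro continuous_intros hol_cont)
  have "compact (?g ` (cball x\<^sub>0 R - ball e (d/2)))" by (rule compact_continuous_image[OF continuous_on_subset[OF cg]]) (auto intro: compact_diff)
  then obtain B where B: "\<forall>x\<in>?g ` (cball x\<^sub>0 R - ball e (d/2)). \<bar>x\<bar> <= B" using compact_imp_bounded bounded_real by blast
  have "u x\<^sub>0 <= ereal (?g x\<^sub>0)" proof (rule subharmonic_comparison[OF sub ball W _ continuous_on_subset[OF cg WF], where B = B])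
   show "u z = -\<infinity>" if "z : cball x\<^sub>0 R - W" for z using that d by (intro inf) (auto simp: W_def)
   show "- B <= ?g z" if "z : cball x\<^sub>0 R Int W" for z using bspec[OF B imageI, of z] that WF by force
   show "u z <= ereal (?g z)" if z: "z : sphere x\<^sub>0 R Int W" for z proof -
    have zz: "cmod (z - x\<^sub>0) = R" "z ~= e" using z d by (auto simp: dist_norm norm_minus_commute W_def)
    thus ?thesis using C[of z] z by (simp add: ReF[OF zz] zz(1) dist_norm norm_minus_commute)
   qed
   show "strict_super ?g p" if "p : ball x\<^sub>0 R Int W" for p proof (rule strict_super_Re_holomorphic[where S = W])
    show "(%z. - of_real N * F z) holomorphic_on W" using holomorphic_on_subset[OF hF WF] by (intro holomorphic_intros)
   qed (use W that in auto)
  qed (use False ball in "auto simp: W_def")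
  also have "?g x\<^sub>0 = C - N / 2 + R^2" using e ball(2) by (auto simp: F_def)
  finally show ?thesis .
 qed
 show ?thesis proof (cases "u x\<^sub>0")
  case (real c)
  define t where "t = \<bar>C + R^2 - c\<bar> + 1"
  have t: "0 < t" "C + R^2 - c < t" unfolding t_def by linarith+
  have "c <= C - (2 * t) / 2 + R^2" using bound[of "2 * t"] real t(1) by simp
  hence False using t(2) by simp
  thus ?thesis ..
 next
  case PInf
  thus ?thesis using bound[of 1] by simp
 qed auto
qed (use d in "intro inf, simp")

lemma plane_subharmonic_on_cong: assumes "!!z. z : W ==> u z = v z" and u: "plane_subharmonic_on u W" shows "plane_subharmonic_on v W" unfolding plane_subharmonic_on_def
proof (intro conjI ballI allI)
 show "v z < \<infinity>" if "z : W" for z using that u assms(1)[OF that] unfolding plane_subharmonic_on_def by auto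
 have "{z\<in>W. v z < a} = {z\<in>W. u z < a}" for a using assms(1) by auto
 thus "open {z\<in>W. v z < a}" for a using u unfolding plane_subharmonic_on_def by simp
 fix w assume w: "w : W"
 then obtain s where s: "s > 0" "ball w s <= W" "!!r. 0 < r ==> r < s ==> u w <= circle_mean u w r" using u unfolding plane_subharmonic_on_def by meson
 have "v w <= circle_mean v w r" if r: "0 < r" "r < s" for r proof -
  have "v w = u w" using assms(1) w by simp
  also have "... <= circle_mean u w r" using s r by blast
  also have "... <= circle_mean v w r" proof (rule circle_mean_mono)
   fix t
   have "w + of_real r * cis t : ball w s" using r by (simp add: dist_norm norm_mult)
   thus "u (w + of_real r * cis t) <= v (w + of_real r * cis t)" using assms(1) s(2) by auto
  qed
  finally show ?thesis .
 qed
 thus "\<exists>s>0. ball w s <= W & (\<forall>r. 0 < r & r < s --> v w <= circle_mean v w r)" using s by blast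
qed

text \<open>The standard coordinate is itself one of the charts over which the definition
  quantifies, on the part of V that it covers.\<close>

lemma subharmonic_on_chart: assumes s: "subharmonic_on s V" and V: "sopen V" shows "plane_subharmonic_on (s \<circ> param c) (param c -` V)" proof -
 define W where "W = param c -` V"
 define V' where "V' = param c ` W"
 define f where "f = inv_into UNIV (param c)"
 have f: "f (param c z) = z" for z unfolding f_def using inj_param by (simp add: inv_f_f)
 have o: "open W" using V openin_sphere_iff W_def by blast
 have "sphere_holomorphic_on f V'" unfolding sphere_holomorphic_on_def
 proof
  fix d
  show "(f \<circ> param d) holomorphic_on (param d -` V')" proof (cases "d = c")
   case True
   hence "f \<circ> param d = (%z. z)" using f by auto
   thus ?thesis by simp
  next
   case False
   hence d: "d = opp c" using chart_cases by blast
   have nz: "z ~= 0" if "z : param d -` V'" for z using that param_other_0[of c] d V'_def by auto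
   have "inverse holomorphic_on (param d -` V')" using nz by (auto intro!: holomorphic_intros)
   thus ?thesis proof (rule holomorphic_transform)
    fix z assume z: "z : param d -` V'"
    show "inverse z = (f \<circ> param d) z" using nz[OF z] f by (simp add: d param_other)
   qed
  qed
 qed
 moreover have "sopen V'" unfolding V'_def using o sopen_image by blast
 moreover have "inj_on f V'" using f by (auto simp: V'_def inj_on_def)
 ultimately have "holomorphic_chart V' f" unfolding holomorphic_chart_def by blast
 moreover have "V' <= V" by (auto simp: V'_def W_def)
 moreover have "\<forall>V' f. holomorphic_chart V' f & V' <= V --> plane_subharmonic_on (s \<circ> inv_into V' f) (f ` V')" using s by (simp add: subharmonic_on_def)
 ultimately have "plane_subharmonic_on (s \<circ> inv_into V' f) (f ` V')" by simp
 moreover have "f ` V' = W" using f by (auto simp: V'_def image_iff)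
 moreover have "inv_into V' f z = param c z" if "z : W" for z by (rule inv_into_f_eq) (use that f `inj_on f V'` in "auto simp: V'_def")
 ultimately have 1: "plane_subharmonic_on (s \<circ> inv_into V' f) W" and 2: "!!z. z : W ==> (s \<circ> inv_into V' f) z = (s \<circ> param c) z" by simp_all
 have "plane_subharmonic_on (s \<circ> param c) W" by (rule plane_subharmonic_on_cong[OF 2 1])
 thus ?thesis by (simp only: W_def)
qed

text \<open>The interior W of the set where s is minus infinity is also relatively closed in V, by
  propagation between discs. As V is connected and s is finite somewhere, W is empty.\<close>

lemma subharmonic_on_finite_dense: assumes s: "subharmonic_on s V" and V: "sopen V" "connectedin riemann_sphere V" and b: "param c b : V" and r: "r > 0"
 obtains z where "z : ball b r" "param c z : V" "s (param c z) ~= -\<infinity>" proof -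
 define W where "W = riemann_sphere interior_of {x\<in>V. s x = -\<infinity>}"
 have W: "W <= {x\<in>V. s x = -\<infinity>}" and oW: "sopen W" unfolding W_def by (rule interior_of_subset openin_interior_of)+
 have WI: "N <= W" if "sopen N" "N <= {x\<in>V. s x = -\<infinity>}" for N unfolding W_def using that by (intro interior_of_maximal)
 have "sopen (V - W)" unfolding openin_sphere_iff
 proof
  fix c
  define U where "U = param c -` V"
  have o: "open U" unfolding U_def using V(1)[unfolded openin_sphere_iff] by (rule spec)
  have ps: "plane_subharmonic_on (s \<circ> param c) U" unfolding U_def by (rule subharmonic_on_chart[OF s V(1)])
  show "open (param c -` (V - W))" proof (subst open_contains_ball, intro ballI)
   fix b assume b: "b : param c -` (V - W)"
   hence "b : U" by (simp add: U_def)
   then obtain r where r: "r > 0" "cball b r <= U" using open_contains_cball[THEN iffD1, OF o] by (elim ballE exE conjE) auto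
   have sub: "ball b (r/4) <= U" using r by (auto simp: subset_iff)
   \<comment> \<open>A quarter of r leaves room: the disc about any x of the small ball whose circle
     passes through e stays inside \<open>cball b r\<close>.\<close>
   have "param c e ~: W" if e: "e : ball b (r/4)" for e
   proof
    assume "param c e : W"
    moreover have "open (param c -` W)" using oW[unfolded openin_sphere_iff] by (rule spec)
    ultimately obtain d where d: "d > 0" "ball e d <= param c -` W" using openE by blast
    have eW: "(s \<circ> param c) z = -\<infinity>" if "z : ball e d" for z using subsetD[OF d(2) that] W by auto
    have inf: "(s \<circ> param c) x = -\<infinity>" if x: "x : ball b (r/4)" for x proof (cases "x = e")
     case False
     show ?thesis proof (rule subharmonic_minus_infinity_propagates[OF ps _ _ refl d(1)])
      have "dist e x < r/2" using e x dist_triangle[of e x b] by (simp add: dist_commute)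
      hence "dist b y <= r" if "dist x y <= dist e x" for y using that x dist_triangle[of b y x] r(1) by simp
      thus "cball x (cmod (e - x)) <= U" unfolding dist_norm[symmetric] using r(2) by (meson mem_cball subset_iff)
     qed (use False in simp, erule eW)
    qed (use d(1) eW[of e] in simp)
    have "param c ` ball b (r/4) <= W" using inf sub by (intro WI sopen_image open_ball) (auto simp: U_def)
    moreover have "param c b : param c ` ball b (r/4)" using r by (intro imageI) simp
    ultimately show False using b by blast
   qed
   thus "\<exists>e>0. ball b e <= param c -` (V - W)" using r(1) sub by (intro exI[of _ "r/4"]) (auto simp: U_def subset_iff)
  qed
 qed
 moreover have "\<exists>x\<in>V. s x ~= -\<infinity>" using s by (simp add: subharmonic_on_def)
 ultimately have W0: "W = {}" proof -
  assume o: "sopen (V - W)" and x: "\<exists>x\<in>V. s x ~= -\<infinity>"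
  have "W Int (V - W) Int V = {}" "V <= W Un (V - W)" "(V - W) Int V ~= {}" "W Int V = W" using x W by blast+
  thus ?thesis using V(2) oW o unfolding connectedin by metis
 qed
 note witness = that
 show ?thesis proof (rule ccontr)
  assume n: "~ thesis"
  have inf: "s (param c z) = -\<infinity>" if "z : ball b r" "param c z : V" for z using n witness[OF that] by blast
  have "open (ball b r Int param c -` V)" using V(1)[unfolded openin_sphere_iff] by (intro open_Int open_ball) (rule spec)
  hence "param c ` (ball b r Int param c -` V) <= W" using inf by (intro WI sopen_image) auto
  moreover have "param c b : param c ` (ball b r Int param c -` V)" using b r by (intro imageI) simp
  ultimately show False using W0 by blast
 qed
qed

section \<open>Polarity excludes bounded strictly subharmonic functions\<close>

lemma i_ddbar_eqI: assumes S: "open S" "z : S" and f: "!!x. x : S ==> ((%u. p (param c u)) has_derivative f' x) (at x)"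
  and A: "((%x. f' x 1) has_derivative A) (at z)" and B: "((%x. f' x \<i>) has_derivative B) (at z)" shows "i_ddbar p c z = (A 1 + B \<i>) / 4" proof -
 let ?F = "%u. complex_of_real (p (param c u))"
 have w: "wirtinger_bar ?F x = (of_real (f' x 1) + \<i> * of_real (f' x \<i>)) / 2" if "x : S" for x proof -
  have "(?F has_derivative (%h. of_real (f' x h))) (at x)" using bounded_linear.has_derivative[OF bounded_linear_of_real f[OF that]] .
  hence "frechet_derivative ?F (at x) = (%h. of_real (f' x h))" using frechet_derivative_at by metis
  thus ?thesis by (simp add: wirtinger_bar_def)
 qed
 \<comment> \<open>The mixed second derivatives enter only the imaginary part of the result; the
   real part is a quarter of the Laplacian.\<close>
 let ?G' = "%h. (of_real (A h) + \<i> * of_real (B h)) / 2"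
 have "((%x. (of_real (f' x 1) + \<i> * of_real (f' x \<i>)) / 2) has_derivative ?G') (at z)" by (auto intro!: derivative_eq_intros A B)
 hence "(wirtinger_bar ?F has_derivative ?G') (at z)" by (rule has_derivative_transform_within_open[OF _ S]) (use w in simp)
 hence "frechet_derivative (wirtinger_bar ?F) (at z) = ?G'" using frechet_derivative_at by metis
 thus ?thesis by (simp add: i_ddbar_def wirtinger_def)
qed

lemma smooth_on_twice_differentiable: assumes "smooth_on f S" "z : S" shows "(f has_derivative frechet_derivative f (at z)) (at z)"
  and "((%x. frechet_derivative f (at x) v) has_derivative frechet_derivative (%x. frechet_derivative f (at x) v) (at z)) (at z)" proof -
 have 1: "times_differentiable_on (Suc (Suc 0)) f S" using assms(1) unfolding smooth_on_def by (rule spec)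
 have 2: "times_differentiable_on (Suc 0) (%x. frechet_derivative f (at x) v) S"
  using 1[unfolded times_differentiable_on.simps(2)[of "Suc 0"], THEN conjunct2] by (rule spec)
 have "f differentiable at z" using 1[unfolded times_differentiable_on.simps(2)[of "Suc 0"], THEN conjunct1] assms(2) by (rule bspec)
 moreover have "(%x. frechet_derivative f (at x) v) differentiable at z"
  using 2[unfolded times_differentiable_on.simps(2)[of 0], THEN conjunct1] assms(2) by (rule bspec)
 ultimately show "(f has_derivative frechet_derivative f (at z)) (at z)"
  "((%x. frechet_derivative f (at x) v) has_derivative frechet_derivative (%x. frechet_derivative f (at x) v) (at z)) (at z)" unfolding frechet_derivative_works .
qed

lemma smooth_on_imp_continuous_on: assumes "smooth_on f S" shows "continuous_on S f" proof -
 have "times_differentiable_on 0 f S" using assms unfolding smooth_on_def by (rule spec)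
 thus ?thesis by simp
qed

lemma volume_form_pos: assumes "volume_form w" shows "continuous_on UNIV (w c)" "w c z > 0" proof -
 from assms[unfolded volume_form_def] obtain f where
  f: "sphere_smooth_on f UNIV & (\<forall>x. f x > 0) & w = (%c z. f (param c z) * fubini_study c z)" by (rule exE)
 hence f1: "\<forall>c. smooth_on (f \<circ> param c) (param c -` UNIV)" and f2: "\<forall>x. f x > 0" and f3: "w = (%c z. f (param c z) * fubini_study c z)"
  unfolding sphere_smooth_on_def by blast+
 have "continuous_on UNIV (f \<circ> param c)" using smooth_on_imp_continuous_on[OF spec[OF f1]] by (simp only: vimage_UNIV)
 hence c: "continuous_on UNIV (%z. f (param c z))" by (simp only: comp_def)
 have p: "0 < 1 + (cmod z)^2" for z by (rule add_pos_nonneg) simp_all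
 have F: "continuous_on UNIV (fubini_study c)" "fubini_study c z > 0" for z proof -
  have nz: "2 * pi * (1 + (cmod z)^2)^2 ~= 0" for z using p[of z] by simp
  thus "continuous_on UNIV (fubini_study c)" unfolding fubini_study_def by (intro continuous_intros) blast
  show "fubini_study c z > 0" using p[of z] by (simp add: fubini_study_def)
 qed
 show "continuous_on UNIV (w c)" unfolding f3 by (intro continuous_on_mult c F)
 show "w c z > 0" unfolding f3 by (intro mult_pos_pos F spec[OF f2])
qed

text \<open>Near a point where \<open>\<psi>\<close> almost attains its supremum M, subtracting k/2
  |z - a|^2 keeps it subharmonic, but lowers it on the circle of radius R by k/2 R^2 and near the
  centre by much less. A local function u that is minus infinity on K lets the maximum principle
  ignore K.\<close>

lemma polar_no_strictly_subharmonic: assumes K: "polar K" "sopen (- K)" "- K ~= {}" and bdd: "bounded (\<psi> ` (- K))" and sm: "sphere_smooth_on \<psi> (- K)"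
  and w: "volume_form w" "form_le_on w (i_ddbar \<psi>) (- K)" shows False proof -
 define M where "M = Sup (\<psi> ` (- K))"
 obtain B where B: "!!x. x : - K ==> \<bar>\<psi> x\<bar> <= B" using bdd unfolding bounded_real by blast
 have bda: "bdd_above (\<psi> ` (- K))" by (rule bounded_imp_bdd_above[OF bdd])
 have M: "\<psi> x <= M" if "x : - K" for x unfolding M_def using bda that by (simp add: cSup_upper)
 \<comment> \<open>Compactness: if every point had a neighbourhood on which \<open>\<psi>\<close>
   stays below M by a positive amount, finitely many of them would push the supremum below M. The
   point obtained may lie in K.\<close>
 have "\<exists>zt. \<forall>N t. sopen N --> zt : N --> t > 0 --> (\<exists>x\<in>N - K. M - t < \<psi> x)" proof (rule ccontr)
  assume "~ ?thesis"
  hence "\<forall>zt. \<exists>N t. sopen N & zt : N & t > 0 & (\<forall>x\<in>N - K. \<psi> x <= M - t)" by (meson not_le)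
  then obtain N e where N: "!!zt. sopen (N zt)" "!!zt. zt : N zt" "!!zt. e zt > 0" "!!zt x. x : N zt - K ==> \<psi> x <= M - e zt" by metis
  have "compactin riemann_sphere UNIV" using sphere_compact_iff[of UNIV] by simp
  hence "(\<forall>U\<in>range N. sopen U) & UNIV <= \<Union>(range N) --> (\<exists>\<F>. finite \<F> & \<F> <= range N & UNIV <= \<Union>\<F>)"
   unfolding compactin_def by (intro impI) (elim conjE allE[of _ "range N"], blast)
  moreover have "UNIV <= \<Union>(range N)" using N(2) by blast
  moreover have "\<forall>U\<in>range N. sopen U" using N(1) by auto
  ultimately have "\<exists>\<F>. finite \<F> & \<F> <= range N & UNIV <= \<Union>\<F>" by (elim impE) (rule conjI)
  then obtain \<F> where \<F>: "finite \<F>" "\<F> <= range N" "UNIV <= \<Union>\<F>" by (elim exE conjE)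
  then obtain A where A: "finite A" "\<F> = N ` A" by (meson finite_subset_image)
  hence "A ~= {}" using \<F>(3) by auto
  define t where "t = Min (e ` A)"
  have t: "t > 0" "!!zt. zt : A ==> t <= e zt" using A(1) `A ~= {}` N(3) by (auto simp: t_def)
  then obtain x where x: "x : - K" "M - t < \<psi> x" using less_cSup_iff[of "\<psi> ` (-K)" "M - t"] bda K(3) unfolding M_def by auto
  obtain zt where "zt : A" "x : N zt" using \<F>(3) A(2) by auto
  thus False using N(4)[of x zt] x t(2)[of zt] by auto
 qed
 then obtain zt where zt: "!!N t. sopen N ==> zt : N ==> t > 0 ==> \<exists>x\<in>N - K. M - t < \<psi> x" by metis
 obtain c a where a: "zt = param c a" by (rule sphere_cases)
 define S where "S = param c -` (- K)"
 have oS: "open S" using K(2) openin_sphere_iff S_def by blast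
 define f where "f = \<psi> \<circ> param c"
 have fsm: "smooth_on f S" using sm unfolding sphere_smooth_on_def f_def S_def by (rule spec)
 obtain V s where V: "sopen V" "connectedin riemann_sphere V" "param c a : V" "subharmonic_on s V" "K Int V <= {x\<in>V. s x = -\<infinity>}" proof -
  from K(1) have "\<exists>V s. sopen V & connectedin riemann_sphere V & param c a : V &
    subharmonic_on s V & K Int V <= {x \<in> V. s x = -\<infinity>}" unfolding polar_def by (rule spec) thus ?thesis using that by (elim exE conjE)
 qed
 define W where "W = param c -` V"
 define u where "u = s \<circ> param c"
 have oW: "open W" "a : W" using V openin_sphere_iff W_def by auto
 obtain R where R: "R > 0" "cball a R <= W" using open_contains_cball[THEN iffD1, OF oW(1)] oW(2) by (elim ballE exE conjE) auto
 have ps: "plane_subharmonic_on u W" using subharmonic_on_chart[OF V(4,1)] unfolding u_def W_def .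
 obtain C where C: "!!z. z : cball a R ==> u z <= ereal C" using plane_subharmonic_bounded_above[OF ps compact_cball R(2)] by blast
 obtain p\<^sub>0 where p0: "p\<^sub>0 : cball a R" "!!z. z : cball a R ==> w c p\<^sub>0 <= w c z" proof -
  have "\<exists>x\<in>cball a R. \<forall>y\<in>cball a R. w c x <= w c y" by (intro continuous_attains_inf continuous_on_subset[OF volume_form_pos(1)[OF w(1)]]) (use R in auto)
  thus ?thesis using that by blast
 qed
 define k where "k = w c p\<^sub>0"
 have k: "k > 0" unfolding k_def using volume_form_pos(2)[OF w(1)] .
 define X where "X = M - k/2 * R^2"
 define q where "q z = f z - k/2 * ((Re (z - a))^2 + (Im (z - a))^2)" for z
 have q': "q z = f z - k/2 * (cmod (z - a))^2" for z by (simp add: q_def cmod_power2)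
 have key: "q x <= X" if x: "x : cball a R" "x : S" "u x ~= -\<infinity>" for x proof -
  \<comment> \<open>On the circle q <= X, so the majorant is at least C there for every N > 0.
    Letting N grow shows that q > X is possible only where u is minus infinity.\<close>
  have ineq: "u x <= ereal (N * (X - q x) + C)" if N: "N > 0" for N proof -
   let ?g = "%z. N * (X - q z) + C"
   have fle: "f z <= M" if "z : S" for z using M[of "param c z"] that by (simp add: S_def f_def)
   show ?thesis proof (rule subharmonic_comparison[OF ps R(2,1) oS])
    show "u z = -\<infinity>" if "z : cball a R - S" for z using that V(5) R(2) unfolding S_def W_def u_def by auto
    show "continuous_on S ?g" unfolding q_def by (intro continuous_intros smooth_on_imp_continuous_on[OF fsm])
    show "- (N * (\<bar>X\<bar> + \<bar>M\<bar>) + \<bar>C\<bar>) <= ?g z" if z: "z : cball a R Int S" for z proof -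
     have "0 <= k/2 * (cmod (z - a))^2" using k by simp
     moreover have "f z <= M" using fle[of z] z by simp
     ultimately have "q z <= M" unfolding q' by linarith
     hence "N * - (\<bar>X\<bar> + \<bar>M\<bar>) <= N * (X - q z)" using N by (intro mult_left_mono) auto
     moreover have "- \<bar>C\<bar> <= C" by simp
     ultimately show ?thesis by (simp only: mult_minus_right)
    qed
    show "u z <= ereal (?g z)" if z: "z : sphere a R Int S" for z proof -
     have "cmod (z - a) = R" using z by (simp add: dist_norm norm_minus_commute)
     hence "q z <= X" using fle[of z] z by (simp add: q' X_def)
     hence "C <= ?g z" using N by simp
     moreover have "u z <= ereal C" using C[of z] z by simp
     ultimately show ?thesis by (meson ereal_less_eq(3) order_trans)
    qed
    show "strict_super ?g p" if p: "p : ball a R Int S" for p proof -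
     have pS: "p : S" using p by simp
     obtain r where r: "r > 0" "ball p r <= S" using oS pS openE by blast
     define D where "D v x = frechet_derivative f (at x) v" for v x
     define D2 where "D2 v = frechet_derivative (D v) (at p)" for v
     have d1: "(f has_derivative (%v. D v x)) (at x)" if "x : S" for x unfolding D_def by (rule smooth_on_twice_differentiable(1)[OF fsm that])
     have d2: "(D v has_derivative D2 v) (at p)" for v unfolding D_def D2_def by (rule smooth_on_twice_differentiable(2)[OF fsm pS])
     have "i_ddbar \<psi> c p = (D2 1 1 + D2 \<i> \<i>) / 4" by (rule i_ddbar_eqI[OF oS pS, where f' = "%x v. D v x"]) (use d1 d2 in "simp_all only: f_def comp_def")
     moreover have "k <= w c p" using p0(2)[of p] p by (simp add: k_def)
     moreover have "w c p <= i_ddbar \<psi> c p" using w(2) pS unfolding form_le_on_def S_def by (simp add: vimage_eq)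
     ultimately have AB: "4 * k <= D2 1 1 + D2 \<i> \<i>" by simp
     define f' where "f' z h = - N * (D h z - k * (Re (z - a) * Re h + Im (z - a) * Im h))" for z h
     show ?thesis proof (rule strict_super_twice_differentiable[OF r(1)])
      fix z assume "z : ball p r"
      hence "z : S" using r by auto
      note d = d1[OF this]
      show "(?g has_derivative f' z) (at z)" unfolding q_def by (rule derivative_eq_intros d refl)+ (simp add: fun_eq_iff f'_def algebra_simps)
     next
      show "((%z. f' z 1) has_derivative (%h. - N * (D2 1 h - k * Re h))) (at p)" unfolding f'_def
       by (rule derivative_eq_intros d2 refl)+ (simp add: fun_eq_iff algebra_simps)
      show "((%z. f' z \<i>) has_derivative (%h. - N * (D2 \<i> h - k * Im h))) (at p)" unfolding f'_def
       by (rule derivative_eq_intros d2 refl)+ (simp add: fun_eq_iff algebra_simps)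
      have "- N * (D2 1 1 - k * Re 1) + - N * (D2 \<i> \<i> - k * Im \<i>) = - N * (D2 1 1 + D2 \<i> \<i> - 2 * k)" by (simp add: algebra_simps)
      also have "... < 0" using AB k N by simp
      finally show "- N * (D2 1 1 - k * Re 1) + - N * (D2 \<i> \<i> - k * Im \<i>) < 0" .
     qed
    qed
   qed (use x in auto)
  qed
  obtain y where y: "u x = ereal y" using x(3) C[OF x(1)] by (cases "u x") auto
  show ?thesis proof (rule ccontr)
   assume "~ ?thesis"
   hence pos: "q x - X > 0" by simp
   define N where "N = (\<bar>C - y\<bar> + 1) / (q x - X)"
   have "N > 0" using pos by (simp add: N_def add_nonneg_pos)
   hence "y <= N * (X - q x) + C" using ineq y by simp
   moreover have "N * (q x - X) = \<bar>C - y\<bar> + 1" using pos by (simp add: N_def)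
   hence "N * (X - q x) = - (\<bar>C - y\<bar> + 1)" by (simp add: algebra_simps)
   ultimately show False by linarith
  qed
 qed
 \<comment> \<open>The defect k/8 R^2 of \<open>\<psi>\<close> and the k/8 R^2 subtracted within
   radius R/2 add up to less than k/2 R^2.\<close>
 define et where "et = k/8 * R^2"
 have et: "et > 0" using k R by (simp add: et_def)
 have "sopen (param c ` ball a (R/2))" by (rule sopen_image) simp
 moreover have "zt : param c ` ball a (R/2)" unfolding a using R(1) by (intro imageI) simp
 ultimately obtain z where z: "z : ball a (R/2)" "z : S" "M - et < f z" using zt[of "param c ` ball a (R/2)" et] et unfolding S_def f_def by auto
 have "open (S Int f -` {M - et<..})" by (intro continuous_open_preimage smooth_on_imp_continuous_on[OF fsm] oS) auto
 hence "open (S Int f -` {M - et<..} Int ball a (R/2))" by blast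
 moreover have "z : S Int f -` {M - et<..} Int ball a (R/2)" using z by simp
 ultimately obtain r where r: "r > 0" "ball z r <= S Int f -` {M - et<..} Int ball a (R/2)" using openE by blast
 have "param c z : V" using z R by (auto simp: W_def subset_iff)
 \<comment> \<open>Points with finite s are dense, so one of them lies where \<open>\<psi>\<close>
   is close to M.\<close>
 then obtain x where x: "x : ball z r" "s (param c x) ~= -\<infinity>" using subharmonic_on_finite_dense[OF V(4,1,2) _ r(1)] by metis
 have xx: "x : S" "M - et < f x" "dist a x < R/2" using x r by auto
 have "q x <= X" by (rule key) (use xx x R in "auto simp: u_def")
 moreover have "k/2 * (cmod (x - a))^2 <= k/2 * (R/2)^2" using xx k by (intro mult_left_mono power_mono) (auto simp: dist_norm norm_minus_commute)
 ultimately have "M - et - k/8 * R^2 < M - k/2 * R^2" using xx by (simp add: q' X_def power2_eq_square)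
 thus False using k R(1) by (simp add: et_def)
qed

section \<open>Logarithmic capacity\<close>

text \<open>The logarithmic potential of a finite weight, with the kernel frozen below distance d so
  that points carrying mass have finite potential.\<close>

definition lpot :: "complex set => (complex => real) => real => complex => real" where "lpot P m d z = (\<Sum>w\<in>P. m w * - ln (tdist d z w))"

text \<open>First order conditions for a minimiser of the energy on the simplex: transferring a
  little mass from i to j cannot lower the energy, so the potential at a point i that carries mass
  is at most the potential at any j.\<close>

lemma simplex_quadratic_minimiser:
 fixes A :: "complex => complex => real" assumes P: "finite P" "P ~= {}" and sym: "!!v w. A v w = A w v" obtains m I where "!!w. 0 <= m w" "sum m P = 1"
  "!!i. i : P ==> I <= (\<Sum>j\<in>P. m j * A i j)" "!!i. i : P ==> m i > 0 ==> (\<Sum>j\<in>P. m j * A i j) = I" proof -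
 \<comment> \<open>Weights are functions on the whole plane that vanish off P; compactness then
   comes from a product of intervals.\<close>
 define S where "S = (\<Pi>\<^sub>E w\<in>UNIV. if w : P then {0..1::real} else {0})"
 define T where "T = S Int {m. sum m P = 1}"
 define E where "E m = (\<Sum>i\<in>P. \<Sum>j\<in>P. m i * m j * A i j)" for m
 define V where "V m i = (\<Sum>j\<in>P. m j * A i j)" for m i
 have "compactin (product_topology (%_. euclidean) UNIV) S" unfolding S_def compactin_PiE by auto
 hence cS: "compact S" by (simp add: euclidean_product_topology)
 have cont: "continuous_on UNIV (%m::complex => real. m i)" for i by (rule continuous_on_product_coordinates)
 have "closed {m. sum m P = (1::real)}" by (intro closed_Collect_eq continuous_intros cont)
 hence cT: "compact T" unfolding T_def by (rule compact_Int_closed[OF cS])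
 have TI: "m : T" if nn: "!!w. w : P ==> 0 <= m w" and out: "!!w. w ~: P ==> m w = 0" and 1: "sum m P = 1" for m :: "complex => real" proof -
  have "m w <= 1" if "w : P" for w using member_le_sum[of w P m] that nn 1 P(1) by simp
  thus ?thesis using nn out 1 by (auto simp: T_def S_def PiE_iff)
 qed
 obtain p where p: "p : P" using P by auto
 have "(%w. if w = p then 1 else 0) : T" by (rule TI) (use P(1) p in auto)
 hence "T ~= {}" by blast
 moreover have "continuous_on T E" unfolding E_def by (intro continuous_intros continuous_on_subset[OF cont subset_UNIV])
 ultimately obtain m where m: "m : T" "!!m'. m' : T ==> E m <= E m'" using continuous_attains_inf[OF cT] by blast
 have m0: "0 <= m w" for w using m(1) by (auto simp: T_def S_def PiE_iff split: if_splits dest: spec[of _ w])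
 have mP: "m w = 0" if "w ~: P" for w using m(1) that by (auto simp: T_def S_def PiE_iff dest: spec[of _ w])
 have m1: "sum m P = 1" using m(1) by (simp add: T_def)
 have shift: "V m i <= V m j" if i: "i : P" "m i > 0" and j: "j : P" for i j proof (cases "i = j")
  case False
  define D where "D w = (if w = j then 1 else 0) - (if w = i then 1 else (0::real))" for w
  define q where "q = A j j + A i i - 2 * A i j"
  have sD: "(\<Sum>w\<in>P. D w * f w) = f j - f i" for f unfolding D_def left_diff_distrib sum_subtractf using P(1) i(1) j
   by (simp add: if_distrib[of "%x. x * _"] cong: if_cong)
  have ineq: "0 <= 2 * e * (V m j - V m i) + e^2 * q" if e: "0 < e" "e <= m i" for e proof -
   have "sum (%w. m w + e * D w) P = sum m P + e * (\<Sum>w\<in>P. D w * 1)" by (simp add: sum.distrib sum_distrib_left)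
   also have "... = 1" unfolding sD using m1 by simp
   finally have "(%w. m w + e * D w) : T" using e m0 mP i j False by (intro TI) (auto simp: D_def add_nonneg_nonneg)
   hence "E m <= E (%w. m w + e * D w)" by (rule m(2))
   also have "E (%w. m w + e * D w) = E m + e * (\<Sum>v\<in>P. m v * (\<Sum>w\<in>P. D w * A v w)) + e * (\<Sum>v\<in>P. D v * (\<Sum>w\<in>P. m w * A v w)) + e^2 * (\<Sum>v\<in>P. D v * (\<Sum>w\<in>P. D w * A v w))"
    unfolding E_def by (simp add: sum_distrib_left sum.distrib algebra_simps power2_eq_square)
   also have "... = E m + 2 * e * (V m j - V m i) + e^2 * q" proof -
    have s1: "(\<Sum>v\<in>P. m v * (\<Sum>w\<in>P. D w * A v w)) = V m j - V m i" unfolding sD by (simp add: V_def right_diff_distrib sum_subtractf sym[of j] sym[of i])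
    have s2: "(\<Sum>v\<in>P. D v * (\<Sum>w\<in>P. m w * A v w)) = V m j - V m i" unfolding sD V_def ..
    have s3: "(\<Sum>v\<in>P. D v * (\<Sum>w\<in>P. D w * A v w)) = q" unfolding sD q_def by (simp add: sym[of j i])
    show ?thesis unfolding s1 s2 s3 by (simp add: algebra_simps)
   qed
   finally show ?thesis by simp
  qed
  show ?thesis proof (rule ccontr)
   assume "~ ?thesis"
   hence neg: "V m i - V m j > 0" by simp
   \<comment> \<open>The bound by \<open>m i\<close> keeps the weight nonnegative, and the other
     bound makes the linear gain outweigh e^2 q.\<close>
   define e where "e = min (m i) ((V m i - V m j) / (\<bar>q\<bar> + 1))"
   have e: "0 < e" "e <= m i" using i neg by (auto simp: e_def add_nonneg_pos)
   have "e <= (V m i - V m j) / (\<bar>q\<bar> + 1)" by (simp add: e_def)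
   hence "e * (\<bar>q\<bar> + 1) <= V m i - V m j" by (simp add: pos_le_divide_eq add_nonneg_pos)
   moreover have "e * q <= e * (\<bar>q\<bar> + 1)" using e by (intro mult_left_mono) auto
   ultimately have "e * q <= V m i - V m j" by (rule order_trans[rotated])
   moreover have "2 * (b - a) + y < 0" if "y <= a - b" "a - b > 0" for a b y :: real using that by argo
   ultimately have "2 * (V m j - V m i) + e * q < 0" using neg by blast
   hence "e * (2 * (V m j - V m i) + e * q) < 0" using e by (simp add: mult_pos_neg)
   moreover have "e * (2 * (V m j - V m i) + e * q) = 2 * e * (V m j - V m i) + e^2 * q" by (simp add: algebra_simps power2_eq_square)
   ultimately show False using ineq[OF e] by simp
  qed
 qed simp
 have "\<exists>i\<in>P. m i > 0" proof (rule ccontr)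
  assume "~ ?thesis"
  hence "m i = 0" if "i : P" for i using m0[of i] that by force
  thus False using m1 by simp
 qed
 then obtain i where i: "i : P" "m i > 0" by blast
 show ?thesis proof (rule that[of m "V m i"])
  show "V m i <= (\<Sum>j\<in>P. m j * A k j)" if "k : P" for k using shift[OF i that] by (simp add: V_def)
  show "(\<Sum>j\<in>P. m j * A k j) = V m i" if "k : P" "m k > 0" for k using shift[OF i that(1)] shift[OF that i(1)] by (simp add: V_def)
 qed (use m0 m1 in auto)
qed

text \<open>The first order conditions hold on a finite net P. They extend because a change of all
  truncated distances by a factor 2 changes the potential by at most ln 2. For the lower bound z is
  compared with a net point closer than d; for the upper bound with the point of the support nearest
  to z, a discrete form of the maximum principle.\<close>

lemma equilibrium_weights: assumes F: "compact F" "F ~= {}" and d: "d > 0" obtains P m I where "finite P" "P <= F" "!!w. 0 <= m w" "sum m P = 1"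
  "!!z. z : F ==> I - ln 2 <= lpot P m d z" "!!z. lpot P m d z <= I + ln 2" proof -
 obtain P where P: "finite P" "P <= F" "F <= (\<Union>x\<in>P. ball x d)" by (rule compactE_image[OF F(1), of F "%x. ball x d"]) (use d in auto)
 have "P ~= {}" using P F by auto
 define A where "A v w = - ln (tdist d v w)" for v w
 have sym: "A v w = A w v" for v w by (simp add: A_def norm_minus_commute)
 obtain m I where m: "!!w. 0 <= m w" "sum m P = 1" "!!i. i : P ==> I <= (\<Sum>j\<in>P. m j * A i j)" "!!i. i : P ==> m i > 0 ==> (\<Sum>j\<in>P. m j * A i j) = I"
  by (rule simplex_quadratic_minimiser[of P A, OF P(1) `P ~= {}` sym]) (rule that)
 have pot: "lpot P m d z = (\<Sum>j\<in>P. m j * A z j)" for z by (simp add: lpot_def A_def)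
 have shift: "(\<Sum>j\<in>P. m j * A x j) - ln 2 <= (\<Sum>j\<in>P. m j * A y j)" if near: "!!j. j : P ==> m j > 0 ==> tdist d y j <= 2 * tdist d x j" for x y proof -
  have "m j * A x j - m j * ln 2 <= m j * A y j" if j: "j : P" for j proof (cases "m j > 0")
   case True
   have pos: "0 < tdist d y j" "0 < tdist d x j" using d by auto
   have pos2: "0 < 2 * tdist d x j" using pos(2) by simp
   have "ln (tdist d y j) <= ln (2 * tdist d x j)" unfolding ln_le_cancel_iff[OF pos(1) pos2] by (rule near[OF j True])
   also have "... = ln 2 + ln (tdist d x j)" using pos(2) by (intro ln_mult_pos) simp_all
   finally have "A x j - ln 2 <= A y j" by (simp add: A_def)
   from mult_left_mono[OF this m(1)[of j]] show ?thesis by (simp add: algebra_simps)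
  next
   case False
   hence "m j = 0" using m(1)[of j] by simp
   thus ?thesis by simp
  qed
  hence "(\<Sum>j\<in>P. m j * A x j - m j * ln 2) <= (\<Sum>j\<in>P. m j * A y j)" by (rule sum_mono)
  thus ?thesis using m(2) by (simp add: sum_subtractf flip: sum_distrib_right)
 qed
 show ?thesis proof (rule that[of P m I])
  fix z assume "z : F"
  then obtain x where x: "x : P" "dist x z < d" using P(3) by auto
  have "(\<Sum>j\<in>P. m j * A x j) - ln 2 <= (\<Sum>j\<in>P. m j * A z j)" proof (rule shift)
   fix j
   have "cmod (z - j) <= d + cmod (x - j)" using x(2) norm_triangle_ineq[of "z - x" "x - j"] by (simp add: dist_norm norm_minus_commute)
   thus "tdist d z j <= 2 * tdist d x j" using d by auto
  qed
  thus "I - ln 2 <= lpot P m d z" unfolding pot using m(3)[OF x(1)] by simp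
 next
  fix z
  define Q where "Q = {w\<in>P. m w > 0}"
  have "Q ~= {}"
  proof
   assume "Q = {}"
   hence "m w = 0" if "w : P" for w using m(1)[of w] that by (force simp: Q_def)
   thus False using m(2) by simp
  qed
  moreover have "finite Q" using P(1) by (simp add: Q_def)
  ultimately obtain x where x: "x : Q" "!!y. y : Q ==> cmod (z - x) <= cmod (z - y)"
   using ex_is_arg_min_if_finite[of Q "%y. cmod (z - y)"] unfolding is_arg_min_linorder by blast
  have "(\<Sum>j\<in>P. m j * A z j) - ln 2 <= (\<Sum>j\<in>P. m j * A x j)" proof (rule shift)
   fix j assume "j : P" "m j > 0"
   hence "cmod (z - x) <= cmod (z - j)" using x by (auto simp: Q_def)
   hence "cmod (x - j) <= 2 * cmod (z - j)" using norm_triangle_ineq[of "x - z" "z - j"] by (simp add: norm_minus_commute)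
   thus "tdist d x j <= 2 * tdist d z j" using d by auto
  qed
  moreover have "(\<Sum>j\<in>P. m j * A x j) = I" using m(4) x(1) by (simp add: Q_def)
  ultimately show "lpot P m d z <= I + ln 2" unfolding pot by simp
 qed (use P m in auto)
qed

text \<open>I plays the part of the Robin constant of F at scale d, and the two bounds are those
  that \<open>equilibrium_weights\<close> delivers, so failure means that I stays below one M at all
  scales. The points of P lie in F and carry mass 1, so the empty set does not satisfy this.\<close>

definition cap_zero :: "complex set => bool" where "cap_zero F = (\<forall>M. \<exists>d P m I. d > 0 & finite P & P <= F & (\<forall>w. 0 <= m w) & sum m P = 1 & M <= I &
   (\<forall>z\<in>F. I - ln 2 <= lpot P m d z) & (\<forall>z. lpot P m d z <= I + ln 2))"

lemma not_cap_zero_weights: assumes F: "compact F" "F ~= {}" and n: "~ cap_zero F"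
 obtains M where "!!d. d > 0 ==> \<exists>P m. finite P & P <= F & (\<forall>w. 0 <= m w) & sum m P = 1 & (\<forall>z. lpot P m d z <= M)" proof -
 from n obtain M where M: "~ (\<exists>d P m I. d > 0 & finite P & P <= F & (\<forall>w. 0 <= m w) & sum m P = 1 & M <= I &
   (\<forall>z\<in>F. I - ln 2 <= lpot P m d z) & (\<forall>z. lpot P m d z <= I + ln 2))" unfolding cap_zero_def not_all by (rule exE) show ?thesis
 proof (rule that[of "M + ln 2"])
  fix d :: real assume d: "d > 0"
  obtain P m I where m: "finite P" "P <= F" "!!w. 0 <= m w" "sum m P = 1" "!!z. z : F ==> I - ln 2 <= lpot P m d z" "!!z. lpot P m d z <= I + ln 2"
   by (rule equilibrium_weights[OF F d]) (rule that)
  have "I < M" proof (rule ccontr)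
   assume "~ I < M"
   hence "M <= I" by simp
   thus False using M d m by blast
  qed
  hence "lpot P m d z <= M + ln 2" for z using m(6)[of z] by simp
  thus "\<exists>P m. finite P & P <= F & (\<forall>w. 0 <= m w) & sum m P = 1 & (\<forall>z. lpot P m d z <= M + ln 2)" using m by blast
 qed
qed

text \<open>A point mass truncated at exp (- M) has potential M at the point and at most M
  elsewhere.\<close>

lemma cap_zero_singleton: "cap_zero {a}" unfolding cap_zero_def
proof
 fix M
 have pot: "lpot {a} (%_. 1) (exp (- M)) z = - ln (max (cmod (z - a)) (exp (- M)))" for z by (simp add: lpot_def)
 have "- ln (max (cmod (z - a)) (exp (- M))) <= M" for z proof -
  have "ln (exp (- M)) <= ln (max (cmod (z - a)) (exp (- M)))" by (subst ln_le_cancel_iff) (auto simp: less_max_iff_disj)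
  thus ?thesis by simp
 qed
 hence "lpot {a} (%_. 1) (exp (- M)) z <= M + ln 2" for z
  unfolding pot using ln_gt_zero[of "2::real"] by (meson add_increasing2 less_imp_le one_less_numeral_iff semiring_norm(76))
 moreover have "M - ln 2 <= lpot {a} (%_. 1) (exp (- M)) a" unfolding pot by (simp add: max_def)
 ultimately show "\<exists>d P m I. d > 0 & finite P & P <= {a} & (\<forall>w. 0 <= m w) & sum m P = 1 & M <= I & (\<forall>z\<in>{a}. I - ln 2 <= lpot P m d z) & (\<forall>z. lpot P m d z <= I + ln 2)"
  by (intro exI[of _ "exp (- M)"] exI[of _ "{a}"] exI[of _ "%_. 1"] exI[of _ M]) auto
qed

lemma measurable_indicator_ennreal:
 fixes q :: "complex => real" assumes "A : sets borel" "continuous_on A q" shows "(%z. ennreal (q z) * indicator A z) : borel_measurable lborel" proof -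
 have "(%z. ennreal (indicator A z *\<^sub>R q z)) : borel_measurable borel" using borel_measurable_continuous_on_indicator[OF assms] by simp
 moreover have "(%z. ennreal (indicator A z *\<^sub>R q z)) = (%z. ennreal (q z) * indicator A z)" by (simp add: indicator_def fun_eq_iff)
 ultimately show ?thesis by simp
qed

section \<open>Mean values of logarithmic potentials\<close>

lemma integral_periodic_shift:
 fixes v :: "real => real" assumes v: "continuous_on UNIV v" and per: "!!t. v (t + T) = v t" and s: "0 <= s" "s <= T" shows "integral {s..s+T} v = integral {0..T} v" proof -
 have int: "v integrable_on {a..b}" for a b by (rule integrable_continuous_real[OF continuous_on_subset[OF v]]) simp
 have "integral {0..s} v + integral {s..T} v = integral {0..T} v" using s by (intro Henstock_Kurzweil_Integration.integral_combine int) auto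
 moreover have "integral {s..T} v + integral {T..s+T} v = integral {s..s+T} v" using s by (intro Henstock_Kurzweil_Integration.integral_combine int) auto
 moreover have "integral {0..s} (v \<circ> (%x. x + T)) = integral {0 + T..s + T} v" by (rule integral_shift[OF continuous_on_subset[OF v]]) simp
 moreover have "v \<circ> (%x. x + T) = v" using per by auto
 ultimately show ?thesis by simp
qed

lemma riemann_sum_le_integral:
 fixes v :: "real => real" assumes v: "continuous_on UNIV v" and h: "h > 0" and osc: "!!t x. t : {s..s + real N * h} ==> x : {t..t+h} ==> v t - e <= v x"
 shows "n <= N ==> (\<Sum>k<n. h * (v (s + real k * h) - e)) <= integral {s..s + real n * h} v" proof (induction n)
 case (Suc n)
 have int: "v integrable_on {a..b}" for a b by (rule integrable_continuous_real[OF continuous_on_subset[OF v]]) simp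
 let ?t = "s + real n * h"
 have "real n * h <= real N * h" using Suc.prems h by (intro mult_right_mono) auto
 hence t: "?t : {s..s + real N * h}" using h by simp
 have "h * (v ?t - e) = integral {?t..?t + h} (%_. v ?t - e)" using h by simp
 also have "... <= integral {?t..?t + h} v" by (rule integral_le) (use int osc[OF t] in auto)
 finally have 1: "h * (v ?t - e) <= integral {?t..?t + h} v" .
 have "integral {s..?t} v + integral {?t..?t + h} v = integral {s..?t + h} v" using h by (intro Henstock_Kurzweil_Integration.integral_combine int) auto
 thus ?case using Suc 1 by (simp add: algebra_simps)
qed simp

text \<open>The product of the rotated copies of \<open>f\<close> and the maximum principle give a point on the circle where
  a Riemann sum of \<open>ln \<bar>f\<bar>\<close> is at least the value at the centre.\<close>

lemma log_max_submean: assumes f: "f holomorphic_on ball p R" and r: "0 < r" "r < R" and d: "d > 0"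
 shows "2 * pi * ln (max (cmod (f p)) d) <= integral {0..2*pi} (%t. ln (max (cmod (f (p + of_real r * cis t))) d))" proof -
 define v where "v t = ln (max (cmod (f (p + of_real r * cis t))) d)" for t
 have inb: "p + of_real r * cis t : ball p R" for t using r by (simp add: dist_norm norm_mult)
 have cf: "continuous_on UNIV (%t. f (p + of_real r * cis t))" by (rule continuous_on_compose2[OF hol_cont[OF f]])
   (use inb in "auto intro!: continuous_intros")
 have mpos: "0 < max x d" for x using d by simp
 have v: "continuous_on UNIV v" unfolding v_def by (intro continuous_intros cf) (use mpos in "simp add: less_imp_neq[symmetric]")
 have int: "v integrable_on {a..b}" for a b by (rule integrable_continuous_real[OF continuous_on_subset[OF v]]) simp
 have vd: "ln d <= v t" for t unfolding v_def by (subst ln_le_cancel_iff) (use d in auto)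
 show ?thesis proof (cases "cmod (f p) <= d")
  case True
  have "integral {0..2*pi} (%_. ln d) <= integral {0..2*pi} v" by (rule integral_le) (use int vd in auto)
  thus ?thesis using True by (simp add: v_def[abs_def] max_def)
 next
  case False
  have "2 * pi * ln (cmod (f p)) <= integral {0..2*pi} v + e" if e: "e > 0" for e proof -
   define q where "q = e / (2 * pi)"
   have q: "q > 0" using e by (simp add: q_def)
   \<comment> \<open>All arguments stay below 6 pi: the starting angle s, the period and the mesh h
     are each at most 2 pi.\<close>
   have "uniformly_continuous_on {0..6*pi} v" by (rule compact_uniformly_continuous[OF continuous_on_subset[OF v]]) auto
   then obtain et where et: "et > 0" "!!x y. x : {0..6*pi} ==> y : {0..6*pi} ==> dist y x < et ==> dist (v y) (v x) < q" using q unfolding uniformly_continuous_on_def by metis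
   obtain N :: nat where N: "2 * pi / et < real N" using reals_Archimedean2 by blast
   hence Npos: "0 < real N" using et(1) pi_gt_zero by (smt (verit) divide_pos_pos)
   define h where "h = 2 * pi / real N"
   have h: "0 < h" "h < et" "real N * h = 2 * pi" "h <= 2 * pi" using N Npos et(1) by (auto simp: h_def field_simps)
   define H where "H z = (\<Prod>k<N. f (p + z * cis (real k * h)))" for z
   have Hhol: "H holomorphic_on ball 0 R" unfolding H_def proof (intro holomorphic_on_prod)
    fix k
    have "(f \<circ> (%z. p + z * cis (real k * h))) holomorphic_on ball 0 R"
     by (rule holomorphic_on_compose_gen[OF _ f]) (auto intro!: holomorphic_intros simp: dist_norm norm_mult)
    thus "(%z. f (p + z * cis (real k * h))) holomorphic_on ball 0 R" by (simp add: comp_def)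
   qed
   have sub: "cball 0 r <= ball (0::complex) R" using r by auto
   have "\<exists>x\<in>sphere (0::complex) r. \<forall>y\<in>sphere 0 r. cmod (H y) <= cmod (H x)" proof (rule continuous_attains_sup)
    show "sphere (0::complex) r ~= {}" using r by (simp add: sphere_eq_empty)
    show "continuous_on (sphere 0 r) (%y. cmod (H y))" by (intro continuous_intros continuous_on_subset[OF hol_cont[OF Hhol]]) (use r in auto)
   qed simp
   then obtain u where u: "u : sphere 0 r" "!!y. y : sphere 0 r ==> cmod (H y) <= cmod (H u)" by blast
   have "cmod (H 0) <= cmod (H u)" proof (rule maximum_modulus_frontier[of H "ball 0 r"])
    show "H holomorphic_on interior (ball 0 r)" using Hhol r by (auto intro: holomorphic_on_subset)
    show "continuous_on (closure (ball 0 r)) H" using r sub by (auto intro!: continuous_on_subset[OF hol_cont[OF Hhol]])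
   qed (use r u in auto)
   moreover have "cmod (H 0) = cmod (f p) ^ N" by (simp add: H_def prod_norm[symmetric] norm_power)
   ultimately have ge: "cmod (f p) ^ N <= (\<Prod>k<N. cmod (f (p + u * cis (real k * h))))" by (simp add: H_def prod_norm[symmetric])
   define s where "s = Arg2pi u"
   have s: "0 <= s" "s <= 2 * pi" "u = of_real r * cis s" using Arg2pi[of u] u(1) by (auto simp: s_def cis_conv_exp is_Arg_def)
   have "real N * ln (cmod (f p)) = ln (cmod (f p) ^ N)" using False d by (simp add: ln_realpow)
   also have "... <= ln (\<Prod>k<N. max (cmod (f (p + u * cis (real k * h)))) d)" proof -
    have "(\<Prod>k<N. cmod (f (p + u * cis (real k * h)))) <= (\<Prod>k<N. max (cmod (f (p + u * cis (real k * h)))) d)" by (intro prod_mono) auto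
    moreover have "0 < cmod (f p)" using False d by linarith
    hence "0 < cmod (f p) ^ N" by simp
    ultimately show ?thesis using ge by (subst ln_le_cancel_iff) (auto intro!: prod_pos mpos)
   qed
   also have "... = (\<Sum>k<N. ln (max (cmod (f (p + u * cis (real k * h)))) d))" using mpos by (intro ln_prod) (auto simp: less_imp_neq[symmetric])
   also have "... = (\<Sum>k<N. v (s + real k * h))" by (simp add: v_def s(3) mult.assoc cis_mult)
   finally have sum: "real N * ln (cmod (f p)) <= (\<Sum>k<N. v (s + real k * h))" .
   have "(\<Sum>k<N. h * (v (s + real k * h) - q)) <= integral {s..s + real N * h} v" proof (rule riemann_sum_le_integral[OF v h(1) _ order_refl])
    fix t x assume t: "t : {s..s + real N * h}" "x : {t..t+h}"
    hence "dist (v x) (v t) < q" using s h by (intro et(2)) (auto simp: dist_real_def)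
    thus "v t - q <= v x" by (simp add: dist_real_def)
   qed
   also have "integral {s..s + real N * h} v = integral {0..2*pi} v" unfolding h(3) proof (rule integral_periodic_shift[OF v])
    show "v (t + 2*pi) = v t" for t by (simp add: v_def cis.ctr)
   qed (use s in auto)
   also have "(\<Sum>k<N. h * (v (s + real k * h) - q)) = h * (\<Sum>k<N. v (s + real k * h)) - 2 * pi * q" proof -
    have "(\<Sum>k<N. h * (v (s + real k * h) - q)) = h * (\<Sum>k<N. v (s + real k * h)) - (real N * h) * q" by (simp add: sum_distrib_left sum_subtractf right_diff_distrib)
    thus ?thesis unfolding h(3) .
   qed
   finally have "h * (\<Sum>k<N. v (s + real k * h)) <= integral {0..2*pi} v + e" by (simp add: q_def)
   moreover have "h * (real N * ln (cmod (f p))) <= h * (\<Sum>k<N. v (s + real k * h))" using sum h(1) by (intro mult_left_mono) auto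
   moreover have "h * (real N * ln (cmod (f p))) = 2 * pi * ln (cmod (f p))" using h(3) by (simp add: mult.assoc[symmetric] mult.commute[of h])
   ultimately show ?thesis by simp
  qed
  hence "2 * pi * ln (cmod (f p)) <= integral {0..2*pi} v" by (rule field_le_epsilon)
  thus ?thesis using False by (simp add: v_def[abs_def] max_def)
 qed
qed

lemma emeasure_cball_le: assumes "r \<ge> 0" shows "emeasure lborel (cball (w::complex) r) <= ennreal (4 * r^2)" proof -
 have "pi * r^2 <= 4 * r^2" using pi_less_4 by (intro mult_right_mono) auto
 thus ?thesis using assms by (simp add: emeasure_cball unit_ball_vol_2 ennreal_leI)
qed

lemma nn_integral_interval:
 fixes f :: "real => real" assumes f: "continuous_on {a..b} f" and nn: "!!t. t : {a..b} ==> 0 <= f t"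
 shows "(\<integral>\<^sup>+t\<in>{a..b}. ennreal (f t) \<partial>lborel) = ennreal (integral {a..b} f)" proof -
 have int: "set_integrable lborel {a..b} f" using borel_integrable_atLeastAtMost'[OF f] .
 have "(\<integral>\<^sup>+t\<in>{a..b}. ennreal (f t) \<partial>lborel) = (\<integral>\<^sup>+t. ennreal (indicator {a..b} t *\<^sub>R f t) \<partial>lborel)" by (intro nn_integral_cong) (auto simp: indicator_def)
 also have "... = ennreal (\<integral>t. indicator {a..b} t *\<^sub>R f t \<partial>lborel)" by (rule nn_integral_eq_integral) (use int nn in "auto simp: set_integrable_def indicator_def")
 also have "(\<integral>t. indicator {a..b} t *\<^sub>R f t \<partial>lborel) = integral {a..b} f" using set_borel_integral_eq_integral(2)[OF int] by (simp add: set_lebesgue_integral_def)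
 finally show ?thesis .
qed

text \<open>Superharmonicity of potentials, stated after composition with a holomorphic g because
  subharmonicity on the sphere is tested in every holomorphic chart.\<close>

lemma lpot_submean: assumes g: "g holomorphic_on ball p s" and r: "0 < r" "r < s" and d: "d > 0" and P: "finite P" "!!w. 0 <= m w"
 shows "continuous_on A (%t. lpot P m d (g (p + of_real r * cis t)))"
  and "integral {0..2*pi} (%t. lpot P m d (g (p + of_real r * cis t))) <= 2 * pi * lpot P m d (g p)" proof -
 have inb: "p + of_real r * cis t : ball p s" for t using r by (simp add: dist_norm norm_mult)
 have cg: "continuous_on A (%t. g (p + of_real r * cis t))" for A by (rule continuous_on_compose2[OF hol_cont[OF g]])
   (use inb in "auto intro!: continuous_intros")
 have mpos: "max x d ~= 0" for x using d by (simp add: max_def)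
 have cl: "continuous_on A (%t. ln (max (cmod (g (p + of_real r * cis t) - w)) d))" for w A by (intro continuous_intros cg) (use mpos in auto)
 show "continuous_on A (%t. lpot P m d (g (p + of_real r * cis t)))" unfolding lpot_def by (intro continuous_intros cl)
 have "integral {0..2*pi} (%t. lpot P m d (g (p + of_real r * cis t))) = (\<Sum>w\<in>P. integral {0..2*pi} (%t. m w * - ln (max (cmod (g (p + of_real r * cis t) - w)) d)))"
  unfolding lpot_def by (intro integral_sum P integrable_continuous_real continuous_intros cl)
 also have "... = (\<Sum>w\<in>P. m w * - integral {0..2*pi} (%t. ln (max (cmod (g (p + of_real r * cis t) - w)) d)))" by simp
 also have "... <= (\<Sum>w\<in>P. m w * - (2 * pi * ln (max (cmod (g p - w)) d)))" proof (intro sum_mono mult_left_mono)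
  fix w
  have "(%z. g z - w) holomorphic_on ball p s" using g by (intro holomorphic_intros)
  from log_max_submean[OF this r d]
  show "- integral {0..2*pi} (%t. ln (max (cmod (g (p + of_real r * cis t) - w)) d)) <= - (2 * pi * ln (max (cmod (g p - w)) d))" by simp
 qed (rule P)
 also have "... = 2 * pi * lpot P m d (g p)" by (simp add: lpot_def sum_distrib_left sum_negf mult.left_commute)
 finally show "integral {0..2*pi} (%t. lpot P m d (g (p + of_real r * cis t))) <= 2 * pi * lpot P m d (g p)" .
qed

lemma lpot_nonneg: assumes "0 < d" "d < 1" "finite P" "!!w. 0 <= m w" "!!w. w : P ==> cmod (z - w) <= 1" shows "0 <= lpot P m d z" unfolding lpot_def
proof (intro sum_nonneg mult_nonneg_nonneg assms)
 fix w assume "w : P"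
 hence "tdist d z w <= 1" "0 < tdist d z w" using assms by auto
 thus "0 <= - ln (tdist d z w)" by simp
qed

text \<open>Applied in contrapositive form: weights whose potential is positive somewhere have d <
  1.\<close>

lemma lpot_le_0: assumes "1 <= d" "finite P" "!!w. 0 <= m w" shows "lpot P m d z <= 0" unfolding lpot_def proof (intro sum_nonpos mult_nonneg_nonpos assms)
 fix w
 have "1 <= tdist d z w" using assms by auto
 thus "- ln (tdist d z w) <= 0" by simp
qed

lemma cap_zero_nonempty: "cap_zero F ==> F ~= {}" unfolding cap_zero_def by (metis sum.empty subset_empty zero_neq_one)

section \<open>Integral estimates for the kernels and the energy\<close>

lemma kernel_summand_le:
 fixes x t h :: real assumes x: "0 < x" "t <= x" "t <= 1" and h: "0 < h" shows "\<exists>k. t <= (1/2)^k & 1 / (x * max x h) <= 2^(k+1) * min (2^(k+1)) (1/h)" proof (cases "x <= 1")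
 case True
 obtain n where n: "(1/2::real) ^ n < x" using real_arch_pow_inv[OF x(1), of "1/2"] by auto
 moreover have "(1/2::real) ^ Suc n <= (1/2) ^ n" by simp
 ultimately have "(1/2::real) ^ Suc n < x" by linarith
 define k where "k = (LEAST k. (1/2::real)^Suc k < x)"
 have k: "(1/2::real)^Suc k < x" unfolding k_def by (rule LeastI) fact
 have "x <= (1/2)^k" proof (cases k)
  case (Suc j)
  hence "~ (1/2::real)^Suc j < x" using not_less_Least[of j "%k. (1/2::real)^Suc k < x"] k_def by simp
  thus ?thesis using Suc by simp
 qed (use True in simp)
 hence 1: "t <= (1/2)^k" using x by simp
 have 2: "1 / x <= 2^(k+1)" using k x(1) by (simp add: field_simps power_one_over)
 have "1 / max x h <= 1 / x" "1 / max x h <= 1 / h" using x h by (auto intro!: divide_left_mono mult_pos_pos simp: less_max_iff_disj)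
 hence "(1/x) * (1 / max x h) <= 2^(k+1) * min (2^(k+1)) (1/h)" using x h 2 by (intro mult_mono) auto
 thus ?thesis using 1 by auto
next
 case False
 have "1 / (x * max x h) <= 1 / (1 * max 1 h)" using False by (intro divide_left_mono mult_mono) auto
 also have "... <= 2 * min 2 (1/h)" using h by (auto simp: max_def min_def field_simps)
 finally show ?thesis using x(3) by (intro exI[of _ 0]) simp
qed

text \<open>The first N terms are at most 16 each and the rest are dominated by a geometric series.
  Since 1/2 <= exp (- 1/2), the choice N >= - 2 ln h gives (1/2)^N <= h, where the tail
  starts.\<close>

lemma dyadic_sum_le: assumes h: "0 < h" shows "(\<Sum>k. ennreal (2^(k+1) * min (2^(k+1)) (1/h) * (4 * (1/4)^k))) <= ennreal (32 + 32 * max 0 (- ln h))" proof -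
 define N where "N = nat \<lceil>- 2 * ln h\<rceil>"
 have Nge: "- 2 * ln h <= real N" by (simp add: N_def real_nat_ceiling_ge)
 have Nle: "real N <= 2 * max 0 (- ln h) + 1" unfolding N_def by linarith
 have N: "(1/2)^N <= h" proof -
  have "(1/2::real)^N <= (exp (-(1/2)))^N" proof (rule power_mono)
   have "exp (1/2::real) <= 1 + 1/2 + (1/2)^2" by (rule exp_bound) auto
   hence "exp (1/2::real) <= 2" by (simp add: power2_eq_square)
   thus "1/2 <= exp (-(1/2::real))" by (simp add: exp_minus field_simps)
  qed simp
  also have "... = exp (- real N / 2)" by (simp add: exp_of_nat_mult[symmetric])
  also have "... <= exp (ln h)" using Nge by (subst exp_le_cancel_iff) linarith
  finally show ?thesis using h by simp
 qed
 define f where "f k = (if k < N then 16 else 8 * (1/2)^k / h)" for k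
 have le: "2^(k+1) * min (2^(k+1)) (1/h) * (4 * (1/4)^k) <= f k" for k proof -
  have e1: "2^(k+1) * 2^(k+1) * (4 * (1/4)^k) = (16::real)" by (induction k) (simp_all add: field_simps)
  have "2^(k+1) * (1/h) * (4 * (1/4)^k) = 8 * (2 * (1/4))^k / h" unfolding power_mult_distrib by simp
  hence e2: "2^(k+1) * (1/h) * (4 * (1/4)^k) = 8 * (1/2)^k / h" by simp
  have "2^(k+1) * min (2^(k+1)) (1/h) * (4 * (1/4)^k) <= 2^(k+1) * 2^(k+1) * (4 * (1/4)^k)"
   "2^(k+1) * min (2^(k+1)) (1/h) * (4 * (1/4)^k) <= 2^(k+1) * (1/h) * (4 * (1/4)^k)" by (intro mult_right_mono mult_left_mono; simp)+
  thus ?thesis unfolding e1 e2 f_def by simp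
 qed
 have "(%i. 8 * (1/2)^N / h * (1/2)^i) sums (8 * (1/2)^N / h * (1 / (1 - 1/2)))" by (intro sums_mult geometric_sums) simp
 hence "(%i. f (i + N)) sums (8 * (1/2)^N / h * 2)" by (simp add: f_def power_add mult_ac)
 hence sums: "f sums (8 * (1/2)^N / h * 2 + (\<Sum>i<N. f i))" by (simp add: sums_iff_shift)
 have "(\<Sum>k. ennreal (2^(k+1) * min (2^(k+1)) (1/h) * (4 * (1/4)^k))) <= (\<Sum>k. ennreal (f k))" by (intro suminf_le ennreal_leI le) auto
 also have "... = ennreal (8 * (1/2)^N / h * 2 + (\<Sum>i<N. f i))" by (rule suminf_ennreal_eq[OF _ sums]) (use h in "auto simp: f_def")
 also have "... <= ennreal (32 + 32 * max 0 (- ln h))" proof (rule ennreal_leI)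
  have "(\<Sum>i<N. f i) = 16 * real N" by (simp add: f_def)
  moreover have "8 * (1/2)^N / h * 2 <= 16" using N h by (simp add: field_simps)
  ultimately show "8 * (1/2)^N / h * 2 + (\<Sum>i<N. f i) <= 32 + 32 * max 0 (- ln h)" using Nle by simp
 qed
 finally show ?thesis .
qed

lemma continuous_on_max_dist_nz: assumes "d > 0" shows "continuous_on A (%z. tdist d z w)" "tdist d z w > 0"
 using assms by (auto intro!: continuous_intros simp: less_max_iff_disj)

text \<open>Decomposition into dyadic shells about w: at distance of order 2^-k the kernel is at
  most 2^(k+1) min (2^(k+1)) (1/h), on an area of at most 4 / 4^k. The cutoff h tames one of the two
  factors, and the logarithm counts the shells larger than h.\<close>

lemma nn_integral_single_kernel_le: assumes d: "0 < d" and h: "0 < h" shows "nnint (cball w 1) (%z. 1 / (tdist d z w * max (tdist d z w) h))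
  <= ennreal (32 + 32 * max 0 (- ln h))" proof - define c where "c k = 2^(k+1) * min (2^(k+1)) (1/h)" for k :: nat have c0: "0 <= c k" for k using h by (simp add: c_def)
 have "nnint (cball w 1) (%z. 1 / (tdist d z w * max (tdist d z w) h)) <= (\<integral>\<^sup>+z. (\<Sum>k. ennreal (c k) * indicator (cball w ((1/2)^k)) z) \<partial>lborel)"
 proof (intro nn_integral_mono)
  fix z
  show "ennreal (1 / (tdist d z w * max (tdist d z w) h)) * indicator (cball w 1) z <= (\<Sum>k. ennreal (c k) * indicator (cball w ((1/2)^k)) z)"
  proof (cases "z : cball w 1")
   case True
   then obtain k where k: "cmod (z - w) <= (1/2)^k" "1 / (tdist d z w * max (tdist d z w) h) <= c k"
    using kernel_summand_le[of "tdist d z w" "cmod (z - w)" h] h d continuous_on_max_dist_nz(2)[OF d, of z w]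
    unfolding c_def by (auto simp: dist_norm norm_minus_commute)
   have "ennreal (c k) = (\<Sum>j\<in>{k}. ennreal (c j) * indicator (cball w ((1/2)^j)) z)" using k(1) by (simp add: dist_norm norm_minus_commute)
   also have "... <= (\<Sum>k. ennreal (c k) * indicator (cball w ((1/2)^k)) z)" by (intro sum_le_suminf) auto
   finally show ?thesis using k(2) True by (auto intro: order_trans[OF ennreal_leI])
  qed simp
 qed
 also have "... = (\<Sum>k. \<integral>\<^sup>+z. ennreal (c k) * indicator (cball w ((1/2)^k)) z \<partial>lborel)"
  by (intro nn_integral_suminf) (simp add: borel_measurable_indicator borel_measurable_times_ennreal)
 also have "... = (\<Sum>k. ennreal (c k) * emeasure lborel (cball w ((1/2)^k)))" by (simp add: nn_integral_cmult_indicator)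
 also have "... <= (\<Sum>k. ennreal (c k * (4 * (1/4)^k)))" proof (intro suminf_le)
  fix k
  have "emeasure lborel (cball w ((1/2)^k)) <= ennreal (4 * ((1/2)^k)^2)" by (rule emeasure_cball_le) simp
  also have "((1/2)^k)^2 = (1/4::real)^k" by (simp add: power2_eq_square flip: power_mult_distrib)
  finally have "ennreal (c k) * emeasure lborel (cball w ((1/2)^k)) <= ennreal (c k) * ennreal (4 * (1/4)^k)" by (intro mult_left_mono) auto
  thus "ennreal (c k) * emeasure lborel (cball w ((1/2)^k)) <= ennreal (c k * (4 * (1/4)^k))" using c0 by (simp add: ennreal_mult)
 qed auto
 also have "... <= ennreal (32 + 32 * max 0 (- ln h))" unfolding c_def by (rule dyadic_sum_le[OF h])
 finally show ?thesis .
qed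

text \<open>For x <= 1 one has - ln x <= 1/x, which is the preceding kernel with h = 1.\<close>

lemma nn_integral_log_kernel_le: assumes d: "d > 0" shows "nnint (cball w 1) (%z. - ln (tdist d z w)) <= ennreal 32" proof -
 let ?x = "%z. tdist d z w"
 have "ennreal (- ln (?x z)) * indicator (cball w 1) z <= ennreal (1 / (?x z * max (?x z) 1)) * indicator (cball w 1) z" for z proof (cases "?x z <= 1")
  case True
  have "0 < ?x z" using d by (simp add: less_max_iff_disj)
  hence "- ln (?x z) <= 1 / (?x z * max (?x z) 1)" using True ln_le_minus_one[of "1 / ?x z"] by (simp add: ln_div max_absorb2 max_def split: if_splits)
  thus ?thesis by (intro mult_right_mono ennreal_leI) auto
 next
  case False
  hence "0 <= ln (?x z)" by (intro ln_ge_zero) linarith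
  thus ?thesis by (simp add: ennreal_neg)
 qed
 hence "nnint (cball w 1) (%z. - ln (?x z)) <= nnint (cball w 1) (%z. 1 / (?x z * max (?x z) 1))" by (rule nn_integral_mono)
 also have "... <= ennreal 32" using nn_integral_single_kernel_le[OF d, of 1 w] by simp
 finally show ?thesis .
qed

lemma nn_integral_lpot_le: assumes d: "d > 0" and P: "finite P" "!!w. 0 <= m w" "sum m P = 1" and S: "S : sets lborel" "!!w. w : P ==> S <= cball w 1"
 shows "nnint S (%z. lpot P m d z) <= ennreal 32" proof -
 let ?k = "%w z. ennreal (- ln (tdist d z w))"
 have mpos: "max x d ~= 0" for x using d by (simp add: max_def)
 have c: "continuous_on UNIV (%z. - ln (tdist d z w))" for w by (intro continuous_intros) (use mpos in auto)
 have meas: "?k w : borel_measurable borel" for w using borel_measurable_continuous_onI[OF c] by measurable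
 have "nnint S (%z. lpot P m d z) <= (\<integral>\<^sup>+z. (\<Sum>w\<in>P. ennreal (m w) * (?k w z * indicator (cball w 1) z)) \<partial>lborel)" proof (intro nn_integral_mono)
  fix z
  show "ennreal (lpot P m d z) * indicator S z <= (\<Sum>w\<in>P. ennreal (m w) * (?k w z * indicator (cball w 1) z))" proof (cases "z : S")
   case True
   have "ennreal (lpot P m d z) <= ennreal (\<Sum>w\<in>P. m w * max 0 (- ln (tdist d z w)))"
    unfolding lpot_def by (intro ennreal_leI sum_mono mult_left_mono P) auto
   also have "... = (\<Sum>w\<in>P. ennreal (m w * max 0 (- ln (tdist d z w))))" by (subst sum_ennreal) (auto intro!: mult_nonneg_nonneg P)
   also have "... = (\<Sum>w\<in>P. ennreal (m w) * (?k w z * indicator (cball w 1) z))" proof (rule sum.cong[OF refl])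
    fix w assume "w : P"
    hence "z : cball w 1" using S(2) True by blast
    thus "ennreal (m w * max 0 (- ln (tdist d z w))) = ennreal (m w) * (?k w z * indicator (cball w 1) z)"
     using P(2)[of w] by (simp add: ennreal_mult ennreal_max_0)
   qed
   finally show ?thesis using True by simp
  qed simp
 qed
 also have "... = (\<Sum>w\<in>P. ennreal (m w) * (\<integral>\<^sup>+z. ?k w z * indicator (cball w 1) z \<partial>lborel))" proof -
  have "(%z. ?k w z * indicator (cball w 1) z) : borel_measurable lborel" for w by (intro borel_measurable_times_ennreal borel_measurable_indicator) (use meas in auto)
  thus ?thesis by (simp add: nn_integral_sum nn_integral_cmult borel_measurable_times_ennreal)
 qed
 also have "... <= (\<Sum>w\<in>P. ennreal (m w) * ennreal 32)" by (intro sum_mono mult_left_mono nn_integral_log_kernel_le d) auto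
 also have "... = ennreal (\<Sum>w\<in>P. m w) * ennreal 32" using P by (simp add: sum_distrib_right[symmetric] sum_ennreal)
 also have "... = ennreal 32" using P by simp
 finally show ?thesis .
qed

text \<open>At every z one of the two distances is at least h, half of the distance between w and
  w'. Hence the product kernel is at most the sum of two single kernels with cutoff h.\<close>

lemma nn_integral_product_kernel_le: assumes d: "0 < d" and S: "S : sets lborel" "S <= cball w 1" "S <= cball w' 1"
 shows "nnint S (%z. 1 / (tdist d z w * tdist d z w')) <= ennreal (128 + 64 * max 0 (- ln (tdist d w w')))" proof -
 define D where "D = tdist d w w'"
 define h where "h = D / 2"
 have h: "h > 0" using d by (simp add: h_def D_def less_max_iff_disj)
 let ?f = "%w z. ennreal (1 / (tdist d z w * max (tdist d z w) h)) * indicator (cball w 1) z"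
 have meas: "?f w : borel_measurable lborel" for w proof (intro borel_measurable_times_ennreal borel_measurable_indicator)
  have "continuous_on UNIV (%z. 1 / (tdist d z w * max (tdist d z w) h))" proof (intro continuous_intros ballI no_zero_divisors)
   show "tdist d z w ~= 0" "max (tdist d z w) h ~= 0" for z using continuous_on_max_dist_nz(2)[OF d, of z w] by linarith+
  qed
  thus "(%z. ennreal (1 / (tdist d z w * max (tdist d z w) h))) : borel_measurable lborel"
   using borel_measurable_continuous_onI by (intro measurable_compose[OF _ measurable_ennreal]) simp
 qed auto
 have "nnint S (%z. 1 / (tdist d z w * tdist d z w')) <= (\<integral>\<^sup>+z. ?f w z + ?f w' z \<partial>lborel)" proof (intro nn_integral_mono)
  fix z
  show "ennreal (1 / (tdist d z w * tdist d z w')) * indicator S z <= ?f w z + ?f w' z" proof (cases "z : S")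
   case True
   define a where "a = tdist d z w"
   define b where "b = tdist d z w'"
   have ab: "a > 0" "b > 0" using d by (auto simp: a_def b_def)
   have "cmod (w - w') <= cmod (z - w) + cmod (z - w')" using norm_triangle_ineq4[of "z - w'" "z - w"] by (simp add: algebra_simps)
   hence D: "h <= max a b" using d by (auto simp: h_def D_def a_def b_def max_def)
   have "1 / (a * b) <= 1 / (a * max a h) + 1 / (b * max b h)" proof (cases "a <= b")
    case True
    hence "1 / (a * b) <= 1 / (a * max a h)" using ab D h by (intro divide_left_mono mult_left_mono mult_pos_pos) auto
    moreover have "0 <= 1 / (b * max b h)" using ab by simp
    ultimately show ?thesis by linarith
   next
    case False
    hence "1 / (a * b) <= 1 / (max b h * b)" using ab D h by (intro divide_left_mono mult_right_mono mult_pos_pos) auto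
    moreover have "0 <= 1 / (a * max a h)" using ab by simp
    ultimately show ?thesis by (simp only: mult.commute[of _ b])
   qed
   from ennreal_leI[OF this] have "ennreal (1 / (a * b)) <= ennreal (1 / (a * max a h)) + ennreal (1 / (b * max b h))"
    using ab by (subst (asm) ennreal_plus) (auto intro!: divide_nonneg_nonneg mult_nonneg_nonneg)
   moreover have "z : cball w 1" "z : cball w' 1" using S True by auto
   ultimately show ?thesis using True by (simp add: a_def b_def)
  qed simp
 qed
 also have "... = (\<integral>\<^sup>+z. ?f w z \<partial>lborel) + (\<integral>\<^sup>+z. ?f w' z \<partial>lborel)" by (rule nn_integral_add[OF meas meas])
 also have "... <= ennreal (32 + 32 * max 0 (- ln h)) + ennreal (32 + 32 * max 0 (- ln h))" by (intro add_mono nn_integral_single_kernel_le d h)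
 also have "... = ennreal (64 + 64 * max 0 (- ln h))" by (subst ennreal_plus[symmetric]) auto
 also have "... <= ennreal (128 + 64 * max 0 (- ln D))" proof (rule ennreal_leI)
  have "- ln h = ln 2 - ln D" using h by (simp add: h_def ln_div)
  moreover have "ln (2::real) <= 1" using ln_le_minus_one[of 2] by simp
  ultimately have "max 0 (- ln h) <= 1 + max 0 (- ln D)" by simp
  thus "64 + 64 * max 0 (- ln h) <= 128 + 64 * max 0 (- ln D)" by simp
 qed
 finally show ?thesis unfolding D_def .
qed

lemma ennreal_double_sum_mult: assumes "!!v w. v : P ==> w : P ==> 0 <= c v w" "!!v w. v : P ==> w : P ==> 0 <= f v w"
 shows "(\<Sum>v\<in>P. \<Sum>w\<in>P. ennreal (c v w) * ennreal (f v w)) = ennreal (\<Sum>v\<in>P. \<Sum>w\<in>P. c v w * f v w)" proof -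
 have "(\<Sum>v\<in>P. \<Sum>w\<in>P. ennreal (c v w) * ennreal (f v w)) = (\<Sum>v\<in>P. \<Sum>w\<in>P. ennreal (c v w * f v w))" by (intro sum.cong refl) (simp add: assms ennreal_mult)
 also have "... = (\<Sum>v\<in>P. ennreal (\<Sum>w\<in>P. c v w * f v w))" by (intro sum.cong refl sum_ennreal) (simp add: assms)
 also have "... = ennreal (\<Sum>v\<in>P. \<Sum>w\<in>P. c v w * f v w)" by (intro sum_ennreal sum_nonneg) (simp add: assms)
 finally show ?thesis .
qed

text \<open>Expanding the square leaves product kernels, whose integrals are bounded by logarithms
  of mutual distances; their weighted sum is the energy, an average of the potential. The radii 1/4
  and 3/4 place S in the unit disc about each point of P, and the mutual distances in P are at most
  1/2, so the positive parts of the logarithms are the logarithms themselves.\<close>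

lemma nn_integral_energy_le: assumes d: "0 < d" "d <= 1" and P: "finite P" "!!w. 0 <= m w" "sum m P = 1" "P <= cball a (1/4)"
  and S: "S : sets lborel" "S <= cball a (3/4)" and M: "!!z. lpot P m d z <= M" shows "nnint S (%z. (\<Sum>w\<in>P. m w / tdist d z w)^2) <= ennreal (128 + 64 * M)"
proof -
 let ?k = "%v w z. 1 / (tdist d z v * tdist d z w)"
 have S1: "S <= cball w 1" if "w : P" for w
 proof
  fix z assume "z : S"
  hence "dist a z <= 3/4" "dist a w <= 1/4" using S that P by auto
  thus "z : cball w 1" using dist_triangle[of w z a] by (simp add: dist_commute)
 qed
 let ?l = "%v w. 128 + 64 * - ln (tdist d v w)"
 have l: "max 0 (- ln (tdist d v w)) = - ln (tdist d v w)" "0 <= ?l v w" if vw: "v : P" "w : P" for v w proof -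
  have "dist v w <= 1" using subsetD[OF P(4) vw(1)] subsetD[OF P(4) vw(2)] dist_triangle2[of v w a] by (simp add: dist_commute)
  hence "tdist d v w <= 1" "0 < tdist d v w" using d by (auto simp: dist_norm)
  hence "ln (tdist d v w) <= 0" by simp
  thus "max 0 (- ln (tdist d v w)) = - ln (tdist d v w)" "0 <= ?l v w" by simp_all
 qed
 have meas: "(%z. ennreal (?k v w z) * indicator S z) : borel_measurable lborel" for v w proof (intro borel_measurable_times_ennreal borel_measurable_indicator)
  have "continuous_on UNIV (?k v w)" proof (intro continuous_intros ballI no_zero_divisors)
   show "tdist d z v ~= 0" "tdist d z w ~= 0" for z
    using continuous_on_max_dist_nz(2)[OF d(1), of z v] continuous_on_max_dist_nz(2)[OF d(1), of z w] by linarith+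
  qed
  thus "(%z. ennreal (?k v w z)) : borel_measurable lborel" using borel_measurable_continuous_onI by (intro measurable_compose[OF _ measurable_ennreal]) simp
 qed (use S in auto)
 have k0: "0 <= ?k v w z" for v w z using d(1) by simp
 have "nnint S (%z. (\<Sum>w\<in>P. m w / tdist d z w)^2) = (\<integral>\<^sup>+z. (\<Sum>v\<in>P. \<Sum>w\<in>P. ennreal (m v * m w) * (ennreal (?k v w z) * indicator S z)) \<partial>lborel)"
 proof (intro nn_integral_cong)
  fix z
  have "(\<Sum>w\<in>P. m w / tdist d z w)^2 = (\<Sum>v\<in>P. \<Sum>w\<in>P. m v * m w * ?k v w z)" by (simp add: power2_eq_square sum_product)
  moreover have "ennreal (\<Sum>v\<in>P. \<Sum>w\<in>P. m v * m w * ?k v w z) = (\<Sum>v\<in>P. \<Sum>w\<in>P. ennreal (m v * m w) * ennreal (?k v w z))"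
   by (rule ennreal_double_sum_mult[symmetric]) (use P(2) k0 in auto)
  ultimately show "ennreal ((\<Sum>w\<in>P. m w / tdist d z w)^2) * indicator S z = (\<Sum>v\<in>P. \<Sum>w\<in>P. ennreal (m v * m w) * (ennreal (?k v w z) * indicator S z))"
   by (simp add: sum_distrib_right mult.assoc)
 qed
 also have "... = (\<Sum>v\<in>P. \<Sum>w\<in>P. ennreal (m v * m w) * (\<integral>\<^sup>+z. ennreal (?k v w z) * indicator S z \<partial>lborel))" proof -
  let ?F = "%v w z. ennreal (m v * m w) * (ennreal (?k v w z) * indicator S z)"
  have m1: "?F v w : borel_measurable lborel" for v w by (rule borel_measurable_times_ennreal[OF _ meas]) simp
  have "(\<integral>\<^sup>+z. (\<Sum>v\<in>P. \<Sum>w\<in>P. ?F v w z) \<partial>lborel) = (\<Sum>v\<in>P. \<integral>\<^sup>+z. (\<Sum>w\<in>P. ?F v w z) \<partial>lborel)" by (rule nn_integral_sum) (intro borel_measurable_sum m1)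
  also have "... = (\<Sum>v\<in>P. \<Sum>w\<in>P. \<integral>\<^sup>+z. ?F v w z \<partial>lborel)" by (intro sum.cong refl nn_integral_sum m1)
  also have "... = (\<Sum>v\<in>P. \<Sum>w\<in>P. ennreal (m v * m w) * (\<integral>\<^sup>+z. ennreal (?k v w z) * indicator S z \<partial>lborel))" by (intro sum.cong refl nn_integral_cmult meas)
  finally show ?thesis .
 qed
 also have "... <= (\<Sum>v\<in>P. \<Sum>w\<in>P. ennreal (m v * m w) * ennreal (?l v w))"
  using nn_integral_product_kernel_le[OF d(1) S(1) S1 S1] l(1) by (intro sum_mono mult_left_mono) (fastforce, simp)
 also have "... = ennreal (\<Sum>v\<in>P. \<Sum>w\<in>P. (m v * m w) * ?l v w)" using P(2) l(2) by (intro ennreal_double_sum_mult) auto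
 also have "(\<Sum>v\<in>P. \<Sum>w\<in>P. (m v * m w) * ?l v w) = 128 * (sum m P * sum m P) + 64 * (\<Sum>v\<in>P. m v * lpot P m d v)"
  by (simp add: lpot_def sum_product sum_distrib_left sum_distrib_right sum.distrib sum_subtractf algebra_simps sum_negf)
 also have "ennreal ... <= ennreal (128 + 64 * M)" proof (rule ennreal_leI)
  have "(\<Sum>v\<in>P. m v * lpot P m d v) <= (\<Sum>v\<in>P. m v * M)" by (intro sum_mono mult_left_mono M P)
  also have "... = M" using P(3) by (simp flip: sum_distrib_right)
  finally show "128 * (sum m P * sum m P) + 64 * (\<Sum>v\<in>P. m v * lpot P m d v) <= 128 + 64 * M" using P(3) by simp
 qed
 finally show ?thesis .
qed

section \<open>Removability for square integrable functions\<close>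

lemma has_derivative_zero_off_support:
 fixes v :: "'a::real_normed_vector => 'b::real_normed_vector" assumes v: "(v has_derivative v') (at z)" and "open S" "z : S" "!!x. x : S ==> v x = 0" shows "v' = (%_. 0)"
proof -
 have "((%_. 0) has_derivative (%_. 0)) (at z)" by simp
 hence "(v has_derivative (%_. 0)) (at z)" by (rule has_derivative_transform_within_open[OF _ assms(2,3)]) (use assms(4) in simp)
 thus ?thesis using v has_derivative_unique by blast
qed

lemma directional_difference_bound:
 fixes v :: "complex => complex" assumes v: "!!z. (v has_derivative v' z) (at z)" and B: "!!z. norm (v' z e) <= B" and s: "s > 0"
 shows "norm (v (z + s *\<^sub>R e) - v z) <= B * s" proof -
 have "norm (v (z + s *\<^sub>R e) - v (z + 0 *\<^sub>R e)) <= B * norm (s - 0)" proof (rule differentiable_bound[of "{0..s}" "%t. v (z + t *\<^sub>R e)" "%t h. h *\<^sub>R v' (z + t *\<^sub>R e) e"])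
  fix t
  have 0: "((%t. z + t *\<^sub>R e) has_derivative (%h. h *\<^sub>R e)) (at t within {0..s})" by (auto intro!: derivative_eq_intros)
  have "((%t. v (z + t *\<^sub>R e)) has_derivative (%h. v' (z + t *\<^sub>R e) (h *\<^sub>R e))) (at t within {0..s})" by (rule has_derivative_compose[OF 0 v])
  thus "((%t. v (z + t *\<^sub>R e)) has_derivative (%h. h *\<^sub>R v' (z + t *\<^sub>R e) e)) (at t within {0..s})" using has_derivative_linear[OF v] by (simp add: linear_scale)
  show "onorm (%h. h *\<^sub>R v' (z + t *\<^sub>R e) e) <= B" proof (rule onorm_le)
   fix h :: real
   show "norm (h *\<^sub>R v' (z + t *\<^sub>R e) e) <= B * norm h" using mult_right_mono[OF B[of "z + t *\<^sub>R e"] abs_ge_zero[of h]] by (simp add: mult.commute)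
  qed
 qed (use s in auto)
 thus ?thesis using s by simp
qed

text \<open>Difference quotients of a compactly supported function have integral 0 by translation
  invariance, and they converge dominatedly to the directional derivative.\<close>

lemma integral_directional_derivative_eq_0:
 fixes v :: "complex => complex" assumes v: "!!z. (v has_derivative v' z) (at z)" and c: "continuous_on UNIV (%z. v' z e)" and supp: "!!z. z ~: cball 0 R ==> v z = 0"
 shows "integrable lborel (%z. v' z e)" "(\<integral>z. v' z e \<partial>lborel) = 0" proof -
 have v'0: "v' z e = 0" if "z ~: cball 0 R" for z using has_derivative_zero_off_support[OF v, of "- cball 0 R" z] that supp by (auto simp: open_Compl)
 have cv: "continuous_on UNIV v" using v has_derivative_continuous_on has_derivative_at_withinI by blast
 have bI: "integrable lborel (%z. indicator (cball 0 R) z *\<^sub>R f z)" if "continuous_on UNIV f" for f :: "complex => complex" and R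
  by (rule borel_integrable_compact) (use that continuous_on_subset in auto)
 have eq: "(%z. indicator (cball 0 R) z *\<^sub>R f z) = f" if "!!z. z ~: cball 0 R ==> f z = 0" for f :: "complex => complex" using that by (auto simp: indicator_def fun_eq_iff)
 show int: "integrable lborel (%z. v' z e)" using bI[OF c, of R] eq[OF v'0] by simp
 have iv: "integrable lborel v" using bI[OF cv, of R] eq[OF supp] by simp
 have "compact ((%z. v' z e) ` cball 0 R)" by (intro compact_continuous_image continuous_on_subset[OF c]) auto
 then obtain B0 where B0: "\<forall>x\<in>(%z. v' z e) ` cball 0 R. norm x <= B0" using compact_imp_bounded bounded_iff by blast
 define B where "B = \<bar>B0\<bar>"
 have B: "norm (v' z e) <= B" for z proof (cases "z : cball 0 R")
  case True
  hence "norm (v' z e) <= B0" using B0 by blast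
  thus ?thesis by (simp add: B_def)
 qed (simp add: v'0 B_def)
 define s where "s n = inverse (real (Suc n))" for n
 have s: "s n > 0" "s n <= 1" for n by (auto simp: s_def inverse_le_1_iff)
 define f where "f n z = (v (z + s n *\<^sub>R e) - v z) /\<^sub>R s n" for n z
 have shift: "integrable lborel (%z. v (z + a))" "(\<integral>z. v (z + a) \<partial>lborel) = (\<integral>z. v z \<partial>lborel)" for a proof -
  have d: "distr lborel borel ((+) a) = (lborel :: complex measure)" by (rule lborel_distr_plus)
  have m: "(+) a : measurable lborel (borel :: complex measure)" by simp
  have bm: "v : borel_measurable borel" using iv by (simp add: borel_measurable_integrable)
  show "integrable lborel (%z. v (z + a))" using iv integrable_distr_eq[OF m bm] by (simp add: d add.commute)
  show "(\<integral>z. v (z + a) \<partial>lborel) = (\<integral>z. v z \<partial>lborel)" using integral_distr[OF m bm] by (simp add: d add.commute)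
 qed
 have f0: "integral\<^sup>L lborel (f n) = 0" for n unfolding f_def using shift iv by simp
 have fm: "f n : borel_measurable lborel" for n unfolding f_def using shift(1) iv by (intro borel_measurable_scaleR borel_measurable_diff) auto
 have "(%n. integral\<^sup>L lborel (f n)) \<longlonglongrightarrow> (\<integral>z. v' z e \<partial>lborel)" proof (rule integral_dominated_convergence[where w = "%z. indicator (cball 0 (\<bar>R\<bar> + norm e)) z *\<^sub>R B"])
  show "AE z in lborel. (%n. f n z) \<longlonglongrightarrow> v' z e" proof (intro AE_I2 LIMSEQ_I)
   fix z and r :: real assume r: "r > 0"
   define r' where "r' = r / (norm e + 1)"
   have r': "r' > 0" using r by (simp add: r'_def add_nonneg_pos)
   obtain d where d: "d > 0" "!!y. norm (y - z) < d ==> norm (v y - v z - v' z (y - z)) <= r' * norm (y - z)" using v[of z] r' unfolding has_derivative_at_alt by metis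
   obtain N where N: "norm e / d < real N" using reals_Archimedean2 by blast
   show "\<exists>no. \<forall>n\<ge>no. norm (f n z - v' z e) < r" proof (intro exI allI impI)
    fix n assume n: "N <= n"
    have "norm e < d * real N" using N d(1) by (simp add: pos_divide_less_eq mult.commute)
    also have "... <= d * real (Suc n)" using n d(1) by (intro mult_left_mono) auto
    finally have "norm e < d * real (Suc n)" .
    hence "norm (s n *\<^sub>R e) < d" by (simp add: s_def field_simps)
    hence "norm (v (z + s n *\<^sub>R e) - v z - v' z (s n *\<^sub>R e)) <= r' * norm (s n *\<^sub>R e)" using d(2)[of "z + s n *\<^sub>R e"] by simp
    hence *: "norm (v (z + s n *\<^sub>R e) - v z - v' z (s n *\<^sub>R e)) / s n <= r' * norm e" using s(1)[of n] by (simp add: pos_divide_le_eq mult_ac)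
    have "f n z - v' z e = (v (z + s n *\<^sub>R e) - v z - v' z (s n *\<^sub>R e)) /\<^sub>R s n"
     using has_derivative_linear[OF v, of z] s(1)[of n] by (simp add: f_def linear_scale scaleR_diff_right)
    hence "norm (f n z - v' z e) = norm (v (z + s n *\<^sub>R e) - v z - v' z (s n *\<^sub>R e)) / s n"
     using s(1)[of n] by (simp only: norm_scaleR) (simp add: divide_inverse_commute)
    also note *
    also have "r' * norm e < r" using r unfolding r'_def by (simp add: pos_divide_less_eq add_nonneg_pos)
    finally show "norm (f n z - v' z e) < r" .
   qed
  qed
  show "AE z in lborel. norm (f n z) <= indicator (cball 0 (\<bar>R\<bar> + norm e)) z *\<^sub>R B" for n proof (intro AE_I2)
   fix z
   show "norm (f n z) <= indicator (cball 0 (\<bar>R\<bar> + norm e)) z *\<^sub>R B" proof (cases "z : cball 0 (\<bar>R\<bar> + norm e)")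
    case True
    have "norm (f n z) = norm (v (z + s n *\<^sub>R e) - v z) / s n" using s(1)[of n] by (simp add: f_def divide_inverse_commute)
    also have "... <= B * s n / s n" using directional_difference_bound[OF v B s(1)] s(1)[of n] by (intro divide_right_mono) auto
    also have "... = B" using s(1)[of n] by simp
    finally show ?thesis using True by simp
   next
    case False
    have "norm (s n *\<^sub>R e) <= norm e" using s[of n] by (simp add: mult_left_le_one_le)
    hence "\<bar>R\<bar> < norm (z + s n *\<^sub>R e)" "\<bar>R\<bar> < norm z" using False norm_triangle_ineq2[of z "- (s n *\<^sub>R e)"] norm_ge_zero[of e] by (auto simp del: norm_ge_zero)
    hence "v (z + s n *\<^sub>R e) = 0" "v z = 0" by (auto intro!: supp)
    thus ?thesis using False by (simp add: f_def)
   qed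
  qed
  show "integrable lborel (%z. indicator (cball 0 (\<bar>R\<bar> + norm e)) z *\<^sub>R B)" by (rule borel_integrable_compact) auto
 qed (use fm int in auto)
 thus "(\<integral>z. v' z e \<partial>lborel) = 0" unfolding f0 using LIMSEQ_unique tendsto_const by blast
qed

text \<open>The integrand is 2 dbar (q P), because a holomorphic q passes through dbar. The product
  q P, continued by 0 off W, is compactly supported, so the integrals of its derivatives
  vanish.\<close>

lemma integral_dbar_cutoff_eq_0:
 fixes P :: "complex => real" assumes W: "open W" and q: "q holomorphic_on W" and P: "!!z. (P has_derivative P' z) (at z)"
  and c: "continuous_on UNIV (%z. P' z 1)" "continuous_on UNIV (%z. P' z \<i>)" and C: "compact C" "C <= W" "!!z. z ~: C ==> P z = 0"
 shows "integrable lborel (%z. indicator W z *\<^sub>R (q z * (of_real (P' z 1) + \<i> * of_real (P' z \<i>))))" (is "integrable _ ?F")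
  and "(\<integral>z. indicator W z *\<^sub>R (q z * (of_real (P' z 1) + \<i> * of_real (P' z \<i>))) \<partial>lborel) = 0" proof -
 define v where "v z = (if z : W then q z * of_real (P z) else 0)" for z
 define v' where "v' z h = (if z : W then deriv q z * h * of_real (P z) + q z * of_real (P' z h) else 0)" for z h
 have oC: "open (- C)" using C(1) by (simp add: compact_imp_closed open_Compl)
 have v0: "v z = 0" if "z : - C" for z using that C(3) by (simp add: v_def)
 have v'0: "v' z h = 0" if "z : - C" for z h using has_derivative_zero_off_support[OF P oC that] that C(3) by (simp add: v'_def)
 have dv: "(v has_derivative v' z) (at z)" for z proof (cases "z : W")
  case True
  have dq: "(q has_derivative (%h. deriv q z * h)) (at z)" using holomorphic_derivI[OF q W True] by (simp add: has_field_derivative_def)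
  have "((%z. q z * of_real (P z)) has_derivative v' z) (at z)" using has_derivative_mult[OF dq bounded_linear.has_derivative[OF bounded_linear_of_real P[of z]]] True
   by (simp add: v'_def[abs_def] add.commute)
  thus ?thesis by (rule has_derivative_transform_within_open[OF _ W True]) (simp add: v_def)
 next
  case False
  hence z: "z : - C" using C(2) by blast
  have "(v has_derivative (%_. 0)) (at z)" by (rule has_derivative_transform_within_open[OF has_derivative_const[of 0] oC z]) (simp add: v0)
  moreover have "v' z = (%_. 0)" by (simp add: fun_eq_iff v'0[OF z])
  ultimately show ?thesis by simp
 qed
 have cv': "continuous_on UNIV (%z. v' z e)" if ce: "continuous_on UNIV (%z. P' z e)" for e proof -
  have "continuous_on W (%z. deriv q z * e * of_real (P z) + q z * of_real (P' z e))" proof (intro continuous_intros)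
   show "continuous_on W (deriv q)" "continuous_on W q" using q W by (auto intro!: hol_cont holomorphic_deriv)
   show "continuous_on W P" using P by (meson has_derivative_continuous_on has_derivative_at_withinI)
   show "continuous_on W (%z. P' z e)" using ce continuous_on_subset by blast
  qed
  hence "continuous_on W (%z. v' z e)" by (rule continuous_on_eq) (simp add: v'_def)
  moreover have "continuous_on (- C) (%z. v' z e)" by (rule continuous_on_eq[of _ "%_. 0"]) (auto simp: v'0)
  ultimately have "continuous_on (W Un - C) (%z. v' z e)" using W oC by (rule continuous_on_open_Un[rotated 2])
  moreover have "W Un - C = UNIV" using C(2) by blast
  ultimately show ?thesis by simp
 qed
 obtain R where "\<forall>z\<in>C. norm z <= R" using compact_imp_bounded[OF C(1)] unfolding bounded_iff by (rule exE)
 hence R: "C <= cball 0 R" by auto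
 have supp: "v z = 0" if "z ~: cball 0 R" for z using v0 R that by blast
 have 1: "integrable lborel (%z. v' z 1)" "(\<integral>z. v' z 1 \<partial>lborel) = 0" by (rule integral_directional_derivative_eq_0[where R = R, OF dv cv'[OF c(1)]], erule supp)+
 have 2: "integrable lborel (%z. v' z \<i>)" "(\<integral>z. v' z \<i> \<partial>lborel) = 0" by (rule integral_directional_derivative_eq_0[where R = R, OF dv cv'[OF c(2)]], erule supp)+
 have F: "?F = (%z. v' z 1 + \<i> * v' z \<i>)" by (auto simp: v'_def fun_eq_iff algebra_simps)
 show "integrable lborel ?F" unfolding F using 1(1) 2(1) by (intro Bochner_Integration.integrable_add Bochner_Integration.integrable_mult_right)
 show "(\<integral>z. ?F z \<partial>lborel) = 0" unfolding F using 1 2 by (subst Bochner_Integration.integral_add) auto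
qed

text \<open>A step from 0 on t <= 1/4 to 1 on t >= 1/2. Squares of positive parts give exactly the
  continuous first derivative that the integration of dbar of a cutoff requires.\<close>

definition sstep :: "real => real" where "sstep t = 1 - (max 0 (1 - (max 0 (4 * t - 1))^2))^2"

definition sstep' :: "real => real" where "sstep' t = 16 * max 0 (1 - (max 0 (4 * t - 1))^2) * max 0 (4 * t - 1)"

lemma DERIV_max_0_power2: "DERIV (%t::real. (max 0 t)^2) t :> 2 * max 0 t" proof (cases "t = 0")
 case False
 show ?thesis proof (cases "t > 0")
  case True
  have "DERIV (%t. t^2) t :> 2 * max 0 t" using True by (auto intro!: derivative_eq_intros)
  thus ?thesis by (rule has_field_derivative_transform_within_open[of _ _ _ "{0<..}"]) (use True in auto)
 next
  case neg: False
  have "DERIV (%t. 0) t :> 2 * max 0 t" using neg by auto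
  thus ?thesis by (rule has_field_derivative_transform_within_open[of _ _ _ "{..<0}"]) (use neg False in auto)
 qed
next
 case True
 have "((%h::real. (max 0 h)^2 / h) \<longlongrightarrow> 0) (at 0)" proof (rule Lim_null_comparison[where g = "%h. \<bar>h\<bar>"])
  show "\<forall>\<^sub>F h in at 0. norm ((max 0 h)^2 / h) <= \<bar>h\<bar>" by (intro always_eventually allI) (auto simp: max_def power2_eq_square)
  show "((%h::real. \<bar>h\<bar>) \<longlongrightarrow> 0) (at 0)" by (auto intro!: tendsto_eq_intros)
 qed
 thus ?thesis unfolding True DERIV_def by simp
qed

lemma sstep: shows "DERIV sstep t :> sstep' t" "continuous_on UNIV sstep'"
  "0 <= sstep t" "sstep t <= 1" "0 <= sstep' t" "sstep' t <= 16" "t <= 1/4 ==> sstep t = 0" "1/2 <= t ==> sstep t = 1"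
  "1/4 < t ==> t < 1/2 ==> 0 < sstep' t" "t <= 1/4 ==> sstep' t = 0" "1/2 <= t ==> sstep' t = 0" proof -
 define u where "u t = 1 - (max 0 (4 * t - 1))^2" for t :: real
 have 0: "DERIV (%t. 4 * t - 1) t :> 4" by (auto intro!: derivative_eq_intros)
 have u': "DERIV u t :> 0 - 4 * (2 * max 0 (4 * t - 1))" using DERIV_diff[OF DERIV_const[of 1] DERIV_chain'[OF 0 DERIV_max_0_power2]] unfolding u_def[abs_def]
  by (simp add: mult.commute)
 show "DERIV sstep t :> sstep' t" using DERIV_diff[OF DERIV_const[of 1] DERIV_chain'[OF u' DERIV_max_0_power2]]
  unfolding sstep_def[abs_def] sstep'_def u_def by (simp add: mult_ac)
 show "continuous_on UNIV sstep'" unfolding sstep'_def[abs_def] by (intro continuous_intros)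
 have "(max 0 (1 - (max 0 (4 * t - 1))^2)) <= 1" by simp
 hence "(max 0 (1 - (max 0 (4 * t - 1))^2))^2 <= 1^2" by (intro power_mono) auto
 thus "0 <= sstep t" "sstep t <= 1" by (auto simp: sstep_def)
 show "0 <= sstep' t" by (simp add: sstep'_def)
 show "sstep' t <= 16" proof (cases "max 0 (4 * t - 1) <= 1")
  case True
  have "max 0 (1 - (max 0 (4 * t - 1))^2) * max 0 (4 * t - 1) <= 1 * 1" by (intro mult_mono True) auto
  thus ?thesis by (simp add: sstep'_def)
 next
  case False
  hence "1 <= (max 0 (4 * t - 1))^2" by (intro one_le_power) auto
  thus ?thesis by (simp add: sstep'_def)
 qed
 have m0: "max 0 (4 * t - 1) = 0" if "t <= 1/4" using that by simp
 show "t <= 1/4 ==> sstep t = 0" unfolding sstep_def using m0 by simp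
 have "1 <= (max 0 (4 * t - 1))^2" if "1/2 <= t" using that by (intro one_le_power) auto
 thus "1/2 <= t ==> sstep t = 1" "1/2 <= t ==> sstep' t = 0" by (simp_all add: sstep_def sstep'_def)
 show "t <= 1/4 ==> sstep' t = 0" unfolding sstep'_def using m0 by simp
 show "0 < sstep' t" if "1/4 < t" "t < 1/2" proof -
  have "(4 * t - 1)^2 < 1" using that by (simp add: power_less_one_iff abs_square_less_1)
  thus ?thesis using that by (simp add: sstep'_def)
 qed
qed

text \<open>The kernel is - ln of the square root of |z - w|^2 + d^2, a differentiable substitute
  for the truncated one within ln 2 / 2 of it.\<close>

definition smooth_pot :: "complex set => (complex => real) => real => complex => real" where "smooth_pot P m d z = (\<Sum>w\<in>P. m w * (- ln ((cmod (z - w))^2 + d^2) / 2))"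

definition smooth_pot' :: "complex set => (complex => real) => real => complex => complex => real" where
 "smooth_pot' P m d z h = (\<Sum>w\<in>P. m w * (- (Re (cnj (z - w) * h) / ((cmod (z - w))^2 + d^2))))"

lemma has_derivative_smooth_pot: assumes "d > 0" shows "(smooth_pot P m d has_derivative smooth_pot' P m d z) (at z)" and "continuous_on UNIV (%z. smooth_pot' P m d z h)"
proof -
 have pos: "0 < (cmod (z - w))^2 + d^2" for z w using assms by (simp add: add_nonneg_pos)
 have 1: "((%z. (Re (z - w))^2 + (Im (z - w))^2) has_derivative (%h. 2 * Re (cnj (z - w) * h))) (at z)" for w
  by (auto intro!: derivative_eq_intros simp: fun_eq_iff algebra_simps)
 have 2: "((%z. (cmod (z - w))^2) has_derivative (%h. 2 * Re (cnj (z - w) * h))) (at z)" for w using 1[of w] by (simp add: cmod_power2)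
 have 3: "((%z. (cmod (z - w))^2 + d^2) has_derivative (%h. 2 * Re (cnj (z - w) * h))) (at z)" for w
  using has_derivative_add[OF 2[of w] has_derivative_const[of "d^2"]] by simp
 note L = has_derivative_ln[where g = "%z. (cmod (z - w))^2 + d^2" and x = z and s = UNIV for w, OF pos 3]
 have eq: "k * (- (2 * x / y) / 2) = k * (- (x / y))" for k x y :: real by simp
 have "((%z. m w * (- ln ((cmod (z - w))^2 + d^2) / 2)) has_derivative (%h. m w * (- (2 * Re (cnj (z - w) * h) * inverse ((cmod (z - w))^2 + d^2)) / 2))) (at z)" for w
  by (intro has_derivative_mult_right bounded_linear.has_derivative[OF bounded_linear_divide] has_derivative_minus L)
 thus "(smooth_pot P m d has_derivative smooth_pot' P m d z) (at z)"
  unfolding smooth_pot_def[abs_def] smooth_pot'_def[abs_def] divide_inverse[symmetric] eq by (intro has_derivative_sum)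
 have "(cmod (z - w))^2 + d^2 ~= 0" for z w using pos[of z w] by linarith
 thus "continuous_on UNIV (%z. smooth_pot' P m d z h)" unfolding smooth_pot'_def by (intro continuous_intros) auto
qed

lemma smooth_pot_bounds: assumes d: "d > 0" and m: "!!w. 0 <= m w" "sum m P = 1"
 shows "lpot P m d z - ln 2 / 2 <= smooth_pot P m d z" "smooth_pot P m d z <= lpot P m d z" proof -
 have b: "- ln (tdist d z w) - ln 2 / 2 <= - ln ((cmod (z - w))^2 + d^2) / 2" "- ln ((cmod (z - w))^2 + d^2) / 2 <= - ln (tdist d z w)" for w proof -
  define x where "x = tdist d z w"
  have x: "x > 0" "cmod (z - w) <= x" "d <= x" "x = cmod (z - w) \<or> x = d" using d by (auto simp: x_def)
  have "(cmod (z - w))^2 + d^2 <= x^2 + x^2" using x d by (intro add_mono power_mono) auto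
  hence "ln ((cmod (z - w))^2 + d^2) <= ln (2 * x^2)" using x d by (subst ln_le_cancel_iff) (auto simp: add_nonneg_pos)
  also have "... = ln 2 + 2 * ln x" using x by (simp add: ln_mult ln_realpow)
  finally show "- ln x - ln 2 / 2 <= - ln ((cmod (z - w))^2 + d^2) / 2" by simp
  have "x^2 <= (cmod (z - w))^2 + d^2" using x(4) by auto
  hence "ln (x^2) <= ln ((cmod (z - w))^2 + d^2)" using x d by (subst ln_le_cancel_iff) (auto simp: add_nonneg_pos)
  thus "- ln ((cmod (z - w))^2 + d^2) / 2 <= - ln x" using x by (simp add: ln_realpow)
 qed
 have "lpot P m d z - ln 2 / 2 = (\<Sum>w\<in>P. m w * (- ln (tdist d z w) - ln 2 / 2))"
  unfolding lpot_def right_diff_distrib sum_subtractf using m(2) by (simp add: sum_divide_distrib[symmetric] sum_distrib_right[symmetric])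
 also have "... <= smooth_pot P m d z" unfolding smooth_pot_def by (intro sum_mono mult_left_mono b m)
 finally show "lpot P m d z - ln 2 / 2 <= smooth_pot P m d z" .
 show "smooth_pot P m d z <= lpot P m d z" unfolding smooth_pot_def lpot_def by (intro sum_mono mult_left_mono b m)
qed

text \<open>The left side is the modulus of 2 dbar of the potential. A point at distance t
  contributes t / (t^2 + d^2), which is at most 1 / max t d; this links the cutoffs to the energy
  estimate.\<close>

lemma smooth_pot'_bound: assumes d: "d > 0" and m: "!!w. 0 <= m w"
 shows "cmod (of_real (smooth_pot' P m d z 1) + \<i> * of_real (smooth_pot' P m d z \<i>)) <= (\<Sum>w\<in>P. m w / tdist d z w)" proof -
 have eq: "of_real (smooth_pot' P m d z 1) + \<i> * of_real (smooth_pot' P m d z \<i>) = (\<Sum>w\<in>P. of_real (m w) * (- ((z - w) / of_real ((cmod (z - w))^2 + d^2))))" proof -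
  have "of_real (m w * (- (Re (cnj (z - w) * 1) / D))) + \<i> * of_real (m w * (- (Re (cnj (z - w) * \<i>) / D)))
   = of_real (m w) * (- ((z - w) / of_real D))" for w and D :: real by (simp add: complex_eq_iff)
  thus ?thesis unfolding smooth_pot'_def of_real_sum sum_distrib_left sum.distrib[symmetric] by (intro sum.cong refl)
 qed
 show ?thesis unfolding eq proof (rule sum_norm_le)
  fix w
  define x where "x = tdist d z w"
  define t where "t = cmod (z - w)"
  have x: "x > 0" "t <= x" "x = t \<or> x = d" "0 <= t" using d by (auto simp: x_def t_def)
  have "x^2 <= t^2 + d^2" using x(3) by auto
  moreover have "t * x <= x^2" unfolding power2_eq_square using x by (intro mult_right_mono) auto
  ultimately have "t * x <= t^2 + d^2" by linarith
  hence "t <= (t^2 + d^2) / x" using x by (simp add: pos_le_divide_eq)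
  moreover have "0 < t^2 + d^2" using d by (simp add: add_nonneg_pos)
  ultimately have le: "t / (t^2 + d^2) <= 1 / x" by (simp add: pos_divide_le_eq)
  have "cmod (of_real (m w) * (- ((z - w) / of_real ((cmod (z - w))^2 + d^2)))) = m w * (t / (t^2 + d^2))"
   using m[of w] d unfolding norm_mult norm_minus_cancel norm_divide norm_of_real t_def by simp
  also have "... <= m w / x" using mult_left_mono[OF le m[of w]] by simp
  finally show "cmod (of_real (m w) * (- ((z - w) / of_real ((cmod (z - w))^2 + d^2)))) <= m w / tdist d z w" by (simp add: x_def)
 qed
qed

text \<open>On F some potential exceeds any given k, while its integral over F is at most 32, so k
  times the area of F is at most 32 for every k.\<close>

lemma cap_zero_null: assumes F: "cap_zero F" "compact F" "F <= cball a (1/4)" shows "emeasure lborel F = 0" proof -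
 have Fs: "F : sets lborel" using F(2) by (simp add: borel_compact)
 have fin: "emeasure lborel F < \<infinity>" using emeasure_compact_finite[OF F(2)] by simp
 have le: "k * measure lborel F <= 32" if k: "k > 0" for k proof -
  obtain d P m I where w: "d > 0" "finite P" "P <= F" "\<forall>w. 0 <= m w" "sum m P = 1" "k + ln 2 <= I" "\<forall>z\<in>F. I - ln 2 <= lpot P m d z"
   using F(1) unfolding cap_zero_def by metis
  have "ennreal k * emeasure lborel F = (\<integral>\<^sup>+z. ennreal k * indicator F z \<partial>lborel)" using Fs by (simp add: nn_integral_cmult_indicator)
  also have "... <= nnint F (%z. lpot P m d z)" proof (intro nn_integral_mono)
   fix z
   have "k <= lpot P m d z" if "z : F" using w(6,7) that by force
   thus "ennreal k * indicator F z <= ennreal (lpot P m d z) * indicator F z" by (auto simp: indicator_def intro: ennreal_leI)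
  qed
  also have "... <= ennreal (32)" proof (rule nn_integral_lpot_le[OF w(1,2) _ w(5) Fs])
   fix v assume "v : P"
   hence v: "dist a v <= 1/4" using w(3) F(3) by auto
   show "F <= cball v 1"
   proof
    fix z assume "z : F"
    hence "dist a z <= 1/4" using F(3) by auto
    thus "z : cball v 1" using v dist_triangle[of v z a] by (simp add: dist_commute)
   qed
  qed (use w in auto)
  finally have "ennreal k * ennreal (measure lborel F) <= ennreal (32)" using fin by (simp add: emeasure_eq_ennreal_measure del: ennreal_numeral)
  thus ?thesis using k by (simp add: ennreal_mult[symmetric] del: ennreal_numeral)
 qed
 have "measure lborel F = 0" using le[of "33 / measure lborel F"] measure_nonneg[of lborel F] by (cases "measure lborel F = 0") auto
 thus ?thesis using fin by (simp add: measure_eq_emeasure_eq_ennreal emeasure_eq_ennreal_measure)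
qed

text \<open>Differentiation under the integral: for v in the ball the kernel stays away from its
  singularity on the support of p, and the remainder of the difference quotient is bounded by a
  constant times |h|.\<close>

lemma cauchy_transform_holomorphic:
 fixes p :: "complex => complex" assumes int: "integrable lborel p" and z: "!!z. z : ball a r ==> p z = 0" shows "(%v. \<integral>z. p z / (z - v) \<partial>lborel) holomorphic_on ball a r"
  and "v : ball a r ==> integrable lborel (%z. p z / (z - v))" proof -
 have pm: "p : borel_measurable lborel" using int by auto
 have far: "r - dist a v <= cmod (z - v)" if "p z ~= 0" for z v proof -
  have "r <= dist a z" using z[of z] that by force
  thus ?thesis using dist_triangle[of a z v] by (simp add: dist_norm norm_minus_commute)
 qed
 have I: "integrable lborel (%z. p z / (z - v) ^ k)" if v: "v : ball a r" for v k
 proof (rule Bochner_Integration.integrable_bound[where f = "%z. (1 / (r - dist a v) ^ k) *\<^sub>R p z"])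
  show "integrable lborel (%z. (1 / (r - dist a v) ^ k) *\<^sub>R p z)" using int by (rule integrable_scaleR_right)
  show "(%z. p z / (z - v) ^ k) : borel_measurable lborel" using pm by measurable
  show "AE z in lborel. norm (p z / (z - v) ^ k) <= norm ((1 / (r - dist a v) ^ k) *\<^sub>R p z)" proof (intro AE_I2)
   fix z
   show "norm (p z / (z - v) ^ k) <= norm ((1 / (r - dist a v) ^ k) *\<^sub>R p z)" proof (cases "p z = 0")
    case False
    have "(r - dist a v) ^ k <= cmod (z - v) ^ k" using far[OF False] v by (intro power_mono) auto
    moreover have "0 < (r - dist a v) ^ k" using v by simp
    ultimately have "cmod (p z) / cmod (z - v) ^ k <= cmod (p z) / (r - dist a v) ^ k" by (intro divide_left_mono mult_pos_pos) auto
    thus ?thesis using v by (simp add: norm_divide norm_power)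
   qed simp
  qed
 qed
 show "v : ball a r ==> integrable lborel (%z. p z / (z - v))" using I[of v 1] by simp
 define F where "F v = (\<integral>z. p z / (z - v) \<partial>lborel)" for v
 have "(F has_field_derivative (\<integral>z. p z / (z - v)^2 \<partial>lborel)) (at v)" if v: "v : ball a r" for v proof -
  define d where "d = r - dist a v"
  have d: "d > 0" using v by (simp add: d_def)
  define G where "G = (\<integral>z. p z / (z - v)^2 \<partial>lborel)"
  define C where "C = (\<integral>z. norm (p z) \<partial>lborel) * (2 / d ^ 3)"
  have bound: "norm ((F (v + h) - F v) / h - G) <= C * norm h" if h: "h ~= 0" "norm h < d/2" for h proof -
   have vh: "v + h : ball a r" using h dist_triangle[of a "v + h" v] d by (simp add: d_def dist_norm)
   let ?k = "%z. (p z / (z - (v + h)) - p z / (z - v)) / h - p z / (z - v)^2"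
   have ik: "integrable lborel ?k" using I[OF vh, of 1] I[OF v, of 1] I[OF v, of 2] by (intro Bochner_Integration.integrable_diff integrable_divide) auto
   have "(\<integral>z. ?k z \<partial>lborel) = (F (v + h) - F v) / h - G" proof -
    have "(\<integral>z. ?k z \<partial>lborel) = (\<integral>z. (p z / (z - (v + h)) - p z / (z - v)) / h \<partial>lborel) - G" unfolding G_def using I[OF vh, of 1] I[OF v, of 1]
     by (intro Bochner_Integration.integral_diff integrable_divide Bochner_Integration.integrable_diff I[OF v]) simp_all
    thus ?thesis using I[OF vh, of 1] I[OF v, of 1] by (simp add: F_def Bochner_Integration.integral_diff)
   qed
   hence "norm ((F (v + h) - F v) / h - G) = norm (\<integral>z. ?k z \<partial>lborel)" by (rule arg_cong[OF sym])
   also have "... <= (\<integral>z. norm (?k z) \<partial>lborel)" by (rule integral_norm_bound)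
   also have "... <= (\<integral>z. norm (p z) * (2 / d ^ 3 * norm h) \<partial>lborel)" proof (rule integral_mono)
    show "integrable lborel (%z. norm (?k z))" using ik by (rule integrable_norm)
    show "integrable lborel (%z. norm (p z) * (2 / d ^ 3 * norm h))" using int by (intro integrable_mult_left integrable_norm)
    fix z
    show "norm (?k z) <= norm (p z) * (2 / d ^ 3 * norm h)" proof (cases "p z = 0")
     case False
     define u where "u = z - v"
     have u: "d <= cmod u" using far[OF False, of v] by (simp add: u_def d_def)
     have uh: "d / 2 <= cmod (u - h)" using norm_triangle_ineq2[of u h] u h by simp
     have nz: "u ~= 0" "u - h ~= 0" using u uh d by auto
     have "(x / (u - h) - x / u) / h - x / u^2 = x * (h / (u^2 * (u - h)))" for x
      using nz h(1) by (simp add: divide_simps power2_eq_square) (simp add: algebra_simps)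
     hence "?k z = p z * (h / (u^2 * (u - h)))" by (simp add: u_def diff_diff_eq)
     hence "norm (?k z) = norm (p z) * (norm h / ((cmod u)^2 * cmod (u - h)))" by (simp add: norm_mult norm_divide norm_power)
     also have "... <= norm (p z) * (norm h / (d^2 * (d / 2)))" using u uh d nz by (intro mult_left_mono divide_left_mono mult_mono power_mono mult_pos_pos) auto
     also have "... = norm (p z) * (2 / d ^ 3 * norm h)" by (simp add: power3_eq_cube power2_eq_square)
     finally show ?thesis .
    qed simp
   qed
   also have "... = C * norm h" using int by (simp add: C_def)
   finally show ?thesis .
  qed
  have "((%h. (F (v + h) - F v) / h - G) \<longlongrightarrow> 0) (at 0)" proof (rule Lim_null_comparison[where g = "%h. C * norm h"])
   show "\<forall>\<^sub>F h in at 0. norm ((F (v + h) - F v) / h - G) <= C * norm h" unfolding eventually_at by (rule exI[of _ "d/2"]) (use bound d in auto)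
   show "((%h. C * norm h) \<longlongrightarrow> 0) (at 0)" by (auto intro!: tendsto_eq_intros)
  qed
  thus ?thesis unfolding DERIV_def G_def[symmetric] by (simp add: LIM_zero_iff)
 qed
 thus "(%v. \<integral>z. p z / (z - v) \<partial>lborel) holomorphic_on ball a r" unfolding F_def[symmetric] holomorphic_on_def field_differentiable_def
  using has_field_derivative_at_within by blast
qed

text \<open>The factor 32 fits the thresholds of \<open>sstep\<close>: the value is 0 from radius
  1/8 on, where 32/64 = 1/2, and 1 within radius 1/12, where 32/144 < 1/4.\<close>

definition bump :: "complex => complex => real" where "bump a z = 1 - sstep (32 * (cmod (z - a))^2)"

definition bump' :: "complex => complex => complex => real" where "bump' a z h = - (sstep' (32 * (cmod (z - a))^2) * (64 * Re (cnj (z - a) * h)))"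

lemma has_derivative_bump: shows "(bump a has_derivative bump' a z) (at z)" and "continuous_on UNIV (%z. bump' a z h)" proof -
 have "((%z. 32 * ((Re (z - a))^2 + (Im (z - a))^2)) has_derivative (%h. 64 * Re (cnj (z - a) * h))) (at z)"
  by (auto intro!: derivative_eq_intros simp: fun_eq_iff algebra_simps)
 hence "((%z. 32 * (cmod (z - a))^2) has_derivative (%h. 64 * Re (cnj (z - a) * h))) (at z)" by (simp add: cmod_power2)
 from has_derivative_compose[OF this sstep(1)[unfolded has_field_derivative_def]]
 have "((%z. sstep (32 * (cmod (z - a))^2)) has_derivative (%h. sstep' (32 * (cmod (z - a))^2) * (64 * Re (cnj (z - a) * h)))) (at z)" .
 from has_derivative_diff[OF has_derivative_const[of 1] this]
 show "(bump a has_derivative bump' a z) (at z)" unfolding bump_def[abs_def] bump'_def[abs_def] by simp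
 have "continuous_on UNIV (%z. sstep' (32 * (cmod (z - a))^2))" by (rule continuous_on_compose2[OF sstep(2)]) (auto intro!: continuous_intros)
 thus "continuous_on UNIV (%z. bump' a z h)" unfolding bump'_def by (intro continuous_intros)
qed

lemma dbar_bump: "of_real (bump' a z 1) + \<i> * of_real (bump' a z \<i>) = - of_real (64 * sstep' (32 * (cmod (z - a))^2)) * (z - a)"
 by (simp add: bump'_def complex_eq_iff)

lemma bump_eq_0: assumes "1/8 <= dist a z" shows "bump a z = 0" "bump' a z h = 0" proof -
 have "(1/8)^2 <= (cmod (z - a))^2" using assms by (intro power_mono) (auto simp: dist_norm norm_minus_commute)
 hence "1/2 <= 32 * (cmod (z - a))^2" by (simp add: power2_eq_square)
 thus "bump a z = 0" "bump' a z h = 0" unfolding bump_def bump'_def using sstep(8,11) by simp_all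
qed

lemma bump'_eq_0: assumes "dist a z <= 1/12" shows "bump' a z h = 0" proof -
 have "(cmod (z - a))^2 <= (1/12)^2" using assms by (intro power_mono) (auto simp: dist_norm norm_minus_commute)
 hence "32 * (cmod (z - a))^2 <= 1/4" by (simp add: power2_eq_square)
 thus ?thesis unfolding bump'_def using sstep(10) by simp
qed

lemma bump_bounds: "0 <= bump a z" "bump a z <= 1" "cmod (of_real (bump' a z 1) + \<i> * of_real (bump' a z \<i>)) <= 128" proof -
 show "0 <= bump a z" "bump a z <= 1" using sstep(3,4) by (auto simp: bump_def)
 show "cmod (of_real (bump' a z 1) + \<i> * of_real (bump' a z \<i>)) <= 128" proof (cases "1/8 <= dist a z")
  case True
  thus ?thesis by (simp add: bump_eq_0)
 next
  case False
  hence "cmod (z - a) <= 1/8" by (simp add: dist_norm norm_minus_commute)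
  moreover have "\<bar>64 * sstep' (32 * (cmod (z - a))^2)\<bar> <= 64 * 16" using sstep(5,6) by simp
  ultimately have "\<bar>64 * sstep' (32 * (cmod (z - a))^2)\<bar> * cmod (z - a) <= (64 * 16) * (1/8)" by (intro mult_mono) auto
  thus ?thesis unfolding dbar_bump norm_mult norm_minus_cancel norm_of_real by simp
 qed
qed

lemma continuous_on_lpot: "d > 0 ==> continuous_on A (lpot P m d)" unfolding lpot_def by (intro continuous_intros) (auto simp: max_def)

text \<open>Evans' construction: potentials U k that are at least 2^k on F, multiplied by 2^-k,
  contribute at least 1 each on F, whereas off F they are bounded by - ln of the distance to F, so
  the series converges. On the disc all terms are nonnegative and the partial sums increase.\<close>

lemma cap_zero_locally_polar: assumes F: "cap_zero F" "F <= cball a (1/4)" "compact F"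
 obtains s where "subharmonic_on s (param c ` ball a (1/4))" "!!z. z : F ==> s (param c z) = -\<infinity>" proof -
 define B where "B = ball a (1/4)"
 have "\<forall>k. \<exists>d P m. d > 0 & finite P & P <= F & (\<forall>w. 0 <= m w) & sum m P = 1 & (\<forall>z\<in>F. 2 ^ k <= lpot P m d z)"
 proof
  fix k :: nat
  obtain d P m I where "d > 0" "finite P" "P <= F" "\<forall>w. 0 <= m w" "sum m P = 1" "2^k + ln 2 <= I"
   "\<forall>z\<in>F. I - ln 2 <= lpot P m d z" using F(1) unfolding cap_zero_def by metis
  thus "\<exists>d P m. d > 0 & finite P & P <= F & (\<forall>w. 0 <= m w) & sum m P = 1 & (\<forall>z\<in>F. 2 ^ k <= lpot P m d z)" by (intro exI[of _ d] exI[of _ P] exI[of _ m]) force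
 qed
 then obtain d P m where d: "!!k. d k > 0" and P: "!!k. finite (P k)" "!!k. P k <= F" "!!k w. 0 <= m k w"
  "!!k. sum (m k) (P k) = 1" and big: "!!k z. z : F ==> 2 ^ k <= lpot (P k) (m k) (d k) z" by metis
 define U where "U k = lpot (P k) (m k) (d k)" for k
 obtain z\<^sub>0 where z0: "z\<^sub>0 : F" using cap_zero_nonempty[OF F(1)] by blast
 have d1: "d k < 1" for k proof (rule ccontr)
  assume "~ d k < 1"
  hence "lpot (P k) (m k) (d k) z\<^sub>0 <= 0" using P by (intro lpot_le_0) auto
  thus False using big[OF z0, of k] by (smt (verit) zero_less_power)
 qed
 have near: "cmod (z - w) <= 1" if "z : B" "w : P k" for z w k proof -
  have "dist a z < 1/4" "dist a w <= 1/4" using that P(2) F(2) by (auto simp: B_def subset_iff)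
  thus ?thesis using dist_triangle2[of z w a] by (simp add: dist_norm norm_minus_commute)
 qed
 have U0: "0 <= U k z" if "z : B" for k z unfolding U_def using lpot_nonneg[OF d d1 P(1) P(3) near[OF that]] .
 define X where "X k z = U k z / 2 ^ k" for k z
 have X0: "0 <= X k z" if "z : B" for k z using U0[OF that] by (simp add: X_def)
 define S where "S z = (\<Sum>k. ennreal (X k z))" for z
 define T where "T n z = (\<Sum>k<n. X k z)" for n z
 have ST: "S z = (SUP n. ennreal (T n z))" if "z : B" for z unfolding S_def suminf_eq_SUP T_def by (subst sum_ennreal) (use X0[OF that] in auto)
 have cU: "continuous_on A (U k)" for A k unfolding U_def by (rule continuous_on_lpot[OF d])
 have cX: "continuous_on A (X k)" for A k unfolding X_def by (intro continuous_intros cU) auto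
 have cT: "continuous_on A (T n)" for A n unfolding T_def by (intro continuous_intros cX)
 have SF: "S z = \<infinity>" if "z : F" for z proof -
  have X1: "1 <= X k z" for k using big[OF that, of k] by (simp add: X_def U_def)
  have le: "of_nat n <= S z" for n proof -
   have "of_nat n = (\<Sum>k<n. (1::ennreal))" by simp
   also have "... <= (\<Sum>k<n. ennreal (X k z))" using X1 by (intro sum_mono) (simp add: ennreal_1[symmetric] del: ennreal_1 add: ennreal_leI)
   also have "... <= S z" unfolding S_def by (intro sum_le_suminf) auto
   finally show ?thesis .
  qed
  show ?thesis proof (cases "S z")
   case (real x)
   obtain n :: nat where "x < of_nat n" using reals_Archimedean2 by blast
   thus ?thesis using le[of n] real by (simp add: ennreal_of_nat_eq_real_of_nat)
  qed simp
 qed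
 define s where "s x = - enn2ereal (S (inv_into UNIV (param c) x))" for x
 have sp: "s (param c z) = - enn2ereal (S z)" for z by (simp add: s_def inv_f_f inj_param)
 \<comment> \<open>Since the partial sums T n increase to S, the value - S is below al as soon as
   some - T n is; this gives upper semicontinuity.\<close>
 have less: "(- enn2ereal (S z) < al) = (\<exists>n. ereal (- T n z) < al)" if z: "z : B" for z al proof -
  have T0: "0 <= T n z" for n unfolding T_def using X0[OF z] by (intro sum_nonneg)
  show ?thesis
  proof
   assume l: "- enn2ereal (S z) < al"
   show "\<exists>n. ereal (- T n z) < al" proof (rule ccontr)
    assume "~ ?thesis"
    hence *: "al <= ereal (- T n z)" for n by (meson not_le)
    show False proof (cases al)
     case (real b)
     hence "T n z <= - b" for n using *[of n] by simp
     hence "S z <= ennreal (- b)" unfolding ST[OF z] by (intro SUP_least ennreal_leI)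
     moreover have "0 <= - b" using T0[of 0] `!!n. T n z <= - b`[of 0] by linarith
     ultimately have "enn2ereal (S z) <= ereal (- b)" using less_eq_ennreal.rep_eq by (metis enn2ereal_ennreal)
     hence "al <= - enn2ereal (S z)" using real by (metis ereal_uminus_le_reorder uminus_ereal.simps(1) ereal_minus_le_minus)
     thus False using l by simp
    next
     case PInf thus False using *[of 0] by simp
    next
     case MInf thus False using l by simp
    qed
   qed
  next
   assume "\<exists>n. ereal (- T n z) < al"
   then obtain n where n: "ereal (- T n z) < al" by blast
   have "ennreal (T n z) <= S z" unfolding ST[OF z] by (rule SUP_upper) simp
   hence "ereal (T n z) <= enn2ereal (S z)" using T0[of n] less_eq_ennreal.rep_eq by (metis enn2ereal_ennreal)
   hence "- enn2ereal (S z) <= ereal (- T n z)" by (metis ereal_minus_le_minus uminus_ereal.simps(1))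
   thus "- enn2ereal (S z) < al" using n by simp
  qed
 qed
 have usc: "open {z\<in>B. - enn2ereal (S z) < al}" for al proof -
  have "{z\<in>B. - enn2ereal (S z) < al} = (\<Union>n. {z\<in>B. ereal (- T n z) < al})" using less by blast
  moreover have "open {z\<in>B. ereal (- T n z) < al}" for n proof -
   have "open {z. ereal (- T n z) < al}" by (intro open_Collect_less continuous_intros cT)
   moreover have "{z\<in>B. ereal (- T n z) < al} = B Int {z. ereal (- T n z) < al}" by auto
   ultimately show ?thesis by (simp add: B_def open_Int)
  qed
  ultimately show ?thesis by auto
 qed
 have mean: "(\<integral>\<^sup>+t\<in>{0..2*pi}. S (g (w + of_real r * cis t)) \<partial>lborel) <= ennreal (2*pi) * S (g w)"
  if g: "g holomorphic_on ball w R" "g ` ball w R <= B" and r: "0 < r" "r < R" for g w r R proof -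
  have inb: "g (w + of_real r * cis t) : B" for t by (rule subsetD[OF g(2)]) (use r in "auto simp: dist_norm norm_mult intro!: imageI")
  have wB: "g w : B" using g(2) r by (auto simp: subset_iff)
  have c: "continuous_on A (%t. X k (g (w + of_real r * cis t)))" for A k unfolding X_def U_def by (intro continuous_intros lpot_submean(1)[OF g(1) r d P(1,3)]) auto
  have "(\<integral>\<^sup>+t\<in>{0..2*pi}. S (g (w + of_real r * cis t)) \<partial>lborel) = (\<integral>\<^sup>+t. (\<Sum>k. ennreal (X k (g (w + of_real r * cis t))) * indicator {0..2*pi} t) \<partial>lborel)"
   by (simp add: S_def ennreal_suminf_multc)
  also have "... = (\<Sum>k. \<integral>\<^sup>+t. ennreal (X k (g (w + of_real r * cis t))) * indicator {0..2*pi} t \<partial>lborel)" proof (intro nn_integral_suminf)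
   fix k
   have "(%t. X k (g (w + of_real r * cis t))) : borel_measurable borel" by (rule borel_measurable_continuous_onI[OF c])
   thus "(%t. ennreal (X k (g (w + of_real r * cis t))) * indicator {0..2*pi} t) : borel_measurable lborel" by measurable
  qed
  also have "... = (\<Sum>k. ennreal (integral {0..2*pi} (%t. X k (g (w + of_real r * cis t)))))" using X0[OF inb] by (simp add: nn_integral_interval[OF c])
  also have "... <= (\<Sum>k. ennreal (2 * pi) * ennreal (X k (g w)))" proof (intro suminf_le)
   fix k
   have "integral {0..2*pi} (%t. X k (g (w + of_real r * cis t))) = integral {0..2*pi} (%t. U k (g (w + of_real r * cis t))) / 2 ^ k"
    unfolding X_def by (simp add: divide_inverse)
   also have "... <= 2 * pi * U k (g w) / 2 ^ k" unfolding U_def by (intro divide_right_mono lpot_submean(2)[OF g(1) r d P(1,3)]) simp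
   finally have "integral {0..2*pi} (%t. X k (g (w + of_real r * cis t))) <= 2 * pi * X k (g w)" by (simp add: X_def)
   thus "ennreal (integral {0..2*pi} (%t. X k (g (w + of_real r * cis t)))) <= ennreal (2 * pi) * ennreal (X k (g w))"
    using X0[OF wB] by (simp add: ennreal_mult[symmetric] ennreal_leI)
  qed auto
  also have "... = ennreal (2*pi) * S (g w)" by (simp add: S_def)
  finally show ?thesis .
 qed
 \<comment> \<open>F is a null set, so it does not fill the disc; at a point off F the series is
   dominated by a geometric one.\<close>
 have fin: "\<exists>z\<in>B. S z ~= \<infinity>" proof -
  have "F : null_sets lborel" using cap_zero_null[OF F(1,3,2)] F(3) by (simp add: null_sets_def borel_compact)
  hence "negligible F" unfolding negligible_iff_null_sets by (rule null_sets_completionI)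
  hence "~ B <= F" using open_not_negligible[of B] negligible_subset by (auto simp: B_def)
  then obtain z where z: "z : B" "z ~: F" by blast
  obtain e where e: "e > 0" "!!w. w : F ==> e <= dist z w" using separate_point_closed[OF compact_imp_closed[OF F(3)] z(2)] by blast
  have "U k z <= (\<Sum>w\<in>P k. m k w * - ln e)" for k unfolding U_def lpot_def proof (intro sum_mono mult_left_mono P)
   fix v assume "v : P k"
   hence "e <= max (cmod (z - v)) (d k)" using e(2)[of v] P(2)[of k] by (auto simp: dist_norm)
   thus "- ln (max (cmod (z - v)) (d k)) <= - ln e" using e(1) by (simp add: ln_mono)
  qed
  hence "U k z <= - ln e" for k using P(4)[of k] by (metis sum_distrib_right mult_1)
  hence XZ: "X k z <= - ln e * (1/2)^k" for k using divide_right_mono[of "U k z" "- ln e" "2^k"] unfolding X_def power_one_over by simp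
  have "S z <= (\<Sum>k. ennreal (- ln e * (1/2)^k))" unfolding S_def by (intro suminf_le ennreal_leI XZ summableI)
  also have "... = ennreal (- ln e * (1 / (1 - 1/2)))" proof (rule suminf_ennreal_eq)
   show "0 <= - ln e * (1/2)^k" for k using order_trans[OF X0[OF z(1)] XZ] .
  qed (intro sums_mult geometric_sums, simp)
  also have "... < \<infinity>" by simp
  finally show ?thesis using z(1) by (intro bexI[of _ z]) auto
 qed
 have "subharmonic_on s (param c ` B)" unfolding subharmonic_on_def proof (intro conjI allI impI)
  show "\<forall>x\<in>param c ` B. s x < \<infinity>"
  proof
   fix x assume "x : param c ` B"
   then obtain z where z: "z : B" "x = param c z" by (rule imageE)
   have "0 <= enn2ereal (S z)" by simp
   thus "s x < \<infinity>" unfolding z(2) sp by (cases "enn2ereal (S z)") auto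
  qed
  fix al
  have "{x\<in>param c ` B. s x < al} = param c ` {z\<in>B. - enn2ereal (S z) < al}" by (auto simp: sp)
  thus "sopen {x\<in>param c ` B. s x < al}" using sopen_image[OF usc] by simp
 next
  obtain z where "z : B" "S z ~= \<infinity>" using fin by blast
  hence "s (param c z) ~= -\<infinity>" unfolding sp by (metis e2ennreal_enn2ereal e2ennreal_infty ereal_uminus_uminus infinity_ennreal_def uminus_ereal.simps(3))
  thus "\<exists>x\<in>param c ` B. s x ~= -\<infinity>" using `z : B` by blast
 next
  fix V' f assume "holomorphic_chart V' f & V' <= param c ` B"
  hence chart: "sopen V'" "sphere_holomorphic_on f V'" "inj_on f V'" "V' <= param c ` B" by (auto simp: holomorphic_chart_def)
  define A where "A = param c -` V'"
  have A: "open A" unfolding A_def using chart(1) openin_sphere_iff by auto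
  have AB: "A <= B" using chart(4) inj_param[of c] by (auto simp: A_def inj_def)
  have VA: "V' = param c ` A" using chart(4) by (auto simp: A_def)
  define k where "k = f \<circ> param c"
  have k: "k holomorphic_on A" using chart(2) unfolding sphere_holomorphic_on_def k_def A_def by (rule spec)
  have kinj: "inj_on k A" using chart(3) inj_param[of c] by (auto simp: VA k_def inj_on_def inj_def)
  \<comment> \<open>In the given chart the function is - S composed with the inverse g of the
    transition map, a composition covered by \<open>mean\<close>.\<close>
  obtain g where g: "g holomorphic_on k ` A" "!!z. z : A ==> g (k z) = z" using holomorphic_has_inverse[OF k A kinj] by metis
  have oA: "open (k ` A)" using open_mapping_thm3[OF k A kinj] .
  have im: "f ` V' = k ` A" by (auto simp: VA k_def)
  have gA: "g y : A" if "y : k ` A" for y using that g(2) by auto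
  have u: "(s \<circ> inv_into V' f) y = - enn2ereal (S (g y))" if "y : k ` A" for y proof -
   from that obtain z where z: "z : A" "y = k z" by blast
   have "inv_into V' f y = param c z" by (rule inv_into_f_eq[OF chart(3)]) (use z in "auto simp: VA k_def")
   thus ?thesis using z g(2) sp by simp
  qed
  show "plane_subharmonic_on (s \<circ> inv_into V' f) (f ` V')" unfolding plane_subharmonic_on_def im proof (intro conjI ballI allI)
   show "(s \<circ> inv_into V' f) y < \<infinity>" if "y : k ` A" for y proof -
    have "0 <= enn2ereal (S (g y))" by simp
    thus ?thesis unfolding u[OF that] by (cases "enn2ereal (S (g y))") auto
   qed
   fix al
   have "{y\<in>k ` A. (s \<circ> inv_into V' f) y < al} = {y\<in>k ` A. - enn2ereal (S (g y)) < al}" using u by auto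
   also have "... = k ` A Int g -` {z\<in>B. - enn2ereal (S z) < al}" using gA AB by auto
   also have "open ..." by (intro continuous_open_preimage hol_cont[OF g(1)] oA usc)
   finally show "open {y\<in>k ` A. (s \<circ> inv_into V' f) y < al}" .
  next
   fix w assume w: "w : k ` A"
   then obtain R where R: "R > 0" "ball w R <= k ` A" using oA openE by blast
   have "(s \<circ> inv_into V' f) w <= circle_mean (s \<circ> inv_into V' f) w r" if r: "0 < r" "r < R" for r proof -
    have inb: "w + of_real r * cis t : k ` A" for t by (rule subsetD[OF R(2)]) (use r in "simp add: dist_norm norm_mult")
    have 1: "e2ennreal ((s \<circ> inv_into V' f) (w + of_real r * cis t)) = 0" for t unfolding u[OF inb] by (intro e2ennreal_neg) simp
    have 2: "e2ennreal (- (s \<circ> inv_into V' f) (w + of_real r * cis t)) = S (g (w + of_real r * cis t))" for t unfolding u[OF inb] by simp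
    have "(\<integral>\<^sup>+t\<in>{0..2*pi}. S (g (w + of_real r * cis t)) \<partial>lborel) <= ennreal (2*pi) * S (g w)"
     by (rule mean[OF _ _ r]) (use g(1) R(2) gA AB in "auto intro: holomorphic_on_subset")
    hence le: "enn2ereal (\<integral>\<^sup>+t\<in>{0..2*pi}. S (g (w + of_real r * cis t)) \<partial>lborel) <= ereal (2*pi) * enn2ereal (S (g w))"
     unfolding less_eq_ennreal.rep_eq by (simp add: times_ennreal.rep_eq)
    have "circle_mean (s \<circ> inv_into V' f) w r = - enn2ereal (\<integral>\<^sup>+t\<in>{0..2*pi}. S (g (w + of_real r * cis t)) \<partial>lborel) / ereal (2*pi)"
     unfolding circle_mean_def 1 2 by (simp add: zero_ennreal.rep_eq)
    moreover have "- enn2ereal (S (g w)) <= - enn2ereal (\<integral>\<^sup>+t\<in>{0..2*pi}. S (g (w + of_real r * cis t)) \<partial>lborel) / ereal (2*pi)" proof -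
     have "- (ereal (2*pi) * enn2ereal (S (g w))) / ereal (2*pi) <= - enn2ereal (\<integral>\<^sup>+t\<in>{0..2*pi}. S (g (w + of_real r * cis t)) \<partial>lborel) / ereal (2*pi)"
      by (intro ereal_divide_right_mono) (use le in "auto simp: ereal_minus_le_minus")
     moreover have "- (ereal (2*pi) * enn2ereal (S (g w))) / ereal (2*pi) = - enn2ereal (S (g w))" by (cases "enn2ereal (S (g w))") auto
     ultimately show ?thesis by simp
    qed
    ultimately show ?thesis unfolding u[OF w] by simp
   qed
   thus "\<exists>R>0. ball w R <= k ` A & (\<forall>r. 0 < r & r < R --> (s \<circ> inv_into V' f) w <= circle_mean (s \<circ> inv_into V' f) w r)" using R by blast
  qed
 qed
 moreover have "s (param c z) = -\<infinity>" if "z : F" for z unfolding sp SF[OF that] by simp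
 ultimately show ?thesis using that unfolding B_def by blast
qed

lemma integrable_open_indicator_bound:
 fixes f :: "complex => 'b::{banach, second_countable_topology}" assumes W: "open W" and f: "continuous_on W f" and g: "integrable lborel g"
  and le: "!!z. z : W ==> norm (f z) <= g z" "!!z. 0 <= (g z :: real)" shows "integrable lborel (%z. indicator W z *\<^sub>R f z)"
proof (rule Bochner_Integration.integrable_bound[OF g])
 show "(%z. indicator W z *\<^sub>R f z) : borel_measurable lborel" using borel_measurable_continuous_on_indicator[OF _ f] W by simp
 show "AE z in lborel. norm (indicator W z *\<^sub>R f z) <= norm (g z)" by (intro AE_I2) (auto simp: indicator_def le(2) intro: order_trans[OF le(1)])
qed

text \<open>Here b is 2 dbar of the bump. Multiplying the bump by 1 - u n gives a cutoff that
  vanishes near G, for which the integral is 0. The difference consists of q b u n, which tends to 0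
  by dominated convergence, and of q times dbar of u n, which a weighted Cauchy-Schwarz inequality
  bounds through the energy divided by I n squared.\<close>

lemma integral_holomorphic_dbar_bump_eq_0: assumes G: "cap_zero G" "compact G" "G <= cball a (1/4)" and q: "q holomorphic_on ball a (1/4) - G"
  and L2: "integrable lborel (%z. indicator (ball a (1/4) - G) z *\<^sub>R (cmod (q z))^2)"
 defines "b \<equiv> %z. of_real (bump' a z 1) + \<i> * of_real (bump' a z \<i>)" shows "integrable lborel (%z. indicator (ball a (1/4) - G) z *\<^sub>R (q z * b z))"
  and "(\<integral>z. indicator (ball a (1/4) - G) z *\<^sub>R (q z * b z) \<partial>lborel) = 0" proof -
 define U where "U = ball a (1/4) - G"
 define Q where "Q z = indicator U z *\<^sub>R (cmod (q z))^2" for z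
 have oU: "open U" unfolding U_def using G(2) by (intro open_Diff compact_imp_closed) auto
 have cq: "continuous_on U q" using q by (simp add: U_def hol_cont)
 have cb: "continuous_on A b" for A unfolding b_def by (intro continuous_intros continuous_on_subset[OF has_derivative_bump(2) subset_UNIV])
 have iQ: "integrable lborel Q" using L2 by (simp add: Q_def[abs_def] U_def)
 define J where "J z = 128 * (indicator (cball a (1/4)) z + Q z)" for z :: complex
 have "integrable lborel (indicator (cball a (1/4)) :: complex => real)"
  by (rule integrable_real_indicator) (auto simp: emeasure_compact_finite[OF compact_cball, simplified])
 hence iJ: "integrable lborel J" unfolding J_def using iQ by (intro integrable_mult_right Bochner_Integration.integrable_add)
 have Q0: "0 <= Q z" and J0: "0 <= J z" for z by (simp_all add: Q_def J_def)
 have qJ: "cmod (q z) * cmod (b z) * t <= J z" if z: "z : U" and t: "0 <= t" "t <= 1" for z t proof -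
  have "2 * cmod (q z) <= 1 + (cmod (q z))^2" using zero_le_power2[of "cmod (q z) - 1"] by (simp add: power2_diff)
  hence "cmod (q z) <= 1 + (cmod (q z))^2" using norm_ge_zero[of "q z"] by linarith
  hence "cmod (q z) * cmod (b z) * t <= (1 + (cmod (q z))^2) * 128 * 1" using bump_bounds(3)[of a z] t by (intro mult_mono mult_nonneg_nonneg) (auto simp: b_def)
  thus ?thesis using z by (simp add: J_def Q_def U_def)
 qed
 have int: "integrable lborel (%z. indicator U z *\<^sub>R (q z * b z))" proof (rule integrable_open_indicator_bound[OF oU _ iJ])
  show "continuous_on U (%z. q z * b z)" by (intro continuous_intros cq cb)
  show "norm (q z * b z) <= J z" if "z : U" for z using qJ[OF that, of 1] by (simp add: norm_mult)
 qed (rule J0)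
 thus "integrable lborel (%z. indicator (ball a (1/4) - G) z *\<^sub>R (q z * b z))" by (simp add: U_def)
 define Y where "Y = (\<integral>z. indicator U z *\<^sub>R (q z * b z) \<partial>lborel)"
 \<comment> \<open>The summand 4 has two uses: 128 + 64 (I + ln 2) <= 112 I, and on G the smoothed
   potential, at least I - 3/2 ln 2, exceeds I / 2.\<close>
 have "\<forall>n::nat. \<exists>d P m I. d > 0 & finite P & P <= G & (\<forall>w. 0 <= m w) & sum m P = 1 & real n + 4 <= I &
   (\<forall>z\<in>G. I - ln 2 <= lpot P m d z) & (\<forall>z. lpot P m d z <= I + ln 2)" using G(1) unfolding cap_zero_def by blast
 then obtain d P m I where w: "!!n. d n > 0" "!!n::nat. finite (P n)" "!!n. P n <= G" "!!n w. 0 <= m n w"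
  "!!n. sum (m n) (P n) = 1" "!!n. real n + 4 <= I n" "!!n z. z : G ==> I n - ln 2 <= lpot (P n) (m n) (d n) z" "!!n z. lpot (P n) (m n) (d n) z <= I n + ln 2" by metis
 have ln2: "ln (2::real) <= 1" using ln_le_minus_one[of 2] by simp
 have Ipos: "0 < I n" "4 <= I n" for n using w(6)[of n] by linarith+
 obtain z\<^sub>0 where z0: "z\<^sub>0 : G" using cap_zero_nonempty[OF G(1)] by blast
 have d1: "d n <= 1" for n proof (rule ccontr)
  assume "~ d n <= 1"
  hence "lpot (P n) (m n) (d n) z\<^sub>0 <= 0" using w by (intro lpot_le_0) auto
  thus False using w(7)[OF z0, of n] Ipos(2)[of n] ln2 by linarith
 qed
 define W where "W n = smooth_pot (P n) (m n) (d n)" for n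
 define W' where "W' n = smooth_pot' (P n) (m n) (d n)" for n
 define V where "V n z = (\<Sum>w\<in>P n. m n w / max (cmod (z - w)) (d n))" for n z
 define u where "u n z = sstep (W n z / I n)" for n z
 define T where "T n z = indicator U z *\<^sub>R (cmod (q z) * cmod (b z) * u n z)" for n z
 have dW: "(W n has_derivative W' n z) (at z)" for n z unfolding W_def W'_def by (rule has_derivative_smooth_pot(1)[OF w(1)])
 have cW': "continuous_on B (%z. W' n z h)" for n h B unfolding W'_def by (rule continuous_on_subset[OF has_derivative_smooth_pot(2)[OF w(1)] subset_UNIV])
 have cW: "continuous_on B (W n)" for n B using dW by (meson has_derivative_at_withinI has_derivative_continuous_on)
 have cI: "continuous_on B (%z. W n z / I n)" for n B by (intro continuous_intros cW) (use Ipos in "simp add: less_imp_neq[symmetric]")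
 have "continuous_on UNIV sstep" using sstep(1) by (meson DERIV_isCont continuous_at_imp_continuous_on)
 hence cu: "continuous_on B (u n)" for n B unfolding u_def by (rule continuous_on_compose2[OF _ cI]) auto
 have u01: "0 <= u n z" "u n z <= 1" for n z using sstep(3,4) by (auto simp: u_def)
 have W'V: "cmod (of_real (W' n z 1) + \<i> * of_real (W' n z \<i>)) <= V n z" for n z unfolding W'_def V_def by (rule smooth_pot'_bound[OF w(1) w(4)])
 have cV: "continuous_on B (V n)" for n B unfolding V_def using continuous_on_max_dist_nz(2)[OF w(1)]
  by (intro continuous_intros ballI) (simp add: less_imp_neq[symmetric])
 define S where "S = ball a (1/4)"
 define E where "E n z = indicator S z * (V n z)^2" for n z
 have iE: "integrable lborel (E n)" and EI: "(\<integral>z. E n z \<partial>lborel) <= 112 * I n" for n proof -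
  have "(\<integral>\<^sup>+z. ennreal (E n z) \<partial>lborel) = nnint S (%z. (V n z)^2)" by (intro nn_integral_cong) (auto simp: E_def indicator_def)
  also have "... <= ennreal (128 + 64 * (I n + ln 2))" unfolding V_def
   by (rule nn_integral_energy_le[OF w(1) d1 w(2,4,5) _ _ _ w(8)]) (use w(3)[of n] G(3) in "auto simp: S_def")
  also have "... <= ennreal (112 * I n)" using ln2 Ipos(2)[of n] by (intro ennreal_leI) simp
  finally have le: "(\<integral>\<^sup>+z. ennreal (E n z) \<partial>lborel) <= ennreal (112 * I n)" .
  have E0: "0 <= E n z" for z by (simp add: E_def)
  have mE: "E n : borel_measurable lborel" unfolding E_def using borel_measurable_continuous_onI[OF cV]
   by (intro borel_measurable_times borel_measurable_power borel_measurable_indicator) (auto simp: S_def)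
  show "integrable lborel (E n)" by (rule integrableI_nonneg[OF mE]) (use E0 le in "auto intro: le_less_trans")
  hence "ennreal (\<integral>z. E n z \<partial>lborel) <= ennreal (112 * I n)" using le by (subst nn_integral_eq_integral[symmetric]) (use E0 in auto)
  thus "(\<integral>z. E n z \<partial>lborel) <= 112 * I n" using Ipos(1)[of n] by (simp add: ennreal_le_iff)
 qed
 have TJ: "norm (cmod (q z) * cmod (b z) * u n z) <= J z" if "z : U" for n z using qJ[OF that u01, of n z] u01(1)[of n z] by simp
 have iT: "integrable lborel (T n)" for n unfolding T_def by (rule integrable_open_indicator_bound[OF oU _ iJ TJ J0]) (intro continuous_intros cq cb cu)
 have A0: "(%n. \<integral>z. T n z \<partial>lborel) \<longlonglongrightarrow> (\<integral>z. 0 \<partial>(lborel :: complex measure))" proof (rule integral_dominated_convergence[where w = J])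
  show "AE z in lborel. norm (T n z) <= J z" for n using TJ J0 by (intro AE_I2) (auto simp: T_def indicator_def)
  \<comment> \<open>Off G the potentials stay below - ln of the distance to G while I n grows, so u
    n z is 0 from some n on.\<close>
  have "(%n. T n z) \<longlonglongrightarrow> 0" for z proof (cases "z : U")
   case True
   hence "z ~: G" by (simp add: U_def)
   then obtain de where de: "de > 0" "!!w. w : G ==> de <= dist z w" using separate_point_closed[of G z] compact_imp_closed[OF G(2)] by blast
   obtain N :: nat where N: "4 * - ln de < real N" using reals_Archimedean2 by blast
   have "u n z = 0" if "N <= n" for n proof -
    have "W n z <= lpot (P n) (m n) (d n) z" unfolding W_def by (rule smooth_pot_bounds(2)[OF w(1,4,5)])
    also have "... <= (\<Sum>w\<in>P n. m n w * - ln de)" unfolding lpot_def proof (intro sum_mono mult_left_mono w)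
     fix v assume "v : P n"
     hence "de <= max (cmod (z - v)) (d n)" using de(2)[of v] w(3)[of n] by (auto simp: dist_norm)
     thus "- ln (max (cmod (z - v)) (d n)) <= - ln de" using de(1) by (simp add: ln_mono)
    qed
    also have "... = - ln de" using w(5)[of n] by (simp add: sum_negf sum_distrib_right[symmetric])
    also have "... <= I n / 4" using N that w(6)[of n] by simp
    finally have "W n z / I n <= 1/4" using Ipos(1)[of n] by (simp add: field_simps)
    thus ?thesis unfolding u_def by (rule sstep(7))
   qed
   thus ?thesis by (intro tendsto_eventually eventually_sequentiallyI[of N]) (simp add: T_def)
  qed (simp add: T_def)
  thus "AE z in lborel. (%n. T n z) \<longlonglongrightarrow> 0" by (intro AE_I2)
 qed (use iT iJ in auto)
 \<comment> \<open>With e = 1 / sqrt (I n) both terms of x y <= e x^2 + y^2 / (2 e) become of order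
   e after integration; 14336 is 128 times 112.\<close>
 have key: "cmod Y <= (\<integral>z. T n z \<partial>lborel) + e * ((\<integral>z. Q z \<partial>lborel) + 14336)" if e: "e > 0" "e^2 = 1 / I n" for n e proof -
  define H where "H z = bump a z * (1 - u n z)" for z
  define u' where "u' z h = sstep' (W n z / I n) * (W' n z h / I n)" for z h
  define H' where "H' z h = bump a z * (0 - u' z h) + bump' a z h * (1 - u n z)" for z h
  have du: "(u n has_derivative u' z) (at z)" for z
   using has_derivative_compose[OF bounded_linear.has_derivative[OF bounded_linear_divide dW] sstep(1)[unfolded has_field_derivative_def]]
   unfolding u_def[abs_def] u'_def[abs_def] .
  have dH: "(H has_derivative H' z) (at z)" for z unfolding H_def[abs_def] H'_def[abs_def]
   by (intro has_derivative_mult has_derivative_bump(1) has_derivative_diff has_derivative_const du)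
  have cst': "continuous_on UNIV (%z. sstep' (W n z / I n))" by (rule continuous_on_compose2[OF sstep(2) cI]) auto
  have cbump: "continuous_on UNIV (bump a)" using has_derivative_bump(1) by (meson has_derivative_at_withinI has_derivative_continuous_on)
  have cH': "continuous_on UNIV (%z. H' z h)" for h unfolding H'_def u'_def
   by (intro continuous_intros cst' cbump cu has_derivative_bump(2) cW') (use Ipos(1)[of n] in auto)
  define C where "C = cball a (1/8) Int {z. W n z <= I n / 2}"
  have "closed {z. W n z <= I n / 2}" by (intro closed_Collect_le continuous_intros cW)
  hence C1: "compact C" unfolding C_def by (intro compact_Int_closed) auto
  have C2: "C <= U"
  proof
   fix z assume z: "z : C"
   have "z ~: G"
   proof
    assume "z : G"
    hence "I n - ln 2 <= lpot (P n) (m n) (d n) z" by (rule w(7))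
    moreover have "lpot (P n) (m n) (d n) z - ln 2 / 2 <= W n z" unfolding W_def by (rule smooth_pot_bounds(1)[OF w(1,4,5)])
    ultimately show False using z ln2 Ipos(2)[of n] by (simp add: C_def)
   qed
   thus "z : U" using z by (auto simp: C_def U_def)
  qed
  have C3: "H z = 0" if "z ~: C" for z proof (cases "z : cball a (1/8)")
   case True
   hence "1/2 <= W n z / I n" using that Ipos(1)[of n] by (simp add: C_def field_simps)
   hence "u n z = 1" unfolding u_def by (rule sstep(8))
   thus ?thesis by (simp add: H_def)
  qed (simp add: H_def bump_eq_0(1))
  let ?D = "%z. of_real (H' z 1) + \<i> * of_real (H' z \<i>)"
  have iD: "integrable lborel (%z. indicator U z *\<^sub>R (q z * ?D z))" and D0: "(\<integral>z. indicator U z *\<^sub>R (q z * ?D z) \<partial>lborel) = 0"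
   by (rule integral_dbar_cutoff_eq_0[OF oU _ dH cH' cH' C1 C2 C3]; (use q in "simp add: U_def")?)+
  let ?R = "%z. indicator U z *\<^sub>R (q z * b z) - indicator U z *\<^sub>R (q z * ?D z)"
  let ?g = "%z. bump a z * sstep' (W n z / I n) / I n"
  have Req: "b z - ?D z = b z * of_real (u n z) + of_real (?g z) * (of_real (W' n z 1) + \<i> * of_real (W' n z \<i>))" for z
   unfolding H'_def b_def u'_def by (simp add: algebra_simps add_divide_distrib)
  define B where "B z = e * Q z + 128 / (I n)^2 / e * E n z" for z
  have iB: "integrable lborel B" unfolding B_def using iQ iE by auto
  have Rle: "cmod (?R z) <= T n z + B z" for z proof (cases "z : U")
   case True
   have "\<bar>?g z\<bar> <= 1 * 16 / I n" unfolding abs_divide abs_mult using bump_bounds(1,2)[of a z] sstep(5,6) Ipos(1)[of n] by (intro divide_mono mult_mono) auto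
   hence "\<bar>?g z\<bar> * cmod (of_real (W' n z 1) + \<i> * of_real (W' n z \<i>)) <= 16 / I n * V n z" using W'V[of n z] Ipos(1)[of n] by (intro mult_mono) auto
   hence "cmod (b z - ?D z) <= cmod (b z) * u n z + 16 / I n * V n z"
    unfolding Req by (intro norm_triangle_le add_mono) (use u01[of n z] in "simp_all add: norm_mult del: of_real_mult of_real_divide")
   hence "cmod (q z * (b z - ?D z)) <= cmod (q z) * (cmod (b z) * u n z + 16 / I n * V n z)" unfolding norm_mult by (intro mult_left_mono) auto
   moreover have "x * y <= e * x^2 + y^2 / (2 * e)" for x y proof -
    have "0 <= (e * x - y)^2 / (2 * e) + e * x^2 / 2" using e by simp
    also have "... = e * x^2 - x * y + y^2 / (2 * e)" using e by (simp add: power2_eq_square field_simps)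
    finally show ?thesis by simp
   qed
   from this[of "cmod (q z)" "16 / I n * V n z"] have "cmod (q z) * (16 / I n * V n z) <= B z"
    using True by (simp add: power_mult_distrib power_divide B_def Q_def E_def S_def U_def mult.commute[of e])
   ultimately show ?thesis using True by (simp add: T_def distrib_left right_diff_distrib mult.assoc)
  next
   case False
   have "0 <= B z" using e Q0 by (simp add: B_def E_def)
   thus ?thesis using False by (simp add: T_def)
  qed
  have "cmod Y = cmod (\<integral>z. ?R z \<partial>lborel)" unfolding Y_def using int iD D0 by (subst Bochner_Integration.integral_diff) auto
  also have "... <= (\<integral>z. cmod (?R z) \<partial>lborel)" by (rule integral_norm_bound)
  also have "... <= (\<integral>z. T n z + B z \<partial>lborel)"
   by (intro integral_mono integrable_norm Bochner_Integration.integrable_diff Bochner_Integration.integrable_add int iD iT iB Rle)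
  also have "... = (\<integral>z. T n z \<partial>lborel) + (\<integral>z. B z \<partial>lborel)" by (rule Bochner_Integration.integral_add[OF iT iB])
  also have "(\<integral>z. B z \<partial>lborel) = e * (\<integral>z. Q z \<partial>lborel) + 128 / (I n)^2 / e * (\<integral>z. E n z \<partial>lborel)"
   unfolding B_def using iQ iE by (subst Bochner_Integration.integral_add) auto
  finally have "cmod Y <= (\<integral>z. T n z \<partial>lborel) + (e * (\<integral>z. Q z \<partial>lborel) + 128 / (I n)^2 / e * (\<integral>z. E n z \<partial>lborel))" .
  moreover have "128 / (I n)^2 / e * (\<integral>z. E n z \<partial>lborel) <= 128 / (I n)^2 / e * (112 * I n)" using e by (intro mult_left_mono EI) auto
  moreover have "... = e * 14336" proof -
   have "e * e * I n = 1" using e Ipos(1)[of n] by (simp add: power2_eq_square)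
   thus ?thesis using e(1) Ipos(1)[of n] by (simp add: field_simps power2_eq_square)
  qed
  ultimately show ?thesis by (simp add: distrib_left)
 qed
 have "cmod Y <= 0" proof (rule LIMSEQ_le_const)
  have "filterlim I at_top sequentially"
   by (rule filterlim_at_top_mono[OF filterlim_real_sequentially]) (use w(6) in "auto intro!: always_eventually order_trans[OF _ w(6)]")
  hence "(%n. sqrt (inverse (I n))) \<longlonglongrightarrow> sqrt 0" by (intro tendsto_real_sqrt tendsto_inverse_0_at_top)
  thus "(%n. (\<integral>z. T n z \<partial>lborel) + sqrt (inverse (I n)) * ((\<integral>z. Q z \<partial>lborel) + 14336)) \<longlonglongrightarrow> 0" using tendsto_add[OF A0 tendsto_mult_right] by fastforce
  show "\<exists>N. \<forall>n\<ge>N. cmod Y <= (\<integral>z. T n z \<partial>lborel) + sqrt (inverse (I n)) * ((\<integral>z. Q z \<partial>lborel) + 14336)"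
   using Ipos by (intro exI[of _ 0] allI impI key) (auto simp: divide_inverse intro: less_imp_le)
 qed
 thus "(\<integral>z. indicator (ball a (1/4) - G) z *\<^sub>R (q z * b z) \<partial>lborel) = 0" by (simp add: Y_def U_def)
qed

text \<open>The difference quotient q of f at v is again holomorphic and square integrable, and the
  vanishing integral for it reads N v = f v * c v, with N and c the Cauchy transforms of f b and of
  b. Both are holomorphic near a because b vanishes within radius 1/12, so N / c extends f once c a
  is nonzero.\<close>

lemma cap_zero_L2_removable: assumes G: "cap_zero G" "compact G" "G <= cball a (1/4)" and f: "f holomorphic_on ball a (1/4) - G"
  and L2: "integrable lborel (%z. indicator (ball a (1/4) - G) z *\<^sub>R (cmod (f z))^2)"
 obtains r g where "r > 0" "g holomorphic_on ball a r" "!!z. z : ball a r - G ==> g z = f z" proof -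
 define W where "W = ball a (1/4) - G"
 define b where "b z = of_real (bump' a z 1) + \<i> * of_real (bump' a z \<i>)" for z
 have oW: "open W" unfolding W_def using G(2) by (intro open_Diff compact_imp_closed) auto
 have cf: "continuous_on W f" using f by (simp add: W_def hol_cont)
 have ms: "W : sets lborel" using oW by simp
 have b0: "b z = 0" if "z : ball a (1/12)" for z using that by (simp add: b_def bump'_eq_0)
 note main = integral_holomorphic_dbar_bump_eq_0[OF G, folded W_def b_def]
 have iF: "integrable lborel (%z. indicator W z *\<^sub>R (f z * b z))" by (rule main(1)) (use f L2 in "simp_all add: W_def")
 have i1: "integrable lborel (%z. indicator W z *\<^sub>R (1 * b z))" proof (rule main(1))
  show "integrable lborel (%z. indicator W z *\<^sub>R (cmod (1::complex))^2)" proof -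
   have "emeasure lborel W <= emeasure lborel (cball a (1/4))" by (intro emeasure_mono) (auto simp: W_def)
   also have "... < \<infinity>" using emeasure_compact_finite[OF compact_cball] by blast
   finally show ?thesis using ms by (simp add: integrable_real_indicator)
  qed
 qed simp
 define N where "N v = (\<integral>z. (indicator W z *\<^sub>R (f z * b z)) / (z - v) \<partial>lborel)" for v
 define c where "c v = (\<integral>z. (indicator W z *\<^sub>R (1 * b z)) / (z - v) \<partial>lborel)" for v
 have N: "N holomorphic_on ball a (1/12)" unfolding N_def by (rule cauchy_transform_holomorphic(1)[OF iF]) (simp add: b0)
 have c: "c holomorphic_on ball a (1/12)" unfolding c_def by (rule cauchy_transform_holomorphic(1)[OF i1]) (simp add: b0)
 have eq: "N v = f v * c v" if v: "v : ball a (1/12)" "v ~: G" for v proof -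
  have vW: "v : W" using v by (auto simp: W_def)
  define q where "q z = (if z = v then deriv f v else (f z - f v) / (z - v))" for z
  have q: "q holomorphic_on W" unfolding q_def[abs_def] using f by (intro pole_lemma_open) (auto simp: W_def[symmetric] oW)
  have cq: "continuous_on W q" using q hol_cont by blast
  obtain e where e: "e > 0" "cball v e <= W" using open_contains_cball[THEN iffD1, OF oW] vW by (elim ballE exE conjE) auto
  have "compact (q ` cball v e)" by (rule compact_continuous_image[OF continuous_on_subset[OF cq e(2)] compact_cball])
  then obtain B where B: "\<forall>x\<in>q ` cball v e. cmod x <= B" using compact_imp_bounded bounded_iff by metis
  have qle: "(cmod (q z))^2 <= B^2 + 2 / e^2 * ((cmod (f z))^2 + (cmod (f v))^2)" for z proof (cases "z : cball v e")
   case True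
   hence "(cmod (q z))^2 <= B^2" using B by (intro power_mono) auto
   moreover have "0 <= 2 / e^2 * ((cmod (f z))^2 + (cmod (f v))^2)" by simp
   ultimately show ?thesis by linarith
  next
   case False
   hence far: "e <= cmod (z - v)" "z ~= v" using e(1) by (auto simp: dist_norm norm_minus_commute)
   have "cmod (q z) = cmod (f z - f v) / cmod (z - v)" using far by (simp add: q_def norm_divide)
   also have "... <= (cmod (f z) + cmod (f v)) / e" using far e(1) by (intro frac_le norm_triangle_ineq4) auto
   finally have "(cmod (q z))^2 <= ((cmod (f z) + cmod (f v)) / e)^2" by (intro power_mono) auto
   also have "... = (cmod (f z) + cmod (f v))^2 / e^2" by (simp add: power_divide)
   also have "... <= 2 * ((cmod (f z))^2 + (cmod (f v))^2) / e^2"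
    using zero_le_power2[of "cmod (f z) - cmod (f v)"] by (intro divide_right_mono) (auto simp: power2_eq_square algebra_simps)
   finally have "(cmod (q z))^2 <= 2 / e^2 * ((cmod (f z))^2 + (cmod (f v))^2)" by simp
   thus ?thesis using zero_le_power2[of B] by linarith
  qed
  have iO: "integrable lborel (indicator W :: complex => real)" proof (rule integrable_real_indicator[OF ms])
   have "emeasure lborel W <= emeasure lborel (cball a (1/4))" by (intro emeasure_mono) (auto simp: W_def)
   also have "... < \<infinity>" using emeasure_compact_finite[OF compact_cball] by blast
   finally show "emeasure lborel W < \<infinity>" .
  qed
  have "integrable lborel (%z. indicator W z *\<^sub>R (cmod (q z))^2)" proof (rule Bochner_Integration.integrable_bound)
   show "integrable lborel (%z. (B^2 + 2 / e^2 * (cmod (f v))^2) * indicator W z + 2 / e^2 * (indicator W z *\<^sub>R (cmod (f z))^2))"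
    using L2 iO by (intro Bochner_Integration.integrable_add integrable_mult_right) (simp_all add: W_def)
   show "(%z. indicator W z *\<^sub>R (cmod (q z))^2) : borel_measurable lborel"
    using borel_measurable_continuous_on_indicator[OF _ continuous_on_power[OF continuous_on_norm[OF cq]], of 2] oW by simp
   show "AE z in lborel. norm (indicator W z *\<^sub>R (cmod (q z))^2) <= norm ((B^2 + 2 / e^2 * (cmod (f v))^2) * indicator W z + 2 / e^2 * (indicator W z *\<^sub>R (cmod (f z))^2))"
   proof (intro AE_I2)
    fix z
    have "0 <= B^2 + 2 / e^2 * (cmod (f v))^2 + 2 / e^2 * (cmod (f z))^2" by simp
    thus "norm (indicator W z *\<^sub>R (cmod (q z))^2) <= norm ((B^2 + 2 / e^2 * (cmod (f v))^2) * indicator W z + 2 / e^2 * (indicator W z *\<^sub>R (cmod (f z))^2))"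
     using qle[of z] by (simp add: indicator_def distrib_left add_ac)
   qed
  qed
  from main(2)[OF q this] have "(\<integral>z. indicator W z *\<^sub>R (q z * b z) \<partial>lborel) = 0" .
  moreover have "indicator W z *\<^sub>R (q z * b z) = (indicator W z *\<^sub>R (f z * b z)) / (z - v) - f v * ((indicator W z *\<^sub>R (1 * b z)) / (z - v))" for z
   using b0[OF v(1)] by (cases "z = v"; cases "z : W") (simp_all add: q_def diff_divide_distrib left_diff_distrib)
  ultimately have "(\<integral>z. (indicator W z *\<^sub>R (f z * b z)) / (z - v) - f v * ((indicator W z *\<^sub>R (1 * b z)) / (z - v)) \<partial>lborel) = 0" by simp
  hence D: "(\<integral>z. (indicator W z *\<^sub>R (f z * b z)) / (z - v) - f v * ((indicator W z *\<^sub>R (1 * b z)) / (z - v)) \<partial>lborel) = 0" .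
  have I: "integrable lborel (%z. (indicator W z *\<^sub>R (f z * b z)) / (z - v))" by (rule cauchy_transform_holomorphic(2)[OF iF _ v(1)]) (simp add: b0)
  have J: "integrable lborel (%z. (indicator W z *\<^sub>R (1 * b z)) / (z - v))" by (rule cauchy_transform_holomorphic(2)[OF i1 _ v(1)]) (simp add: b0)
  have J': "integrable lborel (%z. f v * ((indicator W z *\<^sub>R (1 * b z)) / (z - v)))" by (rule Bochner_Integration.integrable_mult_right) (rule J)
  have "N v - f v * c v = 0" using D unfolding Bochner_Integration.integral_diff[OF I J'] N_def c_def by (subst (asm) Bochner_Integration.integral_mult_right) (rule J)
  thus ?thesis by simp
 qed
 note eq1 = this
 \<comment> \<open>b / (z - a) is minus a nonnegative function that is positive on a ring off the
   null set G, so its integral cannot vanish.\<close>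
 have ca: "c a ~= 0"
 proof
  assume "c a = 0"
  define k where "k z = indicator W z * (64 * sstep' (32 * (cmod (z - a))^2))" for z
  have k: "(indicator W z *\<^sub>R (1 * b z)) / (z - a) = - of_real (k z)" for z proof (cases "z = a")
   case True
   thus ?thesis using sstep(10)[of 0] by (simp add: k_def)
  next
   case False
   thus ?thesis unfolding b_def dbar_bump k_def by (simp add: scaleR_conv_of_real)
  qed
  have ik: "integrable lborel (%z. - complex_of_real (k z))" unfolding k[symmetric] by (rule cauchy_transform_holomorphic(2)[OF i1, of a "1/12"]) (simp_all add: b0)
  have "integrable lborel (%z. - Re (- complex_of_real (k z)))" by (rule Bochner_Integration.integrable_minus[OF integrable_Re[OF ik]])
  hence ik': "integrable lborel k" by simp
  have k0: "0 <= k z" for z using sstep(5) by (simp add: k_def)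
  have "(\<integral>z. - complex_of_real (k z) \<partial>lborel) = 0" using `c a = 0` unfolding c_def k .
  hence "(\<integral>z. k z \<partial>lborel) = 0" by simp
  hence "AE z in lborel. k z = 0" using integral_nonneg_eq_0_iff_AE[OF ik'] k0 by simp
  hence "{z. k z ~= 0} : null_sets lborel" using AE_iff_null[of lborel "%z. k z = 0"] borel_measurable_integrable[OF ik'] by simp
  moreover have "G : null_sets lborel" using cap_zero_null[OF G] G(2) by (intro null_setsI) (auto simp: borel_compact)
  ultimately have null: "{z. k z ~= 0} Un G : null_sets lborel" by (rule null_sets.Un)
  \<comment> \<open>A small disc inside that ring: its points have modulus, relative to a, between
    1/10 and 1/9, where the argument of \<open>sstep'\<close> lies strictly between 1/4 and
    1/2.\<close>
  define A where "A = ball (a + of_real (3/28)) (1/1000)"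
  have "A <= {z. k z ~= 0} Un G"
  proof
   fix z assume z: "z : A"
   have d: "cmod (z - a - of_real (3/28)) < 1/1000" using z by (simp add: A_def dist_norm norm_minus_commute diff_diff_eq)
   have "cmod (z - a) <= 3/28 + 1/1000" using norm_triangle_ineq[of "z - a - of_real (3/28)" "of_real (3/28)"] d by (simp only: norm_of_real) simp
   moreover have "3/28 - 1/1000 <= cmod (z - a)" using norm_triangle_ineq4[of "z - a" "z - a - of_real (3/28)"] d
    by (simp only: diff_diff_eq2 diff_add_cancel add_diff_cancel_left' norm_of_real) simp
   ultimately have "(1/10)^2 < (cmod (z - a))^2" "(cmod (z - a))^2 < (1/9)^2" by (intro power_strict_mono; simp)+
   hence "1/4 < 32 * (cmod (z - a))^2" "32 * (cmod (z - a))^2 < 1/2" by (simp_all add: power2_eq_square)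
   hence "0 < sstep' (32 * (cmod (z - a))^2)" by (rule sstep(9))
   moreover have "z : ball a (1/4)" using `cmod (z - a) <= 3/28 + 1/1000` by (simp add: dist_norm norm_minus_commute)
   ultimately show "z : {z. k z ~= 0} Un G" by (cases "z : G") (simp_all add: k_def W_def)
  qed
  hence "A : null_sets lborel" using null by (rule null_sets_subset[rotated 2]) (simp add: A_def)
  hence "negligible A" by (simp add: negligible_iff_null_sets null_sets_completionI)
  thus False using open_not_negligible[of A] by (simp add: A_def)
 qed
 have "open (ball a (1/12) Int c -` (- {0}))" by (intro continuous_open_preimage hol_cont[OF c]) auto
 moreover have "a : ball a (1/12) Int c -` (- {0})" using ca by simp
 ultimately obtain r where r: "r > 0" "ball a r <= ball a (1/12) Int c -` (- {0})" using openE by blast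
 show ?thesis proof (rule that[of r "%z. N z / c z"])
  show "(%z. N z / c z) holomorphic_on ball a r" using r(2) by (intro holomorphic_on_divide holomorphic_on_subset[OF N] holomorphic_on_subset[OF c]) auto
  fix z assume that: "z : ball a r - G"
  show "N z / c z = f z" proof -
   have "z : ball a (1/12)" "c z ~= 0" using subsetD[OF r(2), of z] that by auto
   thus ?thesis using eq1[of z] that by simp
  qed
 qed (rule r)
qed

section \<open>Limits of equilibrium weights\<close>

text \<open>\<open>Lam\<close> plays the part of integration against an equilibrium measure: a limit
  along X of averages over P n, available for every function that is bounded on F. M is the bound of
  the potentials, uniform in the truncation radius 1 / (n + 1).\<close>

locale limit_functional =
 fixes F :: "complex set" and a :: complex and M :: real and P :: "nat => complex set" and m :: "nat => complex => real"
  and X :: "nat filter" and Lam :: "(complex => complex) => complex" assumes compact_F: "compact F" and F_sub: "F <= cball a (1/4)"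
  and finite_P: "finite (P n)" and P_sub: "P n <= F" and m_nonneg: "0 <= m n w" and m_sum: "sum (m n) (P n) = 1" and pot_le: "lpot (P n) (m n) (1 / Suc n) z <= M"
  and X_nontrivial: "X ~= bot" and X_le: "X <= sequentially" and lim: "bounded (ph ` F) ==> ((%n. \<Sum>w\<in>P n. of_real (m n w) * ph w) \<longlongrightarrow> Lam ph) X"

text \<open>Tychonoff: the averaging functionals are points of a product of discs with one factor
  for each function, and convergence to a cluster point takes place along a filter finer than
  \<open>sequentially\<close>.\<close>

lemma limit_functional_exists: assumes F: "compact F" "F ~= {}" "F <= cball a (1/4)" and n: "~ cap_zero F" obtains M P m X Lam where "limit_functional F a M P m X Lam"
proof -
 obtain M where M: "!!d. d > 0 ==> \<exists>P m. finite P & P <= F & (\<forall>w. 0 <= m w) & sum m P = 1 & (\<forall>z. lpot P m d z <= M)"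
  by (rule not_cap_zero_weights[OF F(1,2) n]) (rule that)
 have "\<forall>n. \<exists>Pm. finite (fst Pm) & fst Pm <= F & (\<forall>w. 0 <= snd Pm w) & sum (snd Pm) (fst Pm) = 1 & (\<forall>z. lpot (fst Pm) (snd Pm) (1 / Suc n) z <= M)"
 proof
  fix n :: nat
  have "(0::real) < 1 / Suc n" by simp
  from M[OF this] show "\<exists>Pm. finite (fst Pm) & fst Pm <= F & (\<forall>w. 0 <= snd Pm w) & sum (snd Pm) (fst Pm) = 1 & (\<forall>z. lpot (fst Pm) (snd Pm) (1 / Suc n) z <= M)" by simp
 qed
 then obtain Pm where Pm: "\<forall>n. finite (fst (Pm n)) & fst (Pm n) <= F & (\<forall>w. 0 <= snd (Pm n) w) & sum (snd (Pm n)) (fst (Pm n)) = 1 & (\<forall>z. lpot (fst (Pm n)) (snd (Pm n)) (1 / Suc n) z <= M)"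
  by (rule choice[THEN exE])
 define P where "P n = fst (Pm n)" for n
 define m where "m n = snd (Pm n)" for n
 have P: "finite (P n)" "P n <= F" "0 <= m n w" "sum (m n) (P n) = 1" "lpot (P n) (m n) (1 / Suc n) z <= M" for n w z
  using Pm[rule_format, of n] by (simp_all add: P_def m_def)
 \<comment> \<open>The value 0 at functions unbounded on F keeps every coordinate bounded in
   n.\<close>
 define L where "L n f = (if bounded (f ` F) then \<Sum>w\<in>P n. of_real (m n w) * f w else 0)" for n and f :: "complex => complex"
 have "\<exists>B. \<forall>n. cmod (L n f) <= B" for f proof (cases "bounded (f ` F)")
  case True
  then obtain B where B: "\<forall>x\<in>f ` F. cmod x <= B" using bounded_iff by metis
  have "cmod (L n f) <= B" for n proof -
   have "cmod (L n f) <= (\<Sum>w\<in>P n. m n w * B)" using True B P(2)[of n] by (simp add: L_def) (intro sum_norm_le, auto simp: norm_mult P(3) intro!: mult_left_mono)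
   also have "... = B" using P(4)[of n] by (simp flip: sum_distrib_right)
   finally show ?thesis .
  qed
  thus ?thesis by blast
 qed (auto simp: L_def)
 hence "\<forall>f. \<exists>B. \<forall>n. cmod (L n f) <= B" ..
 then obtain B where B: "\<forall>f. \<forall>n. cmod (L n f) <= B f" by (rule choice[THEN exE])
 define S where "S = (\<Pi>\<^sub>E f\<in>UNIV. cball (0::complex) (B f))"
 have "compactin (product_topology (%_. euclidean) UNIV) S" unfolding S_def compactin_PiE by auto
 hence cS: "compact S" by (simp add: euclidean_product_topology)
 have "filtermap L sequentially ~= bot" by (simp add: filtermap_bot_iff)
 moreover have "eventually (%x. x : S) (filtermap L sequentially)" using B by (simp add: eventually_filtermap S_def PiE_UNIV_domain)
 ultimately obtain Lam where Lam: "inf (nhds Lam) (filtermap L sequentially) ~= bot" using cS unfolding compact_filter by (elim allE impE bexE)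
 define X where "X = inf sequentially (filtercomap L (nhds Lam))"
 have "X ~= bot"
 proof
  assume "X = bot"
  hence "eventually (%_. False) X" by simp
  then obtain p q where pq: "eventually p sequentially" "eventually q (filtercomap L (nhds Lam))" "!!n. p n & q n ==> False" unfolding X_def eventually_inf by blast
  obtain r where r: "eventually r (nhds Lam)" "!!n. r (L n) ==> q n" using pq(2) unfolding eventually_filtercomap by blast
  have "eventually (%y. ~ r y) (filtermap L sequentially)" unfolding eventually_filtermap using pq(1) by (rule eventually_mono) (use pq(3) r(2) in blast)
  hence "eventually (%_. False) (inf (nhds Lam) (filtermap L sequentially))" unfolding eventually_inf using r(1) by blast
  thus False using Lam by (simp add: eventually_False)
 qed
 have "filterlim L (nhds Lam) X" unfolding X_def filterlim_def filtermap_filtercomap by (meson dual_order.trans filtermap_filtercomap filtermap_mono inf_le2)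
 hence lim: "((%n. L n f) \<longlongrightarrow> Lam f) X" for f using continuous_on_tendsto_compose[OF continuous_on_product_coordinates[of f]] by simp
 have "limit_functional F a M P m X Lam"
 proof
  show "((%n. \<Sum>w\<in>P n. of_real (m n w) * f w) \<longlongrightarrow> Lam f) X" if "bounded (f ` F)" for f using lim[of f] that by (simp add: L_def)
 qed (use F P `X ~= bot` in "auto simp: X_def")
 thus ?thesis by (rule that)
qed

context limit_functional begin

lemma Lam_eqI: assumes "bounded (f ` F)" and "((%n. \<Sum>w\<in>P n. of_real (m n w) * f w) \<longlongrightarrow> l) X" shows "Lam f = l" using tendsto_unique[OF X_nontrivial lim[OF assms(1)] assms(2)] .

lemma Lam_add: assumes "bounded (f ` F)" "bounded (p ` F)" shows "Lam (%w. f w + p w) = Lam f + Lam p"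
 by (rule Lam_eqI) (use assms tendsto_add[OF assms[THEN lim]] in "simp_all add: bounded_plus_comp distrib_left sum.distrib")

lemma Lam_mult: assumes "bounded (f ` F)" shows "Lam (%w. k * f w) = k * Lam f" proof (rule Lam_eqI)
 show "bounded ((%w. k * f w) ` F)" using bounded_linear_image[OF assms bounded_linear_mult_right[of k]] by (simp add: image_image)
 show "((%n. \<Sum>w\<in>P n. of_real (m n w) * (k * f w)) \<longlongrightarrow> k * Lam f) X" using tendsto_mult_left[OF lim[OF assms], of k] by (simp add: sum_distrib_left mult.left_commute)
qed

lemma Lam_const: "Lam (%_. k) = k" by (rule Lam_eqI) (simp_all add: image_constant_conv m_sum flip: sum_distrib_right of_real_sum)

lemma Lam_cong: assumes "bounded (f ` F)" and "!!w. w : F ==> f w = p w" shows "Lam f = Lam p" proof (rule Lam_eqI[OF assms(1)])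
 have "bounded (p ` F)" using assms by (metis image_cong)
 thus "((%n. \<Sum>w\<in>P n. of_real (m n w) * f w) \<longlongrightarrow> Lam p) X"
  using lim[of p] sum.cong[OF refl, of "P n" "%w. of_real (m n w) * f w" "%w. of_real (m n w) * p w" for n] assms(2) P_sub
  by (smt (verit, best) subset_iff tendsto_cong eventuallyI)
qed

lemma Lam_norm_le: assumes "!!w. w : F ==> cmod (f w) <= B" shows "cmod (Lam f) <= B" proof (rule tendsto_upperbound)
 have "bounded (f ` F)" using assms by (auto simp: bounded_iff)
 thus "((%n. cmod (\<Sum>w\<in>P n. of_real (m n w) * f w)) \<longlongrightarrow> cmod (Lam f)) X" by (intro tendsto_norm lim)
 have "cmod (\<Sum>w\<in>P n. of_real (m n w) * f w) <= B" for n proof -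
  have "cmod (\<Sum>w\<in>P n. of_real (m n w) * f w) <= (\<Sum>w\<in>P n. m n w * B)"
   using assms P_sub[of n] by (intro sum_norm_le) (auto simp: norm_mult m_nonneg intro!: mult_left_mono)
  also have "... = B" using m_sum[of n] by (simp flip: sum_distrib_right)
  finally show ?thesis .
 qed
 thus "eventually (%n. cmod (\<Sum>w\<in>P n. of_real (m n w) * f w) <= B) X" by simp
qed (rule X_nontrivial)

lemma Lam_Re_le: assumes "bounded (f ` F)" and "eventually (%n. (\<Sum>w\<in>P n. m n w * Re (f w)) <= B) sequentially" shows "Re (Lam f) <= B" proof (rule tendsto_upperbound)
 show "((%n. Re (\<Sum>w\<in>P n. of_real (m n w) * f w)) \<longlongrightarrow> Re (Lam f)) X" using assms(1) by (intro tendsto_Re lim)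
 show "eventually (%n. Re (\<Sum>w\<in>P n. of_real (m n w) * f w) <= B) X" using filter_leD[OF X_le assms(2)] by simp
qed (rule X_nontrivial)

text \<open>A point off F has positive distance to F, so for large n the truncation at 1 / (n + 1)
  has no effect there.\<close>

lemma potential_le: assumes "z ~: F" shows "Re (Lam (%w. of_real (- ln (cmod (z - w))))) <= M" proof (rule Lam_Re_le)
 have nz: "cmod (z - w) ~= 0" if "w : F" for w using assms that by auto
 have "continuous_on F (%w. complex_of_real (- ln (cmod (z - w))))" by (intro continuous_intros) (use nz in auto)
 thus "bounded ((%w. complex_of_real (- ln (cmod (z - w)))) ` F)" using compact_F compact_continuous_image compact_imp_bounded by blast
 obtain e where e: "e > 0" "!!w. w : F ==> e <= dist z w" using separate_point_closed[OF compact_imp_closed[OF compact_F] assms] by auto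
 obtain N where N: "inverse (real (Suc N)) < e" using reals_Archimedean[OF e(1)] by blast
 have "(\<Sum>w\<in>P n. m n w * Re (complex_of_real (- ln (cmod (z - w))))) <= M" if n: "N <= n" for n proof -
  have "1 / Suc n <= inverse (real (Suc N))" using n by (simp add: field_simps)
  hence "tdist (1 / Suc n) z w = cmod (z - w)" if "w : P n" for w using e(2)[of w] that P_sub[of n] N by (auto simp: dist_norm max_def)
  hence "lpot (P n) (m n) (1 / Suc n) z = (\<Sum>w\<in>P n. m n w * Re (complex_of_real (- ln (cmod (z - w)))))" unfolding lpot_def by (intro sum.cong) simp_all
  thus ?thesis using pot_le[of n z] by simp
 qed
 thus "eventually (%n. (\<Sum>w\<in>P n. m n w * Re (complex_of_real (- ln (cmod (z - w))))) <= M) sequentially" unfolding eventually_sequentially by blast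
qed

text \<open>Convergence along X is pointwise, so a single n is chosen that is good on a finite net
  of S; a Lipschitz bound spreads this over S with total error at most 1, and the energy estimate
  for the finite weight at n applies. The resulting bound does not depend on S.\<close>

lemma energy_bound: assumes B: "!!w. w : F ==> cmod (p w) <= B" and S: "compact S" "S Int F = {}" "S <= cball a (3/4)" shows "nnint S (%z. (cmod (Lam (%w. p w / (z - w))))^2)
  <= ennreal (2 * B^2 * (128 + 64 * M)) + 2 * emeasure lborel (cball a (3/4))" proof (cases "S = {} \<or> F = {}") case True
 moreover have "F ~= {}" using P_sub[of 0] m_sum[of 0] by auto
 ultimately show ?thesis by simp
next
 case False
 define f where "f z = Lam (%w. p w / (z - w))" for z
 define g where "g n z = (\<Sum>w\<in>P n. of_real (m n w) * (p w / (z - w)))" for n z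
 obtain w0 where "w0 : F" using False by auto
 hence B0: "0 <= B" using B[of w0] norm_ge_zero[of "p w0"] by linarith
 obtain e where e: "e > 0" "!!z w. z : S ==> w : F ==> e <= dist z w" using separate_compact_closed[OF S(1) compact_imp_closed[OF compact_F] S(2)] by auto
 have bdd: "cmod (p w / (z - w)) <= B / e" if "z : S" "w : F" for z w using B[OF that(2)] e(2)[OF that] e(1) B0 by (auto simp: norm_divide dist_norm intro!: frac_le)
 hence bd: "bounded ((%w. p w / (z - w)) ` F)" if "z : S" for z using that by (auto simp: bounded_iff)
 define l where "l = B / e^2 + 1"
 have l0: "l > 0" using B0 e(1) by (simp add: l_def add_nonneg_pos)
 have lip: "cmod (p w / (z - w) - p w / (t - w)) <= l * dist z t" if "z : S" "t : S" "w : F" for z t w proof -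
  have nz: "z - w ~= 0" "t - w ~= 0" using e that by (force simp: dist_norm)+
  have "p w / (z - w) - p w / (t - w) = p w * (t - z) / ((z - w) * (t - w))" using nz by (simp add: field_simps)
  hence "cmod (p w / (z - w) - p w / (t - w)) = cmod (p w) * dist z t / (dist z w * dist t w)" by (simp add: norm_divide norm_mult dist_norm norm_minus_commute)
  also have "... <= B * dist z t / (e * e)" using B[OF that(3)] e(2)[OF that(1,3)] e(2)[OF that(2,3)] e(1) B0
   by (intro frac_le mult_right_mono mult_mono mult_nonneg_nonneg) auto
  also have "... <= l * dist z t" by (simp add: l_def power2_eq_square distrib_right)
  finally show ?thesis .
 qed
 \<comment> \<open>A net of mesh 1 / (3 l) costs 1/3 for the limit f and 1/3 for the average g n;
   the last 1/3 goes to the choice of n.\<close>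
 define d where "d = 1 / (3 * l)"
 have d0: "d > 0" using l0 by (simp add: d_def)
 obtain T where T: "finite T" "T <= S" "S <= (\<Union>t\<in>T. ball t d)" using seq_compact_imp_totally_bounded[OF S(1)[unfolded compact_eq_seq_compact_metric]] d0 by auto
 have "eventually (%n. \<forall>t\<in>T. dist (g n t) (f t) < 1/3) X" unfolding eventually_ball_finite_distrib[OF T(1)]
 proof
  fix t assume "t : T"
  hence "((%n. g n t) \<longlongrightarrow> f t) X" unfolding g_def f_def using T(2) by (intro lim bd) auto
  thus "eventually (%n. dist (g n t) (f t) < 1/3) X" by (rule tendstoD) simp
 qed
 moreover have "eventually (%n. 1 / Suc n < e) X" proof -
  have "(%n. 1 / Suc n) \<longlonglongrightarrow> 0" using LIMSEQ_inverse_real_of_nat by (simp add: inverse_eq_divide)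
  thus ?thesis using filter_leD[OF X_le order_tendstoD(2)] e(1) by blast
 qed
 ultimately have "eventually (%n. (\<forall>t\<in>T. dist (g n t) (f t) < 1/3) & 1 / Suc n < e) X" by (rule eventually_conj)
 then obtain n where n: "\<forall>t\<in>T. dist (g n t) (f t) < 1/3" "1 / Suc n < e" using eventually_happens'[OF X_nontrivial] by blast
 define E where "E z = (\<Sum>w\<in>P n. m n w / tdist (1 / Suc n) z w)" for z
 have E0: "0 <= E z" for z unfolding E_def by (intro sum_nonneg divide_nonneg_nonneg m_nonneg) (simp add: max_def)
 have fE: "cmod (f z) <= B * E z + 1" if z: "z : S" for z proof -
  obtain t where t: "t : T" "dist t z < d" using T(3) z by auto
  hence tS: "t : S" using T(2) by auto
  have L: "l * dist z t <= 1/3" proof -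
   have "l * dist z t <= l * d" using t(2) l0 by (intro mult_left_mono) (auto simp: dist_commute)
   also have "... = 1/3" using l0 by (simp add: d_def)
   finally show ?thesis .
  qed
  have "f z = f t + Lam (%w. p w / (z - w) - p w / (t - w))" using Lam_add[OF bd[OF tS], of "%w. p w / (z - w) - p w / (t - w)"] bounded_minus_comp[OF bd[OF z] bd[OF tS]]
   by (simp add: f_def)
  moreover have "cmod (Lam (%w. p w / (z - w) - p w / (t - w))) <= 1/3" using lip[OF z tS] L by (intro Lam_norm_le) (meson order_trans)
  ultimately have 1: "cmod (f z) <= cmod (f t) + 1/3" using norm_triangle_ineq[of "f t" "Lam (%w. p w / (z - w) - p w / (t - w))"] by simp
  have 2: "cmod (f t) <= cmod (g n t) + 1/3" using n(1) t(1) norm_triangle_ineq2[of "f t" "g n t"] by (force simp: dist_norm norm_minus_commute)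
  have "cmod (g n t - g n z) <= (\<Sum>w\<in>P n. m n w * (1/3))" unfolding g_def sum_subtractf[symmetric] proof (rule sum_norm_le)
   fix w assume w: "w : P n"
   have le3: "cmod (p w / (t - w) - p w / (z - w)) <= 1/3" using lip[OF tS z, of w] L w P_sub[of n] by (auto simp: dist_commute)
   thus "cmod (of_real (m n w) * (p w / (t - w)) - of_real (m n w) * (p w / (z - w))) <= m n w * (1/3)" using mult_left_mono[OF le3 m_nonneg[of n w]] m_nonneg[of n w]
    unfolding right_diff_distrib[symmetric] norm_mult norm_of_real by simp
  qed
  also have "... = 1/3" using m_sum[of n] by (simp flip: sum_divide_distrib)
  finally have 3: "cmod (g n t) <= cmod (g n z) + 1/3" using norm_triangle_ineq2[of "g n t" "g n z"] by simp
  have "cmod (g n z) <= (\<Sum>w\<in>P n. B * (m n w / tdist (1 / Suc n) z w))" unfolding g_def proof (rule sum_norm_le)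
   fix w assume w: "w : P n"
   hence wF: "w : F" using P_sub by auto
   have "tdist (1 / Suc n) z w = cmod (z - w)" using e(2)[OF z wF] n(2) by (simp add: dist_norm max_def)
   thus "cmod (of_real (m n w) * (p w / (z - w))) <= B * (m n w / tdist (1 / Suc n) z w)"
    using mult_right_mono[OF B[OF wF], of "m n w / cmod (z - w)"] m_nonneg[of n w] by (simp add: norm_mult norm_divide mult.commute)
  qed
  hence 4: "cmod (g n z) <= B * E z" by (simp add: E_def sum_distrib_left)
  show ?thesis using 1 2 3 4 by linarith
 qed
 have sq: "(cmod (f z))^2 <= 2 * B^2 * (E z)^2 + 2" if "z : S" for z proof -
  have "(cmod (f z))^2 <= (B * E z + 1)^2" using fE[OF that] by (rule power_mono) simp
  also have "... <= 2 * B^2 * (E z)^2 + 2" using zero_le_power2[of "B * E z - 1"] by (simp add: power2_eq_square algebra_simps)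
  finally show ?thesis .
 qed
 have mS: "S : sets lborel" using S(1) by (simp add: borel_compact)
 have "continuous_on UNIV E" unfolding E_def by (intro continuous_intros) (auto simp: max_def)
 hence mE: "E : borel_measurable borel" by (rule borel_measurable_continuous_onI)
 have "nnint S (%z. (cmod (f z))^2) <= (\<integral>\<^sup>+z. ennreal (2 * B^2) * (ennreal ((E z)^2) * indicator S z) + 2 * indicator S z \<partial>lborel)" proof (rule nn_integral_mono)
  fix z
  have "ennreal ((cmod (f z))^2) <= ennreal (2 * B^2) * ennreal ((E z)^2) + 2" if "z : S" using ennreal_leI[OF sq[OF that]] by (simp add: ennreal_plus ennreal_mult)
  thus "ennreal ((cmod (f z))^2) * indicator S z <= ennreal (2 * B^2) * (ennreal ((E z)^2) * indicator S z) + 2 * indicator S z" by (auto simp: indicator_def)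
 qed
 also have "... = ennreal (2 * B^2) * nnint S (%z. (E z)^2) + 2 * emeasure lborel S" using mS mE by (simp add: nn_integral_add nn_integral_cmult)
 also have "... <= ennreal (2 * B^2) * ennreal (128 + 64 * M) + 2 * emeasure lborel (cball a (3/4))" proof (intro add_mono mult_left_mono)
  show "nnint S (%z. (E z)^2) <= ennreal (128 + 64 * M)" unfolding E_def
   by (rule nn_integral_energy_le) (use P_sub[of n] F_sub finite_P m_nonneg m_sum pot_le mS S(3) in auto)
  show "emeasure lborel S <= emeasure lborel (cball a (3/4))" using S(3) by (intro emeasure_mono) auto
 qed simp_all
 also have "ennreal (2 * B^2) * ennreal (128 + 64 * M) = ennreal (2 * B^2 * (128 + 64 * M))" by (simp add: ennreal_mult'[symmetric])
 finally show ?thesis by (simp add: f_def)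
qed

end

section \<open>Derivatives of potentials and Cauchy transforms of the limit functional\<close>

lemma has_derivative_quadratic:
 fixes f :: "'a::real_normed_vector => 'b::real_normed_vector"
 assumes D: "bounded_linear D" and r: "r > 0" and q: "!!y. dist y x < r ==> norm (f y - f x - D (y - x)) <= C * (norm (y - x))^2" shows "(f has_derivative D) (at x)" proof -
 have "((%y. norm (f y - f x - D (y - x)) / norm (y - x)) \<longlongrightarrow> 0) (at x)" proof (rule Lim_null_comparison)
  have "((%y. C * norm (y - x)) \<longlongrightarrow> C * norm (x - x)) (at x)" by (intro tendsto_intros)
  thus "((%y. C * norm (y - x)) \<longlongrightarrow> 0) (at x)" by simp
  have "norm (norm (f y - f x - D (y - x)) / norm (y - x)) <= C * norm (y - x)" if "y ~= x" "dist y x < r" for y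
   using q[OF that(2)] that(1) by (simp add: field_simps power2_eq_square)
  thus "\<forall>\<^sub>F y in at x. norm (norm (f y - f x - D (y - x)) / norm (y - x)) <= C * norm (y - x)" unfolding eventually_at using r by blast
 qed
 thus ?thesis using D by (simp add: has_derivative_iff_norm)
qed

context limit_functional begin

lemma Lam_diff: assumes "bounded (f ` F)" "bounded (p ` F)" shows "Lam (%w. f w - p w) = Lam f - Lam p"
 by (rule Lam_eqI) (use assms tendsto_diff[OF assms[THEN lim]] in "simp_all add: bounded_minus_comp right_diff_distrib sum_subtractf")

lemma Lam_Re: assumes "bounded (f ` F)" shows "Lam (%w. of_real (Re (f w))) = of_real (Re (Lam f))" proof (rule Lam_eqI)
 show "bounded ((%w. complex_of_real (Re (f w))) ` F)"
  using bounded_linear_image[OF bounded_linear_image[OF assms bounded_linear_Re] bounded_linear_of_real[where 'a=complex]] by (simp add: image_image)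
 show "((%n. \<Sum>w\<in>P n. of_real (m n w) * complex_of_real (Re (f w))) \<longlongrightarrow> of_real (Re (Lam f))) X"
  using tendsto_of_real[OF tendsto_Re[OF lim[OF assms]], where 'a=complex] by simp
qed

lemma bounded_continuous: "continuous_on F f ==> bounded (f ` F)" using compact_F compact_continuous_image compact_imp_bounded by blast

lemma F_nonempty: "F ~= {}" using P_sub[of 0] m_sum[of 0] by auto

context
 fixes al be :: "complex => complex" assumes al: "continuous_on F al" and be: "continuous_on F be"
begin

text \<open>Linear forms treat both charts at once: z - w has coefficients 1 and - w, and its
  counterpart at infinity, 1 - w z, has - w and 1.\<close>

abbreviation lin where "lin w z \<equiv> al w * z + be w"

abbreviation close where "close A z y w \<equiv> cmod (al w * (y - z) / lin w z) <= A * cmod (y - z) & A * cmod (y - z) <= 1/2 &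
 lin w y = lin w z * (1 + al w * (y - z) / lin w z) & lin w y ~= 0"

text \<open>By compactness of F the forms are bounded away from 0 at z uniformly in w, so on a disc
  about z their relative change is at most 1/2.\<close>

lemma linear_form_bounds: assumes z: "\<forall>w\<in>F. lin w z ~= 0" obtains A e where "A > 0" "e > 0" "!!w. w : F ==> e <= cmod (lin w z)" "!!w. w : F ==> cmod (al w) <= A * e"
  "!!y w. dist y z < 1 / (2 * A) ==> w : F ==> close A z y w" proof -
 have "continuous_on F (%w. cmod (lin w z))" by (intro continuous_intros al be)
 then obtain w0 where w0: "w0 : F" "!!w. w : F ==> cmod (al w0 * z + be w0) <= cmod (lin w z)" using continuous_attains_inf[OF compact_F F_nonempty] by blast
 define e where "e = cmod (al w0 * z + be w0)"
 have e: "e > 0" using z w0(1) by (simp add: e_def)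
 obtain B where B: "\<forall>x\<in>al ` F. cmod x <= B" using bounded_continuous[OF al] unfolding bounded_iff by blast
 define A where "A = (\<bar>B\<bar> + 1) / e"
 have A: "A > 0" using e by (simp add: A_def)
 have Ae: "cmod (al w) <= A * e" if "w : F" for w using B that e by (force simp: A_def)
 show ?thesis proof (rule that[OF A e])
  show "e <= cmod (lin w z)" if "w : F" for w using w0(2)[OF that] by (simp add: e_def)
  show "cmod (al w) <= A * e" if "w : F" for w using that by (rule Ae)
  fix y w assume y: "dist y z < 1 / (2 * A)" and w: "w : F"
  let ?l = "lin w z" and ?x = "al w * (y - z) / lin w z"
  have l: "?l ~= 0" "e <= cmod ?l" using z w w0(2)[OF w] by (auto simp: e_def)
  have "cmod ?x = cmod (al w) * cmod (y - z) / cmod ?l" by (simp add: norm_mult norm_divide)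
  also have "... <= (A * e) * cmod (y - z) / e" using Ae[OF w] l(2) e A by (intro frac_le mult_right_mono mult_nonneg_nonneg) auto
  also have "... = A * cmod (y - z)" using e by simp
  finally have 1: "cmod ?x <= A * cmod (y - z)" .
  have 2: "A * cmod (y - z) <= 1/2" using y A by (simp add: dist_norm field_simps)
  have 3: "lin w y = ?l * (1 + ?x)" using l(1) by (simp add: field_simps)
  have "1 + ?x ~= 0"
  proof
   assume "1 + ?x = 0"
   hence "?x = - 1" by (metis add.inverse_unique)
   hence "cmod ?x = 1" by simp
   thus False using 1 2 by linarith
  qed
  hence 4: "lin w y ~= 0" unfolding 3 using l(1) by simp
  show "cmod ?x <= A * cmod (y - z) & A * cmod (y - z) <= 1/2 & lin w y = ?l * (1 + ?x) & lin w y ~= 0" using 1 2 3 4 by blast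
 qed
qed

lemma bounded_linear_form_quotient:
 fixes ph :: "complex => complex" assumes ph: "continuous_on F ph" and z: "\<forall>w\<in>F. lin w z ~= 0" shows "bounded ((%w. ph w / lin w z) ` F)"
 by (rule bounded_continuous) (intro continuous_on_divide ph continuous_on_add continuous_on_mult_right al be z)

text \<open>With x the relative change of the form, the first order remainder of 1 / (1 + x) is x^2
  / (1 + x). It is quadratic in y - z uniformly over F, and \<open>Lam\<close> respects uniform
  bounds.\<close>

lemma has_field_derivative_Lam_quotient:
 fixes ph :: "complex => complex" assumes ph: "continuous_on F ph" and z: "\<forall>w\<in>F. lin w z ~= 0"
 shows "((%z. Lam (%w. ph w / lin w z)) has_field_derivative Lam (%w. - (ph w * al w) / (lin w z)^2)) (at z)" proof -
 obtain A e where A: "A > 0" and e: "e > 0" "!!w. w : F ==> e <= cmod (lin w z)" and *: "!!y w. dist y z < 1 / (2 * A) ==> w : F ==> close A z y w"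
  by (rule linear_form_bounds[OF z]) (rule that)
 obtain B where B: "\<forall>x\<in>ph ` F. cmod x <= B" using bounded_continuous[OF ph] unfolding bounded_iff by blast
 obtain w0 where "w0 : F" using F_nonempty by blast
 hence B0: "0 <= B" using B norm_ge_zero[of "ph w0"] by (meson imageI order_trans)
 let ?D = "%w. - (ph w * al w) / (lin w z)^2"
 have bD: "bounded (?D ` F)" by (intro bounded_continuous continuous_intros al be ph) (use z in auto)
 show ?thesis unfolding has_field_derivative_def proof (rule has_derivative_quadratic)
  show "bounded_linear ((*) (Lam ?D))" by (rule bounded_linear_mult_right)
  show "0 < 1 / (2 * A)" using A by simp
  fix y assume y: "dist y z < 1 / (2 * A)"
  have ynz: "\<forall>w\<in>F. lin w y ~= 0" using *[OF y] by blast
  note bq = bounded_linear_form_quotient[OF ph]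
  have "Lam (%w. ph w / lin w y) - Lam (%w. ph w / lin w z) - Lam ?D * (y - z) = Lam (%w. ph w / lin w y - ph w / lin w z - (y - z) * ?D w)"
   using Lam_diff[OF bounded_minus_comp[OF bq[OF ynz] bq[OF z]], of "%w. (y - z) * ?D w"] Lam_diff[OF bq[OF ynz] bq[OF z]] Lam_mult[OF bD, of "y - z"]
    bounded_linear_image[OF bD bounded_linear_mult_right[of "y - z"]] by (simp add: image_image mult.commute)
  also have "cmod ... <= 2 * B / e * A^2 * (cmod (y - z))^2" proof (rule Lam_norm_le)
   fix w assume w: "w : F"
   let ?l = "lin w z"
   let ?x = "al w * (y - z) / ?l"
   have l: "?l ~= 0" using z w by blast
   note f = *[OF y w]
   have x1: "1/2 <= cmod (1 + ?x)" using f norm_triangle_ineq2[of 1 "- ?x"] by auto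
   hence x2: "1 + ?x ~= 0" by auto
   have "ph w / lin w y - ph w / ?l - (y - z) * ?D w = ph w / ?l * (1 / (1 + ?x) - 1 + ?x)" proof -
    have "(y - z) * ?D w = - (ph w / ?l * ?x)" by (simp add: power2_eq_square mult_ac)
    moreover have "ph w / lin w y = ph w / ?l * (1 / (1 + ?x))" using f by (simp only: times_divide_times_eq mult_1_right)
    ultimately show ?thesis by (simp only: right_diff_distrib distrib_left mult_1_right diff_minus_eq_add)
   qed
   also have "1 / (1 + x) - 1 + x = x^2 / (1 + x)" if "1 + x ~= 0" for x :: complex using that by (simp add: field_simps power2_eq_square)
   note this[OF x2]
   finally have "cmod (ph w / lin w y - ph w / ?l - (y - z) * ?D w) = cmod (ph w) / cmod ?l * ((cmod ?x)^2 / cmod (1 + ?x))"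
    by (simp add: norm_mult norm_divide norm_power)
   also have "... <= (B / e) * ((A * cmod (y - z))^2 / (1/2))" using B w e x1 f B0 by (intro mult_mono frac_le power_mono) auto
   finally show "cmod (ph w / lin w y - ph w / ?l - (y - z) * ?D w) <= 2 * B / e * A^2 * (cmod (y - z))^2" by (simp add: power_mult_distrib mult_ac)
  qed
  finally show "cmod (Lam (%w. ph w / lin w y) - Lam (%w. ph w / lin w z) - Lam ?D * (y - z)) <= 2 * B / e * A^2 * (cmod (y - z))^2" .
 qed
qed

lemma holomorphic_Lam_quotient:
 fixes ph :: "complex => complex" assumes ph: "continuous_on F ph" and S: "!!z w. z : S ==> w : F ==> lin w z ~= 0" shows "(%z. Lam (%w. ph w / lin w z)) holomorphic_on S"
 unfolding holomorphic_on_def field_differentiable_def using has_field_derivative_at_within[OF has_field_derivative_Lam_quotient[OF ph]] S by blast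

text \<open>The same argument with Ln (1 + x) - x, which is bounded by twice |x|^2 for |x| <= 1/2;
  taking real parts gives the change of ln of the modulus.\<close>

lemma has_derivative_Lam_log: assumes z: "\<forall>w\<in>F. lin w z ~= 0" shows "((%z. Re (Lam (%w. of_real (- ln (cmod (lin w z)))))) has_derivative
  (%h. Re (- Lam (%w. al w / lin w z) * h))) (at z)" proof - obtain A e where A: "A > 0" and *: "!!y w. dist y z < 1 / (2 * A) ==> w : F ==> close A z y w"
  by (rule linear_form_bounds[OF z]) (rule that)
 let ?D = "%w. al w / lin w z"
 let ?u = "%z w. complex_of_real (- ln (cmod (lin w z)))"
 have bD: "bounded (?D ` F)" by (rule bounded_linear_form_quotient[OF al z])
 have bu: "bounded (?u x ` F)" if "\<forall>w\<in>F. lin w x ~= 0" for x by (intro bounded_continuous continuous_intros al be) (use that in auto)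
 show ?thesis proof (rule has_derivative_quadratic)
  show "bounded_linear (%h. Re (- Lam ?D * h))" by (rule bounded_linear_compose[OF bounded_linear_Re bounded_linear_mult_right])
  show "0 < 1 / (2 * A)" using A by simp
  fix y assume y: "dist y z < 1 / (2 * A)"
  have ynz: "\<forall>w\<in>F. lin w y ~= 0" using *[OF y] by blast
  let ?E = "%w. (y - z) * ?D w"
  have bE: "bounded (?E ` F)" using bounded_linear_image[OF bD bounded_linear_mult_right[of "y - z"]] by (simp add: image_image)
  have bq: "bounded ((%w. ?u y w - ?u z w + ?E w) ` F)" by (rule bounded_plus_comp[OF bounded_minus_comp[OF bu[OF ynz] bu[OF z]] bE])
  have eq: "Re (Lam (?u y)) - Re (Lam (?u z)) - Re (- Lam ?D * (y - z)) = Re (Lam (%w. ?u y w - ?u z w + ?E w))"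
   unfolding Lam_add[OF bounded_minus_comp[OF bu[OF ynz] bu[OF z]] bE] Lam_diff[OF bu[OF ynz] bu[OF z]] Lam_mult[OF bD] by (simp add: mult.commute)
  have "cmod (Lam (%w. complex_of_real (Re (?u y w - ?u z w + ?E w)))) <= 2 * A^2 * (cmod (y - z))^2" proof (rule Lam_norm_le)
   fix w assume w: "w : F"
   let ?l = "lin w z"
   let ?x = "al w * (y - z) / ?l"
   have l: "?l ~= 0" using z w by blast
   note f = *[OF y w]
   have x1: "cmod ?x <= 1/2" using f by linarith
   have "1 + ?x ~= 0" using f l by auto
   hence "ln (cmod (lin w y)) = ln (cmod ?l) + Re (Ln (1 + ?x))" using f[THEN conjunct2, THEN conjunct2, THEN conjunct1] l by (simp add: norm_mult ln_mult)
   hence "Re (?u y w - ?u z w + ?E w) = - Re (Ln (1 + ?x) - ?x)" by (simp add: mult.commute)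
   hence "\<bar>Re (?u y w - ?u z w + ?E w)\<bar> <= cmod (Ln (1 + ?x) - ?x)" using abs_Re_le_cmod[of "Ln (1 + ?x) - ?x"] by simp
   also have "... <= (cmod ?x)^2 / (1 - cmod ?x)" by (rule Ln_approx_linear) (use x1 in linarith)
   also have "... <= (A * cmod (y - z))^2 / (1/2)" using x1 f by (intro frac_le power_mono) auto
   finally show "cmod (complex_of_real (Re (?u y w - ?u z w + ?E w))) <= 2 * A^2 * (cmod (y - z))^2" by (simp only: norm_of_real power_mult_distrib) simp
  qed
  thus "norm (Re (Lam (?u y)) - Re (Lam (?u z)) - Re (- Lam ?D * (y - z))) <= 2 * A^2 * (norm (y - z))^2" unfolding eq Lam_Re[OF bq] by simp
 qed
qed

end

lemma sum_Un_nonneg_le: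
 fixes f :: "'a => real" assumes "finite A" "finite B" "!!x. 0 <= f x" shows "sum f (A Un B) <= sum f A + sum f B"
 using sum.union_inter[OF assms(1,2), of f] sum_nonneg[of "A Int B" f] assms(3) by simp

text \<open>Mass inside the disc contributes at least - ln r times its amount to the potential at z,
  and all other contributions are nonnegative. Thus a bound for the potentials leaves no point
  masses in the limit.\<close>

lemma mass_cball_le: assumes z: "z : F" and r: "0 < r" "r < 1" and n: "1 / Suc n <= r" shows "(\<Sum>w\<in>P n Int cball z r. m n w) * - ln r <= M" proof -
 have le1: "tdist (1 / Suc n) z w <= 1" if "w : P n" for w proof -
  have "dist a w <= 1/4" "dist a z <= 1/4" using that P_sub[of n] z F_sub by auto
  hence "dist z w <= 1" using dist_triangle[of z w a] by (simp add: dist_commute)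
  thus ?thesis by (simp add: dist_norm)
 qed
 have pos: "0 < tdist (1 / Suc n) z w" for w by (simp add: less_max_iff_disj)
 have "(\<Sum>w\<in>P n Int cball z r. m n w) * - ln r <= (\<Sum>w\<in>P n Int cball z r. m n w * - ln (tdist (1 / Suc n) z w))" unfolding sum_distrib_right
 proof (intro sum_mono mult_left_mono m_nonneg)
  fix w assume "w : P n Int cball z r"
  hence "tdist (1 / Suc n) z w <= r" using n by (simp add: dist_norm)
  thus "- ln r <= - ln (tdist (1 / Suc n) z w)" using ln_mono[OF _ pos[of w]] by simp
 qed
 also have "... <= (\<Sum>w\<in>P n. m n w * - ln (tdist (1 / Suc n) z w))" proof (intro sum_mono2 finite_P mult_nonneg_nonneg m_nonneg)
  fix w assume "w : P n - P n Int cball z r"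
  thus "0 <= - ln (tdist (1 / Suc n) z w)" using ln_le_zero_iff[OF pos[of w]] le1[of w] by simp
 qed auto
 also have "... <= M" using pot_le[of n z] by (simp add: lpot_def)
 finally show ?thesis .
qed

text \<open>Small discs about the finitely many zeros of g carry at most half of the mass by
  \<open>mass_cball_le\<close>, and on the rest of F the function has a positive lower bound
  e.\<close>

lemma Lam_pos: assumes g: "continuous_on F g" "!!w. w : F ==> 0 <= g w" and Z: "finite {w\<in>F. g w = 0}" shows "Re (Lam (%w. of_real (g w))) > 0" proof -
 define Z where "Z = {w\<in>F. g w = 0}"
 define N where "N = real (card Z)"
 have N0: "0 <= N" by (simp add: N_def)
 have fZ: "finite Z" using Z by (simp add: Z_def)
 \<comment> \<open>Chosen so that N discs of mass at most (|M| + 1) / (- ln r) carry at most 1/2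
   together.\<close>
 define r where "r = exp (- (2 * N * (\<bar>M\<bar> + 1) + 1))"
 have lnr: "- ln r = 2 * N * (\<bar>M\<bar> + 1) + 1" by (simp add: r_def)
 have "0 <= 2 * N * (\<bar>M\<bar> + 1)" using N0 by simp
 hence r: "0 < r" "r < 1" by (simp_all add: r_def)
 define K where "K = F - (\<Union>z\<in>Z. ball z r)"
 have cK: "compact K" unfolding K_def by (intro compact_diff compact_F open_UN) auto
 have "\<exists>e>0. \<forall>w\<in>K. e <= g w" proof (cases "K = {}")
  case True thus ?thesis by (intro exI[of _ 1]) auto
 next
  case False
  then obtain w0 where w0: "w0 : K" "\<forall>w\<in>K. g w0 <= g w" using continuous_attains_inf[OF cK False continuous_on_subset[OF g(1)]] by (auto simp only: K_def Diff_subset)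
  have "g w0 ~= 0" "0 <= g w0" using w0(1) r g(2) by (auto simp: K_def Z_def)
  thus ?thesis using w0(2) by (intro exI[of _ "g w0"]) auto
 qed
 then obtain e where e: "e > 0" "\<forall>w\<in>K. e <= g w" by blast
 obtain n0 where n0: "inverse (real (Suc n0)) < r" using reals_Archimedean[OF r(1)] by blast
 have main: "(\<Sum>w\<in>P n. m n w * Re (- complex_of_real (g w))) <= - e / 2" if n: "n0 <= n" for n proof -
  have n1: "1 / Suc n <= r" proof -
   have "1 / Suc n <= inverse (real (Suc n0))" using n by (simp add: field_simps)
   thus ?thesis using n0 by linarith
  qed
  have "(\<Sum>w\<in>P n - K. m n w) <= (\<Sum>w\<in>(\<Union>z\<in>Z. P n Int cball z r). m n w)" using P_sub[of n] by (intro sum_mono2) (auto simp: K_def m_nonneg finite_P fZ)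
  also have "... <= (\<Sum>z\<in>Z. \<Sum>w\<in>P n Int cball z r. m n w)" using fZ proof (induction Z rule: finite_induct)
   case (insert z Z)
   have "sum (m n) (P n Int cball z r Un (\<Union>z\<in>Z. P n Int cball z r)) <= sum (m n) (P n Int cball z r) + sum (m n) (\<Union>z\<in>Z. P n Int cball z r)"
    using insert.hyps(1) by (intro sum_Un_nonneg_le) (simp_all add: m_nonneg finite_P)
   thus ?case using insert by simp
  qed simp
  also have "... <= (\<Sum>z\<in>Z. (\<bar>M\<bar> + 1) / - ln r)" proof (rule sum_mono)
   fix z assume "z : Z"
   hence "(\<Sum>w\<in>P n Int cball z r. m n w) * - ln r <= M" using mass_cball_le[OF _ r n1, of z] by (simp add: Z_def)
   moreover have "0 < - ln r" using r by simp
   ultimately show "(\<Sum>w\<in>P n Int cball z r. m n w) <= (\<bar>M\<bar> + 1) / - ln r" by (subst pos_le_divide_eq) auto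
  qed
  also have "... = N * (\<bar>M\<bar> + 1) / - ln r" by (simp add: N_def)
  also have "... <= 1/2" unfolding lnr using N0 by (subst pos_divide_le_eq) (auto intro!: add_nonneg_pos)
  finally have half: "(\<Sum>w\<in>P n - K. m n w) <= 1/2" .
  have "1 = (\<Sum>w\<in>P n - K. m n w) + (\<Sum>w\<in>P n Int K. m n w)" using m_sum[of n] sum.Int_Diff[OF finite_P, of "m n" n K] by simp
  hence "e / 2 <= (\<Sum>w\<in>P n Int K. m n w) * e" using half e(1) by simp
  also have "... <= (\<Sum>w\<in>P n Int K. m n w * g w)" unfolding sum_distrib_right using e(2) by (intro sum_mono mult_left_mono m_nonneg) auto
  also have "... <= (\<Sum>w\<in>P n. m n w * g w)" using P_sub[of n] g(2) by (intro sum_mono2 finite_P) (auto intro!: mult_nonneg_nonneg m_nonneg)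
  finally show ?thesis by (simp add: sum_negf)
 qed
 have bg: "bounded ((%w. complex_of_real (g w)) ` F)" by (intro bounded_continuous continuous_intros g)
 have "Re (Lam (%w. - complex_of_real (g w))) <= - e / 2" using bg main by (intro Lam_Re_le) (auto simp: eventually_sequentially bounded_uminus image_image[symmetric])
 thus ?thesis using Lam_mult[OF bg, of "-1"] e(1) by simp
qed

end

section \<open>Orthogonal polynomials of the limit functional\<close>

context limit_functional begin

lemma Lam_cnj: assumes "bounded (f ` F)" shows "Lam (%w. cnj (f w)) = cnj (Lam f)" proof (rule Lam_eqI)
 show "bounded ((%w. cnj (f w)) ` F)" using bounded_linear_image[OF assms bounded_linear_cnj] by (simp add: image_image)
 show "((%n. \<Sum>w\<in>P n. of_real (m n w) * cnj (f w)) \<longlongrightarrow> cnj (Lam f)) X" using tendsto_cnj[OF lim[OF assms]] by simp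
qed

definition pinner :: "complex poly => complex poly => complex" where "pinner p q = Lam (%w. poly p w * cnj (poly q w))"

lemma bounded_pinner: "bounded ((%w. poly p w * cnj (poly q w)) ` F)" by (intro bounded_continuous continuous_intros)

lemma pinner_diff: "pinner (p - q) r = pinner p r - pinner q r"
 unfolding pinner_def using Lam_diff[OF bounded_pinner bounded_pinner, of p r q r] by (simp add: left_diff_distrib)

lemma pinner_add: "pinner (p + q) r = pinner p r + pinner q r"
 unfolding pinner_def using Lam_add[OF bounded_pinner bounded_pinner, of p r q r] by (simp add: distrib_right)

lemma pinner_smult: "pinner (Polynomial.smult k p) r = k * pinner p r"
 unfolding pinner_def using Lam_mult[OF bounded_pinner, of k p r] by (simp add: mult.assoc)

lemma pinner_sum: "pinner (\<Sum>i\<in>I. p i) r = (\<Sum>i\<in>I. pinner (p i) r)" proof (induction I rule: infinite_finite_induct)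
qed (use pinner_smult[of 0 0 r] in "simp_all add: pinner_add")

lemma pinner_commute: "pinner q p = cnj (pinner p q)" unfolding pinner_def using Lam_cnj[OF bounded_pinner, of p q] by (simp add: mult.commute)

text \<open>A nonzero polynomial has finitely many roots, so \<open>Lam_pos\<close> applies to its
  squared modulus; here the absence of point masses enters.\<close>

lemma pinner_self_nonzero: assumes "p ~= 0" shows "pinner p p ~= 0" proof -
 have "{w \<in> F. (cmod (poly p w))^2 = 0} <= {w. poly p w = 0}" by auto
 hence "finite {w \<in> F. (cmod (poly p w))^2 = 0}" using poly_roots_finite[OF assms] finite_subset by blast
 moreover have "continuous_on F (%w. (cmod (poly p w))^2)" by (intro continuous_intros)
 ultimately have "Re (Lam (%w. of_real ((cmod (poly p w))^2))) > 0" by (intro Lam_pos) auto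
 moreover have "(%w. poly p w * cnj (poly p w)) = (%w. of_real ((cmod (poly p w))^2))" by (simp add: fun_eq_iff complex_norm_square del: of_real_power)
 ultimately show ?thesis by (auto simp: pinner_def)
qed

text \<open>Gram-Schmidt applied to the monomials without normalising; the coefficient of degree j
  stays 1, which keeps every \<open>orth j\<close> nonzero.\<close>

fun orth :: "nat => complex poly" where
 "orth j = monom 1 j - (\<Sum>i\<in>{..<j}. Polynomial.smult (pinner (monom 1 j) (orth i) / pinner (orth i) (orth i)) (orth i))"

declare orth.simps [simp del]

lemma degree_orth: "degree (orth j) <= j" proof (induction j rule: less_induct)
 case (less j)
 have "degree (Polynomial.smult c (orth i)) <= j" if "i < j" for c i using degree_smult_le[of c "orth i"] less[OF that] that by linarith
 note * = this
 show ?case by (subst orth.simps) (intro degree_diff_le degree_sum_le degree_monom_le *, simp_all)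
qed

lemma orth_nonzero: "orth j ~= 0" proof -
 have "coeff (orth i) j = 0" if "i < j" for i using degree_orth[of i] that by (intro coeff_eq_0) simp
 hence "coeff (orth j) j = 1" by (subst orth.simps) (simp add: coeff_sum)
 thus ?thesis by auto
qed

lemma orth_orthogonal: assumes "i ~= j" shows "pinner (orth j) (orth i) = 0" proof -
 have *: "pinner (orth j) (orth i) = 0" if "i < j" for i j using that proof (induction j arbitrary: i rule: less_induct)
  case (less j)
  let ?c = "%k. pinner (monom 1 j) (orth k) / pinner (orth k) (orth k)"
  have 0: "pinner (orth k) (orth i) = 0" if "k < j" "k ~= i" for k proof (cases "i < k")
   case True thus ?thesis using less.IH[of k i] that by simp
  next
   case False
   thus ?thesis using less.IH[of i k] less.prems that pinner_commute[of "orth k" "orth i"] by simp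
  qed
  have "pinner (orth j) (orth i) = pinner (monom 1 j) (orth i) - (\<Sum>k<j. ?c k * pinner (orth k) (orth i))"
   by (subst (1) orth.simps) (simp add: pinner_diff pinner_sum pinner_smult)
  also have "(\<Sum>k<j. ?c k * pinner (orth k) (orth i)) = (\<Sum>k<j. if k = i then pinner (monom 1 j) (orth i) else 0)"
   by (intro sum.cong) (use 0 pinner_self_nonzero[OF orth_nonzero] in auto)
  also have "... = pinner (monom 1 j) (orth i)" using less.prems by simp
  finally show ?case by simp
 qed
 show ?thesis proof (cases "i < j")
  case False
  thus ?thesis using *[of j i] assms pinner_commute[of "orth j" "orth i"] by simp
 qed (rule *)
qed

lemma pinner_monom_orth: "k <= j ==> pinner (monom 1 k) (orth j) = (if k = j then pinner (orth j) (orth j) else 0)" proof -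
 assume kj: "k <= j"
 let ?c = "%i. pinner (monom 1 k) (orth i) / pinner (orth i) (orth i)"
 have "monom 1 k = orth k + (\<Sum>i<k. Polynomial.smult (?c i) (orth i))" by (subst orth.simps) simp
 hence "pinner (monom 1 k) (orth j) = pinner (orth k) (orth j) + (\<Sum>i<k. ?c i * pinner (orth i) (orth j))"
  by (metis (no_types, lifting) pinner_add pinner_smult pinner_sum sum.cong)
 also have "(\<Sum>i<k. ?c i * pinner (orth i) (orth j)) = 0" using kj by (intro sum.neutral) (simp add: orth_orthogonal)
 finally show ?thesis using orth_orthogonal[of j k] by auto
qed

lemma Lam_orth_low: "k < j ==> Lam (%w. w ^ k * cnj (poly (orth j) w)) = 0" using pinner_monom_orth[of k j] by (simp add: pinner_def poly_monom)

lemma Lam_orth_top: "Lam (%w. w ^ j * cnj (poly (orth j) w)) ~= 0" using pinner_monom_orth[of j j] pinner_self_nonzero[OF orth_nonzero[of j]]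
 by (simp add: pinner_def poly_monom)

text \<open>Repeated use of 1 / (z - w) = 1/z + w / (z (z - w)): each vanishing moment raises the
  order of vanishing at infinity by one. For an orthogonal polynomial the remaining factor is
  nonzero at infinity by \<open>Lam_orth_top\<close>.\<close>

lemma Lam_cauchy_expansion: assumes f: "continuous_on F f" and z: "z ~: F" "z ~= 0" and 0: "!!k. k < j ==> Lam (%w. w ^ k * f w) = 0"
 shows "Lam (%w. f w / (z - w)) = inverse z ^ Suc j * Lam (%w. w ^ j * f w / (1 - w * inverse z))" proof -
 have nz: "\<forall>w\<in>F. z - w ~= 0" using z by auto
 have b1: "bounded ((%w. w ^ k * f w / (z - w)) ` F)" for k by (intro bounded_continuous continuous_on_divide continuous_intros f nz)
 have b2: "bounded ((%w. w ^ k * f w) ` F)" for k by (intro bounded_continuous continuous_intros f)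
 have step: "Lam (%w. w ^ k * f w / (z - w)) = inverse z * Lam (%w. w ^ Suc k * f w / (z - w)) + inverse z * Lam (%w. w ^ k * f w)" for k proof -
  have "Lam (%w. w ^ k * f w / (z - w)) = Lam (%w. inverse z * (w ^ Suc k * f w / (z - w) + w ^ k * f w))" proof (rule Lam_cong[OF b1])
   fix w assume "w : F"
   hence "z - w ~= 0" using nz by blast
   thus "w ^ k * f w / (z - w) = inverse z * (w ^ Suc k * f w / (z - w) + w ^ k * f w)" using z(2) by (simp add: field_simps)
  qed
  also have "... = inverse z * Lam (%w. w ^ Suc k * f w / (z - w) + w ^ k * f w)" by (rule Lam_mult[OF bounded_plus_comp[OF b1 b2]])
  finally show ?thesis unfolding Lam_add[OF b1 b2] distrib_left .
 qed
 have "k <= j ==> Lam (%w. f w / (z - w)) = inverse z ^ k * Lam (%w. w ^ k * f w / (z - w))" for k proof (induction k)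
  case (Suc k)
  thus ?case using step[of k] 0[of k] by (simp add: mult.assoc mult.left_commute)
 qed simp
 from this[of j] have "Lam (%w. f w / (z - w)) = inverse z ^ j * Lam (%w. w ^ j * f w / (z - w))" by simp
 also have "Lam (%w. w ^ j * f w / (z - w)) = Lam (%w. inverse z * (w ^ j * f w / (1 - w * inverse z)))" proof (rule Lam_cong[OF b1])
  fix w assume "w : F"
  hence "z - w ~= 0" using nz by blast
  hence "z - w = z * (1 - w * inverse z)" using z(2) by (simp add: field_simps)
  thus "w ^ j * f w / (z - w) = inverse z * (w ^ j * f w / (1 - w * inverse z))" by (simp add: divide_inverse mult_ac)
 qed
 also have "... = inverse z * Lam (%w. w ^ j * f w / (1 - w * inverse z))" proof (rule Lam_mult, intro bounded_continuous continuous_on_divide continuous_intros f ballI)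
  fix w assume "w : F"
  thus "1 - w * inverse z ~= 0" using nz z(2) by (auto simp: field_simps)
 qed
 finally show ?thesis by simp
qed

text \<open>The complement of F is exhausted by compact sets, and \<open>energy_bound\<close> is the
  same for all of them, so monotone convergence applies.\<close>

lemma energy_finite: assumes p: "continuous_on F p" shows "nnint (cball a (3/4) - F) (%z. (cmod (Lam (%w. p w / (z - w))))^2) < \<infinity>" proof -
 obtain B where B: "\<forall>x\<in>p ` F. cmod x <= B" using bounded_continuous[OF p] unfolding bounded_iff by blast
 let ?C = "ennreal (2 * B^2 * (128 + 64 * M)) + 2 * emeasure lborel (cball a (3/4))"
 define f where "f z = Lam (%w. p w / (z - w))" for z
 define S where "S k = cball a (3/4) Int {z. 1 / Suc k <= infdist z F}" for k :: nat
 have cS: "compact (S k)" for k unfolding S_def by (intro compact_Int_closed compact_cball closed_Collect_le continuous_intros)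
 have "1 / Suc (Suc k) <= 1 / Suc k" for k by (simp add: field_simps)
 hence mono: "S k <= S (Suc k)" for k unfolding S_def using order_trans by blast
 have un: "(\<Union>k. S k) = cball a (3/4) - F" proof (intro equalityI subsetI)
  fix z assume "z : (\<Union>k. S k)"
  then obtain k where k: "z : S k" by blast
  hence "1 / Suc k <= infdist z F" by (simp add: S_def)
  moreover have "0 < 1 / real (Suc k)" by simp
  ultimately have "0 < infdist z F" by linarith
  hence "z ~: F" using infdist_zero[of z F] by linarith
  thus "z : cball a (3/4) - F" using k by (simp add: S_def)
 next
  fix z assume z: "z : cball a (3/4) - F"
  hence "infdist z F > 0" using in_closed_iff_infdist_zero[OF compact_imp_closed[OF compact_F] F_nonempty, of z] infdist_nonneg[of z F] by simp
  then obtain k where "inverse (real (Suc k)) < infdist z F" using reals_Archimedean by blast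
  thus "z : (\<Union>k. S k)" using z by (intro UN_I[of k]) (auto simp: S_def inverse_eq_divide)
 qed
 have hf: "f holomorphic_on - F"
  using holomorphic_Lam_quotient[OF continuous_on_const continuous_on_minus[OF continuous_on_id] p, of "- F" 1] by (force simp: f_def[abs_def])
 have meas: "(%z. ennreal ((cmod (f z))^2) * indicator (S k) z) : borel_measurable lborel" for k using un hol_cont[OF hf] cS
  by (intro measurable_indicator_ennreal continuous_intros) (auto elim!: continuous_on_subset simp: borel_compact)
 have sup: "(SUP k. ennreal ((cmod (f z))^2) * indicator (S k) z) = ennreal ((cmod (f z))^2) * indicator (cball a (3/4) - F) z" for z proof (cases "z : (\<Union>k. S k)")
  case True
  then obtain k where k: "z : S k" by (elim UN_E)
  show ?thesis proof (rule antisym)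
   show "(SUP k. ennreal ((cmod (f z))^2) * indicator (S k) z) <= ennreal ((cmod (f z))^2) * indicator (cball a (3/4) - F) z"
    using True unfolding un by (intro SUP_least mult_left_mono) (simp_all add: indicator_def)
   show "ennreal ((cmod (f z))^2) * indicator (cball a (3/4) - F) z <= (SUP k. ennreal ((cmod (f z))^2) * indicator (S k) z)"
    using k True unfolding un by (intro SUP_upper2[of k]) simp_all
  qed
 next
  case False
  hence "z ~: S k" for k by simp
  thus ?thesis using False unfolding un by simp
 qed
 have inc: "incseq (%k z. ennreal ((cmod (f z))^2) * indicator (S k) z)" using mono by (intro incseq_SucI le_funI mult_left_mono) (auto simp: indicator_def)
 have "nnint (cball a (3/4) - F) (%z. (cmod (f z))^2) = (SUP k. \<integral>\<^sup>+z\<in>S k. ennreal ((cmod (f z))^2) \<partial>lborel)"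
  unfolding sup[symmetric] by (rule nn_integral_monotone_convergence_SUP[OF inc meas])
 also have "... <= ?C" proof (rule SUP_least)
  fix k show "nnint (S k) (%z. (cmod (f z))^2) <= ?C" unfolding f_def by (rule energy_bound) (use B cS un in "auto simp: S_def")
 qed
 also have "?C < \<infinity>" using emeasure_compact_finite[OF compact_cball[of a "3/4"]] by (simp add: ennreal_mult_less_top)
 finally show ?thesis by (simp add: f_def)
qed

end

text \<open>\<open>h j\<close> describes \<open>f j\<close> near infinity in the coordinate 1/z; as
  it is nonzero at 0, the order of vanishing is exactly j + 1. These distinct orders later give
  linear independence.\<close>

lemma not_cap_zero_holomorphic_sequence: assumes F: "compact F" "F ~= {}" "F <= cball a (1/4)" and n: "~ cap_zero F"
 obtains f h :: "nat => complex => complex" where "!!j. f j holomorphic_on - F" "!!j. h j holomorphic_on {v. \<forall>w\<in>F. w * v ~= 1}" "!!j. h j 0 ~= 0"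
  "!!j z. z ~: F ==> z ~= 0 ==> f j z = inverse z ^ Suc j * h j (inverse z)" "!!j. (nnint (cball a (3/4) - F) (%z. (cmod (f j z))^2)) < \<infinity>" proof -
 obtain M P m X Lam where "limit_functional F a M P m X Lam" by (rule limit_functional_exists[OF F n])
 then interpret limit_functional F a M P m X Lam .
 let ?q = "%j w. cnj (poly (orth j) w)"
 have cq: "continuous_on F (?q j)" for j by (intro continuous_intros)
 show ?thesis proof (rule that[of "%j z. Lam (%w. ?q j w / (z - w))" "%j v. Lam (%w. w ^ j * ?q j w / (1 - w * v))"])
  fix j
  show "(%z. Lam (%w. ?q j w / (z - w))) holomorphic_on - F"
   using holomorphic_Lam_quotient[OF continuous_on_const continuous_on_minus[OF continuous_on_id] cq, of "- F" 1] by force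
  show "(%v. Lam (%w. w ^ j * ?q j w / (1 - w * v))) holomorphic_on {v. \<forall>w\<in>F. w * v ~= 1}"
   using holomorphic_Lam_quotient[OF continuous_on_minus[OF continuous_on_id] continuous_on_const
     continuous_on_mult[OF continuous_on_power[OF continuous_on_id] cq], of "{v. \<forall>w\<in>F. w * v ~= 1}" 1 j j] by simp
  show "Lam (%w. w ^ j * ?q j w / (1 - w * 0)) ~= 0" using Lam_orth_top[of j] by simp
  show "nnint (cball a (3/4) - F) (%z. (cmod (Lam (%w. ?q j w / (z - w))))^2) < \<infinity>" by (rule energy_finite[OF cq])
  fix z assume "z ~: F" "z ~= 0"
  thus "Lam (%w. ?q j w / (z - w)) = inverse z ^ Suc j * Lam (%w. w ^ j * ?q j w / (1 - w * inverse z))" by (intro Lam_cauchy_expansion cq Lam_orth_low)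
 qed
qed

section \<open>Smoothness of explicit functions and the strictly subharmonic potential\<close>

lemma times_differentiable_on_cong: assumes "open S" "!!x. x : S ==> f x = g x" shows "times_differentiable_on n f S \<longleftrightarrow> times_differentiable_on n g S" using assms(2)
proof (induction n arbitrary: f g)
 case 0
 thus ?case using continuous_on_cong[OF refl, of S f g] by simp
next
 case (Suc n)
 have d: "((f has_derivative D) (at x)) = ((g has_derivative D) (at x))" if "x : S" for x D
  using has_derivative_transform_within_open[OF _ assms(1) that, of f D UNIV g] has_derivative_transform_within_open[OF _ assms(1) that, of g D UNIV f] Suc.prems
  by auto
 hence "frechet_derivative f (at x) = frechet_derivative g (at x)" if "x : S" for x using that by (simp add: frechet_derivative_def)
 moreover have "f differentiable (at x) \<longleftrightarrow> g differentiable (at x)" if "x : S" for x using d[OF that] by (simp add: differentiable_def)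
 ultimately show ?case using Suc.IH[of "%x. frechet_derivative f (at x) v" "%x. frechet_derivative g (at x) v" for v] by simp
qed

lemma smooth_on_cong: assumes "open S" "!!x. x : S ==> f x = g x" shows "smooth_on f S = smooth_on g S"
 using times_differentiable_on_cong[OF assms] by (simp add: smooth_on_def)

lemma times_differentiable_on_SucI: assumes "open S" and d: "!!x. x : S ==> (f has_derivative f' x) (at x)" and n: "!!v. times_differentiable_on n (%x. f' x v) S"
 shows "times_differentiable_on (Suc n) f S" proof -
 have "frechet_derivative f (at x) v = f' x v" if "x : S" for x v using frechet_derivative_at[OF d[OF that]] by simp
 hence "times_differentiable_on n (%x. frechet_derivative f (at x) v) S" for v
  using times_differentiable_on_cong[OF assms(1), of "%x. frechet_derivative f (at x) v" "%x. f' x v" n] n by simp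
 thus ?thesis using d by (auto simp: differentiable_def)
qed

lemma times_differentiable_on_SucD: "times_differentiable_on (Suc n) f S ==> times_differentiable_on n f S" proof (induction n arbitrary: f)
 case 0
 thus ?case by (auto intro!: continuous_at_imp_continuous_on differentiable_imp_continuous_within)
next
 case (Suc n)
 hence 1: "\<forall>x\<in>S. f differentiable (at x)" "times_differentiable_on (Suc n) (%x. frechet_derivative f (at x) v) S" for v
  unfolding times_differentiable_on.simps(2)[of "Suc n"] by simp_all
 thus ?case using Suc.IH by simp
qed

lemma times_differentiable_on_add:
 fixes f g :: "'a::real_normed_vector => 'b::real_normed_vector" assumes "open S"
 shows "times_differentiable_on n f S ==> times_differentiable_on n g S ==> times_differentiable_on n (%x. f x + g x) S" proof (induction n arbitrary: f g)
 case (Suc n)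
 show ?case proof (rule times_differentiable_on_SucI[OF assms])
  show "((%x. f x + g x) has_derivative (%v. frechet_derivative f (at x) v + frechet_derivative g (at x) v)) (at x)" if "x : S" for x
   using Suc.prems that by (intro has_derivative_add) (auto simp: frechet_derivative_works)
  show "times_differentiable_on n (%x. frechet_derivative f (at x) v + frechet_derivative g (at x) v) S" for v using Suc.prems by (intro Suc.IH) auto
 qed
qed (simp add: continuous_on_add)

lemma times_differentiable_on_mult:
 fixes f g :: "'a::real_normed_vector => real" assumes "open S"
 shows "times_differentiable_on n f S ==> times_differentiable_on n g S ==> times_differentiable_on n (%x. f x * g x) S" proof (induction n arbitrary: f g)
 case (Suc n)
 show ?case proof (rule times_differentiable_on_SucI[OF assms])
  show "((%x. f x * g x) has_derivative (%v. f x * frechet_derivative g (at x) v + frechet_derivative f (at x) v * g x)) (at x)" if "x : S" for x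
   using Suc.prems that by (intro has_derivative_mult) (auto simp: frechet_derivative_works)
  show "times_differentiable_on n (%x. f x * frechet_derivative g (at x) v + frechet_derivative f (at x) v * g x) S" for v
   using Suc.prems Suc.prems[THEN times_differentiable_on_SucD] by (intro times_differentiable_on_add[OF assms] Suc.IH) simp_all
 qed
qed (simp add: continuous_on_mult)

text \<open>The factor k closes the family under directional derivatives: the derivative of Re (f k)
  in direction v is Re (f' v k), so the induction runs with v k in place of k.\<close>

lemma times_differentiable_on_Re_holomorphic: assumes "open S" shows "f holomorphic_on S ==> times_differentiable_on n (%x. Re (f x * k)) S"
proof (induction n arbitrary: f k)
 case 0
 thus ?case by (auto intro!: continuous_intros hol_cont)
next
 case (Suc n)
 show ?case proof (rule times_differentiable_on_SucI[OF assms])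
  show "((%x. Re (f x * k)) has_derivative (%v. Re (deriv f x * v * k))) (at x)" if "x : S" for x
   using holomorphic_derivI[OF Suc.prems assms that, THEN has_field_derivative_imp_has_derivative]
   by (intro bounded_linear.has_derivative[OF bounded_linear_Re] has_derivative_mult_left)
  show "times_differentiable_on n (%x. Re (deriv f x * v * k)) S" for v using Suc.IH[OF holomorphic_deriv[OF Suc.prems assms], of "v * k"] by (simp add: mult.assoc)
 qed
qed

lemma one_plus_norm2_pos: "0 < 1 + (cmod z)^2" by (simp add: add_pos_nonneg)

lemma has_derivative_cmod2: "((%z. (cmod z)^2) has_derivative (%v. 2 * Re (z * cnj v))) (at z)" proof -
 have "((%z. (Re z)^2 + (Im z)^2) has_derivative (%v. 2 * Re (z * cnj v))) (at z)"
  by (rule has_derivative_eq_rhs[OF has_derivative_add[OF has_derivative_power[OF has_derivative_Re] has_derivative_power[OF has_derivative_Im]]], rule has_derivative_ident, rule has_derivative_ident)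
   (simp add: fun_eq_iff)
 thus ?thesis by (simp add: cmod_power2)
qed

lemma has_derivative_fs_density:
 "((%z. inverse (1 + (cmod z)^2)) has_derivative (%v. - 2 * Re (z * cnj v) * (inverse (1 + (cmod z)^2) * inverse (1 + (cmod z)^2)))) (at z)" proof -
 have "1 + (cmod z)^2 ~= 0" using one_plus_norm2_pos[of z] by linarith
 thus ?thesis
  by (intro has_derivative_eq_rhs[OF Deriv.has_derivative_inverse[OF _ has_derivative_add[OF has_derivative_const has_derivative_cmod2]]]) (simp_all add: fun_eq_iff algebra_simps)
qed

lemma has_derivative_fs_potential: "((%z. ln (1 + (cmod z)^2)) has_derivative (%v. 2 * Re (z * cnj v) * inverse (1 + (cmod z)^2))) (at z)"
 by (rule has_derivative_eq_rhs[OF has_derivative_ln[OF one_plus_norm2_pos has_derivative_add[OF has_derivative_const has_derivative_cmod2]]])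
  (simp add: fun_eq_iff divide_inverse)

text \<open>A directional derivative is a linear function times the square of the density itself, so
  the induction closes.\<close>

lemma times_differentiable_on_fs_density: "times_differentiable_on n (%z. inverse (1 + (cmod z)^2)) UNIV" proof (induction n)
 case 0
 have "1 + (cmod z)^2 ~= 0" for z using one_plus_norm2_pos[of z] by linarith
 thus ?case by (auto intro!: continuous_intros)
next
 case (Suc n)
 have "times_differentiable_on n (%x. Re ((- 2 * x) * cnj v)) UNIV" for v by (intro times_differentiable_on_Re_holomorphic holomorphic_intros) simp
 hence "times_differentiable_on n (%x. - 2 * Re (x * cnj v)) UNIV" for v by (simp add: mult.assoc)
 thus ?case by (intro times_differentiable_on_SucI[OF open_UNIV has_derivative_fs_density]
   times_differentiable_on_mult[OF open_UNIV _ times_differentiable_on_mult[OF open_UNIV Suc.IH Suc.IH]])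
qed

lemma times_differentiable_on_subset: "times_differentiable_on n f T ==> S <= T ==> times_differentiable_on n f S"
 by (induction n arbitrary: f) (auto intro: continuous_on_subset)

context limit_functional begin

text \<open>ln (1 + |z|^2) plus twice the potential of \<open>Lam\<close>, divided by 2 pi. Off F
  the potential is harmonic, so the complex Hessian is exactly the Fubini-Study coefficient; total
  mass 1 cancels the growth at infinity. The pairs (1, - w) and (- w, 1) for b and B give the
  expressions in the two charts.\<close>

definition strict_pot :: "(complex => complex) => (complex => complex) => complex => real" where
 "strict_pot b B z = (ln (1 + (cmod z)^2) + 2 * Re (Lam (%w. of_real (- ln (cmod (b w * z + B w)))))) / (2 * pi)"

lemma strict_pot_smooth:
 fixes b B :: "complex => complex" assumes b: "continuous_on F b" and B: "continuous_on F B" and S: "open S" "!!z w. z : S ==> w : F ==> b w * z + B w ~= 0"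
  and p: "!!z. z : S ==> p (param c z) = strict_pot b B z" shows "smooth_on (p \<circ> param c) S" "z : S ==> i_ddbar p c z = fubini_study c z" proof -
 let ?U = "%z. Re (Lam (%w. of_real (- ln (cmod (b w * z + B w)))))"
 define f where "f z = Lam (%w. b w / (b w * z + B w))" for z
 have f: "f holomorphic_on S" unfolding f_def[abs_def] by (rule holomorphic_Lam_quotient[OF b B b S(2)])
 have U: "(?U has_derivative (%h. Re (- f z * h))) (at z)" if "z : S" for z unfolding f_def using S(2)[OF that] by (intro has_derivative_Lam_log b B) blast
 define D where "D z v = (2 * Re (z * cnj v) * inverse (1 + (cmod z)^2) + 2 * Re (- f z * v)) / (2 * pi)" for z v
 have D: "(strict_pot b B has_derivative D z) (at z)" if "z : S" for z unfolding strict_pot_def[abs_def] D_def[abs_def] divide_inverse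
  by (intro has_derivative_mult_left has_derivative_add has_derivative_fs_potential has_derivative_mult_right U that)
 have cong: "smooth_on (p \<circ> param c) S = smooth_on (strict_pot b B) S" using p by (intro smooth_on_cong[OF S(1)]) simp
 have "times_differentiable_on (Suc n) (strict_pot b B) S" for n proof (rule times_differentiable_on_SucI[OF S(1) D])
  fix v
  have 1: "times_differentiable_on n (%x. Re (x * cnj v * (1 / pi))) S" for n
   using times_differentiable_on_Re_holomorphic[OF S(1), of "%x. x" n "cnj v * (1 / pi)"] by (simp add: mult.assoc)
  have 2: "times_differentiable_on n (%x. Re (- f x * (v * (1 / pi)))) S" for n by (intro times_differentiable_on_Re_holomorphic[OF S(1)] holomorphic_intros f)
  have "D x v = Re (x * cnj v * (1 / pi)) * inverse (1 + (cmod x)^2) + Re (- f x * (v * (1 / pi)))" for x proof -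
   have "(2 * X * q + 2 * Y) / (2 * pi) = X / pi * q + Y / pi" for X Y q :: real by (simp add: field_simps)
   moreover have "Re (u * complex_of_real (1 / pi)) = Re u / pi" for u by simp
   ultimately show ?thesis unfolding D_def mult.assoc[symmetric] by metis
  qed
  thus "times_differentiable_on n (%x. D x v) S" by (simp only:) (intro times_differentiable_on_add[OF S(1)] times_differentiable_on_mult[OF S(1)] 1 2
    times_differentiable_on_subset[OF times_differentiable_on_fs_density], simp)
 qed
 hence "smooth_on (strict_pot b B) S" unfolding smooth_on_def using times_differentiable_on_SucD by blast
 thus "smooth_on (p \<circ> param c) S" using cong by simp
 assume z: "z : S"
 let ?q = "%z. inverse (1 + (cmod z)^2)"
 define g where "g = deriv f z"
 have fd: "(f has_derivative (%h. g * h)) (at z)" using holomorphic_derivI[OF f S(1) z] by (simp add: has_field_derivative_def g_def)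
 define A where "A v h = ((2 * Re (z * cnj v) * (- 2 * Re (z * cnj h) * (?q z * ?q z)) + 2 * Re (h * cnj v) * ?q z) + 2 * Re (- (g * h) * v)) / (2 * pi)" for v h
 have A: "((%x. D x v) has_derivative A v) (at z)" for v unfolding D_def[abs_def] A_def[abs_def] divide_inverse
  by (intro has_derivative_mult_left has_derivative_add has_derivative_mult has_derivative_fs_density has_derivative_mult_right
    bounded_linear.has_derivative[OF bounded_linear_Re] has_derivative_minus fd has_derivative_ident)
 have "i_ddbar p c z = (A 1 1 + A \<i> \<i>) / 4" proof (rule i_ddbar_eqI[OF S(1) z _ A A])
  fix x assume x: "x : S"
  show "((%u. p (param c u)) has_derivative D x) (at x)" by (rule has_derivative_transform_within_open[OF D[OF x] S(1) x]) (simp add: p)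
 qed
 also have "A 1 1 + A \<i> \<i> = (4 * ?q z - 4 * ((Re z)^2 + (Im z)^2) * (?q z)^2) / (2 * pi)" unfolding A_def add_divide_distrib[symmetric]
  by (rule arg_cong[where f = "%x. x / (2 * pi)"]) (simp add: power2_eq_square algebra_simps)
 also have "(Re z)^2 + (Im z)^2 = (1 + (cmod z)^2) - 1" by (simp add: cmod_power2)
 also have "4 * ?q z - 4 * ((1 + (cmod z)^2) - 1) * (?q z)^2 = 4 * (?q z)^2" proof -
  have "t ~= 0 ==> 4 * inverse t - 4 * (t - 1) * (inverse t)^2 = 4 * (inverse t)^2" for t :: real by (simp add: field_simps power2_eq_square)
  thus ?thesis using one_plus_norm2_pos[of z] by (metis less_irrefl)
 qed
 also have "4 * (?q z)^2 / (2 * pi) / 4 = fubini_study c z" proof -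
  have "4 * (inverse t)^2 / (2 * pi) / 4 = 1 / (2 * pi * t^2)" for t :: real by (cases "t = 0") (simp_all add: divide_simps power2_eq_square)
  thus ?thesis by (simp only: fubini_study_def)
 qed
 finally show "i_ddbar p c z = fubini_study c z" .
qed

text \<open>In the first chart the potential lies between - ln of the largest distance to F and M,
  the latter by \<open>potential_le\<close>. Near infinity the second chart is used, where 1 - w / z
  has modulus between 1/2 and 3/2.\<close>

lemma strict_pot_bounded: assumes "z ~: F" shows "cmod z <= R ==> \<bar>strict_pot (%_. 1) (%w. - w) z\<bar> <= R^2 + 2 * (\<bar>M\<bar> + (R + cmod a + 1))"
  and "2 * cmod a + 2 <= cmod z ==> \<bar>strict_pot (%w. - w) (%_. 1) (inverse z)\<bar> <= 3" proof -
 have div: "\<bar>x / (2 * pi)\<bar> <= C" if "\<bar>x\<bar> <= C" for x C :: real proof -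
  have "\<bar>x / (2 * pi)\<bar> = \<bar>x\<bar> / (2 * pi)" by simp
  also have "... <= \<bar>x\<bar>" using pi_gt3 by (simp add: divide_le_eq mult_le_cancel_left1)
  finally show ?thesis using that by linarith
 qed
 have gen: "\<bar>l + 2 * u\<bar> <= B + 2 * (N + T)" if "0 <= l" "l <= B" "u <= N" "- T <= u" "0 <= T" "0 <= N" for l u B N T :: real using that by (simp add: abs_le_iff)
 have F_norm: "cmod w <= cmod a + 1/4" if "w : F" for w using F_sub that norm_triangle_ineq2[of w a] by (force simp: dist_norm norm_minus_commute)
 { assume z: "cmod z <= R"
  let ?T = "R + cmod a + 1"
  have T: "0 <= R" using z norm_ge_zero[of z] by linarith
  hence T: "1 <= ?T" by simp
  let ?u = "%w. complex_of_real (- ln (cmod (z - w)))"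
  have nz: "!!w. w : F ==> cmod (z - w) ~= 0" using assms by auto
  have b: "bounded (?u ` F)" by (intro bounded_continuous continuous_intros) (use nz in auto)
  have up: "Re (Lam ?u) <= M" by (rule potential_le[OF assms])
  have "Re (Lam (%w. - ?u w)) <= ln ?T" proof (rule Lam_Re_le)
   show "bounded ((%w. - ?u w) ` F)" using bounded_linear_image[OF b bounded_linear_minus[OF bounded_linear_ident]] by (simp only: image_image)
   have "(\<Sum>w\<in>P n. m n w * Re (- ?u w)) <= ln ?T" for n proof -
    have "(\<Sum>w\<in>P n. m n w * Re (- ?u w)) <= (\<Sum>w\<in>P n. m n w * ln ?T)" proof (intro sum_mono mult_left_mono m_nonneg)
     fix w assume "w : P n"
     hence w: "w : F" using P_sub by blast
     have "cmod (z - w) <= ?T" using norm_triangle_ineq4[of z w] z F_norm[OF w] by linarith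
     thus "Re (- ?u w) <= ln ?T" using nz[OF w] ln_mono[of "cmod (z - w)" ?T] by simp
    qed
    also have "... = ln ?T" using m_sum[of n] by (simp flip: sum_distrib_right)
    finally show ?thesis .
   qed
   thus "\<forall>\<^sub>F n in sequentially. (\<Sum>w\<in>P n. m n w * Re (- ?u w)) <= ln ?T" by simp
  qed
  moreover have "ln ?T <= ?T" using ln_le_minus_one[of ?T] T by linarith
  ultimately have lo: "- ?T <= Re (Lam ?u)" using Lam_mult[OF b, of "-1"] by simp
  have "0 <= ln (1 + (cmod z)^2)" by (intro ln_ge_zero) simp
  moreover have "ln (1 + (cmod z)^2) <= R^2" using ln_le_minus_one[OF one_plus_norm2_pos, of z] power_mono[OF z norm_ge_zero, of 2] by linarith
  moreover have eq: "strict_pot (%_. 1) (%w. - w) z = (ln (1 + (cmod z)^2) + 2 * Re (Lam ?u)) / (2 * pi)" by (simp add: strict_pot_def)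
  ultimately show "\<bar>strict_pot (%_. 1) (%w. - w) z\<bar> <= R^2 + 2 * (\<bar>M\<bar> + ?T)" unfolding eq using up lo T by (intro div gen order_trans[OF up abs_ge_self]) simp_all }
 { assume z: "2 * cmod a + 2 <= cmod z"
  let ?z = "inverse z"
  have "0 < cmod z" using z norm_ge_zero[of a] by linarith
  let ?u = "%w. complex_of_real (- ln (cmod (- w * ?z + 1)))"
  have "cmod (Lam ?u) <= 1" proof (rule Lam_norm_le)
   fix w assume "w : F"
   have "cmod (w * ?z) = cmod w / cmod z" by (simp add: norm_mult norm_inverse divide_inverse)
   also have "... <= 1/2" using F_norm[OF `w : F`] z `0 < cmod z` by (simp add: divide_le_eq)
   finally have h: "cmod (w * ?z) <= 1/2" .
   have 1: "1/2 <= cmod (- w * ?z + 1)" using norm_triangle_ineq2[of 1 "w * ?z"] h by simp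
   have 2: "cmod (- w * ?z + 1) <= 3/2" using norm_triangle_ineq4[of 1 "w * ?z"] h by simp
   have "ln (cmod (- w * ?z + 1)) <= 1" using ln_le_minus_one[of "cmod (- w * ?z + 1)"] 1 2 by linarith
   moreover have "- 1 <= ln (cmod (- w * ?z + 1))" proof -
    have "- 1 <= ln (1/2::real)" using ln_2_less_1 by (simp add: ln_div)
    also have "... <= ln (cmod (- w * ?z + 1))" by (rule ln_mono[OF 1]) simp
    finally show ?thesis .
   qed
   ultimately show "cmod (?u w) <= 1" unfolding norm_of_real by simp
  qed
  hence "\<bar>Re (Lam ?u)\<bar> <= 1" using abs_Re_le_cmod[of "Lam ?u"] by linarith
  moreover have "0 <= ln (1 + (cmod ?z)^2)" by (intro ln_ge_zero) simp
  moreover have "ln (1 + (cmod ?z)^2) <= 1" proof -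
   have "1 <= cmod z" using z norm_ge_zero[of a] by linarith
   hence "cmod ?z <= 1" by (simp add: norm_inverse inverse_le_1_iff)
   hence "(cmod ?z)^2 <= 1" by (simp add: power_le_one)
   thus ?thesis using ln_le_minus_one[OF one_plus_norm2_pos, of ?z] by linarith
  qed
  ultimately show "\<bar>strict_pot (%w. - w) (%_. 1) ?z\<bar> <= 3" unfolding strict_pot_def by (intro div) linarith }
qed

text \<open>From |z - w| = |z| |1 - w / z| and total mass 1 the potentials differ by - ln |z|, which
  is compensated by ln (1 + |z|^2) = ln (1 + |1/z|^2) + 2 ln |z|.\<close>

lemma strict_pot_inverse: assumes "z ~: F" "z ~= 0" shows "strict_pot (%_. 1) (%w. - w) z = strict_pot (%w. - w) (%_. 1) (inverse z)" proof -
 let ?u = "%w. complex_of_real (- ln (cmod (- w * inverse z + 1)))"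
 have nz: "- w * inverse z + 1 ~= 0" if "w : F" for w using assms that by (auto simp: field_simps)
 have b: "bounded (?u ` F)" by (intro bounded_continuous continuous_intros) (use nz in auto)
 have "Lam (%w. ?u w + of_real (- ln (cmod z))) = Lam (%w. complex_of_real (- ln (cmod (1 * z + - w))))" proof (rule Lam_cong[OF bounded_plus_comp[OF b]])
  fix w assume w: "w : F"
  have "1 * z + - w = (- w * inverse z + 1) * z" using assms(2) by (simp add: field_simps)
  hence "ln (cmod (1 * z + - w)) = ln (cmod (- w * inverse z + 1)) + ln (cmod z)" using nz[OF w] assms(2) by (simp only: norm_mult) (simp add: ln_mult)
  thus "?u w + of_real (- ln (cmod z)) = complex_of_real (- ln (cmod (1 * z + - w)))" by (simp only: minus_add_distrib of_real_add)
 qed (simp add: image_constant_conv)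
 moreover have "Lam (%w. ?u w + of_real (- ln (cmod z))) = Lam ?u + of_real (- ln (cmod z))" by (subst Lam_add[OF b]) (simp_all add: image_constant_conv Lam_const)
 moreover have "ln (1 + (cmod (inverse z))^2) = ln (1 + (cmod z)^2) - 2 * ln (cmod z)" proof -
  have "1 + (cmod (inverse z))^2 = (1 + (cmod z)^2) / (cmod z)^2" proof -
   have "t ~= 0 ==> 1 + (inverse t)^2 = (1 + t^2) / t^2" for t :: real by (simp add: field_simps)
   thus ?thesis using assms(2) by (simp only: norm_inverse) simp
  qed
  thus ?thesis using assms(2) one_plus_norm2_pos[of z] by (simp add: ln_div ln_realpow)
 qed
 ultimately show ?thesis unfolding strict_pot_def by simp
qed

end

lemma not_cap_zero_strictly_subharmonic: assumes F: "compact F" "F ~= {}" "F <= cball a (1/4)" and n: "~ cap_zero F"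
 obtains p where "bounded (p ` (- param c ` F))" "sphere_smooth_on p (- param c ` F)" "!!d z. param d z ~: param c ` F ==> i_ddbar p d z = fubini_study d z" proof -
 obtain M P m X Lam where "limit_functional F a M P m X Lam" by (rule limit_functional_exists[OF F n])
 then interpret limit_functional F a M P m X Lam .
 let ?g1 = "strict_pot (%_. 1) (%w. - w)" and ?g2 = "strict_pot (%w. - w) (%_. 1)"
 let ?c' = "opp c"
 define p where "p x = (if x = param ?c' 0 then ?g2 0 else ?g1 (inv_into UNIV (param c) x))" for x
 have p1: "p (param c z) = ?g1 z" for z proof -
  have "param c z ~= param ?c' 0" using param_other_0[of c] by (metis rangeI)
  thus ?thesis by (simp add: p_def inv_into_f_f[OF inj_param])
 qed
 have in_iff: "(param c z : param c ` F) = (z : F)" for z using inj_param[of c] by (auto dest: injD)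
 have p2: "p (param ?c' z) = ?g2 z" if "param ?c' z ~: param c ` F" for z proof (cases "z = 0")
  case True thus ?thesis by (simp add: p_def)
 next
  case False
  hence e: "param ?c' z = param c (inverse z)" by (rule param_other)
  hence "inverse z ~: F" using that in_iff by simp
  thus ?thesis using strict_pot_inverse[of "inverse z"] False by (simp add: e p1)
 qed
 have nz2: "- w * z + 1 ~= 0" if "param ?c' z ~: param c ` F" "w : F" for z w
 proof
  assume e: "- w * z + 1 = 0"
  hence "z ~= 0" by auto
  hence "w = inverse z" using e by (simp add: field_simps)
  hence "param ?c' z = param c w" using param_other[OF `z ~= 0`, of c] by simp
  thus False using that by blast
 qed
 have S1: "param c -` (- param c ` F) = - F" using in_iff by blast
 have o1: "open (- F)" using compact_F compact_imp_closed by blast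
 let ?S2 = "param ?c' -` (- param c ` F)"
 have o2: "open ?S2" proof -
  have "sopen (- param c ` F)" using image_compactin[OF _ continuous_map_param, of F c] compact_F sphere_compact_iff by simp
  thus ?thesis by (simp add: openin_sphere_iff)
 qed
 note s1 = strict_pot_smooth[OF continuous_on_const continuous_on_minus[OF continuous_on_id] o1 _ p1]
 note s2 = strict_pot_smooth[OF continuous_on_minus[OF continuous_on_id] continuous_on_const o2 _ p2, OF nz2]
 have sm1: "smooth_on (p \<circ> param c) (- F)" by (rule s1) auto
 have sm2: "smooth_on (p \<circ> param ?c') ?S2" by (rule s2) auto
 have dd1: "i_ddbar p c z = fubini_study c z" if "z ~: F" for z by (rule s1) (use that in auto)
 have dd2: "i_ddbar p ?c' z = fubini_study ?c' z" if "param ?c' z ~: param c ` F" for z by (rule s2) (use that in auto)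
 show ?thesis proof (rule that)
  show "sphere_smooth_on p (- param c ` F)" unfolding sphere_smooth_on_def
  proof
   fix d show "smooth_on (p \<circ> param d) (param d -` (- param c ` F))" using chart_cases[of d c] sm1 sm2 S1 by auto
  qed
  show "i_ddbar p d z = fubini_study d z" if "param d z ~: param c ` F" for d z using chart_cases[of d c] dd1[of z] dd2[of z] that in_iff by auto
  let ?R = "2 * cmod a + 2"
  let ?B = "max (max (?R^2 + 2 * (\<bar>M\<bar> + (?R + cmod a + 1))) 3) \<bar>?g2 0\<bar>"
  have "\<bar>p x\<bar> <= ?B" if x: "x ~: param c ` F" for x proof (cases "x = param ?c' 0")
   case True thus ?thesis by (simp add: p_def)
  next
   case False
   then obtain z where z: "x = param c z" using in_range_param by blast
   have zF: "z ~: F" using x z in_iff by simp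
   show ?thesis proof (cases "cmod z <= ?R")
    case True
    thus ?thesis using strict_pot_bounded(1)[OF zF True] by (simp add: z p1)
   next
    case 2: False
    hence "z ~= 0" using norm_ge_zero[of a] by auto
    have "\<bar>p x\<bar> <= 3" using strict_pot_bounded(2)[OF zF] strict_pot_inverse[OF zF `z ~= 0`] 2 by (simp add: z p1)
    also have "3 <= ?B" by (rule max.coboundedI1, rule max.coboundedI2) simp
    finally show ?thesis .
   qed
  qed
  thus "bounded (p ` (- param c ` F))" unfolding bounded_iff by auto
 qed
qed

section \<open>Line bundles on the sphere\<close>

lemma holomorphic_on_locally: assumes "!!z. z : S ==> \<exists>T. open T & z : T & f holomorphic_on T" shows "f holomorphic_on S" unfolding holomorphic_on_def
proof
 fix z assume "z : S"
 then obtain T where "open T" "z : T" "f holomorphic_on T" using assms by blast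
 hence "f field_differentiable at z" by (metis holomorphic_on_imp_differentiable_at)
 thus "f field_differentiable (at z within S)" by (rule field_differentiable_at_within)
qed

text \<open>Inside the range of one chart the other coordinate is its inverse and nowhere 0, so one
  chart decides.\<close>

lemma sphere_holomorphic_on_chartI: assumes D: "D <= range (param c)" "sopen D" and f: "(f \<circ> param c) holomorphic_on (param c -` D)"
 shows "sphere_holomorphic_on f D" unfolding sphere_holomorphic_on_def
proof
 fix d
 show "(f \<circ> param d) holomorphic_on param d -` D" proof (cases "d = c")
  case False
  hence d: "d = opp c" using chart_cases by metis
  have o: "open (param d -` D)" using D(2) openin_sphere_iff by blast
  have nz: "z ~= 0" if "z : param d -` D" for z using that D(1) param_other_0[of c] by (auto simp: d)
  have eq: "param c (inverse z) = param d z" if "z : param d -` D" for z using param_other[OF nz[OF that], of c] by (simp add: d)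
  have "((f \<circ> param c) \<circ> inverse) holomorphic_on param d -` D" proof (rule holomorphic_on_compose_gen[OF _ f])
   show "inverse holomorphic_on param d -` D" using nz by (intro holomorphic_intros) auto
   show "inverse ` (param d -` D) <= param c -` D" proof (rule image_subsetI)
    fix z assume z: "z : param d -` D"
    thus "inverse z : param c -` D" using eq[OF z] by simp
   qed
  qed
  thus ?thesis by (rule holomorphic_transform) (simp add: eq)
 qed (use f in simp)
qed

lemma sphere_holomorphic_on_subset: "sphere_holomorphic_on f D ==> D' <= D ==> sphere_holomorphic_on f D'"
 unfolding sphere_holomorphic_on_def by (meson holomorphic_on_subset vimage_mono)

lemma sphere_holomorphic_on_mult: "sphere_holomorphic_on f D ==> sphere_holomorphic_on g D ==> sphere_holomorphic_on (%x. f x * g x) D"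
 unfolding sphere_holomorphic_on_def comp_def by (intro allI holomorphic_on_mult) simp_all

lemma sphere_holomorphic_on_cong: "(!!x. x : D ==> f x = g x) ==> sphere_holomorphic_on f D \<longleftrightarrow> sphere_holomorphic_on g D"
 unfolding sphere_holomorphic_on_def by (metis (mono_tags, lifting) comp_apply holomorphic_cong vimageE)

context holomorphic_line_bundle begin

abbreviation fib :: "sphere => 'e set" where "fib x \<equiv> carrier (fibre L x)"

abbreviation smul where "smul == fib_smult L"

definition hol_sec :: "sphere set => (sphere => 'e) => bool" where "hol_sec D s = ((\<forall>x\<in>D. s x : fib x) & (\<forall>(U, t)\<in>trivs L. sphere_holomorphic_on (t \<circ> s) (U Int D)))"

definition frame :: "sphere set => (sphere => 'e) => bool" where "frame D e = (sopen D & hol_sec D e & (\<forall>x\<in>D. e x ~= fib_zero L x))"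

definition ratio :: "'e => 'e => complex" where "ratio a b = (THE k. a = smul k b)"

lemma hol_secI: assumes "!!x. x : D ==> s x : fib x" "!!U t. (U, t) : trivs L ==> sphere_holomorphic_on (%x. t (s x)) (U Int D)" shows "hol_sec D s"
 unfolding hol_sec_def comp_def using assms by (intro conjI ballI) (simp_all add: split_beta)

lemma hol_secD: assumes "hol_sec D s" shows "x : D ==> s x : fib x" "(U, t) : trivs L ==> sphere_holomorphic_on (%x. t (s x)) (U Int D)" proof -
 show "x : D ==> s x : fib x" using assms by (simp add: hol_sec_def)
 have "\<forall>p\<in>trivs L. sphere_holomorphic_on (%x. snd p (s x)) (fst p Int D)" using assms by (simp add: hol_sec_def comp_def split_beta)
 thus "(U, t) : trivs L ==> sphere_holomorphic_on (%x. t (s x)) (U Int D)" by force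
qed

lemma frameD: assumes "frame D e" shows "sopen D" "hol_sec D e" "x : D ==> e x : fib x" "x : D ==> e x ~= fib_zero L x"
 using assms hol_secD(1)[of D e x] by (simp_all add: frame_def)

lemma triv_at: obtains U t where "(U, t) : trivs L" "x : U" proof -
 have "x : (\<Union>(U, t)\<in>trivs L. U)" unfolding trivs_cover by (rule UNIV_I)
 thus ?thesis using that by auto
qed

lemma smult_in: "a : fib x ==> smul k a : fib x" proof -
 interpret vectorspace class_ring "fibre L x" by (rule fibre_vectorspace)
 show "a : fib x ==> smul k a : fib x" using smult_closed[of k a] by (simp add: fibre_def class_ring_simps)
qed

lemma zero_in: "fib_zero L x : fib x" proof -
 interpret vectorspace class_ring "fibre L x" by (rule fibre_vectorspace)
 show ?thesis using M.zero_closed by (simp add: fibre_def)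
qed

lemma add_in: "a : fib x ==> b : fib x ==> fib_add L a b : fib x" proof -
 interpret vectorspace class_ring "fibre L x" by (rule fibre_vectorspace)
 show "a : fib x ==> b : fib x ==> fib_add L a b : fib x" using M.add.m_closed[of a b] by (simp add: fibre_def)
qed

lemma triv_inj: "(U, t) : trivs L ==> x : U ==> a : fib x ==> b : fib x ==> t a = t b ==> a = b" using triv_bij[of U t x] by (meson bij_betw_imp_inj_on inj_onD)

lemma triv_zero: assumes "(U, t) : trivs L" "x : U" shows "t (fib_zero L x) = 0" proof -
 interpret vectorspace class_ring "fibre L x" by (rule fibre_vectorspace)
 have "fib_add L (fib_zero L x) (fib_zero L x) = fib_zero L x" using M.l_zero[OF M.zero_closed] by (simp add: fibre_def)
 thus ?thesis using triv_add[OF assms zero_in zero_in] by simp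
qed

lemma triv_eq_0_iff: "(U, t) : trivs L ==> x : U ==> a : fib x ==> t a = 0 \<longleftrightarrow> a = fib_zero L x" using triv_zero triv_inj zero_in by metis

lemma ratio_triv: assumes t: "(U, T) : trivs L" "x : U" and a: "a : fib x" and b: "b : fib x" "b ~= fib_zero L x"
 shows "ratio a b = T a / T b" "smul (ratio a b) b = a" proof -
 have nz: "T b ~= 0" using triv_eq_0_iff[OF t b(1)] b(2) by simp
 have *: "(a = smul k b) = (k = T a / T b)" for k using triv_inj[OF t a smult_in[OF b(1)], of k] triv_smult[OF t b(1), of k] nz by (auto simp: field_simps)
 show 1: "ratio a b = T a / T b" unfolding ratio_def * by simp
 show "smul (ratio a b) b = a" using *[of "ratio a b"] 1 by simp
qed

lemma ratio_smult: assumes "a : fib x" "b : fib x" "b ~= fib_zero L x" shows "smul (ratio a b) b = a" using triv_at[of x] ratio_triv(2)[OF _ _ assms] by metis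

lemma ratio_unique: assumes "b : fib x" "b ~= fib_zero L x" shows "ratio (smul k b) b = k" proof -
 obtain U T where t: "(U, T) : trivs L" "x : U" by (rule triv_at)
 thus ?thesis using ratio_triv(1)[OF t smult_in[OF assms(1)] assms] triv_smult[OF t assms(1)] triv_eq_0_iff[OF t assms(1)] assms(2) by simp
qed

lemma smult_eq_zero_iff: assumes "b : fib x" shows "(smul k b = fib_zero L x) = (k = 0 \<or> b = fib_zero L x)" proof -
 obtain U T where t: "(U, T) : trivs L" "x : U" by (rule triv_at)
 show ?thesis using triv_eq_0_iff[OF t smult_in[OF assms], of k] triv_smult[OF t assms, of k] triv_eq_0_iff[OF t assms] by auto
qed

lemma smult_smult: assumes "b : fib x" shows "smul k (smul l b) = smul (k * l) b" proof -
 obtain U T where t: "(U, T) : trivs L" "x : U" by (rule triv_at)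
 show ?thesis by (rule triv_inj[OF t]) (simp_all add: smult_in assms triv_smult[OF t])
qed

lemma smult_one: "b : fib x ==> smul 1 b = b" proof -
 assume b: "b : fib x"
 obtain U T where t: "(U, T) : trivs L" "x : U" by (rule triv_at)
 show ?thesis by (rule triv_inj[OF t]) (simp_all add: smult_in b triv_smult[OF t])
qed

lemma hol_sec_ratio: assumes e: "frame D e" and s: "hol_sec D s" shows "sphere_holomorphic_on (%x. ratio (s x) (e x)) D" unfolding sphere_holomorphic_on_def
proof
 fix c show "((%x. ratio (s x) (e x)) \<circ> param c) holomorphic_on param c -` D" proof (rule holomorphic_on_locally)
  fix z assume z: "z : param c -` D"
  obtain U b where t: "(U, b) : trivs L" "param c z : U" by (rule triv_at)
  have "sopen (U Int D)" using triv_open[OF t(1)] e by (simp add: frame_def openin_Int)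
  hence o: "open (param c -` (U Int D))" using openin_sphere_iff by blast
  have h: "(b \<circ> s \<circ> param c) holomorphic_on param c -` (U Int D)" "(b \<circ> e \<circ> param c) holomorphic_on param c -` (U Int D)"
   using hol_secD(2)[OF s t(1)] hol_secD(2)[OF frameD(2)[OF e] t(1)] by (simp_all add: sphere_holomorphic_on_def comp_def)
  have nz: "b (e x) ~= 0" if "x : U Int D" for x using that frameD(3,4)[OF e] triv_eq_0_iff[OF t(1), of x "e x"] by simp
  have "(%z. (b \<circ> s \<circ> param c) z / (b \<circ> e \<circ> param c) z) holomorphic_on param c -` (U Int D)" using nz by (intro holomorphic_on_divide h) simp
  hence "((%x. ratio (s x) (e x)) \<circ> param c) holomorphic_on param c -` (U Int D)" proof (rule holomorphic_transform)
   fix w assume "w : param c -` (U Int D)"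
   thus "(b \<circ> s \<circ> param c) w / (b \<circ> e \<circ> param c) w = ((%x. ratio (s x) (e x)) \<circ> param c) w"
    using ratio_triv(1)[OF t(1), of "param c w" "s (param c w)" "e (param c w)"] frameD(3,4)[OF e] hol_secD(1)[OF s] by simp
  qed
  thus "\<exists>T. open T & z : T & ((%x. ratio (s x) (e x)) \<circ> param c) holomorphic_on T" using o z t(2) by (intro exI[of _ "param c -` (U Int D)"]) auto
 qed
qed

lemma hol_sec_smult: assumes s: "hol_sec D s" and g: "sphere_holomorphic_on g D" shows "hol_sec D (%x. smul (g x) (s x))" proof (rule hol_secI)
 show "smul (g x) (s x) : fib x" if "x : D" for x by (rule smult_in[OF hol_secD(1)[OF s that]])
 fix U T assume t: "(U, T) : trivs L"
 have "sphere_holomorphic_on (%x. g x * T (s x)) (U Int D)" by (intro sphere_holomorphic_on_mult sphere_holomorphic_on_subset[OF g] hol_secD(2)[OF s t]) simp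
 thus "sphere_holomorphic_on (%x. T (smul (g x) (s x))) (U Int D)" proof (rule sphere_holomorphic_on_cong[THEN iffD1, rotated])
  fix x assume "x : U Int D"
  thus "g x * T (s x) = T (smul (g x) (s x))" using triv_smult[OF t, of x "s x" "g x"] hol_secD(1)[OF s, of x] by simp
 qed
qed

lemma frame_smult: assumes e: "frame D e" and g: "sphere_holomorphic_on g D" "!!x. x : D ==> g x ~= 0" shows "frame D (%x. smul (g x) (e x))"
 using hol_sec_smult[OF frameD(2)[OF e] g(1)] frameD[OF e] g(2) smult_eq_zero_iff by (simp add: frame_def)

lemma hol_sec_subset: "hol_sec D s ==> D' <= D ==> hol_sec D' s" by (rule hol_secI) (auto intro: hol_secD(1) sphere_holomorphic_on_subset[OF hol_secD(2)])

lemma frame_subset: "frame D e ==> D' <= D ==> sopen D' ==> frame D' e" unfolding frame_def using hol_sec_subset by blast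

lemma hol_sec_glue: assumes D: "sopen D1" "sopen D2" and s: "hol_sec D1 s1" "hol_sec D2 s2" and eq: "!!x. x : D1 ==> x : D2 ==> s1 x = s2 x"
 shows "hol_sec (D1 Un D2) (%x. if x : D1 then s1 x else s2 x)" proof (rule hol_secI)
 let ?s = "%x. if x : D1 then s1 x else s2 x"
 show "?s x : fib x" if "x : D1 Un D2" for x using that s hol_secD(1) by auto
 fix U T assume t: "(U, T) : trivs L"
 show "sphere_holomorphic_on (%x. T (?s x)) (U Int (D1 Un D2))" unfolding sphere_holomorphic_on_def
 proof
  fix c
  let ?f = "(%x. T (?s x)) \<circ> param c"
  have h: "((%x. T (s1 x)) \<circ> param c) holomorphic_on param c -` (U Int D1)" "((%x. T (s2 x)) \<circ> param c) holomorphic_on param c -` (U Int D2)"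
   using hol_secD(2)[OF s(1) t] hol_secD(2)[OF s(2) t] by (simp_all add: sphere_holomorphic_on_def)
  have o: "open (param c -` (U Int D1))" "open (param c -` (U Int D2))"
   using openin_Int[OF triv_open[OF t] D(1)] openin_Int[OF triv_open[OF t] D(2)] unfolding openin_sphere_iff by simp_all
  have h1: "?f holomorphic_on param c -` (U Int D1)" by (rule holomorphic_transform[OF h(1)]) simp
  have h2: "?f holomorphic_on param c -` (U Int D2)" by (rule holomorphic_transform[OF h(2)]) (use eq in auto)
  have "?f holomorphic_on (param c -` (U Int D1)) Un (param c -` (U Int D2))" by (rule holomorphic_on_Un[OF h1 h2 o])
  thus "?f holomorphic_on param c -` (U Int (D1 Un D2))" by (simp only: Int_Un_distrib vimage_Un)
 qed
qed

lemma frame_glue: assumes "frame D1 e1" "frame D2 e2" and "!!x. x : D1 ==> x : D2 ==> e1 x = e2 x" shows "frame (D1 Un D2) (%x. if x : D1 then e1 x else e2 x)"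
 using hol_sec_glue[of D1 D2 e1 e2] assms by (auto simp: frame_def)

lemma frame_triv: assumes t: "(U, T) : trivs L" shows "frame U (%x. inv_into (fib x) T 1)" proof -
 let ?e = "%x. inv_into (fib x) T 1"
 have e: "?e x : fib x" "T (?e x) = 1" if "x : U" for x using triv_bij[OF t that] by (auto simp: bij_betw_def inv_into_into f_inv_into_f)
 have "hol_sec U ?e" proof (rule hol_secI)
  show "?e x : fib x" if "x : U" for x by (rule e(1)[OF that])
  fix V s assume t': "(V, s) : trivs L"
  obtain g where g: "sphere_holomorphic_on g (U Int V)" "\<forall>x\<in>U Int V. \<forall>e\<in>fib x. s e = g x * T e" using triv_transition[OF t t'] by (elim exE conjE)
  have eq: "g x = s (?e x)" if "x : U Int V" for x using g(2)[rule_format, OF that, of "?e x"] e[of x] that by simp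
  show "sphere_holomorphic_on (%x. s (?e x)) (V Int U)" unfolding Int_commute[of V U] by (rule sphere_holomorphic_on_cong[THEN iffD1, OF eq g(1)])
 qed
 moreover have "?e x ~= fib_zero L x" if "x : U" for x using e[OF that] triv_zero[OF t that] by force
 ultimately show ?thesis using triv_open[OF t] by (simp add: frame_def)
qed

end

section \<open>Cauchy integrals and multiplicative splittings\<close>

lemma cauchy_path_integral_holomorphic: assumes y: "valid_path y" "!!t. t : {0..1} ==> cmod (vector_derivative y (at t)) <= B" and f: "continuous_on (path_image y) f"
  and int: "!!g. continuous_on (path_image y) g ==> g contour_integrable_on y" shows "(%z. contour_integral y (%w. f w / (w - z))) holomorphic_on - path_image y" proof -
 have i: "((%u. f u / (u - w) ^ 1) has_contour_integral contour_integral y (%u. f u / (u - w))) y" if "w : UNIV - path_image y" for w proof -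
  have "continuous_on (path_image y) (%u. f u / (u - w))" by (intro continuous_intros f) (use that in auto)
  thus ?thesis using has_contour_integral_integral[OF int] by simp
 qed
 show ?thesis unfolding holomorphic_on_def field_differentiable_def
 proof
  fix z assume "z : - path_image y"
  hence "z : UNIV - path_image y" by simp
  from Cauchy_next_derivative(2)[OF f y(2) i _ open_UNIV y(1) this]
  show "\<exists>f'. ((%z. contour_integral y (%w. f w / (w - z))) has_field_derivative f') (at z within - path_image y)" by (blast intro: has_field_derivative_at_within)
 qed
qed

lemma cauchy_linepath_integral_holomorphic: assumes "continuous_on (closed_segment p q) f"
 shows "(%z. contour_integral (linepath p q) (%w. f w / (w - z))) holomorphic_on - closed_segment p q"
 using cauchy_path_integral_holomorphic[of "linepath p q" "cmod (q - p)" f] assms by (simp add: contour_integrable_continuous_linepath)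

lemma cauchy_circlepath_integral_holomorphic: assumes "continuous_on (sphere 0 r) f" "0 <= r"
 shows "(%z. contour_integral (circlepath 0 r) (%w. f w / (w - z))) holomorphic_on - sphere 0 r" proof -
 have "cmod (vector_derivative (circlepath 0 r) (at t)) <= 2 * pi * r" for t using assms(2) by (simp add: vector_derivative_circlepath norm_mult)
 thus ?thesis using cauchy_path_integral_holomorphic[of "circlepath 0 r" "2 * pi * r" f] assms by (simp add: contour_integrable_continuous_circlepath)
qed

text \<open>Cousin's splitting: the Cauchy integral over the boundary of a rectangle around the segment is cut
  into the integral over the left side and the one over the other three sides.\<close>

lemma cousin_splitting:
 fixes x0 c d :: real assumes V: "open V" "!!y. c <= y ==> y <= d ==> Complex x0 y : V" and g: "g holomorphic_on V" "!!z. z : V ==> g z ~= 0" and cd: "c <= d"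
 obtains e g1 g2 where "e > 0" "g1 holomorphic_on {z. Re z < x0 + e & c - e < Im z & Im z < d + e}" "g2 holomorphic_on {z. x0 - e < Re z & c - e < Im z & Im z < d + e}"
  "!!z. g1 z ~= 0" "!!z. g2 z ~= 0" "!!z. [|x0 - e < Re z; Re z < x0 + e; c - e < Im z; Im z < d + e|] ==> z : V & g z * g1 z = g2 z" proof -
 let ?S = "closed_segment (Complex x0 c) (Complex x0 d)"
 have "?S <= V"
 proof
  fix z assume "z : ?S"
  hence "Re z = x0" "c <= Im z" "Im z <= d" using cd by (auto simp: closed_segment_same_Re closed_segment_eq_real_ivl)
  thus "z : V" using V(2)[of "Im z"] by (metis complex.collapse)
 qed
 then obtain t where t: "t > 0" "(\<Union>x\<in>?S. ball x t) <= V" using compact_subset_open_imp_ball_epsilon_subset[OF compact_segment V(1)] by blast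
 define C where "C = box (Complex (x0 - t/2) (c - t/2)) (Complex (x0 + t/2) (d + t/2))"
 define e where "e = t / 8"
 have e: "e > 0" using t by (simp add: e_def)
 have C_iff: "(z : C) = (x0 - t/2 < Re z & Re z < x0 + t/2 & c - t/2 < Im z & Im z < d + t/2)" for z by (auto simp: C_def in_box_complex_iff)
 have CV: "C <= V"
 proof
  fix z assume z: "z : C"
  define w where "w = Complex x0 (max c (min d (Im z)))"
  have "w : ?S" using cd by (auto simp: w_def closed_segment_same_Re closed_segment_eq_real_ivl)
  moreover have "dist w z < t" proof -
   have "\<bar>Re (w - z)\<bar> < t/2" "\<bar>Im (w - z)\<bar> < t/2" using z cd t(1) unfolding abs_less_iff C_iff by (auto simp: w_def max_def min_def)
   thus ?thesis using cmod_le[of "w - z"] by (simp add: dist_norm)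
  qed
  ultimately show "z : V" using t(2) by (meson UN_I mem_ball subsetD)
 qed
 have C: "convex C" "open C" by (simp_all add: C_def open_box)
 have "Complex x0 c : C" using cd t by (simp add: C_iff)
 \<comment> \<open>On the convex box C the function has a logarithm, which turns the multiplicative
   problem into an additive one.\<close>
 then obtain f where f: "f holomorphic_on C" "!!z. z : C ==> exp (f z) = g z" using holomorphic_logarithm_exists[OF C holomorphic_on_subset[OF g(1) CV]] g(2) CV by blast
 define a1 where "a1 = Complex (x0 - 2 * e) (c - 2 * e)"
 define a2 where "a2 = Complex (x0 + 2 * e) (c - 2 * e)"
 define a3 where "a3 = Complex (x0 + 2 * e) (d + 2 * e)"
 define a4 where "a4 = Complex (x0 - 2 * e) (d + 2 * e)"
 have rect: "rectpath a1 a3 = linepath a1 a2 +++ linepath a2 a3 +++ linepath a3 a4 +++ linepath a4 a1" by (simp add: rectpath_def a1_def a2_def a3_def a4_def Let_def)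
 have le: "Re a1 <= Re a3" "Im a1 <= Im a3" using e cd by (simp_all add: a1_def a3_def)
 have aC: "a1 : C" "a2 : C" "a3 : C" "a4 : C" using t(1) cd by (auto simp: C_iff a1_def a2_def a3_def a4_def e_def)
 have cf: "continuous_on (closed_segment p q) f" if "p : C" "q : C" for p q
  using hol_cont[OF f(1)] closed_segment_subset[OF that C(1)] continuous_on_subset by blast
 define G where "G p q z = contour_integral (linepath p q) (%w. f w / (w - z)) / (2 * pi * \<i>)" for p q z
 have G: "G p q holomorphic_on - closed_segment p q" if "p : C" "q : C" for p q
  unfolding G_def by (intro holomorphic_intros cauchy_linepath_integral_holomorphic cf that) simp
 have sum: "f z = G a1 a2 z + G a2 a3 z + G a3 a4 z + G a4 a1 z" if z: "z : box a1 a3" for z proof -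
  have nin: "z ~: path_image (rectpath a1 a3)" using path_image_rectpath_inter_box[OF le] z by blast
  have segs: "path_image (rectpath a1 a3) = closed_segment a1 a2 Un closed_segment a2 a3 Un closed_segment a3 a4 Un closed_segment a4 a1"
   unfolding rect by (simp add: path_image_join Un_assoc)
  have i: "(%w. f w / (w - z)) contour_integrable_on linepath p q" if "p : C" "q : C" "z ~: closed_segment p q" for p q
   using that by (intro contour_integrable_continuous_linepath continuous_intros cf) auto
  have i': "(%w. f w / (w - z)) contour_integrable_on linepath a1 a2" "(%w. f w / (w - z)) contour_integrable_on linepath a2 a3"
   "(%w. f w / (w - z)) contour_integrable_on linepath a3 a4" "(%w. f w / (w - z)) contour_integrable_on linepath a4 a1" using i aC nin segs by auto
  have sub: "path_image (rectpath a1 a3) <= C - {z}" using nin closed_segment_subset[OF _ _ C(1)] aC unfolding segs by blast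
  have "cbox a1 a3 <= C" using t(1) by (auto simp: C_iff in_cbox_complex_iff a1_def a3_def e_def)
  hence zC: "z : interior C" using z box_subset_cbox[of a1 a3] C(2) by (auto simp: interior_open)
  have "((%w. f w / (w - z)) has_contour_integral of_real (2 * pi) * \<i> * winding_number (rectpath a1 a3) z * f z) (rectpath a1 a3)"
   by (rule Cauchy_integral_formula_convex_simple[OF C(1) f(1) zC _ sub]) auto
  hence "contour_integral (rectpath a1 a3) (%w. f w / (w - z)) = 2 * pi * \<i> * f z" using winding_number_rectpath[OF z] contour_integral_unique by force
  moreover have "contour_integral (rectpath a1 a3) (%w. f w / (w - z)) = 2 * pi * \<i> * (G a1 a2 z + G a2 a3 z + G a3 a4 z + G a4 a1 z)"
   unfolding rect G_def by (simp add: contour_integral_join i' contour_integrable_joinI distrib_left)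
  ultimately show ?thesis by simp
 qed
 \<comment> \<open>The left side of the rectangle has real part x0 - 2 e, so its integral is
   holomorphic to the right of x0 - e; the other three sides stay away from the half strip to the
   left of x0 + e.\<close>
 show ?thesis proof (rule that[of e "%z. exp (- (G a1 a2 z + G a2 a3 z + G a3 a4 z))" "%z. exp (G a4 a1 z)"])
  have s: "z ~: closed_segment a1 a2" "z ~: closed_segment a3 a4" if "c - e < Im z" "Im z < d + e" for z
   using that e by (auto simp: closed_segment_same_Im a1_def a2_def a3_def a4_def)
  have s': "z ~: closed_segment a2 a3" if "Re z < x0 + e" for z using that e by (auto simp: closed_segment_same_Re a2_def a3_def)
  have s'': "z ~: closed_segment a4 a1" if "x0 - e < Re z" for z using that e by (auto simp: closed_segment_same_Re a4_def a1_def)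
  show "(%z. exp (- (G a1 a2 z + G a2 a3 z + G a3 a4 z))) holomorphic_on {z. Re z < x0 + e & c - e < Im z & Im z < d + e}"
   using s s' by (intro holomorphic_intros holomorphic_on_subset[OF G] aC) auto
  show "(%z. exp (G a4 a1 z)) holomorphic_on {z. x0 - e < Re z & c - e < Im z & Im z < d + e}"
   using s'' by (intro holomorphic_intros holomorphic_on_subset[OF G] aC) auto
  fix z assume z: "x0 - e < Re z" "Re z < x0 + e" "c - e < Im z" "Im z < d + e"
  have zC: "z : C" using z t(1) by (auto simp: C_iff e_def)
  have "z : box a1 a3" using z e by (auto simp: in_box_complex_iff a1_def a3_def)
  hence "exp (f z) * exp (- (G a1 a2 z + G a2 a3 z + G a3 a4 z)) = exp (G a4 a1 z)" unfolding exp_add[symmetric] by (simp add: sum)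
  thus "z : V & g z * exp (- (G a1 a2 z + G a2 a3 z + G a3 a4 z)) = exp (G a4 a1 z)" using f(2)[OF zC] CV zC by auto
 qed (use e in simp_all)
qed

lemma less_norm_inverse_iff: "w ~= 0 ==> 0 < s ==> s < cmod (inverse w) \<longleftrightarrow> cmod w < 1 / s" unfolding norm_inverse by (simp add: field_simps)

lemma norm_inverse_less_iff: "w ~= 0 ==> 0 < s ==> cmod (inverse w) < 1 / s \<longleftrightarrow> s < cmod w" unfolding norm_inverse by (simp add: field_simps)

lemma annulus_circle_integral_eq: assumes "f holomorphic_on {z. r < cmod z & cmod z < R}" "r < s" "s <= t" "t < R" "0 < s"
 shows "contour_integral (circlepath 0 s) f = contour_integral (circlepath 0 t) f" proof (rule Cauchy_theorem_homotopic_loops)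
 let ?A = "{z. r < cmod z & cmod z < R}"
 show "open ?A" by (intro open_Collect_conj open_Collect_less continuous_intros)
 show "homotopic_loops ?A (circlepath 0 s) (circlepath 0 t)" proof (rule homotopic_loops_linear)
  fix x :: real
  show "closed_segment (circlepath 0 s x) (circlepath 0 t x) <= ?A"
  proof
   fix z assume "z : closed_segment (circlepath 0 s x) (circlepath 0 t x)"
   then obtain u where u: "0 <= u" "u <= 1" "z = (1 - u) *\<^sub>R circlepath 0 s x + u *\<^sub>R circlepath 0 t x" by (auto simp: in_segment)
   hence "z = of_real (s + u * (t - s)) * exp (2 * of_real pi * \<i> * of_real x)" by (simp add: circlepath scaleR_conv_of_real algebra_simps)
   hence "cmod z = \<bar>s + u * (t - s)\<bar>" by (simp add: norm_mult del: of_real_add of_real_mult of_real_diff)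
   moreover have "s <= s + u * (t - s)" "s + u * (t - s) <= t" using u assms mult_left_le_one_le[of "t - s" u] by auto
   ultimately show "z : ?A" using assms by simp
  qed
 qed auto
qed (use assms in auto)

text \<open>The difference quotient of h at z is holomorphic on the annulus, so its integrals over
  both circles agree. The kernel 1 / (w - z) integrates to 2 pi i over the outer circle and to 0
  over the inner one.\<close>

lemma annulus_laurent_splitting: assumes h: "h holomorphic_on {z. r < cmod z & cmod z < R}" and st: "r < s" "s < t" "t < R" "0 < s" and z: "s < cmod z" "cmod z < t"
 shows "2 * pi * \<i> * h z = contour_integral (circlepath 0 t) (%w. h w / (w - z)) - contour_integral (circlepath 0 s) (%w. h w / (w - z))" proof -
 let ?A = "{z. r < cmod z & cmod z < R}"
 have oA: "open ?A" by (intro open_Collect_conj open_Collect_less continuous_intros)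
 define q where "q w = (if w = z then deriv h z else (h w - h z) / (w - z))" for w
 have q: "q holomorphic_on ?A" unfolding q_def[abs_def] by (rule pole_lemma_open[OF h oA])
 have ch: "continuous_on (sphere 0 rh) h" if "r < rh" "rh < R" for rh using hol_cont[OF h] by (rule continuous_on_subset) (use that in auto)
 have split: "contour_integral (circlepath 0 rh) q = contour_integral (circlepath 0 rh) (%w. h w / (w - z)) - h z * contour_integral (circlepath 0 rh) (%w. 1 / (w - z))"
  if rh: "r < rh" "rh < R" "0 < rh" "cmod z ~= rh" for rh proof -
  have nz: "w - z ~= 0" if "w : path_image (circlepath 0 rh)" for w using that rh by auto
  have i1: "(%w. h w / (w - z)) contour_integrable_on circlepath 0 rh"
   using ch[OF rh(1,2)] rh(3) nz by (intro contour_integrable_continuous_circlepath continuous_intros) auto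
  have i2: "(%w. 1 / (w - z)) contour_integrable_on circlepath 0 rh" using nz by (intro contour_integrable_continuous_circlepath continuous_intros) auto
  have "contour_integral (circlepath 0 rh) q = contour_integral (circlepath 0 rh) (%w. h w / (w - z) - h z * (1 / (w - z)))"
   by (rule contour_integral_eq) (use nz in "auto simp: q_def diff_divide_distrib")
  thus ?thesis by (simp only: contour_integral_diff[OF i1 contour_integrable_lmul[OF i2]] contour_integral_lmul[OF i2])
 qed
 have "winding_number (circlepath 0 t) z = 1" by (rule winding_number_circlepath) (use z in simp)
 hence t1: "contour_integral (circlepath 0 t) (%w. 1 / (w - z)) = 2 * pi * \<i>" using winding_number_valid_path[of "circlepath 0 t" z] z st by simp
 have "winding_number (circlepath 0 s) z = 0" by (rule winding_number_zero_outside[of _ "cball 0 s"]) (use z st in auto)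
 hence s1: "contour_integral (circlepath 0 s) (%w. 1 / (w - z)) = 0" using winding_number_valid_path[of "circlepath 0 s" z] z st by simp
 show ?thesis using annulus_circle_integral_eq[OF q st(1) _ st(3,4)] split[of t] split[of s] z st s1 t1 by (simp add: algebra_simps)
qed

text \<open>Birkhoff factorisation in rank one. With d the winding number, g'/g - d/z has integral 0
  over circles; its Laurent splitting h0 - h1 has primitives in z and in 1/z, and exponentials of
  these, together with z^d, reproduce g up to a constant.\<close>

lemma annulus_factorisation: assumes g: "g holomorphic_on {z. r < cmod z & cmod z < R}" and nz: "!!z. r < cmod z ==> cmod z < R ==> g z ~= 0"
  and st: "r < s" "s < t" "t < R" "0 < s" obtains d u v where "u holomorphic_on ball 0 t" "v holomorphic_on ball 0 (1 / s)" "!!z. u z ~= 0" "!!z. v z ~= (0::complex)"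
  "!!z. s < cmod z ==> cmod z < t ==> g z = z powi d * u z * v (inverse z)" proof -
 let ?A = "{z. r < cmod z & cmod z < R}"
 have oA: "open ?A" by (intro open_Collect_conj open_Collect_less continuous_intros)
 define q where "q z = deriv g z / g z" for z
 have q: "q holomorphic_on ?A" unfolding q_def[abs_def] using nz by (intro holomorphic_on_divide holomorphic_deriv g oA) auto
 have pis: "path_image (circlepath 0 s) <= ?A" using st by auto
 define d' where "d' = winding_number (g \<circ> circlepath 0 s) 0"
 have 0: "0 ~: path_image (g \<circ> circlepath 0 s)" using pis nz by (auto simp: path_image_compose)
 have vp: "valid_path (g \<circ> circlepath 0 s)" by (rule valid_path_compose_holomorphic[OF _ g oA pis]) simp
 have "d' : \<int>" unfolding d'_def by (rule integer_winding_number_eq[THEN iffD2]) (use 0 vp in "simp_all add: valid_path_imp_path pathstart_compose pathfinish_compose")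
 then obtain d where d: "d' = of_int d" using Ints_cases by blast
 have iq: "contour_integral (circlepath 0 s) q = 2 * pi * \<i> * of_int d" proof -
  have "contour_integral (g \<circ> circlepath 0 s) (%w. 1 / (w - 0)) = contour_integral (circlepath 0 s) (%w. deriv g w * (1 / (g w - 0)))"
   by (rule contour_integral_comp_analyticW[of g ?A]) (use g oA pis in "auto simp: analytic_on_open")
  thus ?thesis using winding_number_valid_path[OF vp 0] by (simp add: q_def[abs_def] d'_def[symmetric] d)
 qed
 have A0: "z ~= 0" if "s <= cmod z" for z using that st by auto
 define A' where "A' = {z. max r (s/2) < cmod z & cmod z < R}"
 have A'A: "A' <= ?A" "!!z. z : A' ==> z ~= 0" using st by (auto simp: A'_def)
 define h where "h z = q z - of_int d / z" for z
 have h: "h holomorphic_on A'" unfolding h_def[abs_def] using A'A by (intro holomorphic_intros holomorphic_on_subset[OF q]) auto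
 have st': "max r (s/2) < s" using st by simp
 have ch: "continuous_on (sphere 0 rh) h" if "s <= rh" "rh < R" for rh
  using hol_cont[OF h] by (rule continuous_on_subset) (use that st in "auto simp: A'_def")
 have ih: "contour_integral (circlepath 0 s) h = 0" proof -
  have i1: "q contour_integrable_on circlepath 0 s"
   using hol_cont[OF q] continuous_on_subset pis by (intro contour_integrable_continuous_circlepath) blast
  have i2: "(%w. 1 / w) contour_integrable_on circlepath 0 s" using st by (intro contour_integrable_continuous_circlepath continuous_intros) auto
  have "contour_integral (circlepath 0 s) (%w. 1 / w) = 2 * pi * \<i>"
   using winding_number_valid_path[of "circlepath 0 s" 0] winding_number_circlepath_centre[of s 0] st by simp
  moreover have "h = (%w. q w - of_int d * (1 / w))" by (simp add: h_def[abs_def])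
  ultimately show ?thesis by (simp only: contour_integral_diff[OF i1 contour_integrable_lmul[OF i2]] contour_integral_lmul[OF i2] iq) simp
 qed
 define h0 where "h0 z = contour_integral (circlepath 0 t) (%w. h w / (w - z)) / (2 * pi * \<i>)" for z
 define h1 where "h1 z = contour_integral (circlepath 0 s) (%w. h w / (w - z)) / (2 * pi * \<i>)" for z
 have h0: "h0 holomorphic_on ball 0 t" unfolding h0_def[abs_def] using st
  by (intro holomorphic_intros holomorphic_on_subset[OF cauchy_circlepath_integral_holomorphic] ch) auto
 have h1: "h1 holomorphic_on - cball 0 s" unfolding h1_def[abs_def] using st
  by (intro holomorphic_intros holomorphic_on_subset[OF cauchy_circlepath_integral_holomorphic] ch) auto
 have split: "h z = h0 z - h1 z" if "s < cmod z" "cmod z < t" for z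
  using annulus_laurent_splitting[OF h[unfolded A'_def] st' st(2-4) that] by (simp add: h0_def h1_def field_simps)
 \<comment> \<open>The division by w^2 makes - h1 the derivative of a primitive of k taken at
   1/z.\<close>
 define k where "k w = h1 (inverse w) / w^2" for w
 have "(h1 \<circ> inverse) holomorphic_on ball 0 (1 / s) - {0}" proof (rule holomorphic_on_compose_gen[OF _ h1])
  show "inverse holomorphic_on ball 0 (1 / s) - {0}" by (intro holomorphic_intros) auto
  show "inverse ` (ball 0 (1 / s) - {0}) <= - cball (0::complex) s" proof (rule image_subsetI)
   fix w :: complex assume "w : ball 0 (1 / s) - {0}"
   thus "inverse w : - cball 0 s" using st less_norm_inverse_iff[of w s] by simp
  qed
 qed
 hence k: "k holomorphic_on ball 0 (1 / s) - {0}" unfolding k_def[abs_def] comp_def by (intro holomorphic_intros) auto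
 obtain B where B: "\<forall>w\<in>h ` sphere 0 s. cmod w <= B" using compact_imp_bounded[OF compact_continuous_image[OF ch[of s] compact_sphere]] st unfolding bounded_iff by auto
 have B0: "0 <= B" proof -
  have "of_real s : sphere (0::complex) s" using st by simp
  thus ?thesis using B norm_ge_zero order_trans by blast
 qed
 have kb: "cmod (k w) <= 2 * B * s * s" if w: "w ~= 0" "cmod w < 1 / (2 * s)" for w proof -
  define z where "z = inverse w"
  have z: "2 * s < cmod z" "z ~= 0" using w st less_norm_inverse_iff[of w "2 * s"] by (simp_all add: z_def)
  have nz': "u - z ~= 0" if "u : sphere 0 s" for u using that z st by auto
  have i1: "(%u. h u / (u - z)) contour_integrable_on circlepath 0 s" using ch[of s] st nz' by (intro contour_integrable_continuous_circlepath continuous_intros) auto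
  have i2: "h contour_integrable_on circlepath 0 s" using ch[of s] st by (intro contour_integrable_continuous_circlepath) auto
  \<comment> \<open>Adding h / z, whose integral is 0, improves the decay of the kernel from 1/|z|
    to 1/|z|^2, which keeps k bounded near 0.\<close>
  have "((%u. h u / (u - z) + 1 / z * h u) has_contour_integral contour_integral (circlepath 0 s) (%u. h u / (u - z)) + 1 / z * 0) (circlepath 0 s)"
   using has_contour_integral_integral[OF i2] ih by (intro has_contour_integral_add has_contour_integral_lmul has_contour_integral_integral i1) simp
  moreover have "cmod (h u / (u - z) + 1 / z * h u) <= 2 * B * s / (cmod z)^2" if "cmod (u - 0) = s" for u proof -
   have us: "u : sphere 0 s" using that by simp
   have "h u / (u - z) + 1 / z * h u = h u * u / (z * (u - z))" using nz'[OF us] z(2) by (simp add: field_simps)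
   hence "cmod (h u / (u - z) + 1 / z * h u) = cmod (h u) * s / (cmod z * cmod (u - z))" using that by (simp add: norm_mult norm_divide)
   also have "... <= B * s / (cmod z * (cmod z / 2))" proof (intro frac_le mult_right_mono mult_left_mono)
    show "cmod (h u) <= B" using B us by blast
    show "cmod z / 2 <= cmod (u - z)" using norm_triangle_ineq2[of z u] z that by (simp add: norm_minus_commute)
   qed (use st B0 z in auto)
   finally show ?thesis by (simp add: power2_eq_square mult_ac)
  qed
  moreover have "0 <= 2 * B * s / (cmod z)^2" using B0 st by simp
  ultimately have "cmod (contour_integral (circlepath 0 s) (%u. h u / (u - z)) + 1 / z * 0) <= 2 * B * s / (cmod z)^2 * (2 * pi * s)"
   using has_contour_integral_bound_circlepath[OF _ _ st(4)] by blast
  hence "cmod (h1 z) <= 2 * B * s * s / (cmod z)^2" by (simp add: h1_def norm_divide norm_mult field_simps)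
  moreover have "cmod (k w) = cmod (h1 z) * (cmod z)^2" by (simp add: k_def z_def norm_divide norm_power norm_inverse field_simps)
  ultimately show ?thesis using z(2) by (simp add: field_simps)
 qed
 have "\<forall>\<^sub>F w in at 0. cmod (k w) <= 2 * B * s * s" unfolding eventually_at using kb st by (intro exI[of _ "1 / (2 * s)"]) simp
 then obtain k' where k': "k' holomorphic_on ball 0 (1 / s)" "\<forall>w\<in>ball 0 (1 / s) - {0}. k' w = k w"
  using holomorphic_on_extend_bounded[OF k] st by (auto simp: interior_open)
 obtain H0 where H0: "!!x. x : ball 0 t ==> (H0 has_field_derivative h0 x) (at x)"
  using holomorphic_convex_primitive'[OF convex_ball open_ball h0] by (metis at_within_open open_ball)
 obtain H1 where H1: "!!x. x : ball 0 (1 / s) ==> (H1 has_field_derivative k' x) (at x)"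
  using holomorphic_convex_primitive'[OF convex_ball open_ball k'(1)] by (metis at_within_open open_ball)
 define E where "E z = z powi d * exp (H0 z + H1 (inverse z))" for z
 let ?B = "{z. s < cmod z & cmod z < t}"
 have E: "(E has_field_derivative E z * q z) (at z)" "E z ~= 0" if z: "z : ?B" for z proof -
  have z0: "z ~= 0" using z A0 by simp
  have iz: "inverse z : ball 0 (1 / s) - {0}" using z st z0 norm_inverse_less_iff[of z s] by simp
  have dH1: "((%z. H1 (inverse z)) has_field_derivative k' (inverse z) * - (inverse z ^ 2)) (at z)"
   using DERIV_chain2[OF H1 DERIV_inverse[OF z0]] iz by (simp add: numeral_2_eq_2)
  have "k' (inverse z) * - (inverse z ^ 2) = - h1 z" using k'(2)[rule_format, OF iz] z0 by (simp add: k_def)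
  hence "((%z. H0 z + H1 (inverse z)) has_field_derivative h0 z + - h1 z) (at z)" using DERIV_add[OF H0 dH1] z by simp
  hence dd: "((%z. H0 z + H1 (inverse z)) has_field_derivative h z) (at z)" using split[of z] z by simp
  have dp: "((%z. z powi d) has_field_derivative of_int d * z powi (d - 1) * 1) (at z)" by (rule DERIV_power_int[OF DERIV_ident disjI2[OF z0]])
  have "(E has_field_derivative of_int d * z powi (d - 1) * 1 * exp (H0 z + H1 (inverse z)) + exp (H0 z + H1 (inverse z)) * h z * z powi d) (at z)"
   unfolding E_def[abs_def] by (rule DERIV_mult[OF dp DERIV_chain2[OF DERIV_exp dd]])
  moreover have "of_int d * z powi (d - 1) * 1 * exp (H0 z + H1 (inverse z)) + exp (H0 z + H1 (inverse z)) * h z * z powi d = E z * q z" proof -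
   have "z powi (d - 1) = z powi d / z" using z0 by (simp add: power_int_diff)
   thus ?thesis by (simp add: E_def h_def algebra_simps)
  qed
  ultimately show "(E has_field_derivative E z * q z) (at z)" by simp
  show "E z ~= 0" using z0 by (simp add: E_def)
 qed
 have BA: "z : ?A" if "z : ?B" for z using that st by auto
 \<comment> \<open>E has the logarithmic derivative q of g, so the quotient is constant on the
   connected ring.\<close>
 have der0: "((%z. g z / E z) has_field_derivative 0) (at z)" if z: "z : ?B" for z proof -
  have "(g has_field_derivative deriv g z) (at z)" by (rule holomorphic_derivI[OF g oA BA[OF z]])
  moreover have "deriv g z = g z * q z" using nz[of z] BA[OF z] by (simp add: q_def)
  ultimately have "(g has_field_derivative g z * q z) (at z)" by simp
  from DERIV_divide[OF this E[OF z]] show ?thesis by (simp add: mult_ac)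
 qed
 have "connected ?B" using connected_annulus(1)[of s "0::complex" t] by simp
 moreover have oB: "open ?B" by (intro open_Collect_conj open_Collect_less continuous_intros)
 moreover have "continuous_on ?B (%z. g z / E z)" using der0 DERIV_isCont by (intro continuous_at_imp_continuous_on) blast
 ultimately obtain C where C: "!!z. z : ?B ==> g z / E z = C" using DERIV_zero_connected_constant[of ?B "{}" "%z. g z / E z"] der0 by auto
 define z0 where "z0 = complex_of_real ((s + t) / 2)"
 have "z0 : ?B" unfolding z0_def using st by (simp only: mem_Collect_eq norm_of_real) simp
 hence C0: "C ~= 0" using C[of z0] E(2)[of z0] nz BA by auto
 show ?thesis proof (rule that[of "%z. C * exp (H0 z)" "%z. exp (H1 z)" d])
  have "H0 holomorphic_on ball 0 t" unfolding holomorphic_on_open[OF open_ball] using H0 by blast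
  thus "(%z. C * exp (H0 z)) holomorphic_on ball 0 t" by (intro holomorphic_intros)
  have "H1 holomorphic_on ball 0 (1 / s)" unfolding holomorphic_on_open[OF open_ball] using H1 by blast
  thus "(%z. exp (H1 z)) holomorphic_on ball 0 (1 / s)" by (intro holomorphic_intros)
  fix z :: complex assume "s < cmod z" "cmod z < t"
  hence "g z = C * E z" using C[of z] E(2)[of z] by (simp add: field_simps)
  thus "g z = z powi d * (C * exp (H0 z)) * exp (H1 (inverse z))" by (simp add: E_def exp_add)
 qed (use C0 in simp_all)
qed

definition coord :: "std_chart => sphere => complex" where "coord c x = inv_into UNIV (param c) x"

lemma coord_param [simp]: "coord c (param c z) = z" by (simp add: coord_def inv_into_f_f[OF inj_param])

lemma param_coord: "x : range (param c) ==> param c (coord c x) = x" by (simp add: coord_def f_inv_into_f)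

lemma param_eq_iff [simp]: "(param c z = param c w) = (z = w)" by (rule inj_eq[OF inj_param])

lemma param_in_image_iff [simp]: "(param c z : param c ` S) = (z : S)" by (rule inj_image_mem_iff[OF inj_param])

lemma vimage_param_image [simp]: "param c -` param c ` S = S" by (rule inj_vimage_image_eq[OF inj_param])

section \<open>Frames over the charts\<close>

context holomorphic_line_bundle begin

lemma frame_smult_chart: assumes e: "frame D e" and D: "D <= range (param c)" and f: "f holomorphic_on param c -` D" "!!z. param c z : D ==> f z ~= 0"
 shows "frame D (%x. smul (f (coord c x)) (e x))" proof (rule frame_smult[OF e])
 have "((%x. f (coord c x)) \<circ> param c) holomorphic_on param c -` D" using f(1) by (simp add: comp_def)
 thus "sphere_holomorphic_on (%x. f (coord c x)) D" by (rule sphere_holomorphic_on_chartI[OF D frameD(1)[OF e]])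
 show "f (coord c x) ~= 0" if "x : D" for x using f(2) param_coord[of x c] D that by force
qed

lemma ratio_chart_holomorphic: assumes "frame D e" "hol_sec D s" shows "(%z. ratio (s (param c z)) (e (param c z))) holomorphic_on param c -` D"
 using hol_sec_ratio[OF assms] by (simp add: sphere_holomorphic_on_def comp_def)

lemma ratio_frames_nonzero: assumes "frame D e" "frame D e'" "x : D" shows "ratio (e' x) (e x) ~= 0"
 using ratio_smult[of "e' x" x "e x"] smult_eq_zero_iff[of "e x" x 0] frameD(3,4)[OF assms(1,3)] frameD(3,4)[OF assms(2,3)] by force

text \<open>The frame is asked for on an open neighbourhood of A, so that closed rectangles sharing
  an edge have overlapping frames there.\<close>

definition good :: "std_chart => complex set => bool" where "good c A = (\<exists>S e. A <= S & open S & frame (param c ` S) e)"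

lemma good_locally: obtains S e where "open S" "z : S" "frame (param c ` S) e" proof -
 obtain U T where t: "(U, T) : trivs L" "param c z : U" by (rule triv_at)
 have o: "open (param c -` U)" using triv_open[OF t(1)] openin_sphere_iff by blast
 have "frame (param c ` (param c -` U)) (%x. inv_into (fib x) T 1)" by (rule frame_subset[OF frame_triv[OF t(1)] image_vimage_subset sopen_image[OF o]])
 thus ?thesis using that[of "param c -` U"] o t(2) by simp
qed

text \<open>The factor k rotates the picture: for k = \<i> the real part of z / k is Im z, so the
  joining lemma for left and right neighbours also joins segments lying above each other. Degenerate
  rectangles are segments.\<close>

definition rect :: "complex => real => real => real => real => complex set" where "rect k a b c d = {z. a <= Re (z / k) & Re (z / k) <= b & c <= Im (z / k) & Im (z / k) <= d}"

text \<open>Near the common edge the two frames differ by a nowhere zero holomorphic function, which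
  Cousin's splitting writes as a quotient of functions living on the two sides. Each frame divided
  by its own function agrees with the other on the overlap.\<close>

lemma good_glue_rect: assumes g: "good ch (rect k a b c d)" "good ch (rect k b e c d)" and le: "a <= b" "b <= e" "c <= d" and k: "k ~= 0" shows "good ch (rect k a e c d)"
proof -
 obtain S1 e1 where S1: "rect k a b c d <= S1" "open S1" "frame (param ch ` S1) e1" using g(1) unfolding good_def by blast
 obtain S2 e2 where S2: "rect k b e c d <= S2" "open S2" "frame (param ch ` S2) e2" using g(2) unfolding good_def by blast
 let ?V = "S1 Int S2"
 have oV: "open ?V" using S1 S2 by blast
 have f1: "frame (param ch ` ?V) e1" and f2: "frame (param ch ` ?V) e2" by (rule frame_subset[OF S1(3)], use oV sopen_image in auto)
   (rule frame_subset[OF S2(3)], use oV sopen_image in auto)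
 define r where "r z = ratio (e2 (param ch z)) (e1 (param ch z))" for z
 have r: "r holomorphic_on ?V" using ratio_chart_holomorphic[OF f1 frameD(2)[OF f2], of ch] by (simp add: r_def[abs_def])
 have r0: "r z ~= 0" if "z : ?V" for z unfolding r_def using ratio_frames_nonzero[OF f1 f2] that by blast
 let ?W = "(%w. k * w) -` ?V"
 have oW: "open ?W" using oV by (intro open_vimage continuous_intros)
 have hr: "(r \<circ> (%w. k * w)) holomorphic_on ?W" by (rule holomorphic_on_compose_gen[OF _ r]) (auto intro!: holomorphic_intros)
 have pts: "Complex b y : ?W" if "c <= y" "y <= d" for y using S1(1) S2(1) that le k by (auto simp: rect_def subset_iff)
 have nzr: "(r \<circ> (%w. k * w)) z ~= 0" if "z : ?W" for z using r0 that by simp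
 obtain q g1 g2 where q: "q > 0" "g1 holomorphic_on {z. Re z < b + q & c - q < Im z & Im z < d + q}" "g2 holomorphic_on {z. b - q < Re z & c - q < Im z & Im z < d + q}"
  "!!z. g1 z ~= 0" "!!z. g2 z ~= 0" "!!z. [|b - q < Re z; Re z < b + q; c - q < Im z; Im z < d + q|] ==> z : ?W & (r \<circ> (%w. k * w)) z * g1 z = g2 z"
  by (rule cousin_splitting[OF oW pts hr nzr le(3)]) (assumption | rule that)+
 define T1 where "T1 = S1 Int (%z. z / k) -` {z. Re z < b + q & c - q < Im z & Im z < d + q}"
 define T2 where "T2 = S2 Int (%z. z / k) -` {z. b - q < Re z & c - q < Im z & Im z < d + q}"
 have oT: "open T1" "open T2" unfolding T1_def T2_def using S1(2) S2(2) k by (intro open_Int open_vimage open_Collect_conj open_Collect_less continuous_intros; simp)+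
 have h1: "(%z. inverse (g1 (z / k))) holomorphic_on T1" proof -
  have "(g1 \<circ> (%z. z / k)) holomorphic_on T1" by (rule holomorphic_on_compose_gen[OF _ q(2)]) (use k in "auto simp: T1_def intro!: holomorphic_intros")
  thus ?thesis using q(4) by (intro holomorphic_intros) (simp_all add: comp_def)
 qed
 have h2: "(%z. inverse (g2 (z / k))) holomorphic_on T2" proof -
  have "(g2 \<circ> (%z. z / k)) holomorphic_on T2" by (rule holomorphic_on_compose_gen[OF _ q(3)]) (use k in "auto simp: T2_def intro!: holomorphic_intros")
  thus ?thesis using q(5) by (intro holomorphic_intros) (simp_all add: comp_def)
 qed
 have F1: "frame (param ch ` T1) (%x. smul (inverse (g1 (coord ch x / k))) (e1 x))"
  using frame_smult_chart[OF frame_subset[OF S1(3)], of "param ch ` T1" ch "%z. inverse (g1 (z / k))"] h1 q(4) oT sopen_image by (auto simp: T1_def)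
 have F2: "frame (param ch ` T2) (%x. smul (inverse (g2 (coord ch x / k))) (e2 x))"
  using frame_smult_chart[OF frame_subset[OF S2(3)], of "param ch ` T2" ch "%z. inverse (g2 (z / k))"] h2 q(5) oT sopen_image by (auto simp: T2_def)
 have eq: "smul (inverse (g1 (coord ch x / k))) (e1 x) = smul (inverse (g2 (coord ch x / k))) (e2 x)" if x: "x : param ch ` T1" "x : param ch ` T2" for x
 proof -
  obtain z where z: "x = param ch z" "z : T1" "z : T2" using x by auto
  hence zV: "z : ?V" by (simp add: T1_def T2_def)
  have e1: "e1 x : fib x" "e1 x ~= fib_zero L x" using frameD(3,4)[OF f1] zV z(1) by auto
  have e2: "e2 x = smul (r z) (e1 x)" using ratio_smult[OF frameD(3)[OF f2] e1] zV z(1) by (simp add: r_def)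
  have rg: "r z * g1 (z / k) = g2 (z / k)" using q(6)[of "z / k"] z k by (simp add: T1_def T2_def)
  have "inverse (g1 (z / k)) = inverse (g2 (z / k)) * r z" unfolding rg[symmetric] using q(4) r0[OF zV] by (simp add: field_simps)
  thus ?thesis using smult_smult[OF e1(1)] z(1) e2 by simp
 qed
 have "frame (param ch ` (T1 Un T2)) (%x. if x : param ch ` T1 then smul (inverse (g1 (coord ch x / k))) (e1 x) else smul (inverse (g2 (coord ch x / k))) (e2 x))"
  unfolding image_Un by (rule frame_glue[OF F1 F2 eq])
 moreover have "rect k a e c d <= T1 Un T2"
 proof
  fix z assume z: "z : rect k a e c d"
  show "z : T1 Un T2" proof (cases "Re (z / k) <= b")
   case True
   hence "z : S1" using z by (intro subsetD[OF S1(1)]) (simp add: rect_def)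
   thus ?thesis using z True q(1) by (simp add: T1_def rect_def)
  next
   case False
   hence "z : S2" using z by (intro subsetD[OF S2(1)]) (simp add: rect_def)
   thus ?thesis using z False q(1) by (simp add: T2_def rect_def)
  qed
 qed
 ultimately show ?thesis unfolding good_def using oT by blast
qed

text \<open>Bisection: short segments lie in a set with a frame, and adjacent segments can be
  joined. Since Im (z / \<i>) = - Re z, the segment lies on Re z = - x, which explains the
  signs.\<close>

lemma good_vertical: "a <= b ==> good ch (rect \<i> a b x x)" proof (rule Bolzano[where P = "%a b. good ch (rect \<i> a b x x)"])
 fix y :: real
 obtain S e where S: "open S" "Complex (- x) y : S" "frame (param ch ` S) e" by (rule good_locally)
 obtain q where q: "q > 0" "ball (Complex (- x) y) q <= S" using S(1,2) openE by blast
 have "good ch (rect \<i> a b x x)" if "a <= y" "y <= b" "b - a < q" for a b proof -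
  have "rect \<i> a b x x <= ball (Complex (- x) y) q"
  proof
   fix z assume "z : rect \<i> a b x x"
   hence "Re z = - x" "a <= Im z" "Im z <= b" by (auto simp: rect_def)
   hence "\<bar>Re (Complex (- x) y - z)\<bar> + \<bar>Im (Complex (- x) y - z)\<bar> < q" using that by simp
   thus "z : ball (Complex (- x) y) q" using cmod_le[of "Complex (- x) y - z"] by (simp add: dist_norm)
  qed
  thus ?thesis unfolding good_def using S q(2) by blast
 qed
 thus "\<exists>d>0. \<forall>a b. a <= y & y <= b & b - a < d --> good ch (rect \<i> a b x x)" using q(1) by blast
qed (assumption, erule (1) good_glue_rect, simp_all)

text \<open>Bisection in the horizontal direction: a frame near a vertical segment serves, by
  compactness of the segment, for every sufficiently thin rectangle around it.\<close>

lemma good_square: "a <= b ==> c <= d ==> good ch (rect 1 a b c d)" proof (rule Bolzano[where P = "%a b. good ch (rect 1 a b c d)"])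
 fix x :: real
 assume cd: "c <= d"
 obtain S e where S: "rect \<i> c d (- x) (- x) <= S" "open S" "frame (param ch ` S) e" using good_vertical[OF cd, of ch "- x"] unfolding good_def by blast
 let ?T = "closed_segment (Complex x c) (Complex x d)"
 have "?T <= rect \<i> c d (- x) (- x)" using cd by (auto simp: rect_def closed_segment_same_Re closed_segment_eq_real_ivl)
 hence "?T <= S" using S(1) by blast
 then obtain q where q: "q > 0" "(\<Union>z\<in>?T. ball z q) <= S" using compact_subset_open_imp_ball_epsilon_subset[OF compact_segment S(2)] by blast
 have "good ch (rect 1 a b c d)" if ab: "a <= x" "x <= b" "b - a < q" for a b proof -
  have "rect 1 a b c d <= S"
  proof
   fix z assume z: "z : rect 1 a b c d"
   hence "Complex x (Im z) : ?T" using cd by (auto simp: rect_def closed_segment_same_Re closed_segment_eq_real_ivl)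
   moreover have "dist (Complex x (Im z)) z < q" proof -
    have "\<bar>Re (Complex x (Im z) - z)\<bar> + \<bar>Im (Complex x (Im z) - z)\<bar> < q" using z ab by (simp add: rect_def abs_less_iff; linarith)
    thus ?thesis using cmod_le[of "Complex x (Im z) - z"] by (simp add: dist_norm)
   qed
   ultimately show "z : S" using q(2) by (meson UN_I mem_ball subsetD)
  qed
  thus ?thesis unfolding good_def using S(2,3) by (intro exI conjI)
 qed
 thus "\<exists>e>0. \<forall>a b. a <= x & x <= b & b - a < e --> good ch (rect 1 a b c d)" using q(1) by blast
qed (assumption, erule (1) good_glue_rect, simp_all)

lemma openin_sphere_other: "sopen (param c ` {z. s < cmod z})" by (intro sopen_image open_Collect_less continuous_intros)

text \<open>Grothendieck's classification: the bundle is \<open>O(d)\<close> up to the sign convention.\<close>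

lemma global_frames: obtains e0 e1 d where "frame (range (param c)) e0" "frame (range (param (opp c))) e1"
  "!!z. z ~= 0 ==> e0 (param c z) = smul (z powi d) (e1 (param c z))" proof -
 let ?c' = "opp c"
 obtain S1 e1 where S1: "open S1" "0 : S1" "frame (param ?c' ` S1) e1" by (rule good_locally)
 obtain q where q: "q > 0" "ball 0 q <= S1" using S1(1,2) openE by blast
 \<comment> \<open>The frame e1 lives on a disc of radius q about the missing point, which is |z| >
   r in the coordinate c; the ring between r and r + 3 is where both frames are compared.\<close>
 define r where "r = 1 / q"
 have r0: "r > 0" using q by (simp add: r_def)
 let ?s = "r + 1" and ?t = "r + 2" and ?R = "r + 3"
 have "- ?R <= ?R" using r0 by simp
 then obtain S0 e0 where S0: "rect 1 (- ?R) ?R (- ?R) ?R <= S0" "open S0" "frame (param c ` S0) e0"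
  using good_square[of "- ?R" ?R "- ?R" ?R c] unfolding good_def by blast
 have sub0: "z : S0" if "cmod z < ?R" for z using S0(1) that abs_Re_le_cmod[of z] abs_Im_le_cmod[of z] by (auto simp: rect_def subset_iff abs_le_iff)
 have sub1: "param c z : param ?c' ` S1" if "r < cmod z" for z proof -
  have "z ~= 0" using that r0 by auto
  hence "inverse z : ball 0 q" using norm_inverse_less_iff[of z r] that r0 by (simp add: r_def)
  moreover have "param c z = param ?c' (inverse z)" using param_other[of "inverse z" c] `z ~= 0` by simp
  ultimately show ?thesis using q(2) by auto
 qed
 let ?A = "{z. r < cmod z & cmod z < ?R}"
 have oA: "sopen (param c ` ?A)" by (intro sopen_image open_Collect_conj open_Collect_less continuous_intros)
 have f0: "frame (param c ` ?A) e0" by (rule frame_subset[OF S0(3) _ oA]) (use sub0 in auto)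
 have f1: "frame (param c ` ?A) e1" by (rule frame_subset[OF S1(3) _ oA]) (use sub1 in auto)
 define g where "g z = ratio (e0 (param c z)) (e1 (param c z))" for z
 have g: "g holomorphic_on ?A" using ratio_chart_holomorphic[OF f1 frameD(2)[OF f0], of c] by (simp add: g_def[abs_def])
 have g0: "g z ~= 0" if "r < cmod z" "cmod z < ?R" for z unfolding g_def by (rule ratio_frames_nonzero[OF f1 f0]) (use that in auto)
 obtain d u v where uv: "u holomorphic_on ball 0 ?t" "v holomorphic_on ball 0 (1 / ?s)" "!!z. u z ~= 0" "!!z. v z ~= (0::complex)"
  "!!z. ?s < cmod z ==> cmod z < ?t ==> g z = z powi d * u z * v (inverse z)" by (rule annulus_factorisation[OF g g0, of ?s ?t]) (use r0 in simp_all)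
 let ?D0 = "param c ` ball 0 ?t" and ?D1 = "param c ` {z. ?s < cmod z}" and ?D2 = "param ?c' ` ball 0 (1 / ?s)"
 define a0 where "a0 x = smul (inverse (u (coord c x))) (e0 x)" for x
 define b1 where "b1 x = smul (v (coord ?c' x)) (e1 x)" for x
 have fa0: "frame ?D0 a0" unfolding a0_def proof (rule frame_smult_chart[OF frame_subset[OF S0(3)]])
  show "(%z. inverse (u z)) holomorphic_on param c -` ?D0" using uv by (auto intro!: holomorphic_intros)
 qed (use uv sub0 sopen_image in auto)
 have sub2: "?D2 <= param ?c' ` S1" proof -
  have "1 / ?s <= q" using q(1) by (simp add: r_def field_simps)
  thus ?thesis by (intro image_mono order_trans[OF subset_ball q(2)])
 qed
 have fb1: "frame ?D2 b1" unfolding b1_def proof (rule frame_smult_chart[OF frame_subset[OF S1(3) sub2]])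
  show "v holomorphic_on param ?c' -` ?D2" using uv by simp
 qed (use uv sopen_image in auto)
 have D12: "?D1 <= ?D2"
 proof
  fix x assume "x : ?D1"
  then obtain z where z: "x = param c z" "?s < cmod z" by auto
  hence "z ~= 0" using r0 by auto
  hence "inverse z : ball 0 (1 / ?s)" using norm_inverse_less_iff[of z ?s] z r0 by simp
  moreover have "x = param ?c' (inverse z)" using param_other[of "inverse z" c] `z ~= 0` z by simp
  ultimately show "x : ?D2" by blast
 qed
 have fa1: "frame ?D1 (%x. smul (coord c x powi d) (b1 x))" proof (rule frame_smult_chart[OF frame_subset[OF fb1 D12 openin_sphere_other]])
  show "(%z. z powi d) holomorphic_on param c -` ?D1" using r0 by (auto intro!: holomorphic_intros)
 qed (use r0 in auto)
 have a_eq: "a0 x = smul (coord c x powi d) (b1 x)" if x: "x : ?D0" "x : ?D1" for x proof -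
  obtain z where z: "x = param c z" "?s < cmod z" "cmod z < ?t" using x by auto
  hence zA: "x : param c ` ?A" and z0: "z ~= 0" using r0 by auto
  have ex: "e1 x : fib x" "e1 x ~= fib_zero L x" using frameD(3,4)[OF f1 zA] by auto
  have e0: "e0 x = smul (g z) (e1 x)" using ratio_smult[OF frameD(3)[OF f0 zA] ex] by (simp add: g_def z(1))
  have "x = param ?c' (inverse z)" using param_other[of "inverse z" c] z0 z(1) by simp
  hence c': "coord ?c' x = inverse z" by simp
  have "inverse (u z) * g z = z powi d * v (inverse z)" using uv(3)[of z] uv(5)[OF z(2,3)] by simp
  thus ?thesis unfolding a0_def b1_def e0 c' smult_smult[OF ex(1)] by (simp add: z(1))
 qed
 \<comment> \<open>On the ring a0 equals z^d b1, so a0 continues over the whole chart as z^d b1, a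
   frame away from 0. In the same way z^(-d) E continues b1 over the other chart.\<close>
 define E where "E x = (if x : ?D0 then a0 x else smul (coord c x powi d) (b1 x))" for x
 have "?D0 Un ?D1 = range (param c)" by (auto simp flip: image_Un)
 hence fE: "frame (range (param c)) E" using frame_glue[OF fa0 fa1 a_eq] by (simp add: E_def[abs_def])
 have E1: "E x = smul (coord c x powi d) (b1 x)" if "x : ?D1" for x using a_eq that by (auto simp: E_def)
 let ?D3 = "param c ` (- {0})"
 have fE3: "frame ?D3 (%x. smul (coord c x powi (- d)) (E x))" proof (rule frame_smult_chart[OF frame_subset[OF fE]])
  show "(%z. z powi (- d)) holomorphic_on param c -` ?D3" by (auto intro!: holomorphic_intros)
 qed (use sopen_image[of "- {0}" c] in auto)
 have pc: "(param ?c' z : ?D3) = (z ~= 0)" for z proof (cases "z = 0")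
  case True thus ?thesis using param_other_0[of c] by auto
 next
  case False thus ?thesis using param_other[of z c] by simp
 qed
 have e_eq: "smul (coord c x powi (- d)) (E x) = b1 x" if x: "x : ?D3" "x : ?D2" for x proof -
  obtain z where z: "x = param c z" "z ~= 0" using x by auto
  have "x = param ?c' (inverse z)" using param_other[of "inverse z" c] z by simp
  hence "cmod (inverse z) < 1 / ?s" using x by auto
  hence "?s < cmod z" using norm_inverse_less_iff[of z ?s] z r0 by simp
  hence e: "E x = smul (z powi d) (b1 x)" using E1[of x] z by simp
  have "z powi (- d) * z powi d = 1" using z(2) by (simp add: power_int_minus)
  thus ?thesis using smult_smult[OF frameD(3)[OF fb1 x(2)], of "z powi (- d)" "z powi d"] smult_one[OF frameD(3)[OF fb1 x(2)]] z(1) e by simp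
 qed
 define F where "F x = (if x : ?D3 then smul (coord c x powi (- d)) (E x) else b1 x)" for x
 have "?D3 Un ?D2 = range (param ?c')"
 proof
  show "?D3 Un ?D2 <= range (param ?c')"
  proof
   fix x assume "x : ?D3 Un ?D2"
   thus "x : range (param ?c')"
   proof
    assume "x : ?D3"
    then obtain z where "x = param c z" "z ~= 0" by auto
    hence "x = param ?c' (inverse z)" using param_other[of "inverse z" c] by simp
    thus ?thesis by simp
   qed auto
  qed
  show "range (param ?c') <= ?D3 Un ?D2"
  proof
   fix x assume "x : range (param ?c')"
   then obtain z where z: "x = param ?c' z" by auto
   show "x : ?D3 Un ?D2" using pc[of z] r0 z by (cases "z = 0") auto
  qed
 qed
 hence fF: "frame (range (param ?c')) F" using frame_glue[OF fE3 fb1 e_eq] by (simp add: F_def[abs_def])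
 show ?thesis proof (rule that[OF fE fF])
  fix z :: complex assume z: "z ~= 0"
  have "E (param c z) : fib (param c z)" by (rule frameD(3)[OF fE]) simp
  moreover have "z powi d * z powi (- d) = 1" using z by (simp add: power_int_minus)
  ultimately show "E (param c z) = smul (z powi d) (F (param c z))"
   using z smult_smult[of "E (param c z)" "param c z" "z powi d" "z powi (- d)"] smult_one by (simp add: F_def)
 qed
qed

end

section \<open>Bergman spaces\<close>

text \<open>The passage from real^2, where change of variables is expressed by Jacobian
  determinants, to the complex plane.\<close>

definition plane :: "real^2 => complex" where "plane v = Complex (v $ 1) (v $ 2)"

lemma linear_plane: "bounded_linear plane" unfolding linear_conv_bounded_linear[symmetric] by (rule linearI) (simp_all add: plane_def complex_eq_iff)

lemma plane_surj: "plane (vector [Re z, Im z]) = z" by (simp add: plane_def)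

lemma inj_plane: "inj plane" unfolding inj_def plane_def Finite_Cartesian_Product.vec_eq_iff forall_2 by simp

lemma plane_measurable [measurable]: "plane : borel_measurable borel" using linear_plane by (intro borel_measurable_continuous_onI linear_continuous_on)

lemma lborel_distr_plane: "distr lborel borel plane = lborel" proof (rule sym, rule lborel_eqI)
 fix l u :: complex
 assume lu: "!!b. b : Basis ==> l \<bullet> b <= u \<bullet> b"
 have le: "Re l <= Re u" "Im l <= Im u" using lu[of 1] lu[of \<i>] by (auto simp: Basis_complex_def)
 have "plane -` box l u = box (vector [Re l, Im l]) (vector [Re u, Im u])" by (auto simp: in_box_complex_iff mem_box_cart plane_def forall_2)
 hence "emeasure (distr lborel borel plane) (box l u) = emeasure lborel (box (vector [Re l, Im l]) (vector [Re u, Im u]) :: (real^2) set)" by (simp add: emeasure_distr)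
 also have "... = ennreal (\<Prod>b\<in>Basis. (vector [Re u, Im u] - vector [Re l, Im l] :: real^2) \<bullet> b)" proof (rule emeasure_lborel_box)
  fix b :: "real^2" assume "b : Basis"
  then obtain i where "b = axis i 1" by (auto simp: Basis_vec_def)
  thus "(vector [Re l, Im l] :: real^2) \<bullet> b <= vector [Re u, Im u] \<bullet> b" using le exhaust_2[of i] by (auto simp: inner_axis)
 qed
 also have "(\<Prod>b\<in>Basis. (vector [Re u, Im u] - vector [Re l, Im l] :: real^2) \<bullet> b) = (Re u - Re l) * (Im u - Im l)" proof -
  have B: "(Basis :: (real^2) set) = {axis 1 1, axis 2 1}" unfolding Basis_vec_def UNIV_2 by auto
  have "axis 1 1 ~= (axis 2 1 :: real^2)" by (simp add: axis_eq_axis)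
  thus ?thesis unfolding B by (subst prod.insert) (simp_all add: inner_axis)
 qed
 also have "... = (\<Prod>b\<in>Basis. (u - l) \<bullet> b)" by (simp add: Basis_complex_def)
 finally show "emeasure (distr lborel borel plane) (box l u) = ennreal (\<Prod>b\<in>Basis. (u - l) \<bullet> b)" .
qed simp

lemma integrable_plane_iff:
 fixes u :: "complex => real" assumes u: "u : borel_measurable borel" and A: "A : sets borel" and u0: "!!z. 0 <= u z"
 shows "((%v. (Finite_Cartesian_Product.vec (u (plane v)) :: real^1)) absolutely_integrable_on (plane -` A)) = (nnint A u < \<infinity>)" proof -
 have mA: "plane -` A : sets borel" using measurable_sets[OF plane_measurable A] by simp
 have B: "(Basis :: (real^1) set) = {axis 1 1}" unfolding Basis_vec_def UNIV_1 by auto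
 have "((%v. (Finite_Cartesian_Product.vec (u (plane v)) :: real^1)) absolutely_integrable_on (plane -` A)) = ((%v. u (plane v)) absolutely_integrable_on (plane -` A))"
  unfolding absolutely_integrable_componentwise_iff[where f = "%v. Finite_Cartesian_Product.vec (u (plane v))"] B by (simp add: inner_axis)
 also have "(...) = (integrable lborel (%v. indicator (plane -` A) v *\<^sub>R u (plane v)))" unfolding set_integrable_def proof (rule integrable_completion)
  have "(%z. indicator A z *\<^sub>R u z) : borel_measurable borel" using u A by measurable
  from measurable_compose[OF plane_measurable this] show "(%v. indicator (plane -` A) v *\<^sub>R u (plane v)) : borel_measurable lborel" by (simp add: indicator_def)
 qed
 also have "(...) = integrable (distr lborel borel plane) (%z. indicator A z *\<^sub>R u z)" proof -
  have "(%v. indicator (plane -` A) v *\<^sub>R u (plane v)) = (%v. (%z. indicator A z *\<^sub>R u z) (plane v))" by (simp add: fun_eq_iff indicator_def)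
  thus ?thesis using u A by (subst integrable_distr_eq) simp_all
 qed
 also have "(...) = ((\<integral>\<^sup>+z. ennreal (indicator A z *\<^sub>R u z) \<partial>lborel) < \<infinity>)" unfolding lborel_distr_plane using u A u0 by (subst integrable_iff_bounded) simp
 also have "(%z. ennreal (indicator A z *\<^sub>R u z)) = (%z. ennreal (u z) * indicator A z)" by (simp add: fun_eq_iff indicator_def)
 finally show ?thesis .
qed

text \<open>The derivative of inversion at z is multiplication by - 1 / z^2, whose real determinant
  is |z|^-4.\<close>

lemma inverse_change_of_variables:
 fixes u :: "complex => real" assumes u: "u : borel_measurable borel" "!!z. 0 <= u z" and A: "open A" "0 ~: A"
 shows "(nnint A (%z. (cmod (inverse z)) ^ 4 * u (inverse z)) < \<infinity>) = (nnint (inverse ` A) u < \<infinity>)" proof -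
 define q where "q z = (vector [Re z, Im z] :: real^2)" for z :: complex
 have pq: "plane (q z) = z" for z by (simp add: q_def plane_surj)
 have qp: "q (plane v) = v" for v using inj_plane pq by (metis injD)
 have q: "bounded_linear q" unfolding linear_conv_bounded_linear[symmetric] q_def by (rule linearI) (simp_all add: Finite_Cartesian_Product.vec_eq_iff forall_2)
 define g where "g v = q (inverse (plane v))" for v
 define g' where "g' v h = q (- (inverse (plane v) * plane h * inverse (plane v)))" for v h
 have S: "open (plane -` A)" using linear_plane A(1) by (intro open_vimage linear_continuous_on)
 have gim: "g ` (plane -` A) = plane -` (inverse ` A)" proof (intro equalityI subsetI)
  fix v assume "v : plane -` (inverse ` A)"
  then obtain z where z: "z : A" "plane v = inverse z" by auto
  hence "v = g (q z)" unfolding g_def pq by (metis qp)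
  thus "v : g ` (plane -` A)" using z(1) pq by auto
 qed (auto simp: g_def pq)
 have "inverse ` A = inverse -` A" using A(2) by (auto intro: image_eqI[of _ inverse "inverse x" for x])
 have der: "(g has_derivative g' v) (at v within plane -` A)" if "v : plane -` A" for v unfolding g_def[abs_def] g'_def[abs_def]
  by (intro bounded_linear.has_derivative[OF q] Deriv.has_derivative_inverse bounded_linear_imp_has_derivative linear_plane) (use that A(2) in auto)
 have inj: "inj_on g (plane -` A)" by (rule inj_onI) (metis g_def pq qp inverse_inverse_eq)
 have det: "\<bar>Determinants.det (matrix (g' v))\<bar> = (cmod (inverse (plane v))) ^ 4" for v proof -
  define k where "k = - ((inverse (plane v))^2)"
  have "g' v h = q (k * plane h)" for h by (simp add: g'_def k_def power2_eq_square mult_ac)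
  hence "Determinants.det (matrix (g' v)) = (Re k)^2 + (Im k)^2" by (simp add: Determinants.det_2 matrix_def q_def plane_def axis_def power2_eq_square)
  also have "... = (cmod k)^2" by (simp add: cmod_power2)
  finally show ?thesis by (simp add: k_def norm_power norm_mult flip: power_mult)
 qed
 have m: "(%z. (cmod (inverse z)) ^ 4 * u (inverse z)) : borel_measurable borel" using u(1) by measurable
 have oB: "inverse ` A : sets borel" unfolding \<open>inverse ` A = inverse -` A\<close> using measurable_sets[of "inverse :: complex => complex" borel borel A] A(1) by simp
 have "(nnint A (%z. (cmod (inverse z)) ^ 4 * u (inverse z)) < \<infinity>) = ((%v. (Finite_Cartesian_Product.vec ((cmod (inverse (plane v))) ^ 4 * u (inverse (plane v))) :: real^1)) absolutely_integrable_on (plane -` A))"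
  using integrable_plane_iff[OF m, of A] A u(2) by simp
 also have "(%v. (Finite_Cartesian_Product.vec ((cmod (inverse (plane v))) ^ 4 * u (inverse (plane v))) :: real^1)) = (%v. \<bar>Determinants.det (matrix (g' v))\<bar> *\<^sub>R (%v. Finite_Cartesian_Product.vec (u (plane v))) (g v))"
  by (simp add: det g_def pq Finite_Cartesian_Product.vec_eq_iff fun_eq_iff)
 also have "(... absolutely_integrable_on (plane -` A)) = ((%v. (Finite_Cartesian_Product.vec (u (plane v)) :: real^1)) absolutely_integrable_on (plane -` (inverse ` A)))"
 proof -
  let ?f = "%v. (Finite_Cartesian_Product.vec (u (plane v)) :: real^1)"
  have "((%x. \<bar>Determinants.det (matrix (g' x))\<bar> *\<^sub>R ?f (g x)) absolutely_integrable_on (plane -` A) &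
      integral (plane -` A) (%x. \<bar>Determinants.det (matrix (g' x))\<bar> *\<^sub>R ?f (g x)) = b) = (?f absolutely_integrable_on (g ` (plane -` A)) & integral (g ` (plane -` A)) ?f = b)" for b
   by (rule has_absolute_integral_change_of_variables[OF _ der inj]) (use S in simp_all)
  thus ?thesis unfolding gim by blast
 qed
 also have "(...) = (nnint (inverse ` A) u < \<infinity>)" by (rule integrable_plane_iff[OF u(1) oB u(2)])
 finally show ?thesis .
qed

lemma nnint_finite_mono:
 fixes p q :: "complex => real" assumes A: "A : sets borel" "continuous_on A q" "A' <= A" and le: "!!z. z : A' ==> p z <= C * q z" and C: "0 <= C" and fin: "nnint A q < \<infinity>"
 shows "nnint A' p < \<infinity>" proof -
 have "nnint A' p <= (\<integral>\<^sup>+z. ennreal C * (ennreal (q z) * indicator A z) \<partial>lborel)" proof (rule nn_integral_mono)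
  fix z
  have "ennreal (p z) <= ennreal C * ennreal (q z)" if "z : A'" using ennreal_leI[OF le[OF that]] C by (simp add: ennreal_mult')
  thus "ennreal (p z) * indicator A' z <= ennreal C * (ennreal (q z) * indicator A z)" using A(3) by (auto simp: indicator_def)
 qed
 also have "... = ennreal C * nnint A q" by (rule nn_integral_cmult[OF measurable_indicator_ennreal[OF A(1,2)]])
 also have "... < \<infinity>" using fin by (simp add: ennreal_mult_less_top)
 finally show ?thesis .
qed

lemma nn_integral_finite_Un:
 fixes p :: "complex => real" assumes A: "A : sets borel" "continuous_on A p" "nnint A p < \<infinity>" and B: "B : sets borel" "continuous_on B p" "nnint B p < \<infinity>" and "X <= A Un B"
 shows "nnint X p < \<infinity>" proof -
 have "nnint X p <= (\<integral>\<^sup>+z. ennreal (p z) * indicator A z + ennreal (p z) * indicator B z \<partial>lborel)" using assms(7) by (intro nn_integral_mono) (auto simp: indicator_def)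
 also have "... = nnint A p + nnint B p" by (intro nn_integral_add measurable_indicator_ennreal A B)
 also have "... < \<infinity>" using A(3) B(3) by (simp add: ennreal_add_less_top)
 finally show ?thesis .
qed

lemma nn_integral_finite_compact:
 fixes p :: "complex => real" assumes S: "compact S" "continuous_on S p" shows "nnint S p < \<infinity>" proof -
 obtain C where C: "\<forall>x\<in>p ` S. norm x <= C" using compact_imp_bounded[OF compact_continuous_image[OF S(2,1)]] unfolding bounded_iff by blast
 have one: "nnint S (%z. 1) < \<infinity>" using emeasure_compact_finite[OF S(1)] S(1) by (simp add: borel_compact)
 show ?thesis proof (rule nnint_finite_mono[OF _ _ _ _ _ one])
  fix z assume "z : S"
  from bspec[OF C imageI[OF this]] show "p z <= \<bar>C\<bar> * 1" by simp
 qed (use S in "auto simp: borel_compact")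
qed

text \<open>Relative to (1 + |z|^2)^-2 the density is a continuous positive function on the sphere;
  compactness of the two unit discs bounds it from both sides.\<close>

lemma volume_form_bounds: assumes "volume_form w" obtains k m M where "!!z. 2 * w At_Zero z = k (Some z) / (1 + (cmod z)^2)^2" "!!x. m <= k x" "!!x. k x <= M" "0 < m"
  "!!c. continuous_on UNIV (%z. k (param c z))" proof -
 obtain f where f: "sphere_smooth_on f UNIV" "!!x. f x > 0" "w = (%c z. f (param c z) * fubini_study c z)" using assms unfolding volume_form_def by blast
 define k where "k x = f x / pi" for x
 have "continuous_on UNIV (f \<circ> param c)" for c proof -
  have "smooth_on (f \<circ> param c) UNIV" using f(1)[unfolded sphere_smooth_on_def, rule_format, of c] by simp
  thus ?thesis by (rule smooth_on_imp_continuous_on)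
 qed
 hence ck: "continuous_on UNIV (%z. k (param c z))" for c unfolding k_def comp_def by (intro continuous_on_divide continuous_on_const) auto
 have kpos: "0 < k x" for x using f(2) by (simp add: k_def)
 have "\<exists>m M. 0 < m & (\<forall>z\<in>cball 0 1. m <= k (param c z) & k (param c z) <= M)" for c proof -
  note cc = continuous_on_subset[OF ck[of c] subset_UNIV, of "cball 0 1"]
  have ne: "cball (0::complex) 1 ~= {}" by simp
  obtain z1 where z1: "\<forall>z\<in>cball 0 1. k (param c z1) <= k (param c z)" using continuous_attains_inf[OF compact_cball ne cc] by (elim bexE)
  obtain z2 where z2: "\<forall>z\<in>cball 0 1. k (param c z) <= k (param c z2)" using continuous_attains_sup[OF compact_cball ne cc] by (elim bexE)
  show ?thesis by (intro exI[of _ "k (param c z1)"] exI[of _ "k (param c z2)"] conjI ballI kpos) (use z1 z2 in simp_all)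
 qed
 hence "\<forall>c. \<exists>m. \<exists>M. 0 < m & (\<forall>z\<in>cball 0 1. m <= k (param c z) & k (param c z) <= M)" by (rule allI)
 then obtain m where "\<forall>c. \<exists>M. 0 < m c & (\<forall>z\<in>cball 0 1. m c <= k (param c z) & k (param c z) <= M)" by (rule choice[THEN exE])
 then obtain M where mM: "\<forall>c. 0 < m c & (\<forall>z\<in>cball 0 1. m c <= k (param c z) & k (param c z) <= M c)" by (rule choice[THEN exE])
 let ?m = "min (m At_Zero) (m At_Infinity)" and ?M = "max (M At_Zero) (M At_Infinity)"
 have le: "?m <= m c" "M c <= ?M" for c by (cases c; simp)+
 have b: "?m <= k x & k x <= ?M" for x proof -
  obtain c z where x: "x = param c z" "cmod z <= 1" by (rule sphere_cases)
  hence "m c <= k x" "k x <= M c" using mM by simp_all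
  thus ?thesis using le[of c] by linarith
 qed
 show ?thesis proof (rule that)
  show "2 * w At_Zero z = k (Some z) / (1 + (cmod z)^2)^2" for z by (simp add: f(3) fubini_study_def k_def)
  show "?m <= k x" "k x <= ?M" for x using b by blast+
  show "0 < ?m" using mM by simp
 qed (rule ck)
qed

text \<open>Removes the volume form from integrability: on discs of the first chart its density lies
  between positive constants, and near infinity the Jacobian |z|^-4 of inversion is comparable with
  (1 + |z|^2)^-2.\<close>

lemma form_nn_integral_finite: assumes D: "sopen D" and g: "!!c. continuous_on (param c -` D) (%z. g (param c z))" "!!x. x : D ==> 0 <= g x"
  and v: "volume_form v" shows "form_nn_integral D g v < \<infinity> ==> (nnint (param c -` D Int cball 0 R) (%z. g (param c z))) < \<infinity>"
  and "(!!c. (nnint (param c -` D Int cball 0 1) (%z. g (param c z))) < \<infinity>) ==> form_nn_integral D g v < \<infinity>" proof -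
 obtain k m M where k: "!!z. 2 * v At_Zero z = k (Some z) / (1 + (cmod z)^2)^2" "!!x. m <= k x" "!!x. k x <= M" "0 < m" "!!c. continuous_on UNIV (%z. k (param c z))"
  by (rule volume_form_bounds[OF v]) (rule that)
 define D0 where "D0 = {z. Some z : D}"
 have D0: "param At_Zero -` D = D0" by (auto simp: D0_def)
 note op = open_param[OF D]
 hence oD0: "open D0" using D0 by metis
 define q where "q z = g (Some z) * (2 * v At_Zero z)" for z
 have g0: "continuous_on D0 (%z. g (Some z))" using g(1)[of At_Zero] by (simp add: D0)
 have k0: "continuous_on D0 (%z. k (Some z))" using continuous_on_subset[OF k(5)[of At_Zero] subset_UNIV, of D0] by simp
 have pos: "0 < 1 + (cmod z)^2" for z by (simp add: add_pos_nonneg)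
 have cq: "continuous_on D0 q" unfolding q_def k(1) by (intro continuous_intros g0 k0) (use pos in "metis less_irrefl power_not_zero")
 have F: "form_nn_integral D g v = nnint D0 q" by (simp add: form_nn_integral_def D0_def q_def)
 let ?A = "%r. D0 Int {z. r < cmod z}"
 have oA: "open (?A r)" for r by (intro open_Int oD0 open_Collect_less continuous_intros)
 define u where "u zt = indicator (param At_Infinity -` D) zt *\<^sub>R g (param At_Infinity zt)" for zt
 have u: "u : borel_measurable borel" unfolding u_def using op[of At_Infinity] g(1)[of At_Infinity]
  by (intro borel_measurable_continuous_on_indicator) (simp_all del: param.simps)
 have u0: "0 <= u zt" for zt using g(2) by (simp add: u_def indicator_def)
 have uz: "u (inverse z) = g (Some z)" if "z : D0" "z ~= 0" for z using that by (simp add: u_def D0_def)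
 have cov: "(nnint (?A r) (%z. (cmod (inverse z)) ^ 4 * g (Some z)) < \<infinity>) = (nnint (inverse ` ?A r) (%z. g (param At_Infinity z)) < \<infinity>)" if "0 < r" for r proof -
  have nz: "z ~= 0" if "z : ?A r" for z using that `0 < r` by auto
  have 1: "nnint (?A r) (%z. (cmod (inverse z)) ^ 4 * g (Some z)) = nnint (?A r) (%z. (cmod (inverse z)) ^ 4 * u (inverse z))" proof (rule nn_integral_cong)
   fix z show "ennreal ((cmod (inverse z)) ^ 4 * g (Some z)) * indicator (?A r) z = ennreal ((cmod (inverse z)) ^ 4 * u (inverse z)) * indicator (?A r) z"
    by (cases "z : ?A r") (use uz nz in simp_all)
  qed
  have 2: "nnint (inverse ` ?A r) u = nnint (inverse ` ?A r) (%z. g (param At_Infinity z))" proof (rule nn_integral_cong)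
   fix z show "ennreal (u z) * indicator (inverse ` ?A r) z = ennreal (g (param At_Infinity z)) * indicator (inverse ` ?A r) z" proof (cases "z : inverse ` ?A r")
    case True
    then obtain w where w: "z = inverse w" "w : ?A r" by auto
    thus ?thesis using nz[OF w(2)] by (simp add: u_def D0_def)
   qed simp
  qed
  show ?thesis unfolding 1 2[symmetric] by (rule inverse_change_of_variables[OF u u0 oA]) (use that in simp)
 qed
 have inv4: "(cmod (inverse z)) ^ 4 = 1 / ((cmod z)^2)^2" for z proof -
  have "(inverse t) ^ 4 = 1 / (t^2)^2" for t :: real by (simp add: power_divide inverse_eq_divide flip: power_mult)
  thus ?thesis by (simp only: norm_inverse)
 qed
 have kk: "x <= x * (k y / m)" if "0 <= x" for x y using mult_left_mono[of 1 "k y / m", OF _ that] k(2)[of y] k(4) by simp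
 have cinv: "continuous_on (?A r) (%z. (cmod (inverse z)) ^ 4 * g (Some z))" if "0 < r" for r by (intro continuous_intros continuous_on_subset[OF g0]) (use that in auto)
 { assume fin: "form_nn_integral D g v < \<infinity>"
  have 0: "nnint (D0 Int cball 0 R) (%z. g (Some z)) < \<infinity>" proof (rule nnint_finite_mono[OF _ cq])
   fix z assume z: "z : D0 Int cball 0 R"
   hence gz: "0 <= g (Some z)" and "cmod z <= R" using g(2) by (auto simp: D0_def)
   hence "(1 + (cmod z)^2)^2 <= (1 + R^2)^2" by (intro power_mono add_left_mono) auto
   moreover have "0 < (1 + (cmod z)^2)^2" using pos[of z] by simp
   ultimately have "1 <= (1 + R^2)^2 / (1 + (cmod z)^2)^2" by simp
   also have "... <= (1 + R^2)^2 / (1 + (cmod z)^2)^2 * (k (Some z) / m)" by (intro kk) simp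
   also have "... = (1 + R^2)^2 / m * (2 * v At_Zero z)" by (simp add: k(1))
   finally have "1 <= (1 + R^2)^2 / m * (2 * v At_Zero z)" .
   from mult_right_mono[OF this gz] show "g (Some z) <= (1 + R^2)^2 / m * q z" by (simp add: q_def mult_ac)
  qed (use oD0 fin k(4) in "auto simp: F")
  \<comment> \<open>In the coordinate w = 1/z the part |z| > r is |w| < |R| + 1, apart from w = 0,
    and so contains the disc of radius R except its centre.\<close>
  define r where "r = 1 / (\<bar>R\<bar> + 1)"
  have r: "0 < r" by (simp add: r_def)
  have "nnint (?A r) (%z. (cmod (inverse z)) ^ 4 * g (Some z)) < \<infinity>" proof (rule nnint_finite_mono[OF _ cq])
   fix z assume z: "z : ?A r"
   hence gz: "0 <= g (Some z)" and zr: "r < cmod z" using g(2) by (auto simp: D0_def)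
   hence z0: "0 < cmod z" using r by linarith
   have "(1 + (cmod z)^2) / (cmod z)^2 = 1 + 1 / (cmod z)^2" using z0 by (simp add: field_simps)
   also have "... <= 1 + 1 / r^2" using zr r by (intro add_left_mono frac_le power_mono) auto
   finally have "((1 + (cmod z)^2) / (cmod z)^2)^2 <= (1 + 1 / r^2)^2" using pos[of z] by (intro power_mono) auto
   hence "1 / ((cmod z)^2)^2 <= (1 + 1 / r^2)^2 / (1 + (cmod z)^2)^2" using pos[of z] by (simp add: power_divide pos_le_divide_eq)
   also have "... <= (1 + 1 / r^2)^2 / (1 + (cmod z)^2)^2 * (k (Some z) / m)" by (intro kk) simp
   also have "... = (1 + 1 / r^2)^2 / m * (2 * v At_Zero z)" by (simp add: k(1))
   finally have "(cmod (inverse z)) ^ 4 <= (1 + 1 / r^2)^2 / m * (2 * v At_Zero z)" unfolding inv4 .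
   from mult_right_mono[OF this gz] show "(cmod (inverse z)) ^ 4 * g (Some z) <= (1 + 1 / r^2)^2 / m * q z" by (simp add: q_def mult_ac)
  qed (use oD0 fin k(4) in "auto simp: F")
  hence i: "nnint (inverse ` ?A r) (%z. g (param At_Infinity z)) < \<infinity>" unfolding cov[OF r] .
  have sub: "z : inverse ` ?A r" if "z : param At_Infinity -` D Int cball 0 R" "z ~= 0" for z proof (rule image_eqI)
   show "z = inverse (inverse z)" by simp
   have "cmod z <= \<bar>R\<bar>" using that by auto
   hence "r < cmod (inverse z)" using less_norm_inverse_iff[OF that(2) r] by (simp add: r_def)
   thus "inverse z : ?A r" using that by (simp add: D0_def)
  qed
  have 1: "nnint (param At_Infinity -` D Int cball 0 R) (%z. g (param At_Infinity z)) < \<infinity>" proof -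
   \<comment> \<open>The centre w = 0, which inversion does not reach, is a null set.\<close>
   have "AE z in lborel. z ~= (0::complex)" by (rule AE_lborel_singleton)
   hence "nnint (param At_Infinity -` D Int cball 0 R) (%z. g (param At_Infinity z)) <= nnint (inverse ` ?A r) (%z. g (param At_Infinity z))"
   proof (intro nn_integral_mono_AE, eventually_elim)
    fix z :: complex assume "z ~= 0"
    thus "ennreal (g (param At_Infinity z)) * indicator (param At_Infinity -` D Int cball 0 R) z <= ennreal (g (param At_Infinity z)) * indicator (inverse ` ?A r) z"
     using sub[of z] by (intro mult_left_mono) (auto simp: indicator_def simp del: param.simps)
   qed
   thus ?thesis using i by (rule le_less_trans)
  qed
  show "nnint (param c -` D Int cball 0 R) (%z. g (param c z)) < \<infinity>" using 0 1 by (cases c) (simp_all add: D0) }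
 { assume fin: "!!c. (nnint (param c -` D Int cball 0 1) (%z. g (param c z))) < \<infinity>"
  have M: "0 <= M" using k(2,3,4) by (meson less_imp_le order_trans)
  have "0 < (1 + (cmod z)^2)^2" for z using pos[of z] by simp
  have 0: "nnint (D0 Int cball 0 1) q < \<infinity>" proof (rule nnint_finite_mono[of "D0 Int cball 0 1" "%z. g (Some z)"])
   fix z assume "z : D0 Int cball 0 1"
   hence gz: "0 <= g (Some z)" using g(2) by (auto simp: D0_def)
   have "k (Some z) / (1 + (cmod z)^2)^2 <= M / 1" using k(2,3)[of "Some z"] k(4) M by (intro frac_le) auto
   from mult_right_mono[OF this gz] show "q z <= M * g (Some z)" by (simp add: q_def k(1) mult_ac)
  qed (use oD0 fin[of At_Zero] M in "auto simp: D0 intro: continuous_on_subset[OF g0]")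
  have iA: "inverse ` ?A 1 <= param At_Infinity -` D Int cball 0 1" proof (rule image_subsetI)
   fix z assume z: "z : ?A 1"
   hence "z ~= 0" by auto
   thus "inverse z : param At_Infinity -` D Int cball 0 1" using z norm_inverse_less_iff[of z 1] by (simp add: D0_def)
  qed
  have "nnint (inverse ` ?A 1) (%z. g (param At_Infinity z)) <= nnint (param At_Infinity -` D Int cball 0 1) (%z. g (param At_Infinity z))"
   using iA by (intro nn_integral_mono mult_left_mono) (auto simp: indicator_def)
  from le_less_trans[OF this fin[of At_Infinity]]
  have i: "nnint (?A 1) (%z. (cmod (inverse z)) ^ 4 * g (Some z)) < \<infinity>" using cov[of 1] by (simp del: param.simps)
  have 1: "nnint (?A 1) q < \<infinity>" proof (rule nnint_finite_mono[OF _ cinv subset_refl _ M i])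
   fix z assume z: "z : ?A 1"
   hence gz: "0 <= g (Some z)" and z1: "1 < cmod z" using g(2) by (auto simp: D0_def)
   hence "k (Some z) / (1 + (cmod z)^2)^2 <= M / ((cmod z)^2)^2" using k(2,3)[of "Some z"] k(4) M by (intro frac_le power_mono) auto
   from mult_right_mono[OF this gz] show "q z <= M * ((cmod (inverse z)) ^ 4 * g (Some z))" unfolding inv4 by (simp add: q_def k(1) mult_ac)
  qed (use oA in auto)
  show "form_nn_integral D g v < \<infinity>" unfolding F by (rule nn_integral_finite_Un[OF _ _ 0 _ _ 1]) (use oD0 oA in "auto intro: continuous_on_subset[OF cq]") }
qed

section \<open>Coordinates of sections with respect to global frames\<close>

context holomorphic_line_bundle begin

lemma ratio_eqI: assumes "b : fib x" "b ~= fib_zero L x" "a = smul k b" shows "ratio a b = k" using ratio_unique[OF assms(1,2)] assms(3) by simp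

lemma ratio_add: assumes "a : fib x" "a' : fib x" "b : fib x" "b ~= fib_zero L x" shows "ratio (fib_add L a a') b = ratio a b + ratio a' b" proof -
 obtain U T where t: "(U, T) : trivs L" "x : U" by (rule triv_at)
 show ?thesis unfolding ratio_triv(1)[OF t assms(1,3,4)] ratio_triv(1)[OF t assms(2,3,4)] ratio_triv(1)[OF t add_in[OF assms(1,2)] assms(3,4)]
  by (simp add: triv_add[OF t assms(1,2)] add_divide_distrib)
qed

lemma ratio_smult_left: assumes "a : fib x" "b : fib x" "b ~= fib_zero L x" shows "ratio (smul k a) b = k * ratio a b" proof -
 obtain U T where t: "(U, T) : trivs L" "x : U" by (rule triv_at)
 show ?thesis unfolding ratio_triv(1)[OF t assms] ratio_triv(1)[OF t smult_in[OF assms(1)] assms(2,3)] by (simp add: triv_smult[OF t assms(1)])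
qed

lemma ratio_zero: assumes "b : fib x" "b ~= fib_zero L x" shows "ratio (fib_zero L x) b = 0"
 by (rule ratio_eqI[OF assms]) (use smult_eq_zero_iff[OF assms(1), of 0] in simp)

lemma hol_sec_add: assumes s: "hol_sec D s" and t: "hol_sec D t" shows "hol_sec D (%x. fib_add L (s x) (t x))" proof (rule hol_secI)
 show "fib_add L (s x) (t x) : fib x" if "x : D" for x by (rule add_in[OF hol_secD(1)[OF s that] hol_secD(1)[OF t that]])
 fix U T assume u: "(U, T) : trivs L"
 have "sphere_holomorphic_on (%x. T (s x) + T (t x)) (U Int D)" using hol_secD(2)[OF s u] hol_secD(2)[OF t u] unfolding sphere_holomorphic_on_def comp_def
  by (intro allI holomorphic_on_add) simp_all
 thus "sphere_holomorphic_on (%x. T (fib_add L (s x) (t x))) (U Int D)" proof (rule sphere_holomorphic_on_cong[THEN iffD1, rotated])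
  fix x assume "x : U Int D"
  thus "T (s x) + T (t x) = T (fib_add L (s x) (t x))" using triv_add[OF u, of x "s x" "t x"] hol_secD(1)[OF s, of x] hol_secD(1)[OF t, of x] by simp
 qed
qed

lemma hol_sec_cong: assumes "!!x. x : D ==> s x = t x" shows "hol_sec D s = hol_sec D t" proof -
 have *: "hol_sec D t" if s: "hol_sec D s" and eq: "!!x. x : D ==> s x = t x" for s t proof (rule hol_secI)
  show "t x : fib x" if "x : D" for x using hol_secD(1)[OF s that] eq[OF that] by simp
  fix U T assume u: "(U, T) : trivs L"
  show "sphere_holomorphic_on (%x. T (t x)) (U Int D)" by (rule sphere_holomorphic_on_cong[THEN iffD1, OF _ hol_secD(2)[OF s u]]) (simp add: eq)
 qed
 show ?thesis
 proof
  assume "hol_sec D s" thus "hol_sec D t" by (rule *) (rule assms)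
 next
  assume "hol_sec D t" thus "hol_sec D s" by (rule *) (rule assms[symmetric])
 qed
qed

lemma hol_sec_zero: "hol_sec D (fib_zero L)" proof (rule hol_secI)
 fix U t assume u: "(U, t) : trivs L"
 have "sphere_holomorphic_on (%x. 0) (U Int D)" by (simp add: sphere_holomorphic_on_def comp_def)
 thus "sphere_holomorphic_on (%x. t (fib_zero L x)) (U Int D)" by (rule sphere_holomorphic_on_cong[THEN iffD1, rotated]) (use triv_zero[OF u] in simp)
qed (rule zero_in)

lemma carrier_hol_sections: "carrier (hol_sections L D) = {s \<in> extensional D. hol_sec D s}"
 unfolding hol_sections_def hol_sec_def partial_object.select_convs by (rule refl)

end

text \<open>The frames over the two charts are fixed once for all. Coordinates F0 and F1 of a
  section satisfy F1 (1/z) = z^d F0 z, so in this sign convention global sections are polynomials of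
  degree at most - d.\<close>

locale framed_bundle = holomorphic_line_bundle L for L :: "'e line_bundle" +
 fixes e :: "std_chart => sphere => 'e" and d :: int and h :: "'e => 'e => complex" and om :: form11 assumes frame_e: "frame (range (param c)) (e c)"
  and transition0: "z ~= 0 ==> e At_Zero (param At_Zero z) = smul (z powi d) (e At_Infinity (param At_Zero z))"
  and metric: "hermitian_metric L h" and vol: "volume_form om"

lemma framed_bundle_exists: assumes "holomorphic_line_bundle L" "hermitian_metric L h" "volume_form w" obtains e d where "framed_bundle L e d h w" proof -
 interpret holomorphic_line_bundle L by (rule assms(1))
 obtain e0 e1 d where f: "frame (range (param At_Zero)) e0" "frame (range (param (opp At_Zero))) e1"
  "!!z. z ~= 0 ==> e0 (param At_Zero z) = smul (z powi d) (e1 (param At_Zero z))" by (rule global_frames[of At_Zero]) (rule that)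
 have "framed_bundle L (%c. case c of At_Zero => e0 | At_Infinity => e1) d h w" proof (unfold_locales)
  show "frame (range (param c)) (case c of At_Zero => e0 | At_Infinity => e1)" for c using f(1,2) by (cases c) (simp_all del: param.simps)
 qed (use f(3) assms in simp_all)
 thus ?thesis by (rule that)
qed

context framed_bundle begin

definition F :: "std_chart => (sphere => 'e) => complex => complex" where "F c s z = ratio (s (param c z)) (e c (param c z))"

lemma e: "e c (param c z) : fib (param c z)" "e c (param c z) ~= fib_zero L (param c z)" using frameD(3,4)[OF frame_e[of c], of "param c z"] by simp_all

text \<open>The exponent is d in both directions, because exchanging the frames and inverting the
  coordinate each change its sign.\<close>

lemma transition: assumes z: "z ~= 0" shows "e c (param c z) = smul (z powi d) (e (opp c) (param c z))" proof (cases c)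
 case At_Infinity
 let ?x = "param At_Zero (inverse z)"
 have x: "param At_Infinity z = ?x" using z by simp
 have i: "e At_Infinity ?x : fib ?x" using e(1)[of At_Infinity z] x by simp
 have "smul (z powi d) (e At_Zero ?x) = smul (z powi d * inverse z powi d) (e At_Infinity ?x)"
  using transition0[of "inverse z"] z smult_smult[OF i] by (simp del: param.simps)
 moreover have "z powi d * inverse z powi d = 1" using z by (simp add: power_int_inverse)
 ultimately show ?thesis using At_Infinity x smult_one[OF i] by (simp del: param.simps)
qed (use transition0[OF z] in simp)

lemma smult_F: "s (param c z) : fib (param c z) ==> smul (F c s z) (e c (param c z)) = s (param c z)" unfolding F_def by (rule ratio_smult[OF _ e])

lemma F_eqI: "s (param c z) = smul k (e c (param c z)) ==> F c s z = k" unfolding F_def by (rule ratio_eqI[OF e])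

lemma F_other: assumes z: "z ~= 0" and s: "s (param c z) : fib (param c z)" shows "F (opp c) s (inverse z) = z powi d * F c s z" proof (rule F_eqI)
 have x: "param (opp c) (inverse z) = param c z" using param_other[of "inverse z" c] z by simp
 have i: "e (opp c) (param c z) : fib (param c z)" using e(1)[of "opp c" "inverse z"] x by simp
 show "s (param (opp c) (inverse z)) = smul (z powi d * F c s z) (e (opp c) (param (opp c) (inverse z)))"
  using smult_F[of s c z, OF s] transition[OF z, of c] smult_smult[OF i] unfolding x by (simp add: mult.commute)
qed

lemma F_holomorphic: assumes D: "sopen D" and s: "hol_sec D s" shows "F c s holomorphic_on param c -` D" proof -
 have "sopen (range (param c))" using sopen_image[of UNIV c] by simp
 hence "frame (D Int range (param c)) (e c)" using D by (intro frame_subset[OF frame_e]) auto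
 from ratio_chart_holomorphic[OF this hol_sec_subset[OF s], of c]
 show ?thesis by (simp add: F_def[abs_def])
qed

definition Hm :: "std_chart => complex => real" where "Hm c z = Re (h (e c (param c z)) (e c (param c z)))"

lemma metric_smult: assumes "a : fib x" shows "Re (h (smul k a) (smul k a)) = (cmod k)^2 * Re (h a a)" "0 <= Re (h a a)" "a ~= fib_zero L x ==> 0 < Re (h a a)"
proof -
 have 1: "h (smul k a) b = k * h a b" "h b a = cnj (h a b)" if "b : fib x" "a : fib x" for a b k using metric that unfolding hermitian_metric_def by blast+
 have r: "h a a = of_real (Re (h a a))" using 1(2)[OF assms assms] by (simp add: complex_eq_iff)
 have "h (smul k a) (smul k a) = k * cnj k * h a a" proof -
  have "h a (smul k a) = cnj (k * h a a)" using 1(2)[OF assms smult_in[OF assms, of k]] 1(1)[OF assms assms, of k] by simp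
  also have "... = cnj k * h a a" using 1(2)[OF assms assms] by simp
  finally show ?thesis using 1(1)[OF smult_in[OF assms, of k] assms, of k] by simp
 qed
 also have "k * cnj k = of_real ((cmod k)^2)" by (rule complex_norm_square[symmetric])
 also have "of_real ((cmod k)^2) * h a a = of_real ((cmod k)^2) * of_real (Re (h a a))" using r by metis
 finally have "h (smul k a) (smul k a) = of_real ((cmod k)^2 * Re (h a a))" by simp
 thus "Re (h (smul k a) (smul k a)) = (cmod k)^2 * Re (h a a)" by simp
 show p: "0 < Re (h a a)" if "a ~= fib_zero L x" using metric assms that unfolding hermitian_metric_def by blast
 show "0 <= Re (h a a)" proof (cases "a = fib_zero L x")
  case True
  hence "smul 0 a = a" using smult_eq_zero_iff[OF assms, of 0] by simp
  hence "h a a = 0" using 1(1)[OF assms assms, of 0] by simp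
  thus ?thesis by simp
 qed (use p in simp)
qed

lemma Hm_pos: "0 < Hm c z" unfolding Hm_def by (rule metric_smult(3)[OF e])

lemma metric_F: "s (param c z) : fib (param c z) ==> Re (h (s (param c z)) (s (param c z))) = (cmod (F c s z))^2 * Hm c z"
 using metric_smult(1)[OF e(1), of "F c s z" c z] smult_F[of s c z] by (simp add: Hm_def)

text \<open>Smoothness of the metric is given in local trivialisations; the frame differs from the
  local one by a holomorphic factor, which contributes the square of its modulus.\<close>

lemma continuous_Hm: "continuous_on UNIV (Hm c)" proof (intro continuous_at_imp_continuous_on ballI)
 fix z
 obtain U T where t: "(U, T) : trivs L" "param c z : U" by (rule triv_at)
 let ?b = "%x. inv_into (fib x) T 1"
 let ?S = "param c -` U"
 have o: "open ?S" using triv_open[OF t(1)] openin_sphere_iff by blast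
 have "\<forall>p\<in>trivs L. sphere_smooth_on (%x. let e = inv_into (fib x) (snd p) 1 in Re (h e e)) (fst p)" using metric unfolding hermitian_metric_def by (simp add: split_beta)
 from bspec[OF this t(1)] have "sphere_smooth_on (%x. Re (h (?b x) (?b x))) U" by (simp add: Let_def)
 hence "smooth_on ((%x. Re (h (?b x) (?b x))) \<circ> param c) ?S" unfolding sphere_smooth_on_def by (rule spec)
 hence c1: "continuous_on ?S (%z. Re (h (?b (param c z)) (?b (param c z))))" using smooth_on_imp_continuous_on by (simp add: comp_def)
 have "(%z. T (e c (param c z))) holomorphic_on ?S" using hol_secD(2)[OF frameD(2)[OF frame_e[of c]] t(1), unfolded sphere_holomorphic_on_def, THEN spec, of c]
  by (simp add: comp_def)
 hence c2: "continuous_on ?S (%z. T (e c (param c z)))" using hol_cont by blast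
 have eq: "Hm c w = (cmod (T (e c (param c w))))^2 * Re (h (?b (param c w)) (?b (param c w)))" if "w : ?S" for w proof -
  have x: "param c w : U" using that by simp
  have b: "?b (param c w) : fib (param c w)" "T (?b (param c w)) = 1" using triv_bij[OF t(1) x] by (auto simp: bij_betw_def inv_into_into f_inv_into_f)
  have eq: "smul (T (e c (param c w))) (?b (param c w)) = e c (param c w)"
   by (rule triv_inj[OF t(1) x smult_in[OF b(1)] e(1)]) (simp add: triv_smult[OF t(1) x b(1)] b(2))
  show ?thesis using metric_smult(1)[OF b(1), of "T (e c (param c w))"] unfolding eq Hm_def .
 qed
 have c3: "continuous_on ?S (%w. (cmod (T (e c (param c w))))^2 * Re (h (?b (param c w)) (?b (param c w))))" by (intro continuous_intros c1 c2)
 have "continuous_on ?S (Hm c)" by (rule continuous_on_eq[OF c3]) (rule eq[symmetric])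
 hence "\<forall>z\<in>?S. isCont (Hm c) z" by (rule continuous_on_eq_continuous_at[OF o, THEN iffD1])
 thus "isCont (Hm c) z" by (rule bspec) (use t(2) in simp)
qed

definition L2_at :: "sphere set => (sphere => 'e) => std_chart => real => bool" where "L2_at D s c R = (nnint (param c -` D Int cball 0 R) (%z. (cmod (F c s z))^2) < \<infinity>)"

text \<open>On a compact disc the metric of the frame lies between positive constants, so together
  with \<open>form_nn_integral_finite\<close> only the coordinate functions matter.\<close>

lemma L2_iff: assumes D: "sopen D" and s: "hol_sec D s" shows "(form_nn_integral D (%x. Re (h (s x) (s x))) om < \<infinity>) = (\<forall>c. L2_at D s c 1)"
  and "form_nn_integral D (%x. Re (h (s x) (s x))) om < \<infinity> ==> L2_at D s c R" proof -
 let ?g = "%x. Re (h (s x) (s x))"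
 note op = open_param[OF D]
 have sin: "s x : fib x" if "x : D" for x by (rule hol_secD(1)[OF s that])
 have cF: "continuous_on (param c -` D) (%z. (cmod (F c s z))^2)" for c by (intro continuous_intros hol_cont[OF F_holomorphic[OF D s]])
 have eq: "?g (param c z) = (cmod (F c s z))^2 * Hm c z" if "z : param c -` D" for c z by (rule metric_F) (use that sin in simp)
 have cFH: "continuous_on (param c -` D) (%z. (cmod (F c s z))^2 * Hm c z)" for c by (intro continuous_on_mult cF continuous_on_subset[OF continuous_Hm]) simp
 have cg: "continuous_on (param c -` D) (%z. ?g (param c z))" for c by (rule continuous_on_eq[OF cFH]) (rule eq[symmetric])
 have g0: "0 <= ?g x" if "x : D" for x by (rule metric_smult(2)[OF sin[OF that]])
 have bds: "\<exists>m M. 0 < m & (\<forall>z\<in>cball 0 R. m <= Hm c z & Hm c z <= M)" for c R proof (cases "cball (0::complex) R = {}")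
  case True
  thus ?thesis by (intro exI[of _ 1]) simp
 next
  case False
  note cc = continuous_on_subset[OF continuous_Hm[of c] subset_UNIV, of "cball 0 R"]
  obtain z1 where z1: "\<forall>z\<in>cball 0 R. Hm c z1 <= Hm c z" using continuous_attains_inf[OF compact_cball False cc] by (elim bexE)
  obtain z2 where z2: "\<forall>z\<in>cball 0 R. Hm c z <= Hm c z2" using continuous_attains_sup[OF compact_cball False cc] by (elim bexE)
  show ?thesis by (intro exI[of _ "Hm c z1"] exI[of _ "Hm c z2"] conjI ballI Hm_pos) (use z1 z2 in simp_all)
 qed
 have iff: "(nnint (param c -` D Int cball 0 R) (%z. ?g (param c z)) < \<infinity>) = L2_at D s c R" for c R proof -
  obtain m M where m: "0 < m" "\<forall>z\<in>cball 0 R. m <= Hm c z & Hm c z <= M" using bds by blast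
  let ?A = "param c -` D Int cball 0 R"
  have A: "?A : sets borel" using op by simp
  show ?thesis
  proof
   assume "nnint ?A (%z. ?g (param c z)) < \<infinity>"
   thus "L2_at D s c R" unfolding L2_at_def proof (rule nnint_finite_mono[OF A _ subset_refl _ _, rotated -1])
    show "continuous_on ?A (%z. ?g (param c z))" by (rule continuous_on_subset[OF cg]) simp
    show "(cmod (F c s z))^2 <= 1 / m * ?g (param c z)" if "z : ?A" for z proof -
     have "m <= Hm c z" using m(2) that by blast
     from mult_left_mono[OF this, of "(cmod (F c s z))^2"] show ?thesis using eq[of z c] that m(1) by (simp add: field_simps)
    qed
   qed (use m in simp)
  next
   assume "L2_at D s c R"
   thus "nnint ?A (%z. ?g (param c z)) < \<infinity>" unfolding L2_at_def proof (rule nnint_finite_mono[OF A _ subset_refl _ _, rotated -1])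
    show "continuous_on ?A (%z. (cmod (F c s z))^2)" by (rule continuous_on_subset[OF cF]) simp
    show "?g (param c z) <= \<bar>M\<bar> * (cmod (F c s z))^2" if "z : ?A" for z proof -
     have "Hm c z <= \<bar>M\<bar>" using m(2) that by fastforce
     from mult_left_mono[OF this, of "(cmod (F c s z))^2"] show ?thesis using eq[of z c] that by (simp add: mult.commute)
    qed
   qed simp
  qed
 qed
 note fnn = form_nn_integral_finite[OF D cg g0 vol]
 show 1: "L2_at D s c R" if "form_nn_integral D ?g om < \<infinity>" for c R by (rule iff[THEN iffD1, OF fnn(1)]) (assumption | rule that)+
 show "(form_nn_integral D ?g om < \<infinity>) = (\<forall>c. L2_at D s c 1)"
 proof
  assume "\<forall>c. L2_at D s c 1"
  hence "L2_at D s c 1" for c by (rule spec)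
  thus "form_nn_integral D ?g om < \<infinity>" by (intro fnn(2) iff[THEN iffD2])
 qed (use 1 in simp)
qed

end

section \<open>The Bergman space as a vector space\<close>

context holomorphic_line_bundle begin

text \<open>A trivialisation is injective on the fibre and turns each law into one of complex
  numbers.\<close>

lemma fibre_laws: assumes a: "a : fib x" and b: "b : fib x" and c: "c : fib x"
 shows "fib_add L (fib_add L a b) c = fib_add L a (fib_add L b c)" "fib_add L a b = fib_add L b a"
  "fib_add L (fib_zero L x) a = a" "fib_add L (smul (- 1) a) a = fib_zero L x" "smul (k + l) a = fib_add L (smul k a) (smul l a)"
  "smul k (fib_add L a b) = fib_add L (smul k a) (smul k b)" proof -
 obtain U T where t: "(U, T) : trivs L" "x : U" by (rule triv_at)
 note [simp] = a b c add_in smult_in zero_in triv_add[OF t] triv_smult[OF t] triv_zero[OF t]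
 show "fib_add L (fib_add L a b) c = fib_add L a (fib_add L b c)" by (rule triv_inj[OF t]) simp_all
 show "fib_add L a b = fib_add L b a" by (rule triv_inj[OF t]) simp_all
 show "fib_add L (fib_zero L x) a = a" by (rule triv_inj[OF t]) simp_all
 show "fib_add L (smul (- 1) a) a = fib_zero L x" by (rule triv_inj[OF t]) simp_all
 show "smul (k + l) a = fib_add L (smul k a) (smul l a)" by (rule triv_inj[OF t]) (simp_all add: distrib_right)
 show "smul k (fib_add L a b) = fib_add L (smul k a) (smul k b)" by (rule triv_inj[OF t]) (simp_all add: distrib_left)
qed

end

context framed_bundle begin

abbreviation A2 :: "sphere set => (complex, sphere => 'e) module" where "A2 D \<equiv> bergman_space L h om D"

lemma A2_simps [simp]: "zero (A2 D) = (\<lambda>x\<in>D. fib_zero L x)" "add (A2 D) = (%s t. \<lambda>x\<in>D. fib_add L (s x) (t x))" "smult (A2 D) = (%k s. \<lambda>x\<in>D. smul k (s x))"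
 by (simp_all add: bergman_space_def hol_sections_def)

lemma A2_iff: assumes "sopen D" shows "(s : carrier (A2 D)) = (s : extensional D & hol_sec D s & (\<forall>c. L2_at D s c 1))" proof -
 have "(s : carrier (A2 D)) = (s : carrier (hol_sections L D) & form_nn_integral D (%x. Re (h (s x) (s x))) om < \<infinity>)" by (simp add: bergman_space_def)
 also have "(...) = ((s : extensional D & hol_sec D s) & form_nn_integral D (%x. Re (h (s x) (s x))) om < \<infinity>)" unfolding carrier_hol_sections by simp
 finally show ?thesis using L2_iff(1)[OF assms, of s] by (cases "hol_sec D s") simp_all
qed

lemma F_add: "s (param c z) : fib (param c z) ==> t (param c z) : fib (param c z) ==> F c (%x. fib_add L (s x) (t x)) z = F c s z + F c t z"
 unfolding F_def by (rule ratio_add[OF _ _ e])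

lemma F_smult: "s (param c z) : fib (param c z) ==> F c (%x. smul k (s x)) z = k * F c s z" unfolding F_def by (rule ratio_smult_left[OF _ e])

lemma F_zero: "F c (fib_zero L) z = 0" unfolding F_def by (rule ratio_zero[OF e])

lemma F_restrict [simp]: "param c z : D ==> F c (restrict s D) z = F c s z" by (simp add: F_def)

lemma L2_at_restrict [simp]: "L2_at D (restrict s D) c R = L2_at D s c R" proof -
 have eq: "ennreal ((cmod (F c (restrict s D) z))^2) * indicator (param c -` D Int cball 0 R) z = ennreal ((cmod (F c s z))^2) * indicator (param c -` D Int cball 0 R) z" for z
  by (cases "param c z : D") simp_all
 show ?thesis unfolding L2_at_def eq ..
qed

lemma hol_sec_restrict [simp]: "hol_sec D (restrict s D) = hol_sec D s" by (rule hol_sec_cong) simp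

lemma L2_at_smult: assumes D: "sopen D" and s: "hol_sec D s" "L2_at D s c R" shows "L2_at D (%x. smul k (s x)) c R" unfolding L2_at_def
proof (rule nnint_finite_mono[OF _ _ subset_refl _ _ s(2)[unfolded L2_at_def]])
 have "open (param c -` D)" using D openin_sphere_iff by blast
 thus "param c -` D Int cball 0 R : sets borel" by simp
 show "continuous_on (param c -` D Int cball 0 R) (%z. (cmod (F c s z))^2)"
  by (intro continuous_intros continuous_on_subset[OF hol_cont[OF F_holomorphic[OF D s(1)]]]) simp
 fix z assume "z : param c -` D Int cball 0 R"
 thus "(cmod (F c (%x. smul k (s x)) z))^2 <= (cmod k)^2 * (cmod (F c s z))^2"
  using F_smult[of s c z k] hol_secD(1)[OF s(1), of "param c z"] by (simp add: norm_mult power_mult_distrib)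
qed simp

lemma L2_at_add: assumes D: "sopen D" and s: "hol_sec D s" "L2_at D s c R" and t: "hol_sec D t" "L2_at D t c R"
 shows "L2_at D (%x. fib_add L (s x) (t x)) c R" proof -
 let ?A = "param c -` D Int cball 0 R"
 have "open (param c -` D)" using D openin_sphere_iff by blast
 hence A: "?A : sets borel" by simp
 have cF: "continuous_on ?A (%z. (cmod (F c s z))^2)" if "hol_sec D s" for s
  by (intro continuous_intros continuous_on_subset[OF hol_cont[OF F_holomorphic[OF D that]]]) simp
 have m: "(%z. ennreal ((cmod (F c s z))^2) * indicator ?A z) : borel_measurable lborel" if "hol_sec D s" for s by (intro measurable_indicator_ennreal A cF that)
 have "nnint ?A (%z. (cmod (F c s z))^2 + (cmod (F c t z))^2) =
   (\<integral>\<^sup>+z. ennreal ((cmod (F c s z))^2) * indicator ?A z + ennreal ((cmod (F c t z))^2) * indicator ?A z \<partial>lborel)"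
  by (intro nn_integral_cong) (simp add: ennreal_plus distrib_right)
 also have "... = nnint ?A (%z. (cmod (F c s z))^2) + nnint ?A (%z. (cmod (F c t z))^2)" by (rule nn_integral_add[OF m[OF s(1)] m[OF t(1)]])
 also have "... < \<infinity>" using s(2) t(2) by (simp add: L2_at_def ennreal_add_less_top)
 finally have fin: "nnint ?A (%z. (cmod (F c s z))^2 + (cmod (F c t z))^2) < \<infinity>" .
 show ?thesis unfolding L2_at_def proof (rule nnint_finite_mono[OF A _ subset_refl _ _ fin])
  show "continuous_on ?A (%z. (cmod (F c s z))^2 + (cmod (F c t z))^2)" by (intro continuous_on_add cF s t)
  fix z assume z: "z : ?A"
  have "(cmod (F c s z + F c t z))^2 <= (cmod (F c s z) + cmod (F c t z))^2" by (intro power_mono norm_triangle_ineq) simp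
  also have "... <= 2 * ((cmod (F c s z))^2 + (cmod (F c t z))^2)" using zero_le_power2[of "cmod (F c s z) - cmod (F c t z)"] by (simp add: power2_eq_square algebra_simps)
  finally show "(cmod (F c (%x. fib_add L (s x) (t x)) z))^2 <= 2 * ((cmod (F c s z))^2 + (cmod (F c t z))^2)"
   using F_add[of s c z t] hol_secD(1)[OF s(1), of "param c z"] hol_secD(1)[OF t(1), of "param c z"] z by simp
 qed simp
qed

lemma L2_at_zero: "L2_at D (fib_zero L) c R" unfolding L2_at_def F_zero by simp

lemma hol_sec_const_smult: assumes "hol_sec D s" shows "hol_sec D (%x. smul k (s x))" proof -
 have "sphere_holomorphic_on (%x. k) D" by (simp add: sphere_holomorphic_on_def comp_def)
 from hol_sec_smult[OF assms this] show ?thesis .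
qed

lemma A2_vectorspace: assumes D: "sopen D" shows "vectorspace class_ring (A2 D)" proof -
 note I = A2_iff[OF D]
 have sin: "s x : fib x" if "s : carrier (A2 D)" "x : D" for s x using that hol_secD(1) I by blast
 have addc: "(\<lambda>x\<in>D. fib_add L (s x) (t x)) : carrier (A2 D)" if "s : carrier (A2 D)" "t : carrier (A2 D)" for s t
  using that unfolding I by (simp add: hol_sec_add L2_at_add[OF D])
 have smc: "(\<lambda>x\<in>D. smul k (s x)) : carrier (A2 D)" if "s : carrier (A2 D)" for s k using that unfolding I by (simp add: hol_sec_const_smult L2_at_smult[OF D])
 have z: "(\<lambda>x\<in>D. fib_zero L x) : carrier (A2 D)" unfolding I by (simp add: hol_sec_zero L2_at_zero)
 have ext: "s = t" if "s : carrier (A2 D)" "t : carrier (A2 D)" "!!x. x : D ==> s x = t x" for s t using that unfolding I by (meson extensionalityI)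
 have ag: "abelian_group (A2 D)" proof (rule abelian_groupI)
  fix s t u assume s: "s : carrier (A2 D)" and t: "t : carrier (A2 D)" and u: "u : carrier (A2 D)"
  show "add (A2 D) s t : carrier (A2 D)" using addc[OF s t] by simp
  show "add (A2 D) (add (A2 D) s t) u = add (A2 D) s (add (A2 D) t u)"
   by (unfold A2_simps, rule ext; (intro addc smc z s t u)?; simp add: fibre_laws(1)[OF sin[OF s] sin[OF t] sin[OF u]])
  show "add (A2 D) s t = add (A2 D) t s" by (unfold A2_simps, rule ext; (intro addc smc z s t u)?; simp add: fibre_laws(2)[OF sin[OF s] sin[OF t] sin[OF t]])
 next
  show "zero (A2 D) : carrier (A2 D)" using z by simp
  fix s assume s: "s : carrier (A2 D)"
  show "add (A2 D) (zero (A2 D)) s = s" by (unfold A2_simps, rule ext; (intro addc smc z s)?; simp add: fibre_laws(3)[OF sin[OF s] sin[OF s] sin[OF s]])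
  show "\<exists>t\<in>carrier (A2 D). add (A2 D) t s = zero (A2 D)"
  proof
   show "add (A2 D) (\<lambda>x\<in>D. smul (- 1) (s x)) s = zero (A2 D)"
    by (unfold A2_simps, rule ext; (intro addc smc z s)?; simp add: fibre_laws(4)[OF sin[OF s] sin[OF s] sin[OF s]])
  qed (rule smc[OF s])
 qed
 have "module class_ring (A2 D)" proof (rule moduleI[OF class_cring.is_cring ag])
  fix k l :: complex and s t assume s: "s : carrier (A2 D)"
  show "smult (A2 D) k s : carrier (A2 D)" using smc[OF s] by simp
  show "smult (A2 D) (add class_ring k l) s = add (A2 D) (smult (A2 D) k s) (smult (A2 D) l s)"
   by (unfold A2_simps, rule ext; (intro addc smc z s)?; simp add: fibre_laws(5)[OF sin[OF s] sin[OF s] sin[OF s]])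
  show "smult (A2 D) (mult class_ring k l) s = smult (A2 D) k (smult (A2 D) l s)"
   by (unfold A2_simps, rule ext; (intro addc smc z s)?; simp add: smult_smult[OF sin[OF s]])
  show "smult (A2 D) (one class_ring) s = s" by (unfold A2_simps, rule ext; (intro addc smc z s)?; simp add: smult_one[OF sin[OF s]])
  assume t: "t : carrier (A2 D)"
  show "smult (A2 D) k (add (A2 D) s t) = add (A2 D) (smult (A2 D) k s) (smult (A2 D) k t)"
   by (unfold A2_simps, rule ext; (intro addc smc z s t)?; simp add: fibre_laws(6)[OF sin[OF s] sin[OF t] sin[OF t]])
 qed
 thus ?thesis unfolding vectorspace_def using class_field.field_axioms by blast
qed

lemma F_lincomb: assumes D: "sopen D" and A: "finite A" "A <= carrier (A2 D)" and z: "param c z : D"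
 shows "F c (module.lincomb (A2 D) a A) z = (\<Sum>v\<in>A. a v * F c v z)" proof -
 interpret V: vectorspace class_ring "A2 D" by (rule A2_vectorspace[OF D])
 have sin: "s (param c z) : fib (param c z)" if "s : carrier (A2 D)" for s using that z A2_iff[OF D] hol_secD(1) by blast
 show ?thesis using A proof (induction A rule: finite_induct)
  case empty
  have "V.lincomb a {} = zero (A2 D)" by (simp add: V.lincomb_def del: A2_simps)
  thus ?case using z F_restrict[OF z, of "fib_zero L"] F_zero[of c z] by (simp add: restrict_def)
 next
  case (insert v A)
  have v: "v : carrier (A2 D)" and A: "A <= carrier (A2 D)" using insert.prems by auto
  have sc: "smult (A2 D) (a w) w : carrier (A2 D)" if "w : carrier (A2 D)" for w using V.smult_closed[of "a w" w] that by (simp del: A2_simps add: class_ring_simps)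
  have "V.lincomb a (insert v A) = add (A2 D) (smult (A2 D) (a v) v) (V.lincomb a A)"
   unfolding V.lincomb_def using insert.hyps A sc v by (intro V.M.finsum_insert) (auto simp del: A2_simps)
  moreover have l: "V.lincomb a A : carrier (A2 D)" using A by (intro V.lincomb_closed) auto
  ultimately have "F c (V.lincomb a (insert v A)) z = F c (%x. fib_add L ((\<lambda>x\<in>D. smul (a v) (v x)) x) (V.lincomb a A x)) z" using F_restrict[OF z] by simp
  also have "... = F c (\<lambda>x\<in>D. smul (a v) (v x)) z + F c (V.lincomb a A) z" by (rule F_add) (use z sin[OF v] sin[OF l] in "simp_all add: smult_in")
  also have "F c (\<lambda>x\<in>D. smul (a v) (v x)) z = a v * F c v z" unfolding F_restrict[OF z] by (rule F_smult[of v c z, OF sin[OF v]])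
  finally show ?case using insert by simp
 qed
qed

end

section \<open>Localisation of positive capacity\<close>

lemma lpot_antimono_radius: assumes "0 < d'" "d' <= d" "!!w. 0 <= m w" shows "lpot P m d z <= lpot P m d' z" unfolding lpot_def
proof (intro sum_mono mult_left_mono assms(3))
 fix w
 have "ln (max (cmod (z - w)) d') <= ln (tdist d z w)" using assms(1,2) by (intro ln_mono) auto
 thus "- ln (tdist d z w) <= - ln (max (cmod (z - w)) d')" by simp
qed

text \<open>Reciprocity: the average of the first potential against the second weight equals the
  average of the second potential against the first. The former is at least I - ln 2 on F, so the
  second potential cannot stay below M on F, at any radius up to d.\<close>

lemma cap_zero_no_bounded_weights: assumes "cap_zero F"
 shows "\<exists>d>0. \<forall>d' Q q. 0 < d' & d' <= d & finite Q & Q <= F & (\<forall>w. 0 <= q w) & sum q Q = 1 --> (\<exists>z\<in>F. M < lpot Q q d' z)" proof -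
 obtain d P m I where d: "d > 0" and P: "finite P" "P <= F" "\<forall>w. 0 <= m w" "sum m P = 1" and I: "M + 2 <= I" "\<forall>z\<in>F. I - ln 2 <= lpot P m d z"
  using assms unfolding cap_zero_def by (elim allE[of _ "M + 2"] exE conjE)
 show ?thesis proof (intro exI[of _ d] conjI allI impI d, rule ccontr)
  fix d' Q q assume "0 < d' & d' <= d & finite Q & Q <= F & (\<forall>w. 0 <= q w) & sum q Q = (1::real)" and n: "~ (\<exists>z\<in>F. M < lpot Q q d' z)"
  hence d': "0 < d'" "d' <= d" and Q: "finite Q" "Q <= F" "!!w. 0 <= q w" "sum q Q = (1::real)" by simp_all
  from n have le: "lpot Q q d' z <= M" if "z : F" for z using that by force
  have "I - ln 2 = (\<Sum>v\<in>Q. q v * (I - ln 2))" using Q(4) by (simp flip: sum_distrib_right)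
  also have "... <= (\<Sum>v\<in>Q. q v * lpot P m d v)" using I(2) Q by (intro sum_mono mult_left_mono) auto
  also have "... = (\<Sum>w\<in>P. m w * lpot Q q d w)" unfolding lpot_def sum_distrib_left by (subst sum.swap) (intro sum.cong refl, simp add: norm_minus_commute mult_ac)
  also have "... <= (\<Sum>w\<in>P. m w * M)" proof (intro sum_mono mult_left_mono)
   fix w assume "w : P"
   have "lpot Q q d w <= lpot Q q d' w" by (rule lpot_antimono_radius[OF d' Q(3)])
   also have "... <= M" using le `w : P` P(2) by blast
   finally show "lpot Q q d w <= M" .
  qed (use P(3) in simp)
  also have "... = M" using P(4) by (simp flip: sum_distrib_right)
  finally show False using I(1) ln_2_less_1 by linarith
 qed
qed

text \<open>Finite subadditivity by pigeonhole. Of N small discs covering F one carries mass at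
  least 1/N; restricting a weight with bounded potential to it and normalising multiplies the bound
  on F by at most N, since all kernels are nonnegative there.\<close>

lemma not_cap_zero_local: assumes F: "compact F" "F ~= {}" "F <= cball a (1/4)" and n: "~ cap_zero F" and h: "h > 0"
 obtains b where "b : F" "~ cap_zero (F Int cball b h)" proof -
 obtain M where M: "!!d. d > 0 ==> \<exists>P m. finite P & P <= F & (\<forall>w. 0 <= m w) & sum m P = 1 & (\<forall>z. lpot P m d z <= M)"
  by (rule not_cap_zero_weights[OF F(1,2) n]) (rule that)
 obtain B where B: "finite B" "B <= F" "F <= (\<Union>b\<in>B. ball b h)" using seq_compact_imp_totally_bounded[OF F(1)[unfolded compact_eq_seq_compact_metric]] h by auto
 have Bne: "B ~= {}" using B(3) F(2) by auto
 define N where "N = real (card B)"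
 have N: "1 <= N" using Bne B(1) by (simp add: N_def Suc_leI card_gt_0_iff)
 show ?thesis proof (rule ccontr)
  assume "~ thesis"
  hence cz: "cap_zero (F Int cball b h)" if "b : B" for b using that B(2) `!!b. b : F ==> ~ cap_zero (F Int cball b h) ==> thesis` by blast
  have "\<forall>b\<in>B. \<exists>d>0. \<forall>d' Q q. 0 < d' & d' <= d & finite Q & Q <= F Int cball b h & (\<forall>w. 0 <= q w) & sum q Q = 1 --> (\<exists>z\<in>F Int cball b h. N * \<bar>M\<bar> < lpot Q q d' z)"
   using cap_zero_no_bounded_weights[OF cz] by (rule ballI)
  then obtain e where e: "\<forall>b\<in>B. 0 < e b & (\<forall>d' Q q. 0 < d' & d' <= e b & finite Q & Q <= F Int cball b h & (\<forall>w. 0 <= q w) & sum q Q = 1 --> (\<exists>z\<in>F Int cball b h. N * \<bar>M\<bar> < lpot Q q d' z))"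
   by (rule bchoice[THEN exE])
  \<comment> \<open>One radius below the thresholds of all discs, because the disc that receives
    much mass is known only after the weight has been chosen; 1/2 keeps the truncated distances
    below 1.\<close>
  define d where "d = min (1/2) (Min (e ` B))"
  have d: "0 < d" "d <= 1/2" "!!b. b : B ==> d <= e b" using e B(1) Bne by (auto simp: d_def min_le_iff_disj)
  obtain P m where P: "finite P" "P <= F" "\<forall>w. 0 <= m w" "sum m P = 1" "\<forall>z. lpot P m d z <= M" using M[OF d(1)] by (elim exE conjE)
  have "\<exists>b\<in>B. 1 / N <= sum m (P Int cball b h)" proof (rule ccontr)
   assume "~ ?thesis"
   hence "(\<Sum>b\<in>B. sum m (P Int cball b h)) < (\<Sum>b\<in>B. 1 / N)" using B(1) Bne by (intro sum_strict_mono) auto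
   also have "... = 1" using N by (simp add: N_def)
   finally have lt: "(\<Sum>b\<in>B. sum m (P Int cball b h)) < 1" .
   have "sum m P = (\<Sum>w\<in>P. m w * 1)" by simp
   also have "... <= (\<Sum>w\<in>P. m w * (\<Sum>b\<in>B. indicator (cball b h) w))" proof (intro sum_mono mult_left_mono)
    fix w assume "w : P"
    then obtain b where b: "b : B" "w : ball b h" using P(2) B(3) by blast
    have "1 = (indicator (cball b h) w :: real)" using b(2) by simp
    also have "... <= (\<Sum>b\<in>B. indicator (cball b h) w)" by (rule member_le_sum[OF b(1)]) (simp_all add: B(1))
    finally show "1 <= (\<Sum>b\<in>B. indicator (cball b h) w :: real)" .
   qed (use P(3) in simp)
   also have "... = (\<Sum>b\<in>B. sum m (P Int cball b h))" proof -
    have "(\<Sum>w\<in>P. m w * indicator (cball b h) w) = sum m (P Int cball b h)" for b by (rule sum.mono_neutral_cong_right) (use P(1) in auto)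
    thus ?thesis unfolding sum_distrib_left by (subst sum.swap) simp
   qed
   finally show False using lt P(4) by simp
  qed
  then obtain b where b: "b : B" "1 / N <= sum m (P Int cball b h)" by blast
  let ?Q = "P Int cball b h"
  define u where "u = sum m ?Q"
  have u: "0 < u" "1 / u <= N" proof -
   have "0 < 1 / N" using N by simp
   thus "0 < u" using b(2) unfolding u_def by linarith
   thus "1 / u <= N" using b(2) N by (simp add: u_def field_simps)
  qed
  have "\<exists>z\<in>F Int cball b h. N * \<bar>M\<bar> < lpot ?Q (%w. m w / u) d z" proof (rule e[rule_format, OF b(1), THEN conjunct2, rule_format], intro conjI allI)
   show "(\<Sum>w\<in>?Q. m w / u) = 1" using u(1) by (simp add: u_def flip: sum_divide_distrib)
  qed (use d b P u in auto)
  then obtain z where z: "z : F" "N * \<bar>M\<bar> < lpot ?Q (%w. m w / u) d z" by blast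
  have nn: "0 <= m w * - ln (tdist d z w)" if "w : P" for w proof -
   have "dist a z <= 1/4" "dist a w <= 1/4" using F(3) z(1) that P(2) by auto
   hence "dist z w <= 1" using dist_triangle[of z w a] by (simp add: dist_commute)
   hence "tdist d z w <= 1" "0 < tdist d z w" using d by (auto simp: dist_norm less_max_iff_disj)
   hence "ln (tdist d z w) <= 0" using ln_le_zero_iff by blast
   thus ?thesis using P(3) by (intro mult_nonneg_nonneg) auto
  qed
  have "lpot ?Q (%w. m w / u) d z = 1 / u * (\<Sum>w\<in>?Q. m w * - ln (tdist d z w))" unfolding lpot_def sum_distrib_left by (intro sum.cong refl) simp
  also have "... <= 1 / u * lpot P m d z" unfolding lpot_def using u(1) P(1) nn by (intro mult_left_mono sum_mono2) auto
  also have "... <= 1 / u * \<bar>M\<bar>" using u(1) P(5) abs_ge_self[of M] by (intro mult_left_mono) (auto intro: order_trans)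
  also have "... <= N * \<bar>M\<bar>" using u(2) by (intro mult_right_mono) auto
  finally show False using z(2) by simp
 qed
qed

section \<open>Infinite dimension of the Bergman space\<close>

context framed_bundle begin

text \<open>As 1 < R r, the disc of radius R in one chart and the disc of radius r in the other
  cover the sphere. The part of the second unit disc outside radius r is transported from a ring of
  the first chart.\<close>

lemma A2I: assumes D: "sopen D" and s: "hol_sec D s" and R: "1 < R" "0 < r" "1 < R * r" and L2: "L2_at D s c R" "L2_at D s (opp c) r"
 shows "restrict s D : carrier (A2 D)" proof -
 let ?c' = "opp c"
 note op = open_param[OF D]
 have cF: "continuous_on (param c -` D) (%z. (cmod (F c s z))^2)" for c by (intro continuous_intros hol_cont[OF F_holomorphic[OF D s]])
 \<comment> \<open>Inversion takes this ring to 1/R < |w| < 2, which contains all w with r < |w| <=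
   1. On the ring the transition factor z^d is bounded.\<close>
 define A where "A = param c -` D Int {z. 1/2 < cmod z & cmod z < R}"
 have oA: "open A" unfolding A_def by (intro open_Int op open_Collect_conj open_Collect_less continuous_intros)
 have nz: "z ~= 0" if "z : A" for z using that by (auto simp: A_def)
 have pinv: "param ?c' (inverse z) = param c z" if "z ~= 0" for z using param_other[of "inverse z" c] that by simp
 define u where "u v = indicator (param ?c' -` D) v *\<^sub>R (cmod (F ?c' s v))^2" for v
 have u: "u : borel_measurable borel" unfolding u_def by (intro borel_measurable_continuous_on_indicator cF) (use op in simp)
 have u0: "0 <= u v" for v by (simp add: u_def)
 have uz: "u (inverse z) = (cmod (z powi d))^2 * (cmod (F c s z))^2" if "z : A" for z
  using F_other[OF nz[OF that], of s c] hol_secD(1)[OF s, of "param c z"] that pinv[OF nz[OF that]] by (simp add: u_def A_def norm_mult power_mult_distrib)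
 have "continuous_on (cball 0 R - ball 0 (1/2)) (%z. cmod (z powi d))" by (intro continuous_intros) auto
 moreover have "compact (cball (0::complex) R - ball 0 (1/2))" by (intro compact_diff) auto
 ultimately have "bounded ((%z. cmod (z powi d)) ` (cball 0 R - ball 0 (1/2)))" using compact_continuous_image compact_imp_bounded by blast
 then obtain B where B: "\<forall>x\<in>(%z. cmod (z powi d)) ` (cball 0 R - ball 0 (1/2)). norm x <= B" unfolding bounded_iff by blast
 have B: "cmod (z powi d) <= \<bar>B\<bar>" if "z : A" for z proof -
  have "z : cball 0 R - ball 0 (1/2)" using that by (auto simp: A_def)
  thus ?thesis using B by force
 qed
 have fin: "nnint A (%z. (cmod (inverse z)) ^ 4 * u (inverse z)) < \<infinity>" proof (rule nnint_finite_mono[OF _ _ _ _ _ L2(1)[unfolded L2_at_def]])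
  show "A <= param c -` D Int cball 0 R" by (auto simp: A_def)
  show "continuous_on (param c -` D Int cball 0 R) (%z. (cmod (F c s z))^2)" by (rule continuous_on_subset[OF cF]) simp
  fix z assume z: "z : A"
  have "cmod (inverse z) <= 2" using less_norm_inverse_iff[of z 2] nz[OF z] z by (force simp: A_def)
  hence "(cmod (inverse z)) ^ 4 * (cmod (z powi d))^2 <= 2 ^ 4 * \<bar>B\<bar>^2" using B[OF z] by (intro mult_mono power_mono) auto
  from mult_right_mono[OF this, of "(cmod (F c s z))^2"]
  show "(cmod (inverse z)) ^ 4 * u (inverse z) <= 2 ^ 4 * \<bar>B\<bar>^2 * (cmod (F c s z))^2" by (simp add: uz[OF z] mult.assoc)
 qed (use op in auto)
 have i: "nnint (inverse ` A) u < \<infinity>" by (rule inverse_change_of_variables[THEN iffD1, OF u u0 oA _ fin]) (auto simp: A_def)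
 have mS: "inverse ` A : sets borel" proof -
  have "inverse ` A = inverse -` A" proof (intro equalityI subsetI)
   fix w assume "w : inverse -` A"
   thus "w : inverse ` A" by (intro image_eqI[of _ _ "inverse w"]) auto
  qed auto
  thus ?thesis using measurable_sets[of "inverse :: complex => complex" borel borel A] oA by simp
 qed
 have iA: "inverse ` A <= param ?c' -` D" using pinv nz by (auto simp: A_def)
 have "nnint (inverse ` A) u = nnint (inverse ` A) (%z. (cmod (F ?c' s z))^2)" using iA by (intro nn_integral_cong) (auto simp: u_def indicator_def)
 note fin' = i[unfolded this]
 have 1: "L2_at D s ?c' 1" proof -
  show ?thesis unfolding L2_at_def
  proof (rule nn_integral_finite_Un[OF _ _ L2(2)[unfolded L2_at_def] mS _ fin'], use op in simp, rule continuous_on_subset[OF cF], simp, rule continuous_on_subset[OF cF iA], rule subsetI)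
   fix z assume that: "z : param ?c' -` D Int cball 0 1"
   show "z : param ?c' -` D Int cball 0 r Un inverse ` A" proof (cases "cmod z <= r")
   case False
   hence z: "z ~= 0" using R by auto
   have "1 / R < r" using R by (simp add: field_simps)
   hence "1 / R < cmod z" "cmod z < 2" using False that by auto
   hence "cmod (inverse z) < R" "1/2 < cmod (inverse z)" using norm_inverse_less_iff[of z "1 / R"] less_norm_inverse_iff[of z "1/2"] z R by auto
   hence "inverse z : A" using that pinv[of "inverse z"] z by (simp add: A_def)
   thus ?thesis by (intro UnI2 image_eqI[of _ _ "inverse z"]) auto
  qed (use that in auto)
  qed
 qed
 have 0: "L2_at D s c 1" unfolding L2_at_def proof (rule le_less_trans[OF _ L2(1)[unfolded L2_at_def]])
  show "nnint (param c -` D Int cball 0 1) (%z. (cmod (F c s z))^2) <= nnint (param c -` D Int cball 0 R) (%z. (cmod (F c s z))^2)"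
   using R(1) by (intro nn_integral_mono mult_left_mono) (auto simp: indicator_def)
 qed
 have "L2_at D s b 1" for b using chart_cases[of b c] 0 1 by auto
 thus ?thesis using s unfolding A2_iff[OF D] by simp
qed

lemma L2_at_bounded: assumes D: "sopen D" and S: "compact S" "param c -` D Int cball 0 R <= S" and f: "continuous_on S f"
  and eq: "!!z. z : param c -` D ==> F c s z = f z" shows "L2_at D s c R" unfolding L2_at_def proof (rule le_less_trans)
 show "nnint S (%z. (cmod (f z))^2) < \<infinity>" by (intro nn_integral_finite_compact S continuous_intros f)
 show "nnint (param c -` D Int cball 0 R) (%z. (cmod (F c s z))^2) <= nnint S (%z. (cmod (f z))^2)" using S(2) eq by (intro nn_integral_mono) (auto simp: indicator_def)
qed

lemma hol_sec_chart: assumes S: "open S" and f: "f holomorphic_on S" shows "hol_sec (param c ` S) (%x. smul (f (coord c x)) (e c x))" proof (rule hol_sec_smult)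
 have o: "sopen (param c ` S)" by (rule sopen_image[OF S])
 show "hol_sec (param c ` S) (e c)" by (rule hol_sec_subset[OF frameD(2)[OF frame_e[of c]]]) auto
 show "sphere_holomorphic_on (%x. f (coord c x)) (param c ` S)" by (rule sphere_holomorphic_on_chartI[OF _ o]) (use f in "auto simp: comp_def")
qed

text \<open>The order of vanishing at infinity separates the terms.\<close>

lemma leading_terms_independent:
 fixes g :: "nat => complex => complex" assumes J: "finite J" and g: "!!j. isCont (g j) 0" "!!j. g j 0 ~= 0" and 0: "\<forall>\<^sub>F z in at 0. (\<Sum>j\<in>J. a j * (z ^ j * g j z)) = 0"
 shows "j : J ==> a j = 0" proof (rule ccontr)
 assume j: "j : J" "a j ~= 0"
 define k where "k = (LEAST j. j : J & a j ~= 0)"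
 have k: "k : J" "a k ~= 0" using LeastI[of "%j. j : J & a j ~= 0" j] j by (simp_all add: k_def)
 have low: "a i = 0" if "i : J" "i < k" for i using not_less_Least[of i "%j. j : J & a j ~= 0"] that by (auto simp: k_def)
 let ?h = "%z. \<Sum>i\<in>J. a i * (z ^ (i - k) * g i z)"
 have "\<forall>\<^sub>F z in at 0. ?h z = 0" using 0 eventually_neq_at_within[of 0 0 UNIV]
 proof eventually_elim
  case (elim z)
  have "(\<Sum>i\<in>J. a i * (z ^ i * g i z)) = z ^ k * ?h z" unfolding sum_distrib_left proof (intro sum.cong refl)
   fix i assume "i : J"
   show "a i * (z ^ i * g i z) = z ^ k * (a i * (z ^ (i - k) * g i z))" proof (cases "i < k")
    case False
    hence "z ^ i = z ^ k * z ^ (i - k)" by (simp flip: power_add)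
    thus ?thesis by simp
   qed (simp add: low[OF `i : J`])
  qed
  thus ?case using elim by simp
 qed
 hence "(?h \<longlongrightarrow> 0) (at 0)" by (rule tendsto_eventually)
 moreover have "isCont ?h 0" by (intro continuous_intros g)
 hence "(?h \<longlongrightarrow> ?h 0) (at 0)" by (simp add: isCont_def)
 ultimately have "?h 0 = 0" using LIM_unique by blast
 moreover have "?h 0 = (\<Sum>i\<in>J. if i = k then a k * g k 0 else 0)" proof (intro sum.cong refl)
  fix i assume "i : J"
  thus "a i * (0 ^ (i - k) * g i 0) = (if i = k then a k * g k 0 else 0)" using low[of i] by (cases "i < k"; cases "i = k") auto
 qed
 ultimately show False using J k g(2)[of k] by simp
qed

end

context framed_bundle begin

text \<open>The Cauchy transforms are coordinates of sections, since their zeros at infinity absorb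
  the factor z^d. Independence has to be seen on D, of which only a small disc may be at hand;
  therefore F0 is first replaced by a part inside a disc of radius u whose connected complement
  meets that small disc.\<close>

lemma A2_infinite_dimensional: assumes D: "sopen D" "D ~= {}"
  and F0: "compact F0" "F0 ~= {}" "F0 <= cball a (1/4)" "~ cap_zero F0" "D Int param c ` F0 = {}" shows "~ vectorspace.fin_dim class_ring (A2 D)"
proof
 let ?c' = "opp c"
 have op: "open (param c -` D)" for c using D(1) openin_sphere_iff by blast
 have pinv: "param ?c' (inverse z) = param c z" if "z ~= 0" for z using param_other[of "inverse z" c] that by simp
 have "\<exists>q. param c q : D" proof -
  obtain x where x: "x : D" using D(2) by blast
  show ?thesis proof (cases "x = param ?c' 0")
   case True
   hence "0 : param ?c' -` D" using x by simp
   then obtain ep where ep: "ep > 0" "ball 0 ep <= param ?c' -` D" using op[of ?c'] openE by blast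
   have "complex_of_real (ep/2) : ball 0 ep" using ep(1) by simp
   hence "param ?c' (complex_of_real (ep/2)) : D" using ep(2) by blast
   thus ?thesis using param_other[of "complex_of_real (ep/2)" c] ep(1) by (intro exI[of _ "inverse (complex_of_real (ep/2))"]) simp
  next
   case False
   thus ?thesis using in_range_param[of x c] x by auto
  qed
 qed
 then obtain q where "q : param c -` D" by auto
 then obtain rh where rh: "rh > 0" "ball q rh <= param c -` D" using op[of c] openE by blast
 \<comment> \<open>With u < rh the point q lies outside the disc of radius u about any b of F0,
   since otherwise b would lie over D.\<close>
 define u where "u = min (rh/2) (1/4)"
 have u: "0 < u" "u < rh" "u <= 1/4" using rh by (auto simp: u_def)
 obtain b where b: "b : F0" "~ cap_zero (F0 Int cball b u)" by (rule not_cap_zero_local[OF F0(1-4) u(1)]) (rule that)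
 define F' where "F' = F0 Int cball b u"
 have F': "compact F'" "F' ~= {}" "F' <= cball b (1/4)" "F' <= cball b u" "~ cap_zero F'" using F0(1) b u by (auto simp: F'_def intro: compact_Int_closed)
 have DF: "z ~: F'" if "param c z : D" for z using that F0(5) by (auto simp: F'_def)
 have qb: "u < dist b q" proof (rule ccontr)
  assume "~ u < dist b q"
  hence "b : ball q rh" using u(2) by (simp add: dist_commute)
  hence "param c b : D" using rh(2) by blast
  thus False using F0(5) b(1) by blast
 qed
 obtain f h :: "nat => complex => complex" where fh: "!!j. f j holomorphic_on - F'" "!!j. h j holomorphic_on {y. \<forall>w\<in>F'. w * y ~= 1}" "!!j. h j 0 ~= 0"
  "!!j z. z ~: F' ==> z ~= 0 ==> f j z = inverse z ^ Suc j * h j (inverse z)" "!!j. (nnint (cball b (3/4) - F') (%z. (cmod (f j z))^2)) < \<infinity>"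
  by (rule not_cap_zero_holomorphic_sequence[OF F'(1,2,3,5)]) (rule that)
 let ?S2 = "{y. \<forall>w\<in>F'. w * y ~= 1}"
 have oF: "open (- F')" using F'(1) compact_imp_closed by blast
 have S2: "?S2 = param ?c' -` (- param c ` F')" proof (intro equalityI subsetI)
  fix y assume y: "y : ?S2"
  show "y : param ?c' -` (- param c ` F')" proof (rule vimageI2, rule ComplI)
   assume "param ?c' y : param c ` F'"
   then obtain w where w: "w : F'" "param ?c' y = param c w" by auto
   hence "y ~= 0" using param_other_0[of c] by (metis rangeI)
   hence "w = inverse y" using w(2) param_other[of y c] by simp
   thus False using y w(1) `y ~= 0` by auto
  qed
 next
  fix y assume y: "y : param ?c' -` (- param c ` F')"
  show "y : ?S2" proof (intro CollectI ballI notI)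
   fix w assume w: "w : F'" "w * y = 1"
   hence z: "y ~= 0" by auto
   hence "w = inverse y" using w(2) by (simp add: field_simps)
   thus False using y w(1) param_other[OF z, of c] by auto
  qed
 qed
 have "sopen (- param c ` F')" using image_compactin[OF _ continuous_map_param, of F' c] F'(1) sphere_compact_iff by simp
 hence oS2: "open ?S2" by (simp add: openin_sphere_iff S2)
 \<comment> \<open>The shift of the index by N0 makes the exponent i + N0 + 1 - d of the second
   coordinate nonnegative for all i.\<close>
 define N0 where "N0 = nat d"
 define m0 where "m0 = nat (int N0 + 1 - d)"
 have m0: "int m0 = int N0 + 1 - d" by (simp add: m0_def N0_def)
 define g where "g i y = y ^ (i + m0) * h (i + N0) y" for i y
 have g: "g i holomorphic_on ?S2" for i unfolding g_def[abs_def] by (intro holomorphic_intros fh(2))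
 let ?D1 = "param c ` (- F')" and ?D2 = "param ?c' ` ?S2"
 define t where "t i x = (if x : ?D1 then smul (f (i + N0) (coord c x)) (e c x) else smul (g i (coord ?c' x)) (e ?c' x))" for i x
 have agree: "smul (f (i + N0) (coord c x)) (e c x) = smul (g i (coord ?c' x)) (e ?c' x)" if x: "x : ?D1" "x : ?D2" for i x proof -
  obtain z where z: "x = param c z" "z ~: F'" using x(1) by auto
  obtain y where y: "x = param ?c' y" using x(2) by auto
  have y0: "y ~= 0" using param_other_0[of c] y z(1) by (metis rangeI)
  hence zy: "z = inverse y" using param_other[OF y0, of c] y z(1) by simp
  hence z0: "z ~= 0" using y0 by simp
  have i: "e ?c' x : fib x" using e(1)[of ?c' y] y by simp
  have "z powi d = y powi (- d)" unfolding zy using y0 by (simp add: power_int_inverse power_int_minus)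
  hence "y ^ Suc (i + N0) * z powi d = y powi (int (Suc (i + N0)) + (- d))" by (subst power_int_add[OF disjI1[OF y0]]) (simp only: power_int_of_nat)
  also have "int (Suc (i + N0)) + (- d) = int (i + m0)" using m0 by simp
  finally have pw: "y ^ Suc (i + N0) * z powi d = y ^ (i + m0)" unfolding power_int_of_nat .
  have "f (i + N0) z = y ^ Suc (i + N0) * h (i + N0) y" using fh(4)[OF z(2) z0, of "i + N0"] zy by simp
  hence "f (i + N0) z * z powi d = (y ^ Suc (i + N0) * z powi d) * h (i + N0) y" by (simp only: mult_ac)
  hence "f (i + N0) z * z powi d = g i y" unfolding pw g_def .
  thus ?thesis using transition[OF z0, of c] smult_smult[OF i] z(1) y by (metis coord_param)
 qed
 have h1: "hol_sec ?D1 (%x. smul (f (i + N0) (coord c x)) (e c x))" for i by (rule hol_sec_chart[OF oF fh(1)])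
 have h2: "hol_sec ?D2 (%x. smul (g i (coord ?c' x)) (e ?c' x))" for i by (rule hol_sec_chart[OF oS2 g])
 have DD: "D <= ?D1 Un ?D2"
 proof
  fix x assume x: "x : D"
  show "x : ?D1 Un ?D2" proof (cases "x = param ?c' 0")
   case False
   then obtain z where "x = param c z" using in_range_param by blast
   thus ?thesis using DF[of z] x by auto
  qed simp
 qed
 have t: "hol_sec D (t i)" for i unfolding t_def by (rule hol_sec_subset[OF _ DD], rule hol_sec_glue)
   (rule sopen_image[OF oF] sopen_image[OF oS2] h1 h2 agree | assumption)+
 have Fc: "F c (t i) z = f (i + N0) z" if "z ~: F'" for i z by (rule F_eqI) (use that in "simp add: t_def")
 have Fc': "F ?c' (t i) y = g i y" if "y : ?S2" for i y proof (rule F_eqI)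
  show "t i (param ?c' y) = smul (g i y) (e ?c' (param ?c' y))" using agree[of "param ?c' y" i] that by (simp add: t_def)
 qed
 define s where "s i = restrict (t i) D" for i
 \<comment> \<open>Points of F' have modulus at most |b| + 1/4, so the disc of radius
   \<open>?r\<close> in the other chart avoids their inverses, and \<open>?R\<close> times
   \<open>?r\<close> exceeds 1.\<close>
 let ?R = "cmod b + 2" and ?r = "1 / (cmod b + 1)"
 have sA: "s i : carrier (A2 D)" for i unfolding s_def proof (rule A2I[OF D(1) t])
  have "0 < cmod b + 1" using norm_ge_zero[of b] by linarith
  thus "1 < ?R" "0 < ?r" "1 < ?R * ?r" by (simp_all add: field_simps)
  have sub: "cball 0 ?r <= ?S2" proof (intro subsetI CollectI ballI notI)
   fix y w assume y: "y : cball 0 ?r" and w: "w : F'" "w * y = 1"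
   have "cmod w <= cmod b + 1/4" using F'(3) w(1) norm_triangle_ineq2[of w b] by (force simp: dist_norm norm_minus_commute)
   hence "cmod w * cmod y <= (cmod b + 1/4) * ?r" using y by (intro mult_mono) auto
   also have "... < 1" using `0 < cmod b + 1` by (simp add: field_simps)
   finally show False using w(2) by (simp flip: norm_mult)
  qed
  show "L2_at D (t i) ?c' ?r" proof (rule L2_at_bounded[OF D(1) compact_cball])
   show "continuous_on (cball 0 ?r) (g i)" by (rule continuous_on_subset[OF hol_cont[OF g] sub])
   fix y assume "y : param ?c' -` D"
   hence "y : ?S2" unfolding S2 using DF by auto
   thus "F ?c' (t i) y = g i y" by (rule Fc')
  qed simp
  let ?f = "f (i + N0)"
  let ?A = "cball b (3/4) - F'" and ?B = "cball 0 ?R - ball b (1/2)"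
  have BF: "?B <= - F'" using F'(3) by auto
  have cf: "continuous_on (- F') (%z. (cmod (?f z))^2)" by (intro continuous_intros hol_cont fh(1))
  have cB: "compact ?B" by (intro compact_diff) auto
  have "nnint (param c -` D Int cball 0 ?R) (%z. (cmod (F c (t i) z))^2) = nnint (param c -` D Int cball 0 ?R) (%z. (cmod (?f z))^2)"
   using Fc DF by (intro nn_integral_cong) (auto simp: indicator_def)
  also have "... < \<infinity>" by (rule nn_integral_finite_Un[OF _ continuous_on_subset[OF cf] fh(5)[of "i + N0"] _ continuous_on_subset[OF cf BF]
      nn_integral_finite_compact[OF cB continuous_on_subset[OF cf BF]]]) (use F'(1) DF in "auto simp: borel_compact")
  finally show "L2_at D (t i) c ?R" unfolding L2_at_def .
 qed
 have Fs: "F c (s i) z = f (i + N0) z" if "z : ball q rh" for i z proof -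
  have "param c z : D" using that rh(2) by blast
  thus ?thesis using Fc[OF DF] by (simp add: s_def)
 qed
 have indep: "\<forall>i\<in>J. A i = 0" if J: "finite J" and 0: "!!z. z : ball q rh ==> (\<Sum>i\<in>J. A i * F c (s i) z) = 0" for J A
 proof
  fix j assume j: "j : J"
  let ?W = "- cball b u"
  define p where "p z = (\<Sum>i\<in>J. A i * f (i + N0) z)" for z
  have WF: "?W <= - F'" using F'(4) by blast
  have p: "p holomorphic_on ?W" unfolding p_def[abs_def] by (intro holomorphic_intros holomorphic_on_subset[OF fh(1) WF])
  have "connected ?W" by (rule connected_complement_bounded_convex) simp_all
  \<comment> \<open>Identity theorem on the connected complement of the disc about b: the relation
    valid near q holds up to infinity, where the orders of vanishing differ.\<close>
  have z0: "p z = 0" if "z : ?W" for z proof (rule analytic_continuation_open[of "ball q rh Int ?W" ?W p "%_. 0"])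
   have "q : ball q rh Int ?W" using qb rh(1) by simp
   thus "ball q rh Int ?W ~= {}" by (metis empty_iff)
   show "p z = 0" if "z : ball q rh Int ?W" for z using 0[of z] Fs[of z] that by (simp add: p_def)
  qed (use p `connected ?W` that in auto)
  let ?r = "1 / (cmod b + u)"
  have pos: "0 < cmod b + u" using u(1) norm_ge_zero[of b] by linarith
  have "(\<Sum>i\<in>J. A i * (y ^ i * h (i + N0) y)) = 0" if y: "y ~= 0" "dist y 0 < ?r" for y proof -
   have "cmod b + u < cmod (inverse y)" using less_norm_inverse_iff[OF y(1) pos] y(2) by simp
   hence W: "inverse y : ?W" using norm_triangle_ineq2[of "inverse y" b] by (auto simp: dist_norm norm_minus_commute)
   hence "inverse y ~: F'" using WF by blast
   from fh(4)[OF this] y(1) have "f j (inverse y) = y ^ Suc j * h j y" for j by simp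
   hence "0 = (\<Sum>i\<in>J. A i * (y ^ Suc (i + N0) * h (i + N0) y))" using z0[OF W] by (simp add: p_def)
   also have "... = y ^ Suc N0 * (\<Sum>i\<in>J. A i * (y ^ i * h (i + N0) y))" unfolding sum_distrib_left by (intro sum.cong refl) (simp add: power_add mult_ac)
   finally show ?thesis using y(1) by simp
  qed
  hence "\<forall>\<^sub>F y in at 0. (\<Sum>i\<in>J. A i * (y ^ i * h (i + N0) y)) = 0" unfolding eventually_at using pos by (intro exI[of _ ?r]) simp
  moreover have "isCont (h k) 0" for k by (rule continuous_on_eq_continuous_at[OF oS2, THEN iffD1, OF hol_cont[OF fh(2)], THEN bspec]) simp
  ultimately show "A j = 0" using leading_terms_independent[OF J, of "%i. h (i + N0)" A j] fh(3) j by blast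
 qed
 have inj: "inj s" proof (rule injI, rule ccontr)
  fix i j assume ij: "s i = s j" "i ~= j"
  have "(\<Sum>k\<in>{i, j}. (if k = i then 1 else - 1) * F c (s k) z) = 0" for z using ij by simp
  from indep[OF _ this] show False by auto
 qed
 interpret V: vectorspace class_ring "A2 D" by (rule A2_vectorspace[OF D(1)])
 have "V.lin_indpt (range s)"
 proof
  assume "V.lin_dep (range s)"
  then obtain A al v where A: "finite A" "A <= range s" "V.lincomb al A = zero (A2 D)" "v : A" "al v ~= 0"
   unfolding V.lin_dep_def by (auto simp: class_ring_simps simp del: A2_simps)
  define J where "J = s -` A"
  have J: "finite J" unfolding J_def by (rule finite_vimageI[OF A(1) inj])
  have AJ: "A = s ` J" using A(2) by (auto simp: J_def)
  have "(\<Sum>i\<in>J. al (s i) * F c (s i) z) = 0" if z: "z : ball q rh" for z proof -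
   have zD: "param c z : D" using z rh(2) by blast
   have Ac: "A <= carrier (A2 D)" using A(2) sA by auto
   have "(\<Sum>i\<in>J. al (s i) * F c (s i) z) = (\<Sum>v\<in>A. al v * F c v z)" unfolding AJ using inj by (subst sum.reindex) (auto simp: inj_on_def dest: injD)
   also have "... = F c (zero (A2 D)) z" using F_lincomb[OF D(1) A(1) Ac zD, of al] A(3) by simp
   also have "... = 0" using zD F_restrict[OF zD, of "fib_zero L"] F_zero[of c z] by (simp add: restrict_def)
   finally show ?thesis .
  qed
  from indep[OF J this] have "\<forall>i\<in>J. al (s i) = 0" .
  thus False using A(4,5) AJ by auto
 qed
 moreover have "range s <= carrier (A2 D)" using sA by auto
 moreover assume "V.fin_dim"
 ultimately have "finite (range s)" by (intro V.fin_dim_li_fin)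
 thus False using range_inj_infinite[OF inj] by simp
qed

end

section \<open>Global sections as polynomials\<close>

context framed_bundle begin

lemma section_of_coordinates: assumes f: "f0 holomorphic_on UNIV" "f1 holomorphic_on UNIV" and eq: "!!z. z ~= 0 ==> f1 (inverse z) = z powi d * f0 z"
 obtains t where "hol_sec UNIV t" "F At_Zero t = f0" "F At_Infinity t = f1" proof -
 let ?D0 = "range (param At_Zero)" and ?D1 = "range (param At_Infinity)"
 let ?t0 = "%x. smul (f0 (coord At_Zero x)) (e At_Zero x)" and ?t1 = "%x. smul (f1 (coord At_Infinity x)) (e At_Infinity x)"
 define t where "t x = (if x : ?D0 then ?t0 x else ?t1 x)" for x
 have agree: "?t0 x = ?t1 x" if x: "x : ?D0" "x : ?D1" for x proof -
  obtain z where z: "x = param At_Zero z" using x(1) by (rule rangeE)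
  obtain v where v: "x = param At_Infinity v" using x(2) by (rule rangeE)
  have v0: "v ~= 0" using z v by auto
  hence zv: "v = inverse z" and z0: "z ~= 0" using z v by auto
  have i: "e At_Infinity x : fib x" using e(1)[of At_Infinity v] v by simp
  have e0: "e At_Zero x = smul (z powi d) (e At_Infinity x)" using transition[OF z0, of At_Zero] z by simp
  have c0: "coord At_Zero x = z" unfolding z by (rule coord_param)
  have c1: "coord At_Infinity x = v" unfolding v by (rule coord_param)
  show ?thesis unfolding e0 c0 c1 smult_smult[OF i] using eq[OF z0] zv by (simp add: mult.commute)
 qed
 have h: "hol_sec ?D0 ?t0" "hol_sec ?D1 ?t1" using hol_sec_chart[of UNIV f0 At_Zero] hol_sec_chart[of UNIV f1 At_Infinity] f by simp_all
 have o: "sopen (range (param c))" for c using sopen_image[of UNIV c] by simp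
 have "hol_sec (?D0 Un ?D1) t" unfolding t_def by (rule hol_sec_glue) (rule o h agree | assumption)+
 moreover have "?D0 Un ?D1 = UNIV" proof -
  have "x : ?D0 \<or> x : ?D1" for x using in_range_param[of x At_Zero] by auto
  thus ?thesis by blast
 qed
 ultimately have "hol_sec UNIV t" by simp
 moreover have "F At_Zero t z = f0 z" for z by (rule F_eqI) (simp only: t_def rangeI if_True coord_param)
 moreover have "F At_Infinity t z = f1 z" for z proof (rule F_eqI)
  show "t (param At_Infinity z) = smul (f1 z) (e At_Infinity (param At_Infinity z))"
   using agree[of "param At_Infinity z"] unfolding t_def coord_param by (simp only: rangeI) simp
 qed
 ultimately show ?thesis by (intro that) auto
qed

text \<open>Chart c misses a single point, and there the coordinates in the other chart agree by
  continuity.\<close>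

lemma section_eqI: assumes D: "sopen D" and s: "hol_sec D s" and t: "hol_sec D t" and eq: "!!z. param c z : D ==> F c s z = F c t z" and x: "x : D"
 shows "s x = t x" proof -
 have off: "s x = t x" if x: "x : D" "x : range (param c)" for x proof -
  obtain z where z: "x = param c z" using x(2) by (rule rangeE)
  have "s x = smul (F c s z) (e c x)" using smult_F[of s c z] hol_secD(1)[OF s x(1)] z by simp
  also have "... = smul (F c t z) (e c x)" using eq[of z] x(1) z by simp
  also have "... = t x" using smult_F[of t c z] hol_secD(1)[OF t x(1)] z by simp
  finally show ?thesis .
 qed
 show ?thesis proof (cases "x : range (param c)")
  case False
  let ?c' = "opp c"
  have x0: "x = param ?c' 0" using False in_range_param by blast
  note op = open_param[OF D]
  have "F ?c' s z = F ?c' t z" if "z : param ?c' -` D" "z ~= 0" for z using off[of "param ?c' z"] param_other[OF that(2), of c] that(1) by (simp add: F_def)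
  hence ev: "\<forall>\<^sub>F z in at 0. F ?c' s z = F ?c' t z" unfolding eventually_at_topological using op x x0 by blast
  have cont: "isCont (F ?c' u) 0" if "hol_sec D u" for u
   by (rule continuous_on_eq_continuous_at[OF op, THEN iffD1, OF hol_cont[OF F_holomorphic[OF D that]], THEN bspec]) (use x x0 in simp)
  have "F ?c' s \<midarrow>0\<rightarrow> F ?c' t 0" using cont[OF t] ev unfolding isCont_def by (simp add: tendsto_cong)
  hence "F ?c' s 0 = F ?c' t 0" using cont[OF s] unfolding isCont_def by (rule LIM_unique[rotated])
  thus ?thesis using smult_F[of s ?c' 0] smult_F[of t ?c' 0] hol_secD(1)[OF s x] hol_secD(1)[OF t x] x0 by simp
 qed (use off x in blast)
qed

text \<open>The second coordinate is bounded near infinity, so the first grows at most like |z|^(-d)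
  and Liouville's theorem applies. For d > 0 the index set is empty: the first coordinate is
  constant and tends to 0.\<close>

lemma global_section_polynomial: assumes t: "hol_sec UNIV t" obtains b where "!!z. F At_Zero t z = (\<Sum>k | int k <= - d. b k * z ^ k)" proof -
 let ?f0 = "F At_Zero t" and ?f1 = "F At_Infinity t"
 have f0: "?f0 holomorphic_on UNIV" and f1: "?f1 holomorphic_on UNIV" using F_holomorphic[OF openin_topspace[of riemann_sphere, unfolded topspace_sphere] t, of At_Zero]
   F_holomorphic[OF openin_topspace[of riemann_sphere, unfolded topspace_sphere] t, of At_Infinity] by simp_all
 have "compact (?f1 ` cball 0 1)" using hol_cont[OF f1] by (intro compact_continuous_image) (auto elim: continuous_on_subset)
 then obtain B where B: "\<forall>x\<in>?f1 ` cball 0 1. cmod x <= B" using compact_imp_bounded bounded_iff by metis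
 hence B0: "0 <= B" using norm_ge_zero[of "?f1 0"] by (meson centre_in_cball image_eqI order_trans zero_le_one)
 have le: "cmod (?f0 z) <= B * cmod (z powi (- d))" if "1 <= cmod z" for z proof -
  have z: "z ~= 0" using that by auto
  have "inverse z : cball 0 1" using that by (simp add: norm_inverse inverse_le_1_iff)
  hence b: "cmod (?f1 (inverse z)) <= B" using B by blast
  have "?f1 (inverse z) = z powi d * ?f0 z" using F_other[OF z, of t At_Zero] hol_secD(1)[OF t] by simp
  hence "?f0 z = ?f1 (inverse z) * z powi (- d)" using z by (simp add: power_int_minus)
  thus ?thesis using mult_right_mono[OF b, of "cmod (z powi (- d))"] by (simp add: norm_mult)
 qed
 define n where "n = nat (- d)"
 have "cmod (?f0 z) <= B * cmod z ^ n" if "1 <= cmod z" for z proof -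
  have "cmod (z powi (- d)) <= cmod z ^ n" proof (cases "d <= 0")
   case True
   hence "- d = int n" by (simp add: n_def)
   thus ?thesis by (simp add: norm_power)
  next
   case False
   have "cmod z powi (- d) <= 1" using False that by (simp add: norm_power_int power_int_minus inverse_le_1_iff one_le_power_int)
   thus ?thesis using False by (simp add: n_def norm_power_int)
  qed
  from mult_left_mono[OF this B0] show ?thesis using le[OF that] by linarith
 qed
 from Liouville_polynomial[OF f0, of 1 B n, OF this]
 have poly: "?f0 z = (\<Sum>k\<le>n. (deriv ^^ k) ?f0 0 / fact k * z ^ k)" for z by simp
 show ?thesis proof (cases "d <= 0")
  case True
  hence "{k. int k <= - d} = {..n}" by (auto simp: n_def)
  thus ?thesis using that[of "%k. (deriv ^^ k) ?f0 0 / fact k"] poly by simp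
 next
  case False
  hence "n = 0" by (simp add: n_def)
  hence const: "?f0 z = ?f0 0" for z using poly[of z] by simp
  have "?f0 0 = 0" proof (rule ccontr)
   assume nz: "?f0 0 ~= 0"
   \<comment> \<open>The modulus is chosen so that |z| times the constant value exceeds B.\<close>
   define z where "z = complex_of_real (B / cmod (?f0 0) + 1)"
   have zn: "cmod z = B / cmod (?f0 0) + 1" unfolding z_def norm_of_real using B0 by simp
   hence z1: "1 <= cmod z" using B0 by simp
   have "cmod (z powi (- d)) <= inverse (cmod z)" proof -
    have "cmod z powi 1 <= cmod z powi d" using z1 False by (intro power_int_increasing) auto
    hence "inverse (cmod z powi d) <= inverse (cmod z)" using z1 by (intro le_imp_inverse_le) auto
    thus ?thesis by (simp add: norm_power_int power_int_minus norm_inverse)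
   qed
   from mult_left_mono[OF this B0] have "cmod (?f0 0) <= B * inverse (cmod z)" using le[OF z1] const[of z] by simp
   moreover have "0 < cmod z" using z1 by linarith
   ultimately have "cmod (?f0 0) * cmod z <= B" using pos_le_divide_eq[of "cmod z"] by (simp add: divide_inverse)
   thus False unfolding zn using nz by (simp add: distrib_left)
  qed
  moreover have "{k. int k <= - d} = {}" using False by auto
  ultimately show ?thesis using that[of "%_. 0"] const by simp
 qed
qed

text \<open>The monomials z^k with k <= - d are coordinates of global sections, and the restrictions
  of these finitely many sections span.\<close>

lemma A2_finite_dimensional: assumes D: "sopen D" and eq: "carrier (A2 D) = (%s. restrict s D) ` carrier (hol_sections L UNIV)"
 shows "vectorspace.fin_dim class_ring (A2 D)" proof -
 interpret V: vectorspace class_ring "A2 D" by (rule A2_vectorspace[OF D])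
 let ?N = "{k. int k <= - d}"
 have N: "finite ?N" by (rule finite_subset[of _ "{..nat (- d)}"]) auto
 have "\<exists>t. hol_sec UNIV t & F At_Zero t = (%z. z ^ k)" if k: "k : ?N" for k proof -
  have agree: "inverse z ^ (nat (- d) - k) = z powi d * z ^ k" if "z ~= 0" for z :: complex proof -
   have "int (nat (- d) - k) = - (d + int k)" using k by auto
   hence "inverse z ^ (nat (- d) - k) = inverse z powi (- (d + int k))" by (metis power_int_of_nat)
   also have "... = z powi (d + int k)" unfolding power_int_inverse power_int_minus by simp
   also have "... = z powi d * z ^ k" using that by (simp add: power_int_add)
   finally show ?thesis .
  qed
  obtain t where "hol_sec UNIV t" "F At_Zero t = (%z. z ^ k)" "F At_Infinity t = (%z. z ^ (nat (- d) - k))"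
   by (rule section_of_coordinates[of "%z. z ^ k" "%z. z ^ (nat (- d) - k)"]) (auto intro!: holomorphic_intros simp: agree)
  thus ?thesis by blast
 qed
 hence "\<forall>k\<in>?N. \<exists>t. hol_sec UNIV t & F At_Zero t = (%z. z ^ k)" by blast
 then obtain s where s: "\<forall>k\<in>?N. hol_sec UNIV (s k) & F At_Zero (s k) = (%z. z ^ k)" by (rule bchoice[THEN exE])
 define A where "A = (%k. restrict (s k) D) ` ?N"
 have Ac: "A <= carrier (A2 D)" unfolding A_def eq using s by (auto simp: carrier_hol_sections)
 have sub: "submodule class_ring (V.span A) (A2 D)" by (rule V.span_is_submodule[OF Ac])
 have As: "A <= V.span A" by (rule V.in_own_span[OF Ac])
 have sc: "V.span A <= carrier (A2 D)" using sub by (simp add: submodule_def)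
 have sin: "v x : fib x" if "v : carrier (A2 D)" "x : D" for v x using that hol_secD(1) A2_iff[OF D] by blast
 \<comment> \<open>An element of the span is built by induction together with its coordinate
   function, which is all that \<open>section_eqI\<close> needs.\<close>
 have comb: "\<exists>v\<in>V.span A. \<forall>z. param At_Zero z : D --> F At_Zero v z = (\<Sum>k\<in>J. b k * z ^ k)" if "finite J" "J <= ?N" for J b using that
 proof (induction J rule: finite_induct)
  case empty
  have z: "zero (A2 D) : V.span A" using sub unfolding submodule_def by simp
  show ?case proof (rule bexI[OF _ z], intro allI impI)
   fix z assume zD: "param At_Zero z : D"
   show "F At_Zero (zero (A2 D)) z = (\<Sum>k\<in>{}. b k * z ^ k)" using F_restrict[OF zD, of "fib_zero L"] F_zero[of At_Zero z] by (simp add: restrict_def del: param.simps)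
  qed
 next
  case (insert k J)
  then obtain v where v: "v : V.span A" "\<forall>z. param At_Zero z : D --> F At_Zero v z = (\<Sum>k\<in>J. b k * z ^ k)" by auto
  have k: "k : ?N" using insert.prems by blast
  let ?s = "restrict (s k) D"
  have sk: "?s : V.span A" using As k by (auto simp: A_def)
  have w: "smult (A2 D) (b k) ?s : V.span A" using sub sk unfolding submodule_def by (simp add: class_ring_simps del: A2_simps)
  have u: "add (A2 D) (smult (A2 D) (b k) ?s) v : V.span A" using sub w v(1) unfolding submodule_def by (simp del: A2_simps)
  show ?case proof (rule bexI[OF _ u], intro allI impI)
   fix z assume zD: "param At_Zero z : D"
   have i: "?s (param At_Zero z) : fib (param At_Zero z)" "v (param At_Zero z) : fib (param At_Zero z)"
    "smult (A2 D) (b k) ?s (param At_Zero z) : fib (param At_Zero z)"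
    using sin[OF subsetD[OF sc sk] zD] sin[OF subsetD[OF sc v(1)] zD] sin[OF subsetD[OF sc w] zD] by blast+
   have sum: "(\<Sum>k\<in>insert k J. b k * z ^ k) = b k * z ^ k + F At_Zero v z" using v(2)[rule_format, OF zD] insert.hyps by (simp del: A2_simps param.simps)
   have "F At_Zero (add (A2 D) (smult (A2 D) (b k) ?s) v) z = F At_Zero (%x. fib_add L (smult (A2 D) (b k) ?s x) (v x)) z"
    unfolding A2_simps(2) by (rule F_restrict[OF zD])
   also have "... = F At_Zero (smult (A2 D) (b k) ?s) z + F At_Zero v z" by (rule F_add[of "smult (A2 D) (b k) ?s" At_Zero z v, OF i(3,2)])
   also have "F At_Zero (smult (A2 D) (b k) ?s) z = F At_Zero (%x. smul (b k) (?s x)) z" unfolding A2_simps(3) by (rule F_restrict[OF zD])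
   also have "... = b k * F At_Zero ?s z" by (rule F_smult[of ?s, OF i(1)])
   also have "F At_Zero ?s z = z ^ k" using F_restrict[OF zD] s k by simp
   finally show "F At_Zero (add (A2 D) (smult (A2 D) (b k) ?s) v) z = (\<Sum>k\<in>insert k J. b k * z ^ k)" unfolding sum .
  qed
 qed
 have "carrier (A2 D) <= V.span A"
 proof
  fix t' assume t': "t' : carrier (A2 D)"
  then obtain t where t: "t' = restrict t D" "hol_sec UNIV t" unfolding eq by (auto simp: carrier_hol_sections)
  obtain b where b: "!!z. F At_Zero t z = (\<Sum>k\<in>?N. b k * z ^ k)" by (rule global_section_polynomial[OF t(2)]) (rule that)
  obtain v where v: "v : V.span A" "\<forall>z. param At_Zero z : D --> F At_Zero v z = (\<Sum>k\<in>?N. b k * z ^ k)" using comb[OF N subset_refl, of b] by blast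
  have vc: "v : carrier (A2 D)" using v(1) sc by blast
  have "t' x = v x" if "x : D" for x proof (rule section_eqI[OF D _ _ _ that])
   show "hol_sec D t'" "hol_sec D v" using t' vc A2_iff[OF D] by blast+
   show "F At_Zero t' z = F At_Zero v z" if "param At_Zero z : D" for z using v(2) b that F_restrict[OF that, of t] by (simp add: t(1) del: param.simps)
  qed
  hence "t' = v" using t' vc A2_iff[OF D] by (meson extensionalityI)
  thus "t' : V.span A" using v(1) by simp
 qed
 hence "V.span A = carrier (A2 D)" using sc by blast
 thus ?thesis unfolding V.fin_dim_def using N Ac by (intro exI[of _ A]) (simp add: A_def)
qed

end

section \<open>Extension of sections across pieces of capacity zero\<close>

lemma eq_off_negligible:
 fixes f g :: "complex => complex" assumes U: "open U" and f: "continuous_on U f" and g: "continuous_on U g" and N: "negligible N"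
  and eq: "!!z. z : U ==> z ~: N ==> f z = g z" and z: "z : U" shows "f z = g z" proof (rule ccontr)
 assume "f z ~= g z"
 hence ne: "U Int (%z. f z - g z) -` (- {0}) ~= {}" using z by auto
 have "open (U Int (%z. f z - g z) -` (- {0}))" by (rule continuous_open_preimage[OF continuous_on_diff[OF f g] U]) auto
 moreover have "U Int (%z. f z - g z) -` (- {0}) <= N" using eq by auto
 ultimately show False using open_not_negligible[OF _ ne] negligible_subset[OF N] by blast
qed

lemma cap_zero_negligible: assumes "cap_zero F" "compact F" "F <= cball a (1/4)" shows "negligible F" proof -
 have "F : null_sets lborel" using cap_zero_null[OF assms] assms(2) by (simp add: null_sets_def borel_compact)
 thus ?thesis unfolding negligible_iff_null_sets by (rule null_sets_completionI)
qed

text \<open>Each piece is to lie inside a compact set of capacity zero rather than to have capacity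
  zero itself, because a piece may be empty and the empty set does not satisfy
  \<open>cap_zero\<close>.\<close>

definition locally_cap_zero :: "sphere set => bool" where "locally_cap_zero K = (\<forall>c a. \<exists>G. compact G & G <= cball a (1/4) &
   param c -` K Int cball a (1/4) <= G & cap_zero G)"

lemma locally_cap_zeroE: assumes "locally_cap_zero K" obtains G where "compact G" "G <= cball a (1/4)" "param c -` K Int cball a (1/4) <= G" "cap_zero G"
 using assms[unfolded locally_cap_zero_def, rule_format, of a c] by (elim exE conjE) (rule that)

lemma locally_cap_zero_negligible: assumes "locally_cap_zero K" shows "negligible (param c -` K)" proof (rule locally_negligible_alt[THEN iffD2], rule ballI)
 fix a assume a: "a : param c -` K"
 obtain G where G: "compact G" "G <= cball a (1/4)" "param c -` K Int cball a (1/4) <= G" "cap_zero G" by (rule locally_cap_zeroE[OF assms])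
 have "negligible G" by (rule cap_zero_negligible[OF G(4,1,2)])
 hence "negligible (param c -` K Int ball a (1/4))" by (rule negligible_subset) (use G(3) in auto)
 thus "\<exists>U. openin (top_of_set (param c -` K)) U & a : U & negligible U" by (intro exI[of _ "param c -` K Int ball a (1/4)"]) (use a in "auto simp: openin_open")
qed

context framed_bundle begin

text \<open>\<open>cap_zero_L2_removable\<close> extends the coordinate across G. At points of G
  that belong to D the two values agree by continuity, as G is a null set.\<close>

lemma A2_locally_extends: assumes D: "sopen D" and K: "locally_cap_zero (- D)" and s: "s : carrier (A2 D)"
 obtains r g where "r > 0" "g holomorphic_on ball a r" "!!z. z : ball a r ==> param c z : D ==> g z = F c s z" proof -
 obtain G where G: "compact G" "G <= cball a (1/4)" "param c -` (- D) Int cball a (1/4) <= G" "cap_zero G" by (rule locally_cap_zeroE[OF K])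
 let ?S = "ball a (1/4) - G"
 have sub: "?S <= param c -` D" using G(3) by auto
 have S: "open ?S" using G(1) by (intro open_Diff compact_imp_closed) auto
 have hs: "hol_sec D s" and l: "\<forall>c. L2_at D s c 1" using s A2_iff[OF D] by blast+
 have fin: "L2_at D s c (cmod a + 1)" by (rule L2_iff(2)[OF D hs]) (use L2_iff(1)[OF D hs] l in blast)
 have f: "F c s holomorphic_on ?S" by (rule holomorphic_on_subset[OF F_holomorphic[OF D hs] sub])
 have "(%z. indicator ?S z *\<^sub>R (cmod (F c s z))^2) : borel_measurable borel"
  using S by (intro borel_measurable_continuous_on_indicator continuous_intros hol_cont[OF f]) simp
 hence m: "(%z. indicator ?S z *\<^sub>R (cmod (F c s z))^2) : borel_measurable lborel" by simp
 have "(\<integral>\<^sup>+z. ennreal (indicator ?S z *\<^sub>R (cmod (F c s z))^2) \<partial>lborel) <= nnint (param c -` D Int cball 0 (cmod a + 1)) (%z. (cmod (F c s z))^2)"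
 proof (rule nn_integral_mono)
  fix z
  have "z : cball 0 (cmod a + 1)" if "z : ?S" using that norm_triangle_sub[of z a] by (simp add: dist_norm norm_minus_commute)
  thus "ennreal (indicator ?S z *\<^sub>R (cmod (F c s z))^2) <= ennreal ((cmod (F c s z))^2) * indicator (param c -` D Int cball 0 (cmod a + 1)) z"
   using sub by (cases "z : ?S") auto
 qed
 also have "... < \<infinity>" using fin by (simp add: L2_at_def)
 finally have "integrable lborel (%z. indicator ?S z *\<^sub>R (cmod (F c s z))^2)" by (intro integrableI_nonneg m) auto
 from cap_zero_L2_removable[OF G(4,1,2) f this]
 obtain r g where r: "r > 0" "g holomorphic_on ball a r" "!!z. z : ball a r - G ==> g z = F c s z" by blast
 let ?r = "min r (1/4)"
 have "negligible G" by (rule cap_zero_negligible[OF G(4,1,2)])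
 have o: "open (ball a ?r Int param c -` D)" using D openin_sphere_iff by blast
 have "g z = F c s z" if z: "z : ball a ?r" "param c z : D" for z proof (rule eq_off_negligible[where f = g and g = "F c s" and z = z, OF o _ _ `negligible G`])
  show "continuous_on (ball a ?r Int param c -` D) g" by (rule continuous_on_subset[OF hol_cont[OF r(2)]]) auto
  show "continuous_on (ball a ?r Int param c -` D) (F c s)" by (rule continuous_on_subset[OF hol_cont[OF F_holomorphic[OF D hs]]]) auto
 qed (use r(3) z in auto)
 moreover have "g holomorphic_on ball a ?r" by (rule holomorphic_on_subset[OF r(2)]) auto
 ultimately show ?thesis using that[of ?r g] r(1) by simp
qed

text \<open>The complement of D is a null set in the chart, so local extensions agree on overlaps,
  and evaluating at each z the extension centred at z gives an entire function.\<close>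

lemma A2_extends: assumes D: "sopen D" and K: "locally_cap_zero (- D)" and s: "s : carrier (A2 D)"
 obtains f where "f holomorphic_on UNIV" "!!z. param c z : D ==> f z = F c s z" proof -
 have "\<exists>r g. r > 0 & g holomorphic_on ball a r & (\<forall>z\<in>ball a r. param c z : D --> g z = F c s z)" for a by (rule A2_locally_extends[OF D K s, of a c]) blast
 then obtain r g where r: "!!a. r a > 0" and g: "!!a. g a holomorphic_on ball a (r a)" and gF: "!!a z. z : ball a (r a) ==> param c z : D ==> g a z = F c s z" by metis
 have eq: "g a b = g b b" if b: "b : ball a (r a)" for a b
 proof (rule eq_off_negligible[where f = "g a" and g = "g b" and z = b, OF _ _ _ locally_cap_zero_negligible[OF K, of c]])
  show "open (ball a (r a) Int ball b (r b))" by blast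
  show "continuous_on (ball a (r a) Int ball b (r b)) (g a)" "continuous_on (ball a (r a) Int ball b (r b)) (g b)"
   by (rule continuous_on_subset[OF hol_cont[OF g]]; blast)+
  fix z assume "z : ball a (r a) Int ball b (r b)" "z ~: param c -` (- D)"
  thus "g a z = g b z" using gF[of z a] gF[of z b] by simp
 qed (use b r in simp)
 have "(%z. g z z) analytic_on UNIV" unfolding analytic_on_def
 proof
  fix a
  have "(%z. g z z) holomorphic_on ball a (r a)" by (rule holomorphic_transform[OF g]) (rule eq)
  thus "\<exists>e>0. (%z. g z z) holomorphic_on ball a e" using r by blast
 qed
 hence "(%z. g z z) holomorphic_on UNIV" by (rule analytic_imp_holomorphic)
 thus ?thesis by (rule that) (simp add: gF r)
qed

text \<open>The entire coordinates in the two charts satisfy the transition law off a null set,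
  hence for all z apart from 0, and therefore come from a global section.\<close>

lemma A2_eq_global_sections: assumes D: "sopen D" and K: "locally_cap_zero (- D)"
 shows "carrier (A2 D) = (%s. restrict s D) ` carrier (hol_sections L UNIV)"
proof
 have U: "sopen UNIV" using openin_topspace[of riemann_sphere] unfolding topspace_sphere .
 show "(%s. restrict s D) ` carrier (hol_sections L UNIV) <= carrier (A2 D)" proof (rule image_subsetI)
  fix t assume "t : carrier (hol_sections L UNIV)"
  hence t: "hol_sec UNIV t" by (simp add: carrier_hol_sections)
  have c: "continuous_on (cball 0 1) (F c t)" for c using F_holomorphic[OF U t, of c] by (auto intro: hol_cont continuous_on_subset)
  have "L2_at D t c 1" for c by (rule L2_at_bounded[OF D compact_cball _ c[of c]]) auto
  thus "restrict t D : carrier (A2 D)" unfolding A2_iff[OF D] using hol_sec_subset[OF t] by simp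
 qed
 show "carrier (A2 D) <= (%s. restrict s D) ` carrier (hol_sections L UNIV)"
 proof
  fix s assume s: "s : carrier (A2 D)"
  hence hs: "hol_sec D s" and ex: "s : extensional D" using A2_iff[OF D] by blast+
  obtain f0 where f0: "f0 holomorphic_on UNIV" "!!z. param At_Zero z : D ==> f0 z = F At_Zero s z" by (rule A2_extends[OF D K s, of At_Zero]) (rule that)
  obtain f1 where f1: "f1 holomorphic_on UNIV" "!!z. param At_Infinity z : D ==> f1 z = F At_Infinity s z" by (rule A2_extends[OF D K s, of At_Infinity]) (rule that)
  have eq: "f1 (inverse z) = z powi d * f0 z" if z: "z ~= 0" for z
  proof (rule eq_off_negligible[where f = "%z. f1 (inverse z)" and g = "%z. z powi d * f0 z" and z = z, OF _ _ _ locally_cap_zero_negligible[OF K, of At_Zero]])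
   show "open (- {0::complex})" by (rule open_Compl[OF closed_singleton])
   show "continuous_on (- {0}) (%z. f1 (inverse z))" by (rule continuous_on_compose2[OF hol_cont[OF f1(1)]]) (auto intro!: continuous_intros)
   show "continuous_on (- {0}) (%z. z powi d * f0 z)" using hol_cont[OF f0(1)] by (auto intro!: continuous_intros elim: continuous_on_subset)
   fix z assume z: "z : - {0}" "z ~: param At_Zero -` (- D)"
   hence "param At_Zero z : D" "param At_Infinity (inverse z) : D" by auto
   thus "f1 (inverse z) = z powi d * f0 z" using f0(2)[of z] f1(2)[of "inverse z"] F_other[of z s At_Zero] z hol_secD(1)[OF hs, of "param At_Zero z"]
    by (simp del: param.simps)
  qed (use z in simp)
  obtain t where t: "hol_sec UNIV t" "F At_Zero t = f0" by (rule section_of_coordinates[OF f0(1) f1(1) eq]) (assumption | rule that)+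
  have tD: "hol_sec D t" by (rule hol_sec_subset[OF t(1)]) simp
  have "s x = t x" if x: "x : D" for x by (rule section_eqI[OF D hs tD _ x, of At_Zero]) (use t(2) f0(2) in "simp del: param.simps")
  hence "s = restrict t D" using ex by (auto simp: extensional_def restrict_def fun_eq_iff)
  thus "s : (%s. restrict s D) ` carrier (hol_sections L UNIV)" using t(1) by (auto simp: carrier_hol_sections)
 qed
qed

end

section \<open>The four conditions compared\<close>

lemma volume_form_fubini_study: "volume_form fubini_study" proof -
 have "times_differentiable_on n (%z :: complex. k) UNIV" for n and k :: real by (induction n arbitrary: k) (auto simp: frechet_derivative_const)
 hence "sphere_smooth_on (%_. 1) UNIV" by (simp add: sphere_smooth_on_def smooth_on_def comp_def)
 thus ?thesis unfolding volume_form_def by (intro exI[of _ "%_. 1"]) (auto simp: fun_eq_iff)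
qed

lemma not_locally_cap_zeroE: assumes K: "sopen (- K)" and n: "~ locally_cap_zero K"
 obtains c a where "compact (param c -` K Int cball a (1/4))" "param c -` K Int cball a (1/4) ~= {}" "~ cap_zero (param c -` K Int cball a (1/4))" proof -
 have "\<exists>c a. \<forall>G. param c -` K Int cball a (1/4) <= G --> G <= cball a (1/4) --> compact G --> ~ cap_zero G" using n unfolding locally_cap_zero_def by auto
 then obtain c a where no: "\<forall>G. param c -` K Int cball a (1/4) <= G --> G <= cball a (1/4) --> compact G --> ~ cap_zero G" by (elim exE)
 have "open (- (param c -` K))" using K openin_sphere_iff[of "- K"] by (simp add: vimage_Compl)
 hence "compact (param c -` K Int cball a (1/4))" by (intro closed_Int_compact compact_cball) (simp add: closed_def)
 moreover from this have "~ cap_zero (param c -` K Int cball a (1/4))" using no by simp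
 \<comment> \<open>An empty piece would be contained in the singleton of a, which has capacity
   zero.\<close>
 moreover have "param c -` K Int cball a (1/4) ~= {}" using no[rule_format, of "{a}"] cap_zero_singleton[of a] by auto
 ultimately show ?thesis by (intro that)
qed

lemma locally_cap_zero_polar: assumes "locally_cap_zero K" shows "polar K" unfolding polar_def
proof
 fix v
 obtain c a where x: "v = param c a" by (rule sphere_cases)
 obtain G where G: "compact G" "G <= cball a (1/4)" "param c -` K Int cball a (1/4) <= G" "cap_zero G" by (rule locally_cap_zeroE[OF assms])
 obtain s where s: "subharmonic_on s (param c ` ball a (1/4))" "!!z. z : G ==> s (param c z) = -\<infinity>"
  by (rule cap_zero_locally_polar[where c = c, OF G(4,2,1)]) (rule that; assumption)
 have "K Int param c ` ball a (1/4) <= {x \<in> param c ` ball a (1/4). s x = -\<infinity>}"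
 proof
  fix x assume "x : K Int param c ` ball a (1/4)"
  then obtain z where z: "x = param c z" "z : ball a (1/4)" "param c z : K" by auto
  hence "z : G" using G(3) by auto
  thus "x : {x \<in> param c ` ball a (1/4). s x = -\<infinity>}" using s(2) z by blast
 qed
 moreover have "v : param c ` ball a (1/4)" unfolding x by (rule imageI) simp
 moreover have "sopen (param c ` ball a (1/4))" by (rule sopen_image) simp
 moreover have "connectedin riemann_sphere (param c ` ball a (1/4))" by (rule connectedin_param_image) simp
 ultimately show "\<exists>V s. sopen V & connectedin riemann_sphere V & v : V & subharmonic_on s V & K Int V <= {x \<in> V. s x = -\<infinity>}" using s(1) by (intro exI conjI)
qed

lemma strictly_subharmonic_exists: assumes K: "sopen (- K)" and n: "~ locally_cap_zero K"
 shows "\<exists>p w. bounded (p ` (- K)) & sphere_smooth_on p (- K) & volume_form w & form_le_on w (i_ddbar p) (- K)" proof -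
 obtain c a where F: "compact (param c -` K Int cball a (1/4))" "param c -` K Int cball a (1/4) ~= {}"
   "~ cap_zero (param c -` K Int cball a (1/4))" (is "~ cap_zero ?F") by (rule not_locally_cap_zeroE[OF K n])
 have sub: "- K <= - param c ` ?F" by auto
 obtain p where p: "bounded (p ` (- param c ` ?F))" "sphere_smooth_on p (- param c ` ?F)" "!!d z. param d z ~: param c ` ?F ==> i_ddbar p d z = fubini_study d z"
  by (rule not_cap_zero_strictly_subharmonic[OF F(1,2) _ F(3)]) auto
 have "bounded (p ` (- K))" using p(1) by (rule bounded_subset) (rule image_mono[OF sub])
 moreover have "sphere_smooth_on p (- K)" unfolding sphere_smooth_on_def smooth_on_def proof (intro allI)
  fix c' n
  show "times_differentiable_on n (p \<circ> param c') (param c' -` (- K))" by (rule times_differentiable_on_subset[of _ _ "param c' -` (- param c ` ?F)"])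
    (use p(2) sub in "auto simp: sphere_smooth_on_def smooth_on_def")
 qed
 moreover have "form_le_on fubini_study (i_ddbar p) (- K)" unfolding form_le_on_def proof (intro allI impI)
  fix c' z assume "param c' z : - K"
  with sub have "param c' z ~: param c ` ?F" by blast
  from p(3)[OF this] show "fubini_study c' z <= i_ddbar p c' z" by simp
 qed
 ultimately show ?thesis using volume_form_fubini_study by blast
qed

theorem theorem1p3:
 fixes L :: "'e line_bundle" and h :: "'e => 'e => complex" and \<omega>\<^sub>0 :: form11 and K :: "sphere set" assumes "holomorphic_line_bundle L"
  and "hermitian_metric L h" and "volume_form \<omega>\<^sub>0" and "compactin riemann_sphere K" and "K \<subset> topspace riemann_sphere"
 defines "A2 \<equiv> bergman_space L h \<omega>\<^sub>0 (- K)" shows "(polar K \<longleftrightarrow> carrier A2 = (%s. restrict s (- K)) ` carrier (hol_sections L UNIV)) &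
  (polar K \<longleftrightarrow> vectorspace.fin_dim class_ring A2) & (polar K \<longleftrightarrow> ~ (\<exists>\<psi> \<omega>. bounded (\<psi> ` (- K)) & sphere_smooth_on \<psi> (- K) & volume_form \<omega> &
        form_le_on \<omega> (i_ddbar \<psi>) (- K)))" (is "(_ \<longleftrightarrow> ?b) & (_ \<longleftrightarrow> ?c) & (_ \<longleftrightarrow> ~ ?\<psi>)") proof -
 obtain e d where "framed_bundle L e d h \<omega>\<^sub>0" by (rule framed_bundle_exists[OF assms(1-3)])
 then interpret framed_bundle L e d h \<omega>\<^sub>0 .
 have K: "openin riemann_sphere (- K)" using assms(4) sphere_compact_iff[of K] by (rule rev_iffD1)
 have ne: "- K ~= {}" using assms(5) unfolding topspace_sphere by blast
 have polar: "polar K" if "locally_cap_zero K" using that by (rule locally_cap_zero_polar)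
 have \<psi>: "~ ?\<psi>" if "polar K" by (intro notI, elim exE conjE) (rule polar_no_strictly_subharmonic[OF that K ne])
 have zero: "locally_cap_zero K" if "~ ?\<psi>" by (rule ccontr) (rule notE[OF that strictly_subharmonic_exists[OF K]])
 have b: ?b if "locally_cap_zero K" unfolding A2_def using that by (intro A2_eq_global_sections[OF K]) simp
 have c: ?c if ?b unfolding A2_def by (rule A2_finite_dimensional[OF K that[unfolded A2_def]])
 have zero': "locally_cap_zero K" if ?c proof (rule ccontr)
  assume "~ locally_cap_zero K"
  then obtain c a where F: "compact (param c -` K \<inter> cball a (1/4))" "param c -` K \<inter> cball a (1/4) ~= {}" "~ cap_zero (param c -` K \<inter> cball a (1/4))"
   by (rule not_locally_cap_zeroE[OF K])
  have "~ ?c" unfolding A2_def by (rule A2_infinite_dimensional[OF K ne F(1,2) _ F(3), where c = c]) auto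
  thus False using that by (rule notE)
 qed
 \<comment> \<open>Two cycles through capacity zero: one by way of polarity and the absence of
   \<open>\<psi>\<close>, the other by way of the two conditions on the Bergman space.\<close>
 show ?thesis using polar \<psi> zero b c zero' by blast
qed

end
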